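(* Let $\mathsf H$ be a bounded heart in a triangulated category $\mathsf D$ and assume that $\Lambda := K(\mathsf H)$ is a free abelian group of finite rank. Let $\Lambda_{\mathbb R}^* := \operatorname{Hom}(\Lambda,\mathbb R)$. (1) The set $C(\mathsf H)=\{v\in\Lambda_{\mathbb R}^* \mid v([h])\ge 0 \text{ for all } h\in\mathsf H\}$ is a closed, strictly convex cone in $\Lambda_{\mathbb R}^*$. (2) The set of cones $\Delta(\mathsf H) := \bigcup_{\mathsf H[1]\ge \mathsf K\ge \mathsf H}\mathrm{Faces}(C(\mathsf K))$, consisting of the cones $C(\mathsf K)$ for bounded hearts $\mathsf K$ in $\mathsf D$ with $\mathsf H[1]\ge\mathsf K\ge\mathsf H$ together with all their faces, is a fan in $\Lambda_{\mathbb R}^*$. (3) The fan $\Delta(\mathsf H)$ does not depend on the ambient triangulated category: if the abelian category $\mathsf H$ is also realised as a bounded heart in another triangulated category $\mathsf D'$, then the fan constructed as in (2) using hearts in $\mathsf D'$ is equal to $\Delta(\mathsf H)$. (4) If $\mathsf H$ is a length category, then the fan $\Delta(\mathsf H)$ is complete (the union of its cones is $\Lambda_{\mathbb R}^*$), and the following are equivalent: (i) $\Delta(\mathsf H)$ is finite (i.e. a finite set of cones); (ii) every bounded heart $\mathsf K$ in $\mathsf D$ with $\mathsf H[1]\ge\mathsf K\ge\mathsf H$ is a length category; (iii) there are only finitely many bounded hearts $\mathsf K$ in $\mathsf D$ with $\mathsf H[1]\ge\mathsf K\ge\mathsf H$.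
   Context: Categories are essentially small; subcategories are full and closed under isomorphism. A bounded heart in $\mathsf D$ is the heart of a bounded t-structure on $\mathsf D$; for such $\mathsf K$ there is a canonical identification $K(\mathsf K)=K(\mathsf D)$ of Grothendieck groups, so $K(\mathsf K)=K(\mathsf H)=\Lambda$ and $C(\mathsf K)=\{v\in\Lambda_{\mathbb R}^*\mid v([k])\ge0\ \forall k\in\mathsf K\}$ makes sense. Bounded hearts are partially ordered by: $\mathsf K\ge\mathsf H$ iff $\operatorname{Hom}_{\mathsf D}(\mathsf K[n],\mathsf H)=0$ for all $n>0$ (equivalently inclusion of the associated co-aisles); so $\mathsf H[1]\ge\mathsf H$. An abelian category is length if it is noetherian and artinian. A (real) cone in a real vector space is a non-empty subset closed under sums and under multiplication by non-negative scalars; it is strictly convex if it contains no non-zero linear subspace. A face of a cone $\sigma$ is a non-empty subset $\tau\subseteq\sigma$ such that for $a,b\in\sigma$: $a+b\in\tau\iff a,b\in\tau$; $\mathrm{Faces}(\sigma)$ is the set of all faces of $\sigma$ (including $\sigma$). A fan is a set of cones closed under taking faces and such that any two of its cones intersect in a common face. *)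

theory Defs
  imports
    "HOL-Algebra.Free_Abelian_Groups"
    "HOL-Analysis.Analysis"
    "HOL-Library.Function_Algebras"
begin

section \<open>Categories\<close>

text \<open>
  An essentially small category is represented by sets of objects and of arrows, every arrow
  carrying its domain and codomain. Composition is written in applicative order: \<open>g \<cdot> f\<close> is
  ``\<open>f\<close>, then \<open>g\<close>''. Values outside the carrier sets are irrelevant.
\<close>

record ('o, 'm) category_data =
  Ob :: "'o set"
  Arr :: "'m set"
  Dom :: "'m \<Rightarrow> 'o"
  Cod :: "'m \<Rightarrow> 'o"
  Ident :: "'o \<Rightarrow> 'm"
  Cmp :: "'m \<Rightarrow> 'm \<Rightarrow> 'm"  (infixl \<open>\<cdot>\<index>\<close> 70)

definition Homs :: "('o, 'm, 'x) category_data_scheme \<Rightarrow> 'o \<Rightarrow> 'o \<Rightarrow> 'm set" where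
  "Homs C x y = {f \<in> Arr C. Dom C f = x \<and> Cod C f = y}"

locale category =
  fixes C :: "('o, 'm, 'x) category_data_scheme" (structure)
  assumes dom_cod: "f \<in> Arr C \<Longrightarrow> Dom C f \<in> Ob C \<and> Cod C f \<in> Ob C"
    and ident_in: "x \<in> Ob C \<Longrightarrow> Ident C x \<in> Homs C x x"
    and cmp_in: "\<lbrakk>f \<in> Homs C x y; g \<in> Homs C y z\<rbrakk> \<Longrightarrow> g \<cdot> f \<in> Homs C x z"
    and cmp_ident_right: "f \<in> Homs C x y \<Longrightarrow> f \<cdot> Ident C x = f"
    and cmp_ident_left: "f \<in> Homs C x y \<Longrightarrow> Ident C y \<cdot> f = f"
    and cmp_assoc: "\<lbrakk>f \<in> Homs C w x; g \<in> Homs C x y; h \<in> Homs C y z\<rbrakk>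
      \<Longrightarrow> h \<cdot> (g \<cdot> f) = h \<cdot> g \<cdot> f"

definition iso_arr :: "('o, 'm, 'x) category_data_scheme \<Rightarrow> 'm \<Rightarrow> bool" where
  "iso_arr C f \<longleftrightarrow> f \<in> Arr C \<and> (\<exists>g \<in> Homs C (Cod C f) (Dom C f).
     g \<cdot>\<^bsub>C\<^esub> f = Ident C (Dom C f) \<and> f \<cdot>\<^bsub>C\<^esub> g = Ident C (Cod C f))"

definition isomorphic :: "('o, 'm, 'x) category_data_scheme \<Rightarrow> 'o \<Rightarrow> 'o \<Rightarrow> bool" where
  "isomorphic C x y \<longleftrightarrow> (\<exists>f \<in> Homs C x y. iso_arr C f)"

definition monic :: "('o, 'm, 'x) category_data_scheme \<Rightarrow> 'm \<Rightarrow> bool" where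
  "monic C f \<longleftrightarrow> f \<in> Arr C \<and>
     (\<forall>w. \<forall>g \<in> Homs C w (Dom C f). \<forall>h \<in> Homs C w (Dom C f). f \<cdot>\<^bsub>C\<^esub> g = f \<cdot>\<^bsub>C\<^esub> h \<longrightarrow> g = h)"

definition epic :: "('o, 'm, 'x) category_data_scheme \<Rightarrow> 'm \<Rightarrow> bool" where
  "epic C f \<longleftrightarrow> f \<in> Arr C \<and>
     (\<forall>z. \<forall>g \<in> Homs C (Cod C f) z. \<forall>h \<in> Homs C (Cod C f) z. g \<cdot>\<^bsub>C\<^esub> f = h \<cdot>\<^bsub>C\<^esub> f \<longrightarrow> g = h)"

definition zero_object :: "('o, 'm, 'x) category_data_scheme \<Rightarrow> 'o \<Rightarrow> bool" where
  "zero_object C z \<longleftrightarrow> z \<in> Ob C \<and>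
     (\<forall>x \<in> Ob C. (\<exists>!f. f \<in> Homs C x z) \<and> (\<exists>!f. f \<in> Homs C z x))"

definition is_functor ::
  "('o, 'm, 'x) category_data_scheme \<Rightarrow> ('p, 'n, 'y) category_data_scheme
    \<Rightarrow> ('o \<Rightarrow> 'p) \<Rightarrow> ('m \<Rightarrow> 'n) \<Rightarrow> bool" where
  "is_functor C C' Fo Fm \<longleftrightarrow>
     (\<forall>x \<in> Ob C. Fo x \<in> Ob C' \<and> Fm (Ident C x) = Ident C' (Fo x)) \<and>
     (\<forall>x y. \<forall>f \<in> Homs C x y. Fm f \<in> Homs C' (Fo x) (Fo y)) \<and>
     (\<forall>x y z. \<forall>f \<in> Homs C x y. \<forall>g \<in> Homs C y z. Fm (g \<cdot>\<^bsub>C\<^esub> f) = Fm g \<cdot>\<^bsub>C'\<^esub> Fm f)"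

definition is_equivalence ::
  "('o, 'm, 'x) category_data_scheme \<Rightarrow> ('p, 'n, 'y) category_data_scheme
    \<Rightarrow> ('o \<Rightarrow> 'p) \<Rightarrow> ('m \<Rightarrow> 'n) \<Rightarrow> bool" where
  "is_equivalence C C' Fo Fm \<longleftrightarrow> is_functor C C' Fo Fm \<and>
     (\<forall>x \<in> Ob C. \<forall>y \<in> Ob C. bij_betw Fm (Homs C x y) (Homs C' (Fo x) (Fo y))) \<and>
     (\<forall>y \<in> Ob C'. \<exists>x \<in> Ob C. isomorphic C' (Fo x) y)"


section \<open>Additive and abelian categories\<close>

record ('o, 'm) additive_data = "('o, 'm) category_data" +
  Add :: "'m \<Rightarrow> 'm \<Rightarrow> 'm"  (infixl \<open>\<boxplus>\<index>\<close> 65)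
  Zer :: "'o \<Rightarrow> 'o \<Rightarrow> 'm"

definition hom_group :: "('o, 'm, 'x) additive_data_scheme \<Rightarrow> 'o \<Rightarrow> 'o \<Rightarrow> 'm monoid" where
  "hom_group C x y = \<lparr>carrier = Homs C x y, monoid.mult = Add C, one = Zer C x y\<rparr>"

locale additive_category = category C
  for C :: "('o, 'm, 'x) additive_data_scheme" (structure) +
  assumes hom_comm_group: "\<lbrakk>x \<in> Ob C; y \<in> Ob C\<rbrakk> \<Longrightarrow> comm_group (hom_group C x y)"
    and cmp_add_right: "\<lbrakk>f \<in> Homs C x y; f' \<in> Homs C x y; g \<in> Homs C y z\<rbrakk>
      \<Longrightarrow> g \<cdot> (f \<boxplus> f') = g \<cdot> f \<boxplus> g \<cdot> f'"
    and cmp_add_left: "\<lbrakk>f \<in> Homs C x y; g \<in> Homs C y z; g' \<in> Homs C y z\<rbrakk>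
      \<Longrightarrow> (g \<boxplus> g') \<cdot> f = g \<cdot> f \<boxplus> g' \<cdot> f"
    and zero_object_ex: "\<exists>z. zero_object C z"
    and biproduct_ex: "\<lbrakk>x \<in> Ob C; y \<in> Ob C\<rbrakk> \<Longrightarrow>
      \<exists>b \<in> Ob C. \<exists>i \<in> Homs C x b. \<exists>j \<in> Homs C y b. \<exists>p \<in> Homs C b x. \<exists>q \<in> Homs C b y.
        p \<cdot> i = Ident C x \<and> q \<cdot> j = Ident C y \<and> q \<cdot> i = Zer C x y \<and> p \<cdot> j = Zer C y x \<and>
        i \<cdot> p \<boxplus> j \<cdot> q = Ident C b"

definition is_kernel :: "('o, 'm, 'x) additive_data_scheme \<Rightarrow> 'm \<Rightarrow> 'm \<Rightarrow> bool" where
  "is_kernel C k f \<longleftrightarrow> f \<in> Arr C \<and> k \<in> Arr C \<and> Cod C k = Dom C f \<and>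
     f \<cdot>\<^bsub>C\<^esub> k = Zer C (Dom C k) (Cod C f) \<and>
     (\<forall>w. \<forall>t \<in> Homs C w (Dom C f). f \<cdot>\<^bsub>C\<^esub> t = Zer C w (Cod C f) \<longrightarrow>
        (\<exists>!s. s \<in> Homs C w (Dom C k) \<and> k \<cdot>\<^bsub>C\<^esub> s = t))"

definition is_cokernel :: "('o, 'm, 'x) additive_data_scheme \<Rightarrow> 'm \<Rightarrow> 'm \<Rightarrow> bool" where
  "is_cokernel C c f \<longleftrightarrow> f \<in> Arr C \<and> c \<in> Arr C \<and> Dom C c = Cod C f \<and>
     c \<cdot>\<^bsub>C\<^esub> f = Zer C (Dom C f) (Cod C c) \<and>
     (\<forall>z. \<forall>t \<in> Homs C (Cod C f) z. t \<cdot>\<^bsub>C\<^esub> f = Zer C (Dom C f) z \<longrightarrow>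
        (\<exists>!s. s \<in> Homs C (Cod C c) z \<and> s \<cdot>\<^bsub>C\<^esub> c = t))"

locale abelian_category = additive_category C
  for C :: "('o, 'm, 'x) additive_data_scheme" (structure) +
  assumes kernel_ex: "f \<in> Arr C \<Longrightarrow> \<exists>k. is_kernel C k f"
    and cokernel_ex: "f \<in> Arr C \<Longrightarrow> \<exists>c. is_cokernel C c f"
    and monic_normal: "monic C f \<Longrightarrow> \<exists>g. is_kernel C f g"
    and epic_normal: "epic C f \<Longrightarrow> \<exists>g. is_cokernel C f g"

definition short_exact :: "('o, 'm, 'x) additive_data_scheme \<Rightarrow> 'm \<Rightarrow> 'm \<Rightarrow> bool" where
  "short_exact C f g \<longleftrightarrow> is_kernel C f g \<and> is_cokernel C g f"

text \<open>The preorder on monomorphisms with a common codomain whose quotient is the subobject poset.\<close>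

definition subobj_le :: "('o, 'm, 'x) category_data_scheme \<Rightarrow> 'm \<Rightarrow> 'm \<Rightarrow> bool" where
  "subobj_le C f g \<longleftrightarrow> (\<exists>h \<in> Homs C (Dom C f) (Dom C g). f = g \<cdot>\<^bsub>C\<^esub> h)"

definition noetherian_category :: "('o, 'm, 'x) category_data_scheme \<Rightarrow> bool" where
  "noetherian_category C \<longleftrightarrow> (\<forall>x \<in> Ob C. \<forall>m :: nat \<Rightarrow> 'm.
     (\<forall>n. monic C (m n) \<and> Cod C (m n) = x) \<and> (\<forall>n. subobj_le C (m n) (m (Suc n)))
     \<longrightarrow> (\<exists>N. \<forall>n \<ge> N. subobj_le C (m (Suc n)) (m n)))"

definition artinian_category :: "('o, 'm, 'x) category_data_scheme \<Rightarrow> bool" where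
  "artinian_category C \<longleftrightarrow> (\<forall>x \<in> Ob C. \<forall>m :: nat \<Rightarrow> 'm.
     (\<forall>n. monic C (m n) \<and> Cod C (m n) = x) \<and> (\<forall>n. subobj_le C (m (Suc n)) (m n))
     \<longrightarrow> (\<exists>N. \<forall>n \<ge> N. subobj_le C (m n) (m (Suc n))))"

definition length_category :: "('o, 'm, 'x) additive_data_scheme \<Rightarrow> bool" where
  "length_category C \<longleftrightarrow> abelian_category C \<and> noetherian_category C \<and> artinian_category C"

definition full_subcat ::
  "('o, 'm, 'x) additive_data_scheme \<Rightarrow> 'o set \<Rightarrow> ('o, 'm) additive_data" where
  "full_subcat C S = \<lparr>Ob = S, Arr = {f \<in> Arr C. Dom C f \<in> S \<and> Cod C f \<in> S},
     Dom = Dom C, Cod = Cod C, Ident = Ident C, Cmp = Cmp C, Add = Add C, Zer = Zer C\<rparr>"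

definition iso_closed :: "('o, 'm, 'x) category_data_scheme \<Rightarrow> 'o set \<Rightarrow> bool" where
  "iso_closed C S \<longleftrightarrow> S \<subseteq> Ob C \<and> (\<forall>x \<in> S. \<forall>y \<in> Ob C. isomorphic C x y \<longrightarrow> y \<in> S)"


section \<open>Triangulated categories\<close>

text \<open>
  The shift is given by \<open>Sh\<close> on objects and \<open>ShM\<close> on arrows; it is only required to be an additive
  autoequivalence, not an automorphism. An element \<open>(f, g, h)\<close> of \<open>Tri\<close> is a distinguished
  triangle \<open>X \<rightarrow> Y \<rightarrow> Z \<rightarrow> X[1]\<close>.
\<close>

record ('o, 'm) triangulated_data = "('o, 'm) additive_data" +
  Sh :: "'o \<Rightarrow> 'o"
  ShM :: "'m \<Rightarrow> 'm"
  Tri :: "('m \<times> 'm \<times> 'm) set"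

definition pre_triangle :: "('o, 'm, 'x) triangulated_data_scheme \<Rightarrow> 'm \<Rightarrow> 'm \<Rightarrow> 'm \<Rightarrow> bool" where
  "pre_triangle D f g h \<longleftrightarrow> f \<in> Arr D \<and> g \<in> Arr D \<and> h \<in> Arr D \<and>
     Cod D f = Dom D g \<and> Cod D g = Dom D h \<and> Cod D h = Sh D (Dom D f)"

definition neg :: "('o, 'm, 'x) additive_data_scheme \<Rightarrow> 'm \<Rightarrow> 'm" where
  "neg C f = inv\<^bsub>hom_group C (Dom C f) (Cod C f)\<^esub> f"

definition tri_morphism ::
  "('o, 'm, 'x) triangulated_data_scheme \<Rightarrow> 'm \<times> 'm \<times> 'm \<Rightarrow> 'm \<times> 'm \<times> 'm \<Rightarrow> 'm \<Rightarrow> 'm \<Rightarrow> 'm \<Rightarrow> bool"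
where
  "tri_morphism D = (\<lambda>(f, g, h) (f', g', h') a b c.
     a \<in> Homs D (Dom D f) (Dom D f') \<and> b \<in> Homs D (Dom D g) (Dom D g') \<and>
     c \<in> Homs D (Dom D h) (Dom D h') \<and>
     b \<cdot>\<^bsub>D\<^esub> f = f' \<cdot>\<^bsub>D\<^esub> a \<and> c \<cdot>\<^bsub>D\<^esub> g = g' \<cdot>\<^bsub>D\<^esub> b \<and> ShM D a \<cdot>\<^bsub>D\<^esub> h = h' \<cdot>\<^bsub>D\<^esub> c)"

text \<open>
  In the octahedral axiom, the given triangles are \<open>X \<rightarrow> Y \<rightarrow> Z' \<rightarrow> X[1]\<close> on \<open>f\<close>,
  \<open>Y \<rightarrow> Z \<rightarrow> X' \<rightarrow> Y[1]\<close> on \<open>g\<close> and \<open>X \<rightarrow> Z \<rightarrow> Y' \<rightarrow> X[1]\<close> on \<open>g \<cdot> f\<close>; the new one is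
  \<open>Z' \<rightarrow> Y' \<rightarrow> X' \<rightarrow> Z'[1]\<close>.
\<close>

locale triangulated_category = additive_category D
  for D :: "('o, 'm, 'x) triangulated_data_scheme" (structure) +
  assumes shift_equivalence: "is_equivalence D D (Sh D) (ShM D)"
    and shift_additive: "\<lbrakk>f \<in> Homs D x y; g \<in> Homs D x y\<rbrakk> \<Longrightarrow> ShM D (f \<boxplus> g) = ShM D f \<boxplus> ShM D g"
    and tri_pre: "(f, g, h) \<in> Tri D \<Longrightarrow> pre_triangle D f g h"
    and tri_iso: "\<lbrakk>(f, g, h) \<in> Tri D; pre_triangle D f' g' h';
        tri_morphism D (f, g, h) (f', g', h') a b c; iso_arr D a; iso_arr D b; iso_arr D c\<rbrakk>
      \<Longrightarrow> (f', g', h') \<in> Tri D"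
    and tri_ident: "\<lbrakk>x \<in> Ob D; zero_object D z\<rbrakk>
      \<Longrightarrow> (Ident D x, Zer D x z, Zer D z (Sh D x)) \<in> Tri D"
    and tri_ex: "f \<in> Arr D \<Longrightarrow> \<exists>g h. (f, g, h) \<in> Tri D"
    and tri_rotate: "pre_triangle D f g h \<Longrightarrow>
      (f, g, h) \<in> Tri D \<longleftrightarrow> (g, h, neg D (ShM D f)) \<in> Tri D"
    and tri_complete: "\<lbrakk>(f, g, h) \<in> Tri D; (f', g', h') \<in> Tri D;
        a \<in> Homs D (Dom D f) (Dom D f'); b \<in> Homs D (Cod D f) (Cod D f'); b \<cdot> f = f' \<cdot> a\<rbrakk>
      \<Longrightarrow> \<exists>c. tri_morphism D (f, g, h) (f', g', h') a b c"
    and octahedral: "\<lbrakk>(f, f', f'') \<in> Tri D; (g, g', g'') \<in> Tri D; Cod D f = Dom D g;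
        (g \<cdot> f, h', h'') \<in> Tri D\<rbrakk>
      \<Longrightarrow> \<exists>u v. (u, v, ShM D f' \<cdot> g'') \<in> Tri D \<and>
            u \<cdot> f' = h' \<cdot> g \<and> h'' \<cdot> u = f'' \<and> v \<cdot> h' = g' \<and> g'' \<cdot> v = ShM D f \<cdot> h''"


section \<open>Bounded t-structures and their hearts\<close>

text \<open>
  \<open>shift_sub D S n\<close> is \<open>S[n]\<close>, as a subcategory closed under isomorphism. As the shift need not be
  invertible on the nose, negative shifts are inverse images.
\<close>

definition shift_sub :: "('o, 'm, 'x) triangulated_data_scheme \<Rightarrow> 'o set \<Rightarrow> int \<Rightarrow> 'o set" where
  "shift_sub D S n = {x \<in> Ob D.
     if 0 \<le> n then \<exists>s \<in> S. isomorphic D x ((Sh D ^^ nat n) s) else (Sh D ^^ nat (- n)) x \<in> S}"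

definition homs_vanish :: "('o, 'm, 'x) additive_data_scheme \<Rightarrow> 'o set \<Rightarrow> 'o set \<Rightarrow> bool" where
  "homs_vanish C S T \<longleftrightarrow> (\<forall>x \<in> S. \<forall>y \<in> T. Homs C x y = {Zer C x y})"

text \<open>
  \<open>U\<close> and \<open>V\<close> are the aisle and co-aisle, \<open>U = D\<^sup>\<le>\<^sup>0\<close> and \<open>V = D\<^sup>\<ge>\<^sup>0\<close>. Thus
  \<open>shift_sub D U (- n)\<close> is the subcategory of objects in degrees at most \<open>n\<close>, and
  \<open>shift_sub D V (- n)\<close> that of objects in degrees at least \<open>n\<close>.
\<close>

definition t_structure :: "('o, 'm, 'x) triangulated_data_scheme \<Rightarrow> 'o set \<Rightarrow> 'o set \<Rightarrow> bool" where
  "t_structure D U V \<longleftrightarrow> iso_closed D U \<and> iso_closed D V \<and>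
     shift_sub D U 1 \<subseteq> U \<and> shift_sub D V (- 1) \<subseteq> V \<and>
     homs_vanish D U (shift_sub D V (- 1)) \<and>
     (\<forall>x \<in> Ob D. \<exists>(f, g, h) \<in> Tri D. Dom D f \<in> U \<and> Cod D f = x \<and> Cod D g \<in> shift_sub D V (- 1))"

definition bounded_t_structure ::
  "('o, 'm, 'x) triangulated_data_scheme \<Rightarrow> 'o set \<Rightarrow> 'o set \<Rightarrow> bool" where
  "bounded_t_structure D U V \<longleftrightarrow> t_structure D U V \<and>
     (\<forall>x \<in> Ob D. \<exists>m n. x \<in> shift_sub D U m \<and> x \<in> shift_sub D V n)"

definition bounded_heart :: "('o, 'm, 'x) triangulated_data_scheme \<Rightarrow> 'o set \<Rightarrow> bool" where
  "bounded_heart D H \<longleftrightarrow> (\<exists>U V. bounded_t_structure D U V \<and> H = U \<inter> V)"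

definition heart_ge :: "('o, 'm, 'x) triangulated_data_scheme \<Rightarrow> 'o set \<Rightarrow> 'o set \<Rightarrow> bool" where
  "heart_ge D K H \<longleftrightarrow> (\<forall>n > 0. homs_vanish D (shift_sub D K n) H)"

definition intermediate_hearts ::
  "('o, 'm, 'x) triangulated_data_scheme \<Rightarrow> 'o set \<Rightarrow> 'o set set" where
  "intermediate_hearts D H =
     {K. bounded_heart D K \<and> heart_ge D (shift_sub D H 1) K \<and> heart_ge D K H}"


section \<open>Grothendieck groups\<close>

definition presented_group :: "'o set \<Rightarrow> ('o \<Rightarrow>\<^sub>0 int) set \<Rightarrow> ('o \<Rightarrow>\<^sub>0 int) set monoid" where
  "presented_group S R = free_Abelian_group S Mod generate (free_Abelian_group S) R"

text \<open>
  The generators are all objects rather than isomorphism classes; isomorphic objects are identified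
  by the relations, since every isomorphism \<open>A \<rightarrow> B\<close> is part of a short exact sequence
  (or distinguished triangle) with vanishing third term.
\<close>

definition K0_rels :: "('o, 'm, 'x) additive_data_scheme \<Rightarrow> ('o \<Rightarrow>\<^sub>0 int) set" where
  "K0_rels A = {frag_of (Cod A f) - frag_of (Dom A f) - frag_of (Cod A g) | f g. short_exact A f g}"

definition K0 :: "('o, 'm, 'x) additive_data_scheme \<Rightarrow> ('o \<Rightarrow>\<^sub>0 int) set monoid" where
  "K0 A = presented_group (Ob A) (K0_rels A)"

definition K0_class :: "('o, 'm, 'x) additive_data_scheme \<Rightarrow> 'o \<Rightarrow> ('o \<Rightarrow>\<^sub>0 int) set" where
  "K0_class A x =
     generate (free_Abelian_group (Ob A)) (K0_rels A) #>\<^bsub>free_Abelian_group (Ob A)\<^esub> frag_of x"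

definition K0_tri :: "('o, 'm, 'x) triangulated_data_scheme \<Rightarrow> ('o \<Rightarrow>\<^sub>0 int) set monoid" where
  "K0_tri D = presented_group (Ob D)
     {frag_of (Cod D f) - frag_of (Dom D f) - frag_of (Cod D g) | f g h. (f, g, h) \<in> Tri D}"

text \<open>
  The map into a quotient group \<open>Q\<close> induced by a map \<open>\<phi>\<close> of representatives: a coset \<open>X\<close> goes to
  the coset containing \<open>\<phi> ` X\<close>.
\<close>

definition coset_map :: "('b set, 'y) monoid_scheme \<Rightarrow> ('a \<Rightarrow> 'b) \<Rightarrow> 'a set \<Rightarrow> 'b set" where
  "coset_map Q \<phi> X = (THE Y. Y \<in> carrier Q \<and> \<phi> ` X \<subseteq> Y)"

text \<open>
  The canonical identification \<open>K(K) = K(D) = K(H)\<close> for bounded hearts \<open>K\<close> and \<open>H\<close>: the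
  isomorphism \<open>K(K) \<rightarrow> K(D)\<close>, \<open>[k] \<mapsto> [k]\<close>, followed by the inverse of \<open>K(H) \<rightarrow> K(D)\<close>.
\<close>

definition heart_ident ::
  "('o, 'm, 'x) triangulated_data_scheme \<Rightarrow> 'o set \<Rightarrow> ('o \<Rightarrow>\<^sub>0 int) set \<Rightarrow> ('o \<Rightarrow>\<^sub>0 int) set" where
  "heart_ident D H X =
     inv_into (carrier (K0 (full_subcat D H))) (coset_map (K0_tri D) id) (coset_map (K0_tri D) id X)"

text \<open>The homomorphism \<open>K(A) \<rightarrow> K(B)\<close>, \<open>[x] \<mapsto> [F x]\<close>, induced by an exact functor \<open>F\<close>.\<close>

definition K0_map ::
  "('p, 'n, 'y) additive_data_scheme \<Rightarrow> ('o \<Rightarrow> 'p) \<Rightarrow> ('o \<Rightarrow>\<^sub>0 int) set \<Rightarrow> ('p \<Rightarrow>\<^sub>0 int) set" where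
  "K0_map B Fo = coset_map (K0 B) (frag_extend (\<lambda>x. frag_of (Fo x)))"

definition free_of_finite_rank :: "('a, 'x) monoid_scheme \<Rightarrow> bool" where
  "free_of_finite_rank G \<longleftrightarrow> (\<exists>B :: nat set. finite B \<and> G \<cong> free_Abelian_group B)"


section \<open>The real dual of the Grothendieck group\<close>

instantiation "fun" :: (type, real_vector) real_vector
begin

definition scaleR_fun :: "real \<Rightarrow> ('a \<Rightarrow> 'b) \<Rightarrow> 'a \<Rightarrow> 'b" where
  "scaleR_fun c f = (\<lambda>x. c *\<^sub>R f x)"

instance
  by standard (simp_all add: scaleR_fun_def fun_eq_iff algebra_simps)

end

definition real_group :: "real monoid" where
  "real_group = \<lparr>carrier = UNIV, monoid.mult = (+), one = 0\<rparr>"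

text \<open>
  \<open>Hom(G, \<real>)\<close>, as a subspace of the space of all functions: homomorphisms are made unique by the
  value \<open>0\<close> outside the carrier. The topology induced from the product topology is that of pointwise
  convergence; for \<open>G\<close> free of finite rank it is the usual topology of a finite-dimensional real
  vector space.
\<close>

definition real_dual :: "('a, 'x) monoid_scheme \<Rightarrow> ('a \<Rightarrow> real) set" where
  "real_dual G = {v \<in> hom G real_group. \<forall>X. X \<notin> carrier G \<longrightarrow> v X = 0}"

definition heart_dual :: "('o, 'm, 'x) triangulated_data_scheme \<Rightarrow> 'o set
    \<Rightarrow> (('o \<Rightarrow>\<^sub>0 int) set \<Rightarrow> real) set" where
  "heart_dual D H = real_dual (K0 (full_subcat D H))"

definition dual_pullback ::
  "('a, 'x) monoid_scheme \<Rightarrow> ('a \<Rightarrow> 'b) \<Rightarrow> ('b \<Rightarrow> real) \<Rightarrow> 'a \<Rightarrow> real" where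
  "dual_pullback G \<phi> v = (\<lambda>X. if X \<in> carrier G then v (\<phi> X) else 0)"


section \<open>Cones and fans\<close>

text \<open>
  Cones are those of the library, \<^const>\<open>convex_cone\<close>: non-empty, closed under sums and under multiplication by
  non-negative scalars.
\<close>

definition strictly_convex :: "'a::real_vector set \<Rightarrow> bool" where
  "strictly_convex \<sigma> \<longleftrightarrow> (\<forall>S. subspace S \<and> S \<subseteq> \<sigma> \<longrightarrow> S = {0})"

definition faces :: "'a::real_vector set \<Rightarrow> 'a set set" where
  "faces \<sigma> = {\<tau>. \<tau> \<noteq> {} \<and> \<tau> \<subseteq> \<sigma> \<and> (\<forall>a \<in> \<sigma>. \<forall>b \<in> \<sigma>. a + b \<in> \<tau> \<longleftrightarrow> a \<in> \<tau> \<and> b \<in> \<tau>)}"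

definition fan_in :: "'a::real_vector set \<Rightarrow> 'a set set \<Rightarrow> bool" where
  "fan_in W \<Delta> \<longleftrightarrow> (\<forall>\<sigma> \<in> \<Delta>. convex_cone \<sigma> \<and> \<sigma> \<subseteq> W \<and> faces \<sigma> \<subseteq> \<Delta>) \<and>
     (\<forall>\<sigma> \<in> \<Delta>. \<forall>\<tau> \<in> \<Delta>. \<sigma> \<inter> \<tau> \<in> faces \<sigma> \<and> \<sigma> \<inter> \<tau> \<in> faces \<tau>)"

definition complete_fan_in :: "'a::real_vector set \<Rightarrow> 'a set set \<Rightarrow> bool" where
  "complete_fan_in W \<Delta> \<longleftrightarrow> fan_in W \<Delta> \<and> \<Union>\<Delta> = W"


section \<open>The heart cones and the heart fan\<close>

text \<open>\<open>heart_cone D H K\<close> is the cone \<open>C(K)\<close>, as a subset of \<open>Hom(K(H), \<real>)\<close>.\<close>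

definition heart_cone :: "('o, 'm, 'x) triangulated_data_scheme \<Rightarrow> 'o set \<Rightarrow> 'o set
    \<Rightarrow> (('o \<Rightarrow>\<^sub>0 int) set \<Rightarrow> real) set" where
  "heart_cone D H K =
     {v \<in> heart_dual D H. \<forall>k \<in> K. 0 \<le> v (heart_ident D H (K0_class (full_subcat D K) k))}"

definition heart_fan :: "('o, 'm, 'x) triangulated_data_scheme \<Rightarrow> 'o set
    \<Rightarrow> (('o \<Rightarrow>\<^sub>0 int) set \<Rightarrow> real) set set" where
  "heart_fan D H = (\<Union>K \<in> intermediate_hearts D H. faces (heart_cone D H K))"

end

theory Submission
  imports Defs
begin

text \<open>
  The hearts \<open>K\<close> with \<open>H[1] \<ge> K \<ge> H\<close> are the tilts of \<open>H\<close> at its torsion classes \<open>T\<close>, and with torsion-free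
  class \<open>F\<close> the cone \<open>C(K)\<close> consists of the \<open>v\<close> with \<open>v \<ge> 0\<close> on \<open>T\<close> and \<open>v \<le> 0\<close> on \<open>F\<close>. This description
  does not mention \<open>D\<close>, which gives the independence. Comparing the decompositions of objects of \<open>H\<close> with respect
  to two torsion pairs shows that \<open>C(K) \<inter> C(L)\<close> is a face of \<open>C(K)\<close>. If \<open>H\<close> is a length category, every \<open>v\<close> lies in
  the cone of the torsion class of those objects all of whose quotients have \<open>v \<ge> 0\<close>, so the fan is complete.

  If \<open>C(K)\<close> spans the dual space, it contains a functional that is integral and strictly positive on \<open>K\<close>; hence
  \<open>K\<close> is a length category and is determined by \<open>C(K)\<close>. If there are finitely many cones, then among the spanning
  ones with torsion class contained in that of \<open>M\<close> a maximal one exists, and it equals \<open>M\<close>: otherwise a facet of its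
  cone, given by a simple object \<open>s[1]\<close> with \<open>s\<close> torsion in \<open>M\<close>, could be crossed in a generic direction. Thus all
  hearts are length categories, and there are finitely many. Conversely, if all are length categories,
  each torsion class has finitely many minimal upper neighbours, given by the simple objects \<open>s[1]\<close> of the tilt; were there
  infinitely many torsion classes, there would be an infinite ascending chain, contradicted by the tilt at its union.
  The cone of a length heart is cut out by its finitely many simple objects, so it has finitely many faces.
\<close>

section \<open>Additive and triangulated categories\<close>

text \<open>The definitions provide axioms only, so the abelian structure of a heart, the
  identification K(H) = K(D) and the Jordan-Hoelder theorem are derived on the way. Truncation is
  not made functorial; uniqueness up to isomorphism is enough, because most arguments use no more
  than the existence of a triangle on given objects. The identification of Grothendieck groups is
  treated dually: an additive function on a heart extends to D as an alternating sum over cohomology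
  objects, so a functional \<open>v\<close> on K(H) has a value \<open>ev v x\<close> at every
  object \<open>x\<close> of D, and C(K) is the set of those \<open>v\<close> with
  \<open>ev v\<close> non-negative on K. The obstacle in the finiteness statement is that a strictly
  positive real-valued function bounds no chain of subobjects. It is overcome by the lattice K(H): a
  functional inside a spanning cone can be rounded to an integral one, which is a length function.
  Conversely, the cone of a length heart spans because functionals can be prescribed freely on the
  isomorphism classes of its simple objects.\<close>

context category
begin

lemma Homs_Ob: "f \<in> Homs C x y \<Longrightarrow> x \<in> Ob C \<and> y \<in> Ob C"
  using dom_cod by (auto simp: Homs_def)

lemma iso_arrI:
  "\<lbrakk>f \<in> Homs C x y; g \<in> Homs C y x; g \<cdot> f = Ident C x; f \<cdot> g = Ident C y\<rbrakk> \<Longrightarrow> iso_arr C f"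
  by (auto simp: iso_arr_def Homs_def)

lemma iso_arrE:
  assumes "iso_arr C f" "f \<in> Homs C x y"
  obtains g where "g \<in> Homs C y x" "g \<cdot> f = Ident C x" "f \<cdot> g = Ident C y"
  using assms by (auto simp: iso_arr_def Homs_def)

lemma isomorphicI:
  "\<lbrakk>f \<in> Homs C x y; g \<in> Homs C y x; g \<cdot> f = Ident C x; f \<cdot> g = Ident C y\<rbrakk> \<Longrightarrow> isomorphic C x y"
  unfolding isomorphic_def using iso_arrI by blast

lemma isomorphicE:
  assumes "isomorphic C x y"
  obtains f g where "f \<in> Homs C x y" "g \<in> Homs C y x" "g \<cdot> f = Ident C x" "f \<cdot> g = Ident C y"
  using assms iso_arrE unfolding isomorphic_def by metis

lemma isomorphic_Ob: "isomorphic C x y \<Longrightarrow> x \<in> Ob C \<and> y \<in> Ob C"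
  using Homs_Ob by (auto simp: isomorphic_def)

lemma isomorphic_refl: "x \<in> Ob C \<Longrightarrow> isomorphic C x x"
  using isomorphicI[OF ident_in ident_in] cmp_ident_left[OF ident_in] by blast

lemma isomorphic_sym: "isomorphic C x y \<Longrightarrow> isomorphic C y x"
  by (elim isomorphicE, rule isomorphicI)

lemma isomorphic_trans:
  assumes "isomorphic C x y" "isomorphic C y z"
  shows "isomorphic C x z"
proof -
  obtain f g where f: "f \<in> Homs C x y" "g \<in> Homs C y x" "g \<cdot> f = Ident C x" "f \<cdot> g = Ident C y"
    using assms(1) by (rule isomorphicE)
  obtain h k where h: "h \<in> Homs C y z" "k \<in> Homs C z y" "k \<cdot> h = Ident C y" "h \<cdot> k = Ident C z"
    using assms(2) by (rule isomorphicE)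
  have hf: "h \<cdot> f \<in> Homs C x z" and gk: "g \<cdot> k \<in> Homs C z x"
    using f h cmp_in by blast+
  have "(g \<cdot> k) \<cdot> (h \<cdot> f) = g \<cdot> (k \<cdot> (h \<cdot> f))"
    by (rule cmp_assoc[symmetric, OF hf h(2) f(2)])
  also have "k \<cdot> (h \<cdot> f) = f"
    using cmp_assoc[OF f(1) h(1,2)] h(3) cmp_ident_left[OF f(1)] by simp
  finally have 1: "(g \<cdot> k) \<cdot> (h \<cdot> f) = Ident C x" using f by simp
  have "(h \<cdot> f) \<cdot> (g \<cdot> k) = h \<cdot> (f \<cdot> (g \<cdot> k))"
    by (rule cmp_assoc[symmetric, OF gk f(1) h(1)])
  also have "f \<cdot> (g \<cdot> k) = k"
    using cmp_assoc[OF h(2) f(2,1)] f(4) cmp_ident_left[OF h(2)] by simp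
  finally have "(h \<cdot> f) \<cdot> (g \<cdot> k) = Ident C z" using h by simp
  then show ?thesis
    using isomorphicI[OF hf gk 1] by blast
qed

end

text \<open>Equality with the singleton of the zero arrow says more than vanishing: that arrow has
  to lie in the Hom set, so both arguments are objects (\<open>hom0_Ob\<close>). This saves side
  conditions throughout.\<close>

definition hom0 :: "('o, 'm, 'x) additive_data_scheme \<Rightarrow> 'o \<Rightarrow> 'o \<Rightarrow> bool" where
  "hom0 C x y \<longleftrightarrow> Homs C x y = {Zer C x y}"

context additive_category
begin

lemma hom_group_simps [simp]:
  "carrier (hom_group C x y) = Homs C x y" "f \<otimes>\<^bsub>hom_group C x y\<^esub> g = f \<boxplus> g"
  "\<one>\<^bsub>hom_group C x y\<^esub> = Zer C x y"
  by (auto simp: hom_group_def)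

lemma zer_in: "\<lbrakk>x \<in> Ob C; y \<in> Ob C\<rbrakk> \<Longrightarrow> Zer C x y \<in> Homs C x y"
  using group.is_monoid[OF comm_group.axioms(2)[OF hom_comm_group]] monoid.one_closed by fastforce

lemma add_in: "\<lbrakk>f \<in> Homs C x y; g \<in> Homs C x y\<rbrakk> \<Longrightarrow> f \<boxplus> g \<in> Homs C x y"
  using group.is_monoid[OF comm_group.axioms(2)[OF hom_comm_group]] monoid.m_closed Homs_Ob
  by (metis hom_group_simps(1,2))

lemma neg_eq: "f \<in> Homs C x y \<Longrightarrow> neg C f = inv\<^bsub>hom_group C x y\<^esub> f"
  by (auto simp: neg_def Homs_def)

lemma neg_in: "f \<in> Homs C x y \<Longrightarrow> neg C f \<in> Homs C x y"
  using group.inv_closed[OF comm_group.axioms(2)[OF hom_comm_group]] neg_eq Homs_Ob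
  by (metis hom_group_simps(1))

lemma add_neg: "f \<in> Homs C x y \<Longrightarrow> f \<boxplus> neg C f = Zer C x y"
  using group.r_inv[OF comm_group.axioms(2)[OF hom_comm_group]] neg_eq Homs_Ob
  by (metis hom_group_simps)

lemma add_commute: "\<lbrakk>f \<in> Homs C x y; g \<in> Homs C x y\<rbrakk> \<Longrightarrow> f \<boxplus> g = g \<boxplus> f"
  using comm_monoid.m_comm[OF comm_group.axioms(1)[OF hom_comm_group]] Homs_Ob
  by (metis hom_group_simps(1,2))

lemma add_zer: "f \<in> Homs C x y \<Longrightarrow> f \<boxplus> Zer C x y = f"
  using monoid.r_one[OF group.is_monoid[OF comm_group.axioms(2)[OF hom_comm_group]]] Homs_Ob
  by (metis hom_group_simps)

lemma neg_unique:
  assumes "f \<in> Homs C x y" "g \<in> Homs C x y" "f \<boxplus> g = Zer C x y" shows "g = neg C f"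
  using group.inv_equality[OF comm_group.axioms(2)[OF hom_comm_group], of x y g f] assms
  by (metis hom_group_simps Homs_Ob neg_eq add_commute)

lemma neg_neg: "f \<in> Homs C x y \<Longrightarrow> neg C (neg C f) = f"
  by (metis neg_unique add_neg neg_in add_commute)

lemma add_right_cancel:
  "\<lbrakk>f \<in> Homs C x y; g \<in> Homs C x y; h \<in> Homs C x y; f \<boxplus> h = g \<boxplus> h\<rbrakk> \<Longrightarrow> f = g"
  using group.right_cancel[OF comm_group.axioms(2)[OF hom_comm_group], of x y h f g] Homs_Ob
  by (metis hom_group_simps(1,2))

lemma add_idem_zer: "\<lbrakk>f \<in> Homs C x y; f \<boxplus> f = f\<rbrakk> \<Longrightarrow> f = Zer C x y"
  by (metis Homs_Ob add_commute add_right_cancel add_zer zer_in)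

lemma cmp_zer: assumes "g \<in> Homs C y z" "x \<in> Ob C" shows "g \<cdot> Zer C x y = Zer C x z"
proof (rule add_idem_zer)
  have z: "Zer C x y \<in> Homs C x y" using assms Homs_Ob zer_in by blast
  then show "g \<cdot> Zer C x y \<in> Homs C x z" using assms cmp_in by blast
  show "g \<cdot> Zer C x y \<boxplus> g \<cdot> Zer C x y = g \<cdot> Zer C x y"
    using cmp_add_right[OF z z assms(1)] add_zer[OF z] by simp
qed

lemma zer_cmp: assumes "f \<in> Homs C x y" "z \<in> Ob C" shows "Zer C y z \<cdot> f = Zer C x z"
proof (rule add_idem_zer)
  have z: "Zer C y z \<in> Homs C y z" using assms Homs_Ob zer_in by blast
  then show "Zer C y z \<cdot> f \<in> Homs C x z" using assms cmp_in by blast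
  show "Zer C y z \<cdot> f \<boxplus> Zer C y z \<cdot> f = Zer C y z \<cdot> f"
    using cmp_add_left[OF assms(1) z z] add_zer[OF z] by simp
qed

lemma cmp_neg: assumes "f \<in> Homs C x y" "g \<in> Homs C y z" shows "g \<cdot> neg C f = neg C (g \<cdot> f)"
proof (rule neg_unique)
  show "g \<cdot> f \<boxplus> g \<cdot> neg C f = Zer C x z"
    using cmp_add_right[OF assms(1) neg_in[OF assms(1)] assms(2)] add_neg[OF assms(1)]
      cmp_zer[OF assms(2)] Homs_Ob assms by auto
qed (use assms cmp_in neg_in in blast)+

lemma neg_cmp: assumes "f \<in> Homs C x y" "g \<in> Homs C y z" shows "neg C g \<cdot> f = neg C (g \<cdot> f)"
proof (rule neg_unique)
  show "g \<cdot> f \<boxplus> neg C g \<cdot> f = Zer C x z"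
    using cmp_add_left[OF assms(1) assms(2) neg_in[OF assms(2)]] add_neg[OF assms(2)]
      zer_cmp[OF assms(1)] Homs_Ob assms by auto
qed (use assms cmp_in neg_in in blast)+

lemma neg_zer: "x \<in> Ob C \<Longrightarrow> y \<in> Ob C \<Longrightarrow> neg C (Zer C x y) = Zer C x y"
  by (metis neg_unique add_zer zer_in)

lemma neg_eq_zer: "f \<in> Homs C x y \<Longrightarrow> neg C f = Zer C x y \<Longrightarrow> f = Zer C x y"
  by (metis Homs_Ob neg_neg neg_zer)

lemma diff_zer_eq:
  "\<lbrakk>f \<in> Homs C x y; g \<in> Homs C x y; f \<boxplus> neg C g = Zer C x y\<rbrakk> \<Longrightarrow> f = g"
  by (metis neg_unique neg_neg neg_in add_commute)

text \<open>Additivity reduces uniqueness of a factorisation to arrows with zero composite. With its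
  mirror image this turns the non-unique factorisations obtained from triangles into genuine
  universal properties.\<close>

lemma left_cancel_test:
  assumes "f \<in> Homs C y z" "s \<in> Homs C x y" "t \<in> Homs C x y" "f \<cdot> s = f \<cdot> t"
    and "\<And>u. u \<in> Homs C x y \<Longrightarrow> f \<cdot> u = Zer C x z \<Longrightarrow> u = Zer C x y"
  shows "s = t"
proof (rule diff_zer_eq[OF assms(2,3)])
  have "f \<cdot> (s \<boxplus> neg C t) = Zer C x z"
    using cmp_add_right[OF assms(2) neg_in[OF assms(3)] assms(1)] assms cmp_neg[OF assms(3,1)]
      add_neg cmp_in by metis
  then show "s \<boxplus> neg C t = Zer C x y"
    using assms add_in neg_in by blast
qed

lemma right_cancel_test:
  assumes "f \<in> Homs C x y" "s \<in> Homs C y z" "t \<in> Homs C y z" "s \<cdot> f = t \<cdot> f"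
    and "\<And>u. u \<in> Homs C y z \<Longrightarrow> u \<cdot> f = Zer C x z \<Longrightarrow> u = Zer C y z"
  shows "s = t"
proof (rule diff_zer_eq[OF assms(2,3)])
  have "(s \<boxplus> neg C t) \<cdot> f = Zer C x z"
    using cmp_add_left[OF assms(1,2) neg_in[OF assms(3)]] assms neg_cmp[OF assms(1,3)]
      add_neg cmp_in by metis
  then show "s \<boxplus> neg C t = Zer C y z"
    using assms add_in neg_in by blast
qed

lemma hom0I: "\<lbrakk>x \<in> Ob C; y \<in> Ob C; \<And>f. f \<in> Homs C x y \<Longrightarrow> f = Zer C x y\<rbrakk> \<Longrightarrow> hom0 C x y"
  using zer_in by (auto simp: hom0_def)

lemma hom0D: "hom0 C x y \<Longrightarrow> f \<in> Homs C x y \<Longrightarrow> f = Zer C x y"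
  by (auto simp: hom0_def)

lemma hom0_Ob: "hom0 C x y \<Longrightarrow> x \<in> Ob C \<and> y \<in> Ob C"
  using Homs_Ob by (force simp: hom0_def)

lemma hom0_self_left: assumes "hom0 C z z" "x \<in> Ob C" shows "hom0 C z x"
proof (rule hom0I)
  have z: "z \<in> Ob C" using assms hom0_Ob by blast
  have i: "Ident C z = Zer C z z" by (rule hom0D[OF assms(1) ident_in[OF z]])
  show "f = Zer C z x" if f: "f \<in> Homs C z x" for f
    using cmp_ident_right[OF f] cmp_zer[OF f z] i by simp
qed (use assms hom0_Ob in blast)+

lemma hom0_self_right: assumes "hom0 C z z" "x \<in> Ob C" shows "hom0 C x z"
proof (rule hom0I)
  have z: "z \<in> Ob C" using assms hom0_Ob by blast
  have i: "Ident C z = Zer C z z" by (rule hom0D[OF assms(1) ident_in[OF z]])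
  show "f = Zer C x z" if f: "f \<in> Homs C x z" for f
    using cmp_ident_left[OF f] zer_cmp[OF f z] i by simp
qed (use assms hom0_Ob in blast)+

text \<open>Once the identity of \<open>z\<close> is zero, so is every arrow from or to
  \<open>z\<close>. Objects are usually shown to vanish below by squeezing their endomorphism group
  in an exact sequence.\<close>

lemma zero_object_iff: "zero_object C z \<longleftrightarrow> hom0 C z z"
proof
  assume z: "zero_object C z"
  then have "z \<in> Ob C" "\<exists>!f. f \<in> Homs C z z" by (auto simp: zero_object_def)
  then show "hom0 C z z" using zer_in hom0I by metis
next
  assume h: "hom0 C z z"
  then have "z \<in> Ob C" using hom0_Ob by blast
  then show "zero_object C z"
    using hom0_self_left[OF h] hom0_self_right[OF h] by (auto simp: zero_object_def hom0_def)
qed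

lemma zero_hom0: "zero_object C z \<Longrightarrow> x \<in> Ob C \<Longrightarrow> hom0 C z x \<and> hom0 C x z"
  using hom0_self_left hom0_self_right zero_object_iff by blast

lemma hom0_iso_left: assumes "hom0 C x y" "isomorphic C x x'" shows "hom0 C x' y"
proof -
  obtain f g where f: "f \<in> Homs C x x'" "g \<in> Homs C x' x" "g \<cdot> f = Ident C x" "f \<cdot> g = Ident C x'"
    using assms(2) by (rule isomorphicE)
  show ?thesis
  proof (rule hom0I)
    fix u assume u: "u \<in> Homs C x' y"
    have "u = (u \<cdot> f) \<cdot> g" by (metis f cmp_assoc cmp_ident_right u)
    also have "\<dots> = Zer C x y \<cdot> g" using assms(1) hom0D cmp_in f u by metis
    finally show "u = Zer C x' y" using zer_cmp f hom0_Ob assms(1) by metis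
  qed (use f Homs_Ob hom0_Ob assms in blast)+
qed

lemma hom0_iso_right: assumes "hom0 C x y" "isomorphic C y y'" shows "hom0 C x y'"
proof -
  obtain f g where f: "f \<in> Homs C y y'" "g \<in> Homs C y' y" "g \<cdot> f = Ident C y" "f \<cdot> g = Ident C y'"
    using assms(2) by (rule isomorphicE)
  show ?thesis
  proof (rule hom0I)
    fix u assume u: "u \<in> Homs C x y'"
    have "u = f \<cdot> (g \<cdot> u)" by (metis f cmp_assoc cmp_ident_left u)
    also have "\<dots> = f \<cdot> Zer C x y" using assms(1) hom0D cmp_in f u by metis
    finally show "u = Zer C x y'" using cmp_zer f hom0_Ob assms(1) by metis
  qed (use f Homs_Ob hom0_Ob assms in blast)+
qed

lemma zero_object_iso: "zero_object C x \<Longrightarrow> isomorphic C x y \<Longrightarrow> zero_object C y"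
  using hom0_iso_left hom0_iso_right zero_object_iff by blast

end

section \<open>Distinguished triangles: exactness of Hom, octahedra, negative shifts\<close>

definition tria :: "('o, 'm, 'x) triangulated_data_scheme \<Rightarrow> 'o \<Rightarrow> 'o \<Rightarrow> 'o \<Rightarrow> 'm \<Rightarrow> 'm \<Rightarrow> 'm \<Rightarrow> bool" where
  "tria D a b c f g h \<longleftrightarrow> (f, g, h) \<in> Tri D \<and> f \<in> Homs D a b \<and> g \<in> Homs D b c \<and> h \<in> Homs D c (Sh D a)"

text \<open>Extensions and classes in K(D) do not depend on the arrows of a triangle. Forgetting
  them makes it possible to replace the vertices by isomorphic objects
  (\<open>dtri_iso\<close>).\<close>

definition dtri :: "('o, 'm, 'x) triangulated_data_scheme \<Rightarrow> 'o \<Rightarrow> 'o \<Rightarrow> 'o \<Rightarrow> bool" where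
  "dtri D a b c \<longleftrightarrow> (\<exists>f g h. tria D a b c f g h)"

text \<open>As the shift is only an equivalence, the shift by -1 is a choice of object, determined
  up to isomorphism and not extended to arrows.\<close>

definition desusp :: "('o, 'm, 'x) triangulated_data_scheme \<Rightarrow> 'o \<Rightarrow> 'o" where
  "desusp D x = (SOME y. y \<in> Ob D \<and> isomorphic D (Sh D y) x)"

context triangulated_category
begin

lemma sh_functor: "is_functor D D (Sh D) (ShM D)"
  using shift_equivalence by (simp add: is_equivalence_def)

lemma Sh_Ob: "x \<in> Ob D \<Longrightarrow> Sh D x \<in> Ob D"
  using sh_functor by (simp add: is_functor_def)

lemma ShM_Ident: "x \<in> Ob D \<Longrightarrow> ShM D (Ident D x) = Ident D (Sh D x)"
  using sh_functor by (simp add: is_functor_def)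

lemma ShM_in: "f \<in> Homs D x y \<Longrightarrow> ShM D f \<in> Homs D (Sh D x) (Sh D y)"
  using sh_functor by (simp add: is_functor_def)

lemma ShM_cmp: "\<lbrakk>f \<in> Homs D x y; g \<in> Homs D y z\<rbrakk> \<Longrightarrow> ShM D (g \<cdot> f) = ShM D g \<cdot> ShM D f"
  using sh_functor by (simp add: is_functor_def)

lemma ShM_bij: "\<lbrakk>x \<in> Ob D; y \<in> Ob D\<rbrakk> \<Longrightarrow> bij_betw (ShM D) (Homs D x y) (Homs D (Sh D x) (Sh D y))"
  using shift_equivalence by (simp add: is_equivalence_def)

lemma ShM_full:
  assumes "x \<in> Ob D" "y \<in> Ob D" "g \<in> Homs D (Sh D x) (Sh D y)"
  obtains f where "f \<in> Homs D x y" "ShM D f = g"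
proof -
  have "g \<in> ShM D ` Homs D x y"
    using bij_betw_imp_surj_on[OF ShM_bij[OF assms(1,2)]] assms(3) by simp
  then show ?thesis using that by (elim imageE) simp
qed

lemma ShM_faithful:
  assumes "f \<in> Homs D x y" "g \<in> Homs D x y" "ShM D f = ShM D g" shows "f = g"
proof -
  have "inj_on (ShM D) (Homs D x y)"
    using bij_betw_imp_inj_on[OF ShM_bij] Homs_Ob[OF assms(1)] by blast
  then show ?thesis using assms by (simp add: inj_on_def)
qed

lemma ShM_Zer: assumes "x \<in> Ob D" "y \<in> Ob D" shows "ShM D (Zer D x y) = Zer D (Sh D x) (Sh D y)"
proof (rule add_idem_zer)
  have z: "Zer D x y \<in> Homs D x y" using assms zer_in by blast
  show "ShM D (Zer D x y) \<in> Homs D (Sh D x) (Sh D y)" using ShM_in[OF z] .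
  show "ShM D (Zer D x y) \<boxplus> ShM D (Zer D x y) = ShM D (Zer D x y)"
    using shift_additive[OF z z] add_zer[OF z] by simp
qed

lemma ShM_eq_Zer: "f \<in> Homs D x y \<Longrightarrow> ShM D f = Zer D (Sh D x) (Sh D y) \<Longrightarrow> f = Zer D x y"
  using ShM_faithful[of f x y "Zer D x y"] ShM_Zer zer_in Homs_Ob by simp

lemma hom0_shift: assumes "x \<in> Ob D" "y \<in> Ob D" shows "hom0 D (Sh D x) (Sh D y) \<longleftrightarrow> hom0 D x y"
proof
  assume h: "hom0 D (Sh D x) (Sh D y)"
  show "hom0 D x y"
    by (rule hom0I[OF assms]) (metis h hom0D ShM_in ShM_eq_Zer)
next
  assume h: "hom0 D x y"
  show "hom0 D (Sh D x) (Sh D y)"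
  proof (rule hom0I)
    fix g assume "g \<in> Homs D (Sh D x) (Sh D y)"
    then obtain f where f: "f \<in> Homs D x y" "ShM D f = g" using ShM_full assms by metis
    have "f = Zer D x y" by (rule hom0D[OF h f(1)])
    then show "g = Zer D (Sh D x) (Sh D y)" using f ShM_Zer assms by simp
  qed (use assms Sh_Ob in auto)
qed

lemma zero_Sh_iff: "x \<in> Ob D \<Longrightarrow> zero_object D (Sh D x) \<longleftrightarrow> zero_object D x"
  using hom0_shift zero_object_iff by blast

lemma isomorphic_Sh: assumes "isomorphic D x y" shows "isomorphic D (Sh D x) (Sh D y)"
proof -
  obtain f g where f: "f \<in> Homs D x y" "g \<in> Homs D y x" "g \<cdot> f = Ident D x" "f \<cdot> g = Ident D y"
    using assms by (rule isomorphicE)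
  show ?thesis
  proof (rule isomorphicI[OF ShM_in[OF f(1)] ShM_in[OF f(2)]])
    show "ShM D g \<cdot> ShM D f = Ident D (Sh D x)"
      using ShM_cmp[OF f(1,2)] f ShM_Ident isomorphic_Ob[OF assms] by simp
    show "ShM D f \<cdot> ShM D g = Ident D (Sh D y)"
      using ShM_cmp[OF f(2,1)] f ShM_Ident isomorphic_Ob[OF assms] by simp
  qed
qed

lemma isomorphic_Sh_cancel:
  assumes "isomorphic D (Sh D x) (Sh D y)" "x \<in> Ob D" "y \<in> Ob D" shows "isomorphic D x y"
proof -
  obtain f g where f: "f \<in> Homs D (Sh D x) (Sh D y)" "g \<in> Homs D (Sh D y) (Sh D x)"
    "g \<cdot> f = Ident D (Sh D x)" "f \<cdot> g = Ident D (Sh D y)"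
    using assms(1) by (rule isomorphicE)
  obtain f' where f': "f' \<in> Homs D x y" "ShM D f' = f" using ShM_full[OF assms(2,3) f(1)] .
  obtain g' where g': "g' \<in> Homs D y x" "ShM D g' = g" using ShM_full[OF assms(3,2) f(2)] .
  show ?thesis
  proof (rule isomorphicI[OF f'(1) g'(1)])
    show "g' \<cdot> f' = Ident D x"
      by (rule ShM_faithful[OF cmp_in[OF f'(1) g'(1)] ident_in[OF assms(2)]])
        (simp add: ShM_cmp[OF f'(1) g'(1)] f' g' f ShM_Ident assms)
    show "f' \<cdot> g' = Ident D y"
      by (rule ShM_faithful[OF cmp_in[OF g'(1) f'(1)] ident_in[OF assms(3)]])
        (simp add: ShM_cmp[OF g'(1) f'(1)] f' g' f ShM_Ident assms)
  qed
qed

lemma desusp: assumes "x \<in> Ob D" shows "desusp D x \<in> Ob D" "isomorphic D (Sh D (desusp D x)) x"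
proof -
  have "\<exists>y. y \<in> Ob D \<and> isomorphic D (Sh D y) x"
    using shift_equivalence assms by (auto simp: is_equivalence_def)
  from someI_ex[OF this] show "desusp D x \<in> Ob D" "isomorphic D (Sh D (desusp D x)) x"
    unfolding desusp_def by blast+
qed

lemma tria_Ob: "tria D a b c f g h \<Longrightarrow> a \<in> Ob D \<and> b \<in> Ob D \<and> c \<in> Ob D"
  using Homs_Ob by (auto simp: tria_def)

lemma dtri_Ob: "dtri D a b c \<Longrightarrow> a \<in> Ob D \<and> b \<in> Ob D \<and> c \<in> Ob D"
  using tria_Ob by (auto simp: dtri_def)

lemma Tri_tria:
  assumes "(f, g, h) \<in> Tri D"
  shows "tria D (Dom D f) (Cod D f) (Cod D g) f g h"
  using tri_pre[OF assms] assms by (auto simp: tria_def pre_triangle_def Homs_def)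

lemma dtri_Tri: "(f, g, h) \<in> Tri D \<Longrightarrow> dtri D (Dom D f) (Cod D f) (Cod D g)"
  unfolding dtri_def using Tri_tria by blast

lemma dtriE:
  assumes "dtri D a b c"
  obtains f g h where "tria D a b c f g h"
  using assms by (auto simp: dtri_def)

lemma tria_dtri: "tria D a b c f g h \<Longrightarrow> dtri D a b c"
  by (auto simp: dtri_def)

lemma tria_ex:
  assumes "f \<in> Homs D a b" obtains c g h where "tria D a b c f g h"
proof -
  have "f \<in> Arr D" using assms by (simp add: Homs_def)
  then obtain g h where "(f, g, h) \<in> Tri D" using tri_ex by blast
  from Tri_tria[OF this] show ?thesis using that assms by (auto simp: Homs_def)
qed

lemma tria_rotate: assumes "tria D a b c f g h" shows "tria D b c (Sh D a) g h (neg D (ShM D f))"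
proof -
  have "pre_triangle D f g h" using assms by (auto simp: tria_def pre_triangle_def Homs_def)
  then show ?thesis
    using tri_rotate[of f g h] assms neg_in[OF ShM_in] by (auto simp: tria_def)
qed

text \<open>Fullness of the shift exhibits \<open>k\<close> as the negative of a shifted arrow,
  after which the rotation axiom can be read backwards.\<close>

lemma tria_rotate_back:
  assumes "tria D b c (Sh D a) g h k" "a \<in> Ob D"
  obtains f where "tria D a b c f g h" "k = neg D (ShM D f)"
proof -
  have k: "k \<in> Homs D (Sh D a) (Sh D b)" and b: "b \<in> Ob D" using assms tria_Ob by (auto simp: tria_def)
  obtain f where f: "f \<in> Homs D a b" "ShM D f = neg D k" using ShM_full[OF assms(2) b neg_in[OF k]] .
  have kf: "k = neg D (ShM D f)" using f neg_neg[OF k] by simp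
  have "pre_triangle D f g h" using assms f by (auto simp: tria_def pre_triangle_def Homs_def)
  then have "(f, g, h) \<in> Tri D" using tri_rotate[of f g h] assms kf by (auto simp: tria_def)
  then have "tria D a b c f g h" using f(1) assms by (simp add: tria_def)
  then show ?thesis using that kf by blast
qed

lemma dtri_rotate: "dtri D a b c \<Longrightarrow> dtri D b c (Sh D a)"
  unfolding dtri_def by (elim exE) (intro exI, erule tria_rotate)

lemma dtri_rotate_back: "dtri D b c (Sh D a) \<Longrightarrow> a \<in> Ob D \<Longrightarrow> dtri D a b c"
  by (elim dtriE, erule tria_rotate_back) (auto intro: tria_dtri)

lemma dtri_shift: "dtri D a b c \<Longrightarrow> dtri D (Sh D a) (Sh D b) (Sh D c)"
  by (rule dtri_rotate[OF dtri_rotate[OF dtri_rotate]])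

lemma dtri_unshift: "\<lbrakk>dtri D (Sh D a) (Sh D b) (Sh D c); a \<in> Ob D; b \<in> Ob D; c \<in> Ob D\<rbrakk> \<Longrightarrow> dtri D a b c"
  by (rule dtri_rotate_back[OF dtri_rotate_back[OF dtri_rotate_back]])

lemma dtri_iso:
  assumes "dtri D a b c" "isomorphic D a a'" "isomorphic D b b'" "isomorphic D c c'"
  shows "dtri D a' b' c'"
proof -
  obtain f g h where t: "tria D a b c f g h" using assms(1) by (rule dtriE)
  then have fgh: "f \<in> Homs D a b" "g \<in> Homs D b c" "h \<in> Homs D c (Sh D a)" by (auto simp: tria_def)
  obtain p p' where p: "p \<in> Homs D a a'" "p' \<in> Homs D a' a" "p' \<cdot> p = Ident D a" "p \<cdot> p' = Ident D a'"
    using assms(2) by (rule isomorphicE)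
  obtain q q' where q: "q \<in> Homs D b b'" "q' \<in> Homs D b' b" "q' \<cdot> q = Ident D b" "q \<cdot> q' = Ident D b'"
    using assms(3) by (rule isomorphicE)
  obtain r r' where r: "r \<in> Homs D c c'" "r' \<in> Homs D c' c" "r' \<cdot> r = Ident D c" "r \<cdot> r' = Ident D c'"
    using assms(4) by (rule isomorphicE)
  let ?f = "q \<cdot> f \<cdot> p'" and ?g = "r \<cdot> g \<cdot> q'" and ?h = "ShM D p \<cdot> h \<cdot> r'"
  have qf: "q \<cdot> f \<in> Homs D a b'" and rg: "r \<cdot> g \<in> Homs D b c'" and ph: "ShM D p \<cdot> h \<in> Homs D c (Sh D a')"
    using fgh p q r cmp_in ShM_in by blast+
  have H: "?f \<in> Homs D a' b'" "?g \<in> Homs D b' c'" "?h \<in> Homs D c' (Sh D a')"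
    using qf rg ph p q r cmp_in by blast+
  have 1: "q \<cdot> f = ?f \<cdot> p"
    using cmp_assoc[OF p(1,2) qf] p(3) cmp_ident_right[OF qf] by simp
  have 2: "r \<cdot> g = ?g \<cdot> q"
    using cmp_assoc[OF q(1,2) rg] q(3) cmp_ident_right[OF rg] by simp
  have 3: "ShM D p \<cdot> h = ?h \<cdot> r"
    using cmp_assoc[OF r(1,2) ph] r(3) cmp_ident_right[OF ph] by simp
  have "tri_morphism D (f, g, h) (?f, ?g, ?h) p q r"
    using fgh H p q r 1 2 3 by (auto simp: tri_morphism_def Homs_def)
  moreover have "pre_triangle D ?f ?g ?h" using H by (auto simp: pre_triangle_def Homs_def)
  moreover have "iso_arr D p" "iso_arr D q" "iso_arr D r"
    using p q r iso_arrI by blast+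
  ultimately have "(?f, ?g, ?h) \<in> Tri D" using tri_iso t by (auto simp: tria_def)
  then show ?thesis using H by (auto simp: tria_def dtri_def)
qed

lemma tria_ident: "\<lbrakk>x \<in> Ob D; zero_object D z\<rbrakk> \<Longrightarrow> tria D x x z (Ident D x) (Zer D x z) (Zer D z (Sh D x))"
  using tri_ident ident_in zer_in Sh_Ob by (auto simp: tria_def zero_object_def)

lemma tria_zero_left:
  assumes "x \<in> Ob D" "zero_object D z"
  shows "tria D z x x (Zer D z x) (Ident D x) (Zer D x (Sh D z))"
proof -
  have z: "z \<in> Ob D" "zero_object D (Sh D z)" using assms zero_Sh_iff by (auto simp: zero_object_def)
  have "tria D x x (Sh D z) (Ident D x) (Zer D x (Sh D z)) (Zer D (Sh D z) (Sh D x))"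
    using tria_ident assms z by blast
  then obtain f where f: "tria D z x x f (Ident D x) (Zer D x (Sh D z))"
    using tria_rotate_back z by metis
  have "f = Zer D z x" using f zero_hom0[OF assms(2,1)] hom0D by (auto simp: tria_def)
  then show ?thesis using f by simp
qed

lemma triaD: assumes "tria D a b c f g h"
  shows "f \<in> Homs D a b" "g \<in> Homs D b c" "h \<in> Homs D c (Sh D a)" "a \<in> Ob D" "b \<in> Ob D" "c \<in> Ob D"
  using assms tria_Ob by (auto simp: tria_def)

lemma hom0_cmp_left: "\<lbrakk>hom0 D x z; f \<in> Homs D x y; g \<in> Homs D y z\<rbrakk> \<Longrightarrow> g \<cdot> f = Zer D x z"
  by (rule hom0D[OF _ cmp_in])

lemma dtri_ident: "\<lbrakk>x \<in> Ob D; zero_object D z\<rbrakk> \<Longrightarrow> dtri D x x z"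
  by (rule tria_dtri[OF tria_ident])

lemma dtri_zero_left: "\<lbrakk>x \<in> Ob D; zero_object D z\<rbrakk> \<Longrightarrow> dtri D z x x"
  by (rule tria_dtri[OF tria_zero_left])

lemma tria_complete:
  assumes "tria D a b c f g h" "tria D a' b' c' f' g' h'" "p \<in> Homs D a a'" "q \<in> Homs D b b'"
    "q \<cdot> f = f' \<cdot> p"
  obtains r where "r \<in> Homs D c c'" "r \<cdot> g = g' \<cdot> q" "ShM D p \<cdot> h = h' \<cdot> r"
proof -
  have "\<exists>r. tri_morphism D (f, g, h) (f', g', h') p q r"
    by (rule tri_complete) (use assms in \<open>auto simp: tria_def Homs_def\<close>)
  then show ?thesis using that assms by (auto simp: tri_morphism_def tria_def Homs_def)
qed

lemma ex_zero: obtains z where "zero_object D z" "z \<in> Ob D"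
  using zero_object_ex by (auto simp: zero_object_def)

lemma tria_comp_zero: assumes "tria D a b c f g h" shows "g \<cdot> f = Zer D a c"
proof -
  obtain z where z: "zero_object D z" "z \<in> Ob D" by (rule ex_zero)
  have ob: "a \<in> Ob D" "b \<in> Ob D" "c \<in> Ob D" using tria_Ob assms by blast+
  have f: "f \<in> Homs D a b" using assms by (simp add: tria_def)
  have "f \<cdot> Ident D a = f \<cdot> Ident D a" ..
  then obtain r where r: "r \<in> Homs D z c" "r \<cdot> Zer D a z = g \<cdot> f"
    using tria_complete[OF tria_ident[OF ob(1) z(1)] assms ident_in[OF ob(1)] f]
    by (metis cmp_ident_right[OF f])
  then show ?thesis using cmp_zer ob by metis
qed

text \<open>The factorisation is the third arrow of a morphism to the triangle 0 to \<open>w\<close>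
  to \<open>w\<close>; nothing makes it unique.\<close>

lemma weak_cokernel:
  assumes "tria D a b c f g h" "t \<in> Homs D b w" "t \<cdot> f = Zer D a w"
  obtains s where "s \<in> Homs D c w" "s \<cdot> g = t"
proof -
  obtain z where z: "zero_object D z" "z \<in> Ob D" by (rule ex_zero)
  have ob: "a \<in> Ob D" "b \<in> Ob D" "c \<in> Ob D" "w \<in> Ob D" using tria_Ob assms Homs_Ob by blast+
  have a: "Zer D a z \<in> Homs D a z" using zer_in ob z by blast
  have "t \<cdot> f = Zer D z w \<cdot> Zer D a z" using assms zer_cmp[OF a ob(4)] by simp
  then obtain r where "r \<in> Homs D c w" "r \<cdot> g = Ident D w \<cdot> t"
    using tria_complete[OF assms(1) tria_zero_left[OF ob(4) z(1)] a assms(2)] by metis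
  then show ?thesis using that cmp_ident_left[OF assms(2)] by metis
qed

text \<open>The completion axiom yields only the third arrow of a morphism of triangles. Both
  triangles are therefore rotated until the arrow sought, shifted once, is the third; fullness and
  faithfulness then remove the shift and the signs.\<close>

lemma weak_kernel:
  assumes t: "tria D a b c f g h" and u: "u \<in> Homs D w b" "g \<cdot> u = Zer D w c"
  obtains s where "s \<in> Homs D w a" "f \<cdot> s = u"
proof -
  obtain z where z: "zero_object D z" "z \<in> Ob D" by (rule ex_zero)
  have ob: "a \<in> Ob D" "b \<in> Ob D" "c \<in> Ob D" "w \<in> Ob D" using tria_Ob t u Homs_Ob by blast+
  have fgh: "f \<in> Homs D a b" "g \<in> Homs D b c" "h \<in> Homs D c (Sh D a)" using t by (auto simp: tria_def)
  have zc: "Zer D z c \<in> Homs D z c" using zer_in ob z by blast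
  have "Zer D z c \<cdot> Zer D w z = g \<cdot> u" using u zer_cmp[OF zer_in[OF ob(4) z(2)] ob(3)] by simp
  then obtain r where r: "r \<in> Homs D (Sh D w) (Sh D a)"
      "ShM D u \<cdot> neg D (ShM D (Ident D w)) = neg D (ShM D f) \<cdot> r"
    using tria_complete[OF tria_rotate[OF tria_ident[OF ob(4) z(1)]] tria_rotate[OF t] u(1) zc]
    by metis
  obtain s where s: "s \<in> Homs D w a" "ShM D s = r" using ShM_full[OF ob(4,1) r(1)] .
  have fs: "f \<cdot> s \<in> Homs D w b" using cmp_in s fgh by blast
  have "neg D (ShM D u) = neg D (ShM D f \<cdot> ShM D s)"
    using r(2) cmp_neg[OF ShM_in[OF ident_in[OF ob(4)]] ShM_in[OF u(1)]]
      neg_cmp[OF ShM_in[OF s(1)] ShM_in[OF fgh(1)]] s ShM_Ident[OF ob(4)]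
      cmp_ident_right[OF ShM_in[OF u(1)]] by simp
  then have "neg D (ShM D u) = neg D (ShM D (f \<cdot> s))" using ShM_cmp[OF s(1) fgh(1)] by simp
  then have "ShM D u = ShM D (f \<cdot> s)" using neg_neg ShM_in u fs by metis
  then have "f \<cdot> s = u" using ShM_faithful[OF u(1) fs] by simp
  with s show ?thesis using that by blast
qed

lemma hom0_mid_right: assumes "dtri D a b c" "hom0 D w a" "hom0 D w c" shows "hom0 D w b"
proof -
  obtain f g h where t: "tria D a b c f g h" using assms(1) by (rule dtriE)
  have w: "w \<in> Ob D" using hom0_Ob[OF assms(2)] by simp
  show ?thesis
  proof (rule hom0I[OF w triaD(5)[OF t]])
    fix u assume u: "u \<in> Homs D w b"
    obtain s where s: "s \<in> Homs D w a" "f \<cdot> s = u"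
      using weak_kernel[OF t u hom0_cmp_left[OF assms(3) u triaD(2)[OF t]]] .
    have "s = Zer D w a" by (rule hom0D[OF assms(2) s(1)])
    then show "u = Zer D w b" using cmp_zer[OF triaD(1)[OF t] w] s by simp
  qed
qed

lemma hom0_mid_left: assumes "dtri D a b c" "hom0 D a w" "hom0 D c w" shows "hom0 D b w"
proof -
  obtain f g h where t: "tria D a b c f g h" using assms(1) by (rule dtriE)
  have w: "w \<in> Ob D" using hom0_Ob[OF assms(2)] by simp
  show ?thesis
  proof (rule hom0I[OF triaD(5)[OF t] w])
    fix u assume u: "u \<in> Homs D b w"
    obtain s where s: "s \<in> Homs D c w" "s \<cdot> g = u"
      using weak_cokernel[OF t u hom0_cmp_left[OF assms(2) triaD(1)[OF t] u]] .
    have "s = Zer D c w" by (rule hom0D[OF assms(3) s(1)])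
    then show "u = Zer D b w" using zer_cmp[OF triaD(2)[OF t] w] s by simp
  qed
qed

text \<open>Exactness one place further to the left: the shift of \<open>s\<close> factors over
  \<open>h\<close> through an arrow from \<open>w[1]\<close> to \<open>c\<close>, and there is only
  the zero arrow.\<close>

lemma monic_part:
  assumes t: "tria D a b c f g h" and s: "s \<in> Homs D w a" "f \<cdot> s = Zer D w b" and "hom0 D (Sh D w) c"
  shows "s = Zer D w a"
proof -
  have ob: "a \<in> Ob D" "b \<in> Ob D" "c \<in> Ob D" "w \<in> Ob D" using tria_Ob t s Homs_Ob by blast+
  have fgh: "f \<in> Homs D a b" "g \<in> Homs D b c" "h \<in> Homs D c (Sh D a)" using t by (auto simp: tria_def)
  have "neg D (ShM D f) \<cdot> ShM D s = neg D (ShM D (f \<cdot> s))"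
    using neg_cmp[OF ShM_in[OF s(1)] ShM_in[OF fgh(1)]] ShM_cmp[OF s(1) fgh(1)] by simp
  also have "\<dots> = Zer D (Sh D w) (Sh D b)"
    using s(2) ShM_Zer[OF ob(4,2)] neg_zer[OF Sh_Ob[OF ob(4)] Sh_Ob[OF ob(2)]] by simp
  finally obtain m where m: "m \<in> Homs D (Sh D w) c" "h \<cdot> m = ShM D s"
    using weak_kernel[OF tria_rotate[OF tria_rotate[OF t]] ShM_in[OF s(1)]] by blast
  have "m = Zer D (Sh D w) c" by (rule hom0D[OF assms(4) m(1)])
  then have "ShM D s = Zer D (Sh D w) (Sh D a)" using cmp_zer[OF fgh(3) Sh_Ob[OF ob(4)]] m by simp
  then show ?thesis using ShM_eq_Zer s by blast
qed

lemma epic_part: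
  assumes t: "tria D a b c f g h" and s: "s \<in> Homs D c w" "s \<cdot> g = Zer D b w" and "hom0 D (Sh D a) w"
  shows "s = Zer D c w"
proof -
  have w: "w \<in> Ob D" using Homs_Ob s(1) by simp
  obtain m where m: "m \<in> Homs D (Sh D a) w" "m \<cdot> h = s"
    using weak_cokernel[OF tria_rotate[OF t] s] .
  have "m = Zer D (Sh D a) w" by (rule hom0D[OF assms(4) m(1)])
  then show ?thesis using m zer_cmp[OF triaD(3)[OF t] w] by simp
qed

lemma tria_zero_third:
  assumes t: "tria D a b c f g h" and "zero_object D c" shows "iso_arr D f"
proof -
  have ob: "a \<in> Ob D" "b \<in> Ob D" "c \<in> Ob D" using tria_Ob t by blast+
  have fgh: "f \<in> Homs D a b" "g \<in> Homs D b c" "h \<in> Homs D c (Sh D a)" using t by (auto simp: tria_def)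
  have "hom0 D b c" using zero_hom0[OF assms(2) ob(2)] by simp
  then obtain s where s: "s \<in> Homs D b a" "f \<cdot> s = Ident D b"
    using weak_kernel[OF t ident_in[OF ob(2)] hom0_cmp_left[OF _ ident_in[OF ob(2)] fgh(2)]] by blast
  have "s \<cdot> f = Ident D a"
  proof (rule left_cancel_test[OF fgh(1) cmp_in[OF fgh(1) s(1)] ident_in[OF ob(1)]])
    show "f \<cdot> (s \<cdot> f) = f \<cdot> Ident D a"
      using cmp_assoc[OF fgh(1) s(1) fgh(1)] s cmp_ident_left[OF fgh(1)] cmp_ident_right[OF fgh(1)] by simp
    show "u = Zer D a a" if "u \<in> Homs D a a" "f \<cdot> u = Zer D a b" for u
      using monic_part[OF t that] zero_hom0[OF assms(2)] Sh_Ob ob by blast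
  qed
  then show ?thesis using iso_arrI fgh s by blast
qed

lemma dtri_zero_third: "dtri D a b c \<Longrightarrow> zero_object D c \<Longrightarrow> isomorphic D a b"
  by (elim dtriE) (auto simp: isomorphic_def intro: tria_zero_third triaD(1))

lemma dtri_zero_first: "dtri D a b c \<Longrightarrow> zero_object D a \<Longrightarrow> isomorphic D b c"
  using dtri_zero_third[OF dtri_rotate] zero_Sh_iff[of a] dtri_Ob by blast

lemma dtri_zero_mid: "dtri D a b c \<Longrightarrow> zero_object D b \<Longrightarrow> isomorphic D c (Sh D a)"
  using dtri_zero_first[OF dtri_rotate] by blast

text \<open>The domain of \<open>u\<close> and the codomain of \<open>v\<close> in the octahedral axiom are not prescribed; they are
  recovered from the last two commutativity conditions.\<close>

lemma tria_octahedral: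
  assumes t: "tria D a b c f g h" and t': "tria D b d e f' g' h'" and q: "tria D a d q (f' \<cdot> f) k l"
  obtains u v w where "tria D c q e u v w" "u \<cdot> g = k \<cdot> f'" "l \<cdot> u = h" "v \<cdot> k = g'" "h' \<cdot> v = ShM D f \<cdot> l"
proof -
  have fgh: "f \<in> Homs D a b" "g \<in> Homs D b c" "h \<in> Homs D c (Sh D a)" using t by (auto simp: tria_def)
  have fgh': "f' \<in> Homs D b d" "g' \<in> Homs D d e" "h' \<in> Homs D e (Sh D b)" using t' by (auto simp: tria_def)
  have kl: "k \<in> Homs D d q" "l \<in> Homs D q (Sh D a)" using q by (auto simp: tria_def)
  obtain u v where uv: "(u, v, ShM D g \<cdot> h') \<in> Tri D" "u \<cdot> g = k \<cdot> f'" "l \<cdot> u = h" "v \<cdot> k = g'" "h' \<cdot> v = ShM D f \<cdot> l"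
    using octahedral[of f g h f' g' h' k l] t t' q by (auto simp: tria_def Homs_def)
  have w: "ShM D g \<cdot> h' \<in> Homs D e (Sh D c)" by (rule cmp_in[OF fgh'(3) ShM_in[OF fgh(2)]])
  have tu: "tria D (Dom D u) (Cod D u) (Cod D v) u v (ShM D g \<cdot> h')" by (rule Tri_tria[OF uv(1)])
  then have e: "Cod D v = e" using w by (auto simp: tria_def Homs_def)
  have "v \<in> Homs D (Cod D u) e" using tu e by (simp add: tria_def)
  then have "h' \<cdot> v \<in> Homs D (Cod D u) (Sh D b)" using cmp_in fgh'(3) by blast
  moreover have "ShM D f \<cdot> l \<in> Homs D q (Sh D b)" by (rule cmp_in[OF kl(2) ShM_in[OF fgh(1)]])
  ultimately have cq: "Cod D u = q" using uv(5) by (simp add: Homs_def)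
  have "u \<in> Homs D (Dom D u) q" using tu cq by (simp add: tria_def)
  then have "l \<cdot> u \<in> Homs D (Dom D u) (Sh D a)" using cmp_in kl(2) by blast
  then have "Dom D u = c" using uv(3) fgh(3) by (simp add: Homs_def)
  then show ?thesis using that tu cq e uv by simp
qed

lemma dtri_octahedral:
  assumes "dtri D a b c" "dtri D b d e"
  obtains q where "dtri D a d q" "dtri D c q e"
proof -
  obtain f g h where t: "tria D a b c f g h" using assms(1) by (rule dtriE)
  obtain f' g' h' where t': "tria D b d e f' g' h'" using assms(2) by (rule dtriE)
  have c: "f' \<cdot> f \<in> Homs D a d" using t t' cmp_in by (auto simp: tria_def)
  then obtain q k l where q: "tria D a d q (f' \<cdot> f) k l" by (rule tria_ex)
  obtain u v w where u: "tria D c q e u v w" using tria_octahedral[OF t t' q] .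
  show ?thesis by (rule that[OF tria_dtri[OF q] tria_dtri[OF u]])
qed

text \<open>The triangulated form of a preimage: \<open>m\<close> stands for the preimage in
  \<open>b\<close> of the subobject \<open>u\<close> of \<open>c\<close>. It is the desuspended cone
  of the composite \<open>b\<close> to \<open>c\<close> to \<open>w\<close>.\<close>

lemma dtri_pullback:
  assumes "dtri D a b c" "dtri D u c w"
  obtains m where "dtri D a m u" "dtri D m b w"
proof -
  have ob: "a \<in> Ob D" "b \<in> Ob D" "c \<in> Ob D" "u \<in> Ob D" "w \<in> Ob D" using assms dtri_Ob by blast+
  obtain q where q: "dtri D b w q" "dtri D (Sh D a) q (Sh D u)"
    using dtri_octahedral[OF dtri_rotate[OF assms(1)] dtri_rotate[OF assms(2)]] .
  have qo: "q \<in> Ob D" using q dtri_Ob by blast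
  note m = desusp(1)[OF qo] isomorphic_sym[OF desusp(2)[OF qo]]
  have 1: "dtri D b w (Sh D (desusp D q))"
    by (rule dtri_iso[OF q(1) isomorphic_refl[OF ob(2)] isomorphic_refl[OF ob(5)] m(2)])
  have 2: "dtri D (Sh D a) (Sh D (desusp D q)) (Sh D u)"
    by (rule dtri_iso[OF q(2) isomorphic_refl m(2) isomorphic_refl]) (rule Sh_Ob ob)+
  show ?thesis
    by (rule that[OF dtri_unshift[OF 2 ob(1) m(1) ob(4)] dtri_rotate_back[OF 1 m(1)]])
qed

text \<open>The triangulated form of the third isomorphism theorem: once \<open>f\<close> lifts to
  \<open>y0\<close>, the object \<open>j\<close> plays the role of \<open>y0/a\<close> inside
  \<open>y/a\<close>, and the quotient is \<open>y1\<close>.\<close>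

lemma tria_lift:
  assumes y: "tria D y0 y y1 i p r" and a: "tria D a y q f k l" and "p \<cdot> f = Zer D a y1"
  obtains j where "dtri D a y0 j" "dtri D j q y1"
proof -
  obtain s where s: "s \<in> Homs D a y0" "i \<cdot> s = f" using weak_kernel[OF y triaD(1)[OF a] assms(3)] .
  obtain j k' l' where j: "tria D a y0 j s k' l'" using tria_ex[OF s(1)] .
  have a': "tria D a y q (i \<cdot> s) k l" using a s by simp
  obtain u v w where u: "tria D j q y1 u v w" using tria_octahedral[OF j y a'] .
  show ?thesis by (rule that[OF tria_dtri[OF j] tria_dtri[OF u]])
qed

lemma dtri_lift:
  assumes "dtri D y0 y y1" "dtri D a y q" "hom0 D a y1"
  obtains j where "dtri D a y0 j" "dtri D j q y1"
proof -
  obtain i p r where y: "tria D y0 y y1 i p r" using assms(1) by (rule dtriE)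
  obtain f k l where a: "tria D a y q f k l" using assms(2) by (rule dtriE)
  have "p \<cdot> f = Zer D a y1" by (rule hom0_cmp_left[OF assms(3) triaD(1)[OF a] triaD(2)[OF y]])
  from tria_lift[OF y a this] obtain j where "dtri D a y0 j" "dtri D j q y1" .
  then show ?thesis by (rule that)
qed

lemma isomorphic_desusp: assumes "isomorphic D x y" shows "isomorphic D (desusp D x) (desusp D y)"
proof -
  have ob: "x \<in> Ob D" "y \<in> Ob D" using isomorphic_Ob assms by auto
  have "isomorphic D (Sh D (desusp D x)) (Sh D (desusp D y))"
    by (rule isomorphic_trans[OF desusp(2)[OF ob(1)] isomorphic_trans[OF assms isomorphic_sym[OF desusp(2)[OF ob(2)]]]])
  then show ?thesis by (rule isomorphic_Sh_cancel[OF _ desusp(1)[OF ob(1)] desusp(1)[OF ob(2)]])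
qed

lemma desusp_Sh: "x \<in> Ob D \<Longrightarrow> isomorphic D (desusp D (Sh D x)) x"
  using isomorphic_Sh_cancel desusp Sh_Ob by simp

lemma dtri_back: assumes "dtri D a b c" shows "dtri D (desusp D c) a b"
proof -
  have ob: "a \<in> Ob D" "b \<in> Ob D" "c \<in> Ob D" using assms dtri_Ob by blast+
  have "dtri D a b (Sh D (desusp D c))"
    by (rule dtri_iso[OF assms isomorphic_refl isomorphic_refl isomorphic_sym]) (use ob desusp in auto)
  then show ?thesis by (rule dtri_rotate_back[OF _ desusp(1)[OF ob(3)]])
qed

lemma dtri_desusp: "dtri D a b c \<Longrightarrow> dtri D (desusp D a) (desusp D b) (desusp D c)"
  by (rule dtri_back[OF dtri_back[OF dtri_back]])

lemma Sh_pow_Ob: "x \<in> Ob D \<Longrightarrow> (Sh D ^^ n) x \<in> Ob D"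
  by (induction n) (auto simp: Sh_Ob)

lemma desusp_pow_Ob: "x \<in> Ob D \<Longrightarrow> (desusp D ^^ n) x \<in> Ob D"
  by (induction n) (auto simp: desusp(1))

lemma dtri_Sh_pow: "dtri D a b c \<Longrightarrow> dtri D ((Sh D ^^ n) a) ((Sh D ^^ n) b) ((Sh D ^^ n) c)"
  by (induction n) (auto intro: dtri_shift)

lemma dtri_desusp_pow: "dtri D a b c \<Longrightarrow> dtri D ((desusp D ^^ n) a) ((desusp D ^^ n) b) ((desusp D ^^ n) c)"
  by (induction n) (auto intro: dtri_desusp)

lemma isomorphic_Sh_pow: "isomorphic D x y \<Longrightarrow> isomorphic D ((Sh D ^^ n) x) ((Sh D ^^ n) y)"
  by (induction n) (auto intro: isomorphic_Sh)

lemma isomorphic_desusp_pow: "isomorphic D x y \<Longrightarrow> isomorphic D ((desusp D ^^ n) x) ((desusp D ^^ n) y)"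
  by (induction n) (auto intro: isomorphic_desusp)

lemma desusp_pow_Sh_pow: "x \<in> Ob D \<Longrightarrow> isomorphic D ((desusp D ^^ n) ((Sh D ^^ n) x)) x"
proof (induction n)
  case (Suc n)
  have "isomorphic D ((desusp D ^^ n) (desusp D (Sh D ((Sh D ^^ n) x)))) ((desusp D ^^ n) ((Sh D ^^ n) x))"
    by (rule isomorphic_desusp_pow[OF desusp_Sh[OF Sh_pow_Ob[OF Suc.prems]]])
  then show ?case using isomorphic_trans Suc by (simp add: funpow_swap1)
qed (simp add: isomorphic_refl)

lemma Sh_pow_desusp_pow: "x \<in> Ob D \<Longrightarrow> isomorphic D ((Sh D ^^ n) ((desusp D ^^ n) x)) x"
proof (induction n)
  case (Suc n)
  have "isomorphic D ((Sh D ^^ n) (Sh D (desusp D ((desusp D ^^ n) x)))) ((Sh D ^^ n) ((desusp D ^^ n) x))"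
    by (rule isomorphic_Sh_pow[OF desusp(2)[OF desusp_pow_Ob[OF Suc.prems]]])
  then show ?case using isomorphic_trans Suc by (simp add: funpow_swap1)
qed (simp add: isomorphic_refl)

lemma hom0_Sh_pow: "x \<in> Ob D \<Longrightarrow> y \<in> Ob D \<Longrightarrow> hom0 D ((Sh D ^^ n) x) ((Sh D ^^ n) y) \<longleftrightarrow> hom0 D x y"
  by (induction n) (auto simp: hom0_shift Sh_pow_Ob)

lemma zero_Sh_pow: "x \<in> Ob D \<Longrightarrow> zero_object D ((Sh D ^^ n) x) \<longleftrightarrow> zero_object D x"
  by (induction n) (auto simp: zero_Sh_iff Sh_pow_Ob)

end

section \<open>Bounded t-structures\<close>

locale bounded_t = triangulated_category D
  for D :: "('o, 'm, 'x) triangulated_data_scheme" (structure) +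
  fixes U V :: "'o set"
  assumes bounded: "bounded_t_structure D U V"
begin

lemma ts: "t_structure D U V"
  using bounded by (simp add: bounded_t_structure_def)

lemma U_Ob: "x \<in> U \<Longrightarrow> x \<in> Ob D" and V_Ob: "x \<in> V \<Longrightarrow> x \<in> Ob D"
  using ts by (auto simp: t_structure_def iso_closed_def)

lemma U_iso: "x \<in> U \<Longrightarrow> isomorphic D x y \<Longrightarrow> y \<in> U"
  using ts isomorphic_Ob unfolding t_structure_def iso_closed_def by blast

lemma V_iso: "x \<in> V \<Longrightarrow> isomorphic D x y \<Longrightarrow> y \<in> V"
  using ts isomorphic_Ob unfolding t_structure_def iso_closed_def by blast

lemma U_Sh: assumes "x \<in> U" shows "Sh D x \<in> U"
proof -
  have "Sh D x \<in> shift_sub D U 1"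
    using assms Sh_Ob[OF U_Ob] isomorphic_refl[OF Sh_Ob[OF U_Ob]] by (auto simp: shift_sub_def)
  then show ?thesis using ts by (auto simp: t_structure_def)
qed

lemma shift_V: "shift_sub D V (- 1) = {x \<in> Ob D. Sh D x \<in> V}"
  by (auto simp: shift_sub_def)

lemma V_fall: "x \<in> Ob D \<Longrightarrow> Sh D x \<in> V \<Longrightarrow> x \<in> V"
  using ts by (auto simp: t_structure_def shift_V)

lemma V_desusp: assumes "x \<in> V" shows "desusp D x \<in> V" "Sh D (desusp D x) \<in> V" "desusp D x \<in> Ob D"
proof -
  show 1: "Sh D (desusp D x) \<in> V"
    by (rule V_iso[OF assms isomorphic_sym[OF desusp(2)[OF V_Ob[OF assms]]]])
  show 2: "desusp D x \<in> Ob D" using desusp V_Ob assms by blast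
  show "desusp D x \<in> V" by (rule V_fall[OF 2 1])
qed

lemma hom0_UV': "u \<in> U \<Longrightarrow> w \<in> Ob D \<Longrightarrow> Sh D w \<in> V \<Longrightarrow> hom0 D u w"
  using ts by (auto simp: t_structure_def shift_V homs_vanish_def hom0_def)

lemma hom0_UV: assumes "u \<in> U" "v \<in> V" shows "hom0 D (Sh D u) v"
proof -
  have "hom0 D u (desusp D v)" using hom0_UV' assms V_desusp by blast
  then have "hom0 D (Sh D u) (Sh D (desusp D v))"
    using hom0_shift[OF U_Ob[OF assms(1)] V_desusp(3)[OF assms(2)]] by simp
  then show ?thesis using hom0_iso_right desusp(2)[OF V_Ob[OF assms(2)]] by blast
qed

lemma decomp:
  assumes "x \<in> Ob D" obtains u w where "dtri D u x w" "u \<in> U" "w \<in> Ob D" "Sh D w \<in> V"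
proof -
  have "\<exists>(f, g, h) \<in> Tri D. Dom D f \<in> U \<and> Cod D f = x \<and> Cod D g \<in> shift_sub D V (- 1)"
    using ts assms by (simp add: t_structure_def)
  then obtain f g h where t: "(f, g, h) \<in> Tri D" "Dom D f \<in> U" "Cod D f = x" "Cod D g \<in> Ob D" "Sh D (Cod D g) \<in> V"
    unfolding shift_V by auto
  then show ?thesis using that dtri_Tri by metis
qed

lemma decomp1:
  assumes "x \<in> Ob D" obtains u v where "dtri D (Sh D u) x v" "u \<in> U" "v \<in> V"
proof -
  obtain u w where uw: "dtri D u (desusp D x) w" "u \<in> U" "w \<in> Ob D" "Sh D w \<in> V"
    using decomp desusp(1)[OF assms] by blast
  have "dtri D (Sh D u) x (Sh D w)"
    by (rule dtri_iso[OF dtri_shift[OF uw(1)] isomorphic_refl desusp(2)[OF assms] isomorphic_refl])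
      (use uw Sh_Ob U_Ob in auto)
  then show ?thesis using that uw by blast
qed

text \<open>Truncate \<open>x\<close> by a triangle on \<open>u\<close>, \<open>x\<close>,
  \<open>w\<close>. The group Hom(\<open>w\<close>, \<open>w\<close>) lies between
  Hom(\<open>x\<close>, \<open>w\<close>) and Hom(\<open>u[1]\<close>, \<open>w\<close>), which both
  vanish, so \<open>w\<close> is zero. Closure of the aisle under extensions is immediate from this
  orthogonality.\<close>

lemma U_iff: "x \<in> U \<longleftrightarrow> x \<in> Ob D \<and> (\<forall>v \<in> V. hom0 D (Sh D x) v)"
proof
  assume "x \<in> Ob D \<and> (\<forall>v \<in> V. hom0 D (Sh D x) v)"
  then have x: "x \<in> Ob D" and h: "\<And>v. v \<in> V \<Longrightarrow> hom0 D (Sh D x) v" by auto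
  obtain u w where uw: "dtri D u x w" "u \<in> U" "w \<in> Ob D" "Sh D w \<in> V" using decomp[OF x] .
  have "hom0 D x w" using h[OF uw(4)] hom0_shift[OF x uw(3)] by simp
  then have "hom0 D w w"
    using hom0_mid_left[OF dtri_rotate[OF uw(1)]] hom0_UV'[OF U_Sh[OF uw(2)] uw(3,4)] by simp
  then have "isomorphic D u x" using dtri_zero_third[OF uw(1)] zero_object_iff by simp
  then show "x \<in> U" by (rule U_iso[OF uw(2)])
qed (use U_Ob hom0_UV in auto)

lemma V_iff: "x \<in> V \<longleftrightarrow> x \<in> Ob D \<and> (\<forall>u \<in> U. hom0 D (Sh D u) x)"
proof
  assume "x \<in> Ob D \<and> (\<forall>u \<in> U. hom0 D (Sh D u) x)"
  then have x: "x \<in> Ob D" and h: "\<And>u. u \<in> U \<Longrightarrow> hom0 D (Sh D u) x" by auto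
  obtain u v where uv: "dtri D (Sh D u) x v" "u \<in> U" "v \<in> V" using decomp1[OF x] .
  have "hom0 D (Sh D u) (desusp D v)"
    using hom0_UV'[OF U_Sh[OF uv(2)] V_desusp(3,2)[OF uv(3)]] .
  then have "hom0 D (Sh D u) (Sh D u)"
    using hom0_mid_right[OF dtri_back[OF uv(1)] _ h[OF uv(2)]] by simp
  then have "isomorphic D x v" using dtri_zero_first[OF uv(1)] zero_object_iff by simp
  then show "x \<in> V" using V_iso[OF uv(3)] isomorphic_sym by blast
qed (use V_Ob hom0_UV in auto)

lemma U_ext: assumes "dtri D a b c" "a \<in> U" "c \<in> U" shows "b \<in> U"
  unfolding U_iff using hom0_mid_left[OF dtri_shift[OF assms(1)]] hom0_UV assms dtri_Ob by blast

lemma V_ext: assumes "dtri D a b c" "a \<in> V" "c \<in> V" shows "b \<in> V"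
  unfolding V_iff using hom0_mid_right[OF assms(1)] hom0_UV assms dtri_Ob by blast

lemma U_cone: "dtri D a b c \<Longrightarrow> a \<in> U \<Longrightarrow> b \<in> U \<Longrightarrow> c \<in> U"
  using U_ext[OF dtri_rotate] U_Sh by blast

lemma V_fibre: "dtri D a b c \<Longrightarrow> b \<in> V \<Longrightarrow> c \<in> V \<Longrightarrow> a \<in> V"
  using V_ext[OF dtri_back] V_desusp by blast

lemma heart_ext: "dtri D a b c \<Longrightarrow> a \<in> U \<inter> V \<Longrightarrow> c \<in> U \<inter> V \<Longrightarrow> b \<in> U \<inter> V"
  using U_ext V_ext by blast

lemma heart_iso: "a \<in> U \<inter> V \<Longrightarrow> isomorphic D a b \<Longrightarrow> b \<in> U \<inter> V"
  using U_iso V_iso by blast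

lemma zero_heart: assumes "zero_object D z" shows "z \<in> U \<inter> V"
proof -
  have z: "z \<in> Ob D" "zero_object D (Sh D z)" using assms zero_Sh_iff by (auto simp: zero_object_def)
  have "z \<in> U" unfolding U_iff using zero_hom0[OF z(2)] V_Ob z by blast
  moreover have "z \<in> V" unfolding V_iff using zero_hom0[OF assms] U_Ob Sh_Ob z by blast
  ultimately show ?thesis by blast
qed

lemma U_Sh_pow: "x \<in> U \<Longrightarrow> (Sh D ^^ n) x \<in> U"
  by (induction n) (auto intro: U_Sh)

lemma V_desusp_pow: "x \<in> V \<Longrightarrow> (desusp D ^^ n) x \<in> V"
  by (induction n) (auto intro: V_desusp)

lemma V_fall_pow: "x \<in> Ob D \<Longrightarrow> (Sh D ^^ n) x \<in> V \<Longrightarrow> x \<in> V"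
  by (induction n) (auto intro: V_fall Sh_pow_Ob)

lemma hom0_UV_pow: assumes "u \<in> U" "v \<in> V" "0 < n" shows "hom0 D ((Sh D ^^ n) u) v"
  using hom0_UV[OF U_Sh_pow[OF assms(1), of "n - 1"] assms(2)] assms(3) by (cases n) auto

lemma bound_above: assumes "x \<in> Ob D" obtains n where "(Sh D ^^ n) x \<in> U"
proof -
  obtain m where m: "x \<in> shift_sub D U m" using bounded assms by (auto simp: bounded_t_structure_def)
  show ?thesis
  proof (cases "0 \<le> m")
    case True
    then obtain s where s: "s \<in> U" "isomorphic D x ((Sh D ^^ nat m) s)" using m by (auto simp: shift_sub_def)
    then have "x \<in> U" using U_iso[OF U_Sh_pow[OF s(1)]] isomorphic_sym by blast
    then show ?thesis using that[of 0] by simp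
  qed (use m that in \<open>auto simp: shift_sub_def\<close>)
qed

lemma bound_below: assumes "x \<in> Ob D" obtains n where "(desusp D ^^ n) x \<in> V"
proof -
  obtain m where m: "x \<in> shift_sub D V m" using bounded assms by (auto simp: bounded_t_structure_def)
  show ?thesis
  proof (cases "0 \<le> m")
    case True
    then obtain s where s: "s \<in> V" "isomorphic D x ((Sh D ^^ nat m) s)" using m by (auto simp: shift_sub_def)
    have "isomorphic D ((desusp D ^^ nat m) x) s"
      by (rule isomorphic_trans[OF isomorphic_desusp_pow[OF s(2)] desusp_pow_Sh_pow[OF V_Ob[OF s(1)]]])
    then have "(desusp D ^^ nat m) x \<in> V" using V_iso[OF s(1)] isomorphic_sym by blast
    then show ?thesis using that by blast
  next
    case False
    then have "x \<in> V" using m V_fall_pow assms by (auto simp: shift_sub_def)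
    then show ?thesis using that[of 0] by simp
  qed
qed

text \<open>\<open>amp n x\<close>: the cohomology of \<open>x\<close> is concentrated in the degrees \<open>0, \<dots>, n - 1\<close>.\<close>

definition amp :: "nat \<Rightarrow> 'o \<Rightarrow> bool" where
  "amp n x \<longleftrightarrow> x \<in> V \<and> (\<forall>v \<in> V. hom0 D ((Sh D ^^ n) x) v)"

lemma amp_ex: assumes "x \<in> V" obtains n where "amp n x"
proof -
  obtain n where "(Sh D ^^ n) x \<in> U" using bound_above V_Ob assms by blast
  then have "amp (Suc n) x" using hom0_UV assms by (auto simp: amp_def)
  then show ?thesis by (rule that)
qed

lemma amp_0: "amp 0 x \<Longrightarrow> zero_object D x"
  by (auto simp: amp_def zero_object_iff)

lemma amp_pow_U: assumes "amp n x" shows "(Sh D ^^ n) x \<in> U"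
  unfolding U_iff
proof (intro conjI ballI)
  let ?y = "(Sh D ^^ n) x"
  have y: "?y \<in> Ob D" "\<And>v. v \<in> V \<Longrightarrow> hom0 D ?y v" using assms V_Ob Sh_pow_Ob by (auto simp: amp_def)
  show "?y \<in> Ob D" by (rule y)
  fix v assume v: "v \<in> V"
  have "hom0 D ?y (desusp D v)" using y(2)[OF V_desusp(1)[OF v]] .
  then have "hom0 D (Sh D ?y) (Sh D (desusp D v))" using hom0_shift[OF y(1) V_desusp(3)[OF v]] by simp
  then show "hom0 D (Sh D ?y) v" using hom0_iso_right desusp(2)[OF V_Ob[OF v]] by blast
qed

lemma amp_Suc: assumes "amp n x" shows "amp (Suc n) x"
  using assms hom0_UV[OF amp_pow_U[OF assms]] by (simp add: amp_def)

lemma amp_mono: "amp n x \<Longrightarrow> n \<le> m \<Longrightarrow> amp m x"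
  by (induction m) (auto simp: le_Suc_eq intro: amp_Suc)

lemma trunc:
  assumes "x \<in> V" obtains k w where "dtri D k x w" "k \<in> U \<inter> V" "w \<in> Ob D" "Sh D w \<in> V"
proof -
  obtain u w where uw: "dtri D u x w" "u \<in> U" "w \<in> Ob D" "Sh D w \<in> V" using decomp V_Ob[OF assms] by blast
  moreover have "u \<in> V" using V_fibre[OF uw(1) assms] V_fall uw by blast
  ultimately show ?thesis using that by blast
qed

text \<open>Removing the lowest cohomology object leaves the degrees from 1 on; the shift moves them
  down to 0, so one degree is lost.\<close>

lemma amp_trunc:
  assumes "amp (Suc n) x" "dtri D k x w" "k \<in> U" "Sh D w \<in> V" shows "amp n (Sh D w)"
  unfolding amp_def
proof (intro conjI ballI)
  fix v assume v: "v \<in> V"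
  have "hom0 D ((Sh D ^^ Suc n) w) v"
  proof (rule hom0_mid_left[OF dtri_Sh_pow[OF dtri_rotate[OF assms(2)]]])
    show "hom0 D ((Sh D ^^ Suc n) x) v" using assms(1) v by (simp add: amp_def)
    show "hom0 D ((Sh D ^^ Suc n) (Sh D k)) v" using hom0_UV_pow[OF U_Sh[OF assms(3)] v, of "Suc n"] by simp
  qed
  then show "hom0 D ((Sh D ^^ n) (Sh D w)) v" by (simp add: funpow_swap1)
qed (use assms in simp)

text \<open>Replaces functoriality of truncation. The cone \<open>j\<close> of the comparison arrow
  lies in the aisle and in the co-aisle shifted by -1, so its identity vanishes.\<close>

lemma trunc_unique:
  assumes "dtri D u x w" "u \<in> U" "w \<in> Ob D" "Sh D w \<in> V" "dtri D u' x w'" "u' \<in> U" "w' \<in> Ob D" "Sh D w' \<in> V"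
  shows "isomorphic D u u'" "isomorphic D w w'"
proof -
  obtain j where j: "dtri D u u' j" "dtri D j w w'"
    using dtri_lift[OF assms(5,1) hom0_UV'[OF assms(2,7,8)]] .
  have jo: "j \<in> Ob D" using j dtri_Ob by blast
  have "j \<in> U" using U_cone[OF j(1)] assms by blast
  moreover have "Sh D j \<in> V" using V_fibre[OF dtri_shift[OF j(2)]] assms by blast
  ultimately have "zero_object D j" using hom0_UV' jo zero_object_iff by blast
  then show "isomorphic D u u'" "isomorphic D w w'" using dtri_zero_third[OF j(1)] dtri_zero_first[OF j(2)] by auto
qed

lemma cotrunc:
  assumes "x \<in> U" obtains u k where "dtri D (Sh D u) x k" "u \<in> U" "k \<in> U \<inter> V"
proof -
  obtain u v where uv: "dtri D (Sh D u) x v" "u \<in> U" "v \<in> V" using decomp1 U_Ob[OF assms] by blast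
  moreover have "v \<in> U" using U_cone[OF uv(1)] U_Sh uv assms by blast
  ultimately show ?thesis using that by blast
qed

text \<open>A property of heart objects that survives extensions and shifts propagates to the aisle;
  the induction runs over the number of degrees in which \<open>x\<close> may have cohomology.\<close>

lemma aisle_induct:
  assumes "x \<in> U" and zero: "\<And>z. zero_object D z \<Longrightarrow> P z"
    and step: "\<And>u y k. \<lbrakk>dtri D (Sh D u) y k; u \<in> U; k \<in> U \<inter> V; y \<in> U; P u\<rbrakk> \<Longrightarrow> P y"
  shows "P x"
proof -
  obtain n where n: "(desusp D ^^ n) x \<in> V" using bound_below U_Ob[OF assms(1)] by blast
  have xo: "x \<in> Ob D" using U_Ob assms by blast
  have "hom0 D ((Sh D ^^ Suc n) u) x" if u: "u \<in> U" for u
  proof -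
    have "hom0 D ((Sh D ^^ n) (Sh D u)) ((Sh D ^^ n) ((desusp D ^^ n) x))"
      using hom0_Sh_pow[OF Sh_Ob[OF U_Ob[OF u]] V_Ob[OF n]] hom0_UV[OF u n] by simp
    then show ?thesis using hom0_iso_right Sh_pow_desusp_pow[OF xo] by (simp add: funpow_swap1)
  qed
  moreover have "(\<forall>u \<in> U. hom0 D ((Sh D ^^ N) u) x) \<Longrightarrow> P x" if "x \<in> U" for N x
    using that
  proof (induction N arbitrary: x)
    case 0
    then show ?case using zero zero_object_iff by auto
  next
    case (Suc N)
    obtain u k where uk: "dtri D (Sh D u) x k" "u \<in> U" "k \<in> U \<inter> V" using cotrunc Suc.prems by blast
    have "hom0 D ((Sh D ^^ N) u') u" if u': "u' \<in> U" for u'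
    proof -
      have k: "desusp D k \<in> Ob D" "Sh D (desusp D k) \<in> V" using V_desusp uk by blast+
      have "hom0 D ((Sh D ^^ Suc N) u') (Sh D u)"
        by (rule hom0_mid_right[OF dtri_back[OF uk(1)] hom0_UV'[OF U_Sh_pow[OF u'] k]])
          (use Suc.prems u' in blast)
      then show ?thesis using hom0_shift[OF Sh_pow_Ob[OF U_Ob[OF u']] U_Ob[OF uk(2)]] by simp
    qed
    then have "P u" using Suc.IH uk by blast
    then show ?case using step uk Suc.prems by blast
  qed
  ultimately show ?thesis using assms(1) by blast
qed

end

text \<open>A condition on hearts becomes one on aisles: objects of an aisle and of a co-aisle are
  built from shifted heart objects, and vanishing of Hom survives extensions. With \<open>m\<close>
  = 1 this serves the relation K \<ge> H, with \<open>m\<close> = 2 the relation H[1] \<ge>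
  K.\<close>

lemma (in triangulated_category) hearts_hom0:
  assumes "bounded_t_structure D U V" "bounded_t_structure D U' V'"
    and h: "\<And>n k h. \<lbrakk>m \<le> n; k \<in> U \<inter> V; h \<in> U' \<inter> V'\<rbrakk> \<Longrightarrow> hom0 D ((Sh D ^^ n) k) h"
    and "x \<in> U" "v \<in> V'"
  shows "hom0 D ((Sh D ^^ m) x) v"
proof -
  interpret A: bounded_t D U V by unfold_locales (rule assms)
  interpret B: bounded_t D U' V' by unfold_locales (rule assms)
  \<comment> \<open>All \<open>n\<close> from \<open>m\<close> on must be treated together, since
    passing from \<open>v\<close> to its truncation \<open>w[1]\<close> raises the shift of
    \<open>k\<close> by one.\<close>
  have 1: "hom0 D ((Sh D ^^ n) k) v" if "B.amp N v" "m \<le> n" "k \<in> U \<inter> V" for N n k v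
    using that
  proof (induction N arbitrary: v n)
    case 0
    then show ?case using zero_hom0[OF B.amp_0[OF 0(1)] Sh_pow_Ob[OF A.U_Ob]] by simp
  next
    case (Suc N)
    have vV: "v \<in> V'" using Suc.prems by (simp add: B.amp_def)
    obtain h w where hw: "dtri D h v w" "h \<in> U' \<inter> V'" "w \<in> Ob D" "Sh D w \<in> V'" using B.trunc[OF vV] .
    have ko: "k \<in> Ob D" using A.U_Ob Suc.prems by blast
    have "hom0 D ((Sh D ^^ Suc n) k) (Sh D w)"
      using Suc.IH[OF B.amp_trunc[OF Suc.prems(1) hw(1)], of "Suc n"] hw Suc.prems by simp
    then have "hom0 D ((Sh D ^^ n) k) w" using hom0_shift[OF Sh_pow_Ob[OF ko] hw(3)] by simp
    then show ?case using hom0_mid_right[OF hw(1) h[OF Suc.prems(2,3) hw(2)]] by blast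
  qed
  have "\<forall>n v. m \<le> n \<longrightarrow> v \<in> V' \<longrightarrow> hom0 D ((Sh D ^^ n) x) v"
  proof (rule A.aisle_induct[OF assms(4)]; intro allI impI)
    fix z n v assume "zero_object D z" "v \<in> V'"
    then show "hom0 D ((Sh D ^^ n) z) v"
      using zero_hom0[of "(Sh D ^^ n) z" v] zero_Sh_pow[of z n] B.V_Ob by (auto simp: zero_object_def)
  next
    fix u y k n v
    assume a: "dtri D (Sh D u) y k" "k \<in> U \<inter> V" "m \<le> n" "v \<in> V'"
      "\<forall>n v. m \<le> n \<longrightarrow> v \<in> V' \<longrightarrow> hom0 D ((Sh D ^^ n) u) v"
    obtain N where N: "B.amp N v" using B.amp_ex[OF a(4)] .
    have "hom0 D ((Sh D ^^ Suc n) u) v" using a(3-5) by (metis le_SucI)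
    then have "hom0 D ((Sh D ^^ n) (Sh D u)) v" by (simp add: funpow_swap1)
    then show "hom0 D ((Sh D ^^ n) y) v"
      using hom0_mid_left[OF dtri_Sh_pow[OF a(1)]] 1[OF N a(3,2)] by blast
  qed
  then show ?thesis using assms by blast
qed

lemma (in triangulated_category) heart_ge_iff:
  assumes "K \<subseteq> Ob D" "H \<subseteq> Ob D"
  shows "heart_ge D K H \<longleftrightarrow> (\<forall>n \<ge> 1. \<forall>k \<in> K. \<forall>h \<in> H. hom0 D ((Sh D ^^ n) k) h)"
proof
  assume g: "heart_ge D K H"
  show "\<forall>n \<ge> 1. \<forall>k \<in> K. \<forall>h \<in> H. hom0 D ((Sh D ^^ n) k) h"
  proof (intro allI impI ballI)
    fix n :: nat and k h assume a: "1 \<le> n" "k \<in> K" "h \<in> H"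
    have "isomorphic D ((Sh D ^^ n) k) ((Sh D ^^ n) k)" "(Sh D ^^ n) k \<in> Ob D"
      using isomorphic_refl[OF Sh_pow_Ob] Sh_pow_Ob assms(1) a(2) by blast+
    then have "(Sh D ^^ n) k \<in> shift_sub D K (int n)"
      using a(2) by (simp add: shift_sub_def) blast
    moreover have "homs_vanish D (shift_sub D K (int n)) H" using g a by (simp add: heart_ge_def)
    ultimately show "hom0 D ((Sh D ^^ n) k) h" using a by (auto simp: homs_vanish_def hom0_def)
  qed
next
  assume g: "\<forall>n \<ge> 1. \<forall>k \<in> K. \<forall>h \<in> H. hom0 D ((Sh D ^^ n) k) h"
  show "heart_ge D K H"
    unfolding heart_ge_def homs_vanish_def
  proof (intro allI impI ballI)
    fix n :: int and x h assume a: "0 < n" "x \<in> shift_sub D K n" "h \<in> H"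
    then obtain k where k: "k \<in> K" "isomorphic D x ((Sh D ^^ nat n) k)" by (auto simp: shift_sub_def)
    have "hom0 D ((Sh D ^^ nat n) k) h" using g k a by simp
    then have "hom0 D x h" using hom0_iso_left isomorphic_sym k by blast
    then show "Homs D x h = {Zer D x h}" by (simp add: hom0_def)
  qed
qed

section \<open>The heart as an abelian category\<close>

lemma full_subcat_simps [simp]:
  "Ob (full_subcat C S) = S" "Dom (full_subcat C S) = Dom C" "Cod (full_subcat C S) = Cod C"
  "Ident (full_subcat C S) = Ident C" "Cmp (full_subcat C S) = Cmp C" "Add (full_subcat C S) = Add C"
  "Zer (full_subcat C S) = Zer C"
  by (simp_all add: full_subcat_def)

lemma Homs_full_subcat:
  "f \<in> Homs (full_subcat C S) x y \<longleftrightarrow> f \<in> Homs C x y \<and> x \<in> S \<and> y \<in> S"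
  by (auto simp: full_subcat_def Homs_def)

lemma Homs_full_subcat_eq: "x \<in> S \<Longrightarrow> y \<in> S \<Longrightarrow> Homs (full_subcat C S) x y = Homs C x y"
  by (simp add: set_eq_iff Homs_full_subcat)

lemma Arr_full_subcat: "f \<in> Arr (full_subcat C S) \<longleftrightarrow> (\<exists>x \<in> S. \<exists>y \<in> S. f \<in> Homs C x y)"
  by (simp add: full_subcat_def Homs_def)

lemma hom_group_full_subcat: "x \<in> S \<Longrightarrow> y \<in> S \<Longrightarrow> hom_group (full_subcat C S) x y = hom_group C x y"
  by (simp add: hom_group_def Homs_full_subcat_eq)

lemma hom0_full_subcat: "x \<in> S \<Longrightarrow> y \<in> S \<Longrightarrow> hom0 (full_subcat C S) x y \<longleftrightarrow> hom0 C x y"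
  by (simp add: hom0_def Homs_full_subcat_eq)

lemma is_kernel_full_subcat:
  assumes "f \<in> Homs C b c" "k \<in> Homs C a b" "a \<in> S" "b \<in> S" "c \<in> S"
  shows "is_kernel (full_subcat C S) k f \<longleftrightarrow> f \<cdot>\<^bsub>C\<^esub> k = Zer C a c \<and>
    (\<forall>w \<in> S. \<forall>t \<in> Homs C w b. f \<cdot>\<^bsub>C\<^esub> t = Zer C w c \<longrightarrow> (\<exists>!s. s \<in> Homs C w a \<and> k \<cdot>\<^bsub>C\<^esub> s = t))"
proof -
  have d: "Dom C f = b" "Cod C f = c" "Dom C k = a" "Cod C k = b" using assms by (auto simp: Homs_def)
  have m: "f \<in> Arr (full_subcat C S)" "k \<in> Arr (full_subcat C S)" using assms by (auto simp: Arr_full_subcat)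
  have B: "(\<forall>t \<in> Homs (full_subcat C S) w b. P t) \<longleftrightarrow> (w \<in> S \<longrightarrow> (\<forall>t \<in> Homs C w b. P t))" for w P
    using assms(4) by (auto simp: Homs_full_subcat)
  have E: "(s \<in> Homs (full_subcat C S) w a) \<longleftrightarrow> s \<in> Homs C w a" if "w \<in> S" for w s
    using assms(3) that by (simp add: Homs_full_subcat)
  show ?thesis
    unfolding is_kernel_def full_subcat_simps d B Ball_def[of S] by (simp add: m E cong: imp_cong)
qed

lemma is_cokernel_full_subcat:
  assumes "f \<in> Homs C a b" "g \<in> Homs C b c" "a \<in> S" "b \<in> S" "c \<in> S"
  shows "is_cokernel (full_subcat C S) g f \<longleftrightarrow> g \<cdot>\<^bsub>C\<^esub> f = Zer C a c \<and>
    (\<forall>w \<in> S. \<forall>t \<in> Homs C b w. t \<cdot>\<^bsub>C\<^esub> f = Zer C a w \<longrightarrow> (\<exists>!s. s \<in> Homs C c w \<and> s \<cdot>\<^bsub>C\<^esub> g = t))"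
proof -
  have d: "Dom C f = a" "Cod C f = b" "Dom C g = b" "Cod C g = c" using assms by (auto simp: Homs_def)
  have m: "f \<in> Arr (full_subcat C S)" "g \<in> Arr (full_subcat C S)" using assms by (auto simp: Arr_full_subcat)
  have B: "(\<forall>t \<in> Homs (full_subcat C S) b w. P t) \<longleftrightarrow> (w \<in> S \<longrightarrow> (\<forall>t \<in> Homs C b w. P t))" for w P
    using assms(4) by (auto simp: Homs_full_subcat)
  have E: "(s \<in> Homs (full_subcat C S) c w) \<longleftrightarrow> s \<in> Homs C c w" if "w \<in> S" for w s
    using assms(5) that by (simp add: Homs_full_subcat)
  show ?thesis
    unfolding is_cokernel_def full_subcat_simps d B Ball_def[of S] by (simp add: m E cong: imp_cong)
qed

definition ses :: "('o, 'm, 'x) additive_data_scheme \<Rightarrow> 'o \<Rightarrow> 'o \<Rightarrow> 'o \<Rightarrow> bool" where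
  "ses A a b c \<longleftrightarrow> (\<exists>f g. short_exact A f g \<and> f \<in> Homs A a b \<and> g \<in> Homs A b c)"

lemma short_exact_ses: assumes "short_exact A f g" shows "ses A (Dom A f) (Cod A f) (Cod A g)"
proof -
  have "f \<in> Homs A (Dom A f) (Cod A f)" "g \<in> Homs A (Cod A f) (Cod A g)"
    using assms by (auto simp: short_exact_def is_kernel_def Homs_def)
  then show ?thesis using assms unfolding ses_def by blast
qed

lemma (in triangulated_category) tria_iso_third:
  assumes t: "tria D a b c f g h" and r: "r \<in> Homs D c c'" "r' \<in> Homs D c' c"
    "r' \<cdot> r = Ident D c" "r \<cdot> r' = Ident D c'"
  shows "tria D a b c' f (r \<cdot> g) (h \<cdot> r')"
proof -
  note fgh = triaD[OF t]
  have H: "r \<cdot> g \<in> Homs D b c'" "h \<cdot> r' \<in> Homs D c' (Sh D a)" using cmp_in fgh r by blast+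
  have "ShM D (Ident D a) \<cdot> h = h \<cdot> r' \<cdot> r"
    using ShM_Ident[OF fgh(4)] cmp_ident_left[OF fgh(3)] cmp_assoc[OF r(1,2) fgh(3)] r(3)
      cmp_ident_right[OF fgh(3)] by simp
  moreover have "r \<cdot> g = r \<cdot> g \<cdot> Ident D b" "Ident D b \<cdot> f = f \<cdot> Ident D a"
    using cmp_ident_right[OF H(1)] cmp_ident_left[OF fgh(1)] cmp_ident_right[OF fgh(1)] by simp_all
  ultimately have "tri_morphism D (f, g, h) (f, r \<cdot> g, h \<cdot> r') (Ident D a) (Ident D b) r"
    using fgh H r ident_in[OF fgh(4)] ident_in[OF fgh(5)] by (simp add: tri_morphism_def Homs_def)
  moreover have "pre_triangle D f (r \<cdot> g) (h \<cdot> r')" using H fgh by (simp add: pre_triangle_def Homs_def)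
  moreover have "iso_arr D (Ident D a)" "iso_arr D (Ident D b)" "iso_arr D r"
    using iso_arrI[OF ident_in ident_in] cmp_ident_left[OF ident_in] iso_arrI[OF r] fgh by blast+
  moreover have "(f, g, h) \<in> Tri D" using t by (simp add: tria_def)
  ultimately have "(f, r \<cdot> g, h \<cdot> r') \<in> Tri D" using tri_iso by blast
  then show ?thesis using H fgh by (simp add: tria_def)
qed

context bounded_t
begin

abbreviation heart :: "'o set" where "heart \<equiv> U \<inter> V"

abbreviation A where "A \<equiv> full_subcat D heart"

lemma heart_Ob: "x \<in> heart \<Longrightarrow> x \<in> Ob D"
  using U_Ob by blast

lemma hom0_heart: "x \<in> heart \<Longrightarrow> y \<in> heart \<Longrightarrow> hom0 D (Sh D x) y"
  using hom0_UV by blast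

lemma heart_additive: "additive_category A"
proof -
  have cat: "category A"
  proof
    show "f \<in> Arr A \<Longrightarrow> Dom A f \<in> Ob A \<and> Cod A f \<in> Ob A" for f
      by (auto simp: Arr_full_subcat Homs_def)
    show "x \<in> Ob A \<Longrightarrow> Ident A x \<in> Homs A x x" for x
      using ident_in heart_Ob by (simp add: Homs_full_subcat)
    show "\<lbrakk>f \<in> Homs A x y; g \<in> Homs A y z\<rbrakk> \<Longrightarrow> g \<cdot>\<^bsub>A\<^esub> f \<in> Homs A x z" for f g x y z
      using cmp_in by (auto simp: Homs_full_subcat)
    show "f \<in> Homs A x y \<Longrightarrow> f \<cdot>\<^bsub>A\<^esub> Ident A x = f" "f \<in> Homs A x y \<Longrightarrow> Ident A y \<cdot>\<^bsub>A\<^esub> f = f" for f x y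
      using cmp_ident_left cmp_ident_right by (auto simp: Homs_full_subcat)
    show "\<lbrakk>f \<in> Homs A w x; g \<in> Homs A x y; h \<in> Homs A y z\<rbrakk> \<Longrightarrow> h \<cdot>\<^bsub>A\<^esub> (g \<cdot>\<^bsub>A\<^esub> f) = h \<cdot>\<^bsub>A\<^esub> g \<cdot>\<^bsub>A\<^esub> f"
      for f g h w x y z
      using cmp_assoc by (auto simp: Homs_full_subcat)
  qed
  show ?thesis
  proof (rule additive_category.intro[OF cat], rule additive_category_axioms.intro)
    show "\<lbrakk>x \<in> Ob A; y \<in> Ob A\<rbrakk> \<Longrightarrow> comm_group (hom_group A x y)" for x y
      using hom_comm_group heart_Ob by (simp add: hom_group_full_subcat)
    show "\<lbrakk>f \<in> Homs A x y; f' \<in> Homs A x y; g \<in> Homs A y z\<rbrakk>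
      \<Longrightarrow> g \<cdot>\<^bsub>A\<^esub> (f \<boxplus>\<^bsub>A\<^esub> f') = g \<cdot>\<^bsub>A\<^esub> f \<boxplus>\<^bsub>A\<^esub> g \<cdot>\<^bsub>A\<^esub> f'" for f f' g x y z
      using cmp_add_right by (auto simp: Homs_full_subcat)
    show "\<lbrakk>f \<in> Homs A x y; g \<in> Homs A y z; g' \<in> Homs A y z\<rbrakk>
      \<Longrightarrow> (g \<boxplus>\<^bsub>A\<^esub> g') \<cdot>\<^bsub>A\<^esub> f = g \<cdot>\<^bsub>A\<^esub> f \<boxplus>\<^bsub>A\<^esub> g' \<cdot>\<^bsub>A\<^esub> f" for f g g' x y z
      using cmp_add_left by (auto simp: Homs_full_subcat)
    obtain z where z: "zero_object D z" by (rule ex_zero)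
    then have "zero_object A z"
      using zero_heart[OF z] heart_Ob by (simp add: zero_object_def Homs_full_subcat)
    then show "\<exists>z. zero_object A z" by blast
  next
    fix x y assume "x \<in> Ob A" "y \<in> Ob A"
    then have xy: "x \<in> U" "x \<in> V" "y \<in> U" "y \<in> V" by auto
    obtain b i j p q where b: "b \<in> Ob D" "i \<in> Homs D x b" "j \<in> Homs D y b" "p \<in> Homs D b x" "q \<in> Homs D b y"
      and e: "p \<cdot> i = Ident D x" "q \<cdot> j = Ident D y" "q \<cdot> i = Zer D x y" "p \<cdot> j = Zer D y x"
        "i \<cdot> p \<boxplus> j \<cdot> q = Ident D b"
      using biproduct_ex[OF U_Ob U_Ob] xy by blast
    note ip = cmp_in[OF b(4,2)] cmp_in[OF b(5,3)]
    \<comment> \<open>The biproduct formed in D already lies in the heart: an arrow out of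
      \<open>b[1]\<close> is split along the shift of
      \<open>i \<cdot> p \<boxplus> j \<cdot> q\<close>, and each summand factors through a
      vanishing arrow out of \<open>x[1]\<close> or \<open>y[1]\<close>.\<close>
    have "b \<in> U"
      unfolding U_iff
    proof (intro conjI ballI b(1) hom0I Sh_Ob)
      fix v f assume v: "v \<in> V" and f: "f \<in> Homs D (Sh D b) v"
      have z: "Zer D (Sh D b) v \<in> Homs D (Sh D b) v" using zer_in Sh_Ob b V_Ob v by blast
      have 1: "f \<cdot> ShM D (l \<cdot> r) = Zer D (Sh D b) v" if l: "l \<in> Homs D w b" "r \<in> Homs D b w" "w \<in> U" for l r w
      proof -
        have "f \<cdot> ShM D l = Zer D (Sh D w) v"
          by (rule hom0_cmp_left[OF hom0_UV[OF that(3) v] ShM_in[OF l(1)] f])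
        then show ?thesis
          using ShM_cmp[OF l(2,1)] cmp_assoc[OF ShM_in[OF l(2)] ShM_in[OF l(1)] f]
            zer_cmp[OF ShM_in[OF l(2)] V_Ob[OF v]] by simp
      qed
      have "f = f \<cdot> ShM D (i \<cdot> p \<boxplus> j \<cdot> q)" using e(5) ShM_Ident[OF b(1)] cmp_ident_right[OF f] by simp
      also have "\<dots> = f \<cdot> ShM D (i \<cdot> p) \<boxplus> f \<cdot> ShM D (j \<cdot> q)"
        using shift_additive[OF ip] cmp_add_right[OF ShM_in[OF ip(1)] ShM_in[OF ip(2)] f] by simp
      finally show "f = Zer D (Sh D b) v"
        using 1[OF b(2,4) xy(1)] 1[OF b(3,5) xy(3)] add_zer[OF z] by simp
    qed (use V_Ob in auto)
    moreover have "b \<in> V"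
      unfolding V_iff
    proof (intro conjI ballI b(1) hom0I)
      fix u f assume u: "u \<in> U" and f: "f \<in> Homs D (Sh D u) b"
      have uo: "Sh D u \<in> Ob D" using Sh_Ob U_Ob u by blast
      have z: "Zer D (Sh D u) b \<in> Homs D (Sh D u) b" using zer_in uo b by blast
      have 1: "l \<cdot> r \<cdot> f = Zer D (Sh D u) b" if l: "l \<in> Homs D w b" "r \<in> Homs D b w" "w \<in> V" for l r w
      proof -
        have "r \<cdot> f = Zer D (Sh D u) w"
          by (rule hom0_cmp_left[OF hom0_UV[OF u that(3)] f l(2)])
        then show ?thesis using cmp_assoc[OF f l(2,1)] cmp_zer[OF l(1) uo] by simp
      qed
      have "f = (i \<cdot> p \<boxplus> j \<cdot> q) \<cdot> f" using e(5) cmp_ident_left[OF f] by simp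
      also have "\<dots> = i \<cdot> p \<cdot> f \<boxplus> j \<cdot> q \<cdot> f" by (rule cmp_add_left[OF f ip])
      finally show "f = Zer D (Sh D u) b"
        using 1[OF b(2,4) xy(2)] 1[OF b(3,5) xy(4)] add_zer[OF z] by simp
    qed (use U_Ob Sh_Ob in auto)
    ultimately have bh: "b \<in> heart" by blast
    show "\<exists>b \<in> Ob A. \<exists>i \<in> Homs A x b. \<exists>j \<in> Homs A y b. \<exists>p \<in> Homs A b x. \<exists>q \<in> Homs A b y.
        p \<cdot>\<^bsub>A\<^esub> i = Ident A x \<and> q \<cdot>\<^bsub>A\<^esub> j = Ident A y \<and> q \<cdot>\<^bsub>A\<^esub> i = Zer A x y \<and> p \<cdot>\<^bsub>A\<^esub> j = Zer A y x \<and>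
        i \<cdot>\<^bsub>A\<^esub> p \<boxplus>\<^bsub>A\<^esub> j \<cdot>\<^bsub>A\<^esub> q = Ident A b"
      by (rule bexI[of _ b], rule bexI[of _ i], rule bexI[of _ j], rule bexI[of _ p], rule bexI[of _ q])
        (use b e bh xy in \<open>simp_all add: Homs_full_subcat\<close>)
  qed
qed

text \<open>Existence of the factorisations holds in any triangle. Uniqueness is controlled by
  Hom(\<open>w[1]\<close>, \<open>c\<close>) and Hom(\<open>a[1]\<close>, \<open>w\<close>), which
  are zero between objects of the heart.\<close>

lemma tria_short_exact:
  assumes t: "tria D a b c f g h" and K: "a \<in> heart" "b \<in> heart" "c \<in> heart"
  shows "short_exact A f g"
proof -
  note fgh = triaD[OF t]
  have "is_kernel A f g"
    unfolding is_kernel_full_subcat[OF fgh(2,1) K]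
  proof (intro conjI ballI impI tria_comp_zero[OF t])
    fix w u assume w: "w \<in> heart" and u: "u \<in> Homs D w b" "g \<cdot> u = Zer D w c"
    obtain s where s: "s \<in> Homs D w a" "f \<cdot> s = u" using weak_kernel[OF t u] .
    show "\<exists>!s. s \<in> Homs D w a \<and> f \<cdot> s = u"
    proof (rule ex1I[of _ s])
      fix s' assume s': "s' \<in> Homs D w a \<and> f \<cdot> s' = u"
      show "s' = s"
        by (rule left_cancel_test[OF fgh(1) _ s(1)])
          (use s' s monic_part[OF t _ _ hom0_heart[OF w K(3)]] in auto)
    qed (use s in simp)
  qed
  moreover have "is_cokernel A g f"
    unfolding is_cokernel_full_subcat[OF fgh(1,2) K]
  proof (intro conjI ballI impI tria_comp_zero[OF t])
    fix w u assume w: "w \<in> heart" and u: "u \<in> Homs D b w" "u \<cdot> f = Zer D a w"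
    obtain s where s: "s \<in> Homs D c w" "s \<cdot> g = u" using weak_cokernel[OF t u] .
    show "\<exists>!s. s \<in> Homs D c w \<and> s \<cdot> g = u"
    proof (rule ex1I[of _ s])
      fix s' assume s': "s' \<in> Homs D c w \<and> s' \<cdot> g = u"
      show "s' = s"
        by (rule right_cancel_test[OF fgh(2) _ s(1)])
          (use s' s epic_part[OF t _ _ hom0_heart[OF K(1) w]] in auto)
    qed (use s in simp)
  qed
  ultimately show ?thesis by (simp add: short_exact_def)
qed

section \<open>Kernels, cokernels and images from the cone of an arrow\<close>

lemma cone_decomp:
  assumes t: "tria D x y c \<phi> g h" and K: "x \<in> heart" "y \<in> heart"
  obtains k r \<iota> \<rho> \<delta> where "tria D (Sh D k) c r \<iota> \<rho> \<delta>" "k \<in> heart" "r \<in> heart"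
proof -
  have "c \<in> U" using U_cone[OF tria_dtri[OF t]] K by blast
  then obtain k r where kr: "dtri D (Sh D k) c r" "k \<in> U" "r \<in> heart" using cotrunc by blast
  have "hom0 D (Sh D u) k" if u: "u \<in> U" for u
  proof -
    have s: "Sh D u \<in> U" by (rule U_Sh[OF u])
    have "hom0 D (Sh D (Sh D u)) (Sh D x)"
      using hom0_shift[OF U_Ob[OF s] heart_Ob[OF K(1)]] hom0_UV[OF u] K by simp
    then have "hom0 D (Sh D (Sh D u)) c"
      using hom0_mid_right[OF dtri_rotate[OF tria_dtri[OF t]]] hom0_UV[OF s] K by blast
    moreover have "hom0 D (Sh D (Sh D u)) (desusp D r)" using hom0_UV[OF s] V_desusp kr by blast
    ultimately have "hom0 D (Sh D (Sh D u)) (Sh D k)" using hom0_mid_right[OF dtri_back[OF kr(1)]] by blast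
    then show ?thesis using hom0_shift[OF U_Ob[OF s] U_Ob[OF kr(2)]] by simp
  qed
  then have "k \<in> V" using V_iff U_Ob kr by blast
  moreover obtain \<iota> \<rho> \<delta> where "tria D (Sh D k) c r \<iota> \<rho> \<delta>" using kr(1) by (rule dtriE)
  ultimately show ?thesis using that kr by blast
qed

text \<open>The object \<open>k\<close> is the cohomology of the cone in degree -1. If \<phi> kills
  \<open>u\<close>, the shift of \<open>u\<close> factors through the cone, and further through
  \<open>k[1]\<close> because Hom(\<open>w[1]\<close>, \<open>r\<close>) is zero.\<close>

lemma cone_kernel:
  assumes t: "tria D x y c \<phi> g h" and K: "x \<in> heart" "y \<in> heart"
    and d: "tria D (Sh D k) c r \<iota> \<rho> \<delta>" "k \<in> heart" "r \<in> heart"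
    and \<kappa>: "\<kappa> \<in> Homs D k x" "ShM D \<kappa> = h \<cdot> \<iota>"
  shows "is_kernel A \<kappa> \<phi>"
  unfolding is_kernel_full_subcat[OF triaD(1)[OF t] \<kappa>(1) d(2) K]
proof (intro conjI ballI impI)
  note fgh = triaD[OF t] and iod = triaD[OF d(1)]
  note t2 = tria_rotate[OF tria_rotate[OF t]]
  have \<phi>\<kappa>: "\<phi> \<cdot> \<kappa> \<in> Homs D k y" by (rule cmp_in[OF \<kappa>(1) fgh(1)])
  have ob: "x \<in> Ob D" "y \<in> Ob D" "k \<in> Ob D" using K d heart_Ob by auto
  have "neg D (ShM D (\<phi> \<cdot> \<kappa>)) = neg D (ShM D \<phi>) \<cdot> h \<cdot> \<iota>"
    using neg_cmp[OF ShM_in[OF \<kappa>(1)] ShM_in[OF fgh(1)]] ShM_cmp[OF \<kappa>(1) fgh(1)] \<kappa>(2)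
      cmp_assoc[OF iod(1) fgh(3) neg_in[OF ShM_in[OF fgh(1)]]] by simp
  also have "\<dots> = Zer D (Sh D k) (Sh D y)"
    using tria_comp_zero[OF t2] zer_cmp[OF iod(1) Sh_Ob[OF ob(2)]] by simp
  finally have "ShM D (\<phi> \<cdot> \<kappa>) = Zer D (Sh D k) (Sh D y)" by (rule neg_eq_zer[OF ShM_in[OF \<phi>\<kappa>]])
  then show "\<phi> \<cdot> \<kappa> = Zer D k y" by (rule ShM_eq_Zer[OF \<phi>\<kappa>])
  fix w u assume w: "w \<in> heart" and u: "u \<in> Homs D w x" "\<phi> \<cdot> u = Zer D w y"
  have wo: "w \<in> Ob D" using w heart_Ob by blast
  have "neg D (ShM D \<phi>) \<cdot> ShM D u = neg D (ShM D (\<phi> \<cdot> u))"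
    using neg_cmp[OF ShM_in[OF u(1)] ShM_in[OF fgh(1)]] ShM_cmp[OF u(1) fgh(1)] by simp
  also have "\<dots> = Zer D (Sh D w) (Sh D y)"
    using u(2) ShM_Zer[OF wo ob(2)] neg_zer[OF Sh_Ob[OF wo] Sh_Ob[OF ob(2)]] by simp
  finally obtain m where m: "m \<in> Homs D (Sh D w) c" "h \<cdot> m = ShM D u"
    using weak_kernel[OF t2 ShM_in[OF u(1)]] by blast
  obtain s' where s': "s' \<in> Homs D (Sh D w) (Sh D k)" "\<iota> \<cdot> s' = m"
    using weak_kernel[OF d(1) m(1) hom0_cmp_left[OF hom0_heart[OF w d(3)] m(1) iod(2)]] .
  obtain s where s: "s \<in> Homs D w k" "ShM D s = s'" using ShM_full[OF wo ob(3) s'(1)] .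
  have ks: "\<kappa> \<cdot> s \<in> Homs D w x" by (rule cmp_in[OF s(1) \<kappa>(1)])
  have "ShM D (\<kappa> \<cdot> s) = ShM D u"
    using ShM_cmp[OF s(1) \<kappa>(1)] \<kappa>(2) s(2) cmp_assoc[OF s'(1) iod(1) fgh(3)] s'(2) m(2) by simp
  then have e: "\<kappa> \<cdot> s = u" by (rule ShM_faithful[OF ks u(1)])
  \<comment> \<open>Injectivity takes two further vanishings: Hom(\<open>w[1]\<close>,
    \<open>y\<close>) = 0 kills the arrow into the cone, and Hom(\<open>w[2]\<close>,
    \<open>r\<close>) = 0 then kills the shift of \<open>v\<close>.\<close>
  have inj: "v = Zer D w k" if v: "v \<in> Homs D w k" "\<kappa> \<cdot> v = Zer D w x" for v
  proof -
    have iv: "\<iota> \<cdot> ShM D v \<in> Homs D (Sh D w) c" by (rule cmp_in[OF ShM_in[OF v(1)] iod(1)])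
    have "h \<cdot> (\<iota> \<cdot> ShM D v) = Zer D (Sh D w) (Sh D x)"
      using cmp_assoc[OF ShM_in[OF v(1)] iod(1) fgh(3)] \<kappa>(2) ShM_cmp[OF v(1) \<kappa>(1)] v(2) ShM_Zer[OF wo ob(1)]
      by simp
    then obtain n where n: "n \<in> Homs D (Sh D w) y" "g \<cdot> n = \<iota> \<cdot> ShM D v"
      using weak_kernel[OF tria_rotate[OF t] iv] by blast
    have "n = Zer D (Sh D w) y" by (rule hom0D[OF hom0_heart[OF w K(2)] n(1)])
    then have "\<iota> \<cdot> ShM D v = Zer D (Sh D w) c" using n cmp_zer[OF fgh(2) Sh_Ob[OF wo]] by simp
    moreover have "hom0 D (Sh D (Sh D w)) r"
      using hom0_UV[OF U_Sh] w d by blast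
    ultimately have "ShM D v = Zer D (Sh D w) (Sh D k)"
      using monic_part[OF d(1) ShM_in[OF v(1)]] by blast
    then show ?thesis by (rule ShM_eq_Zer[OF v(1)])
  qed
  show "\<exists>!s. s \<in> Homs D w k \<and> \<kappa> \<cdot> s = u"
  proof (rule ex1I[of _ s])
    fix s1 assume s1: "s1 \<in> Homs D w k \<and> \<kappa> \<cdot> s1 = u"
    show "s1 = s" by (rule left_cancel_test[OF \<kappa>(1) _ s(1)]) (use s1 e inj in auto)
  qed (use s e in simp)
qed

lemma cone_cokernel:
  assumes t: "tria D x y c \<phi> g h" and K: "x \<in> heart" "y \<in> heart"
    and d: "tria D (Sh D k) c r \<iota> \<rho> \<delta>" "k \<in> heart" "r \<in> heart"
  shows "is_cokernel A (\<rho> \<cdot> g) \<phi>"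
proof -
  note fgh = triaD[OF t] and iod = triaD[OF d(1)]
  have \<rho>g: "\<rho> \<cdot> g \<in> Homs D y r" by (rule cmp_in[OF fgh(2) iod(2)])
  show ?thesis
    unfolding is_cokernel_full_subcat[OF fgh(1) \<rho>g K d(3)]
  proof (intro conjI ballI impI)
    show "\<rho> \<cdot> g \<cdot> \<phi> = Zer D x r"
      using cmp_assoc[OF fgh(1,2) iod(2)] tria_comp_zero[OF t] cmp_zer[OF iod(2) fgh(4)] by simp
    fix w u assume w: "w \<in> heart" and u: "u \<in> Homs D y w" "u \<cdot> \<phi> = Zer D x w"
    have wo: "w \<in> Ob D" using w heart_Ob by blast
    obtain m where m: "m \<in> Homs D c w" "m \<cdot> g = u" using weak_cokernel[OF t u] .
    obtain s where s: "s \<in> Homs D r w" "s \<cdot> \<rho> = m"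
      using weak_cokernel[OF d(1) m(1) hom0_cmp_left[OF hom0_heart[OF d(2) w] iod(1) m(1)]] .
    have e: "s \<cdot> (\<rho> \<cdot> g) = u" using cmp_assoc[OF fgh(2) iod(2) s(1)] s m by simp
    have inj: "v = Zer D r w" if v: "v \<in> Homs D r w" "v \<cdot> (\<rho> \<cdot> g) = Zer D y w" for v
    proof -
      have "v \<cdot> \<rho> = Zer D c w"
        by (rule epic_part[OF t cmp_in[OF iod(2) v(1)] _ hom0_heart[OF K(1) w]])
          (use cmp_assoc[OF fgh(2) iod(2) v(1)] v in simp)
      moreover have "hom0 D (Sh D (Sh D k)) w" using hom0_UV[OF U_Sh] w d by blast
      ultimately show ?thesis using epic_part[OF d(1) v(1)] by blast
    qed
    show "\<exists>!s. s \<in> Homs D r w \<and> s \<cdot> (\<rho> \<cdot> g) = u"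
    proof (rule ex1I[of _ s])
      fix s1 assume s1: "s1 \<in> Homs D r w \<and> s1 \<cdot> (\<rho> \<cdot> g) = u"
      show "s1 = s" by (rule right_cancel_test[OF \<rho>g _ s(1)]) (use s1 e inj in auto)
    qed (use s e in simp)
  qed
qed

lemma ArrA:
  assumes "f \<in> Arr A" obtains x y where "f \<in> Homs D x y" "x \<in> heart" "y \<in> heart"
  using assms Arr_full_subcat by (metis)

lemma monicD:
  assumes "monic A f" "f \<in> Homs D x y" "x \<in> heart" "y \<in> heart" "p \<in> Homs D w x" "q \<in> Homs D w x"
    "w \<in> heart" "f \<cdot> p = f \<cdot> q"
  shows "p = q"
proof -
  have "Dom A f = x" "p \<in> Homs A w x" "q \<in> Homs A w x" "f \<cdot>\<^bsub>A\<^esub> p = f \<cdot>\<^bsub>A\<^esub> q"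
    using assms by (simp_all add: Homs_full_subcat) (simp add: Homs_def)
  then show ?thesis using assms(1) unfolding monic_def by blast
qed

lemma epicD:
  assumes "epic A f" "f \<in> Homs D x y" "x \<in> heart" "y \<in> heart" "p \<in> Homs D y w" "q \<in> Homs D y w"
    "w \<in> heart" "p \<cdot> f = q \<cdot> f"
  shows "p = q"
proof -
  have "Cod A f = y" "p \<in> Homs A y w" "q \<in> Homs A y w" "p \<cdot>\<^bsub>A\<^esub> f = q \<cdot>\<^bsub>A\<^esub> f"
    using assms by (simp_all add: Homs_full_subcat) (simp add: Homs_def)
  then show ?thesis using assms(1) unfolding epic_def by blast
qed

text \<open>The kernel constructed from the cone must be zero, so the cone has no cohomology in
  degree -1 and is isomorphic to its cokernel part \<open>r\<close>.\<close>

lemma monic_cone: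
  assumes m: "monic A f" and f: "f \<in> Homs D x y" "x \<in> heart" "y \<in> heart"
  obtains c g h where "tria D x y c f g h" "c \<in> heart"
proof -
  obtain c g h where t: "tria D x y c f g h" using tria_ex[OF f(1)] .
  obtain k r \<iota> \<rho> \<delta> where d: "tria D (Sh D k) c r \<iota> \<rho> \<delta>" "k \<in> heart" "r \<in> heart"
    using cone_decomp[OF t f(2,3)] .
  have ko: "k \<in> Ob D" using d heart_Ob by blast
  obtain \<kappa> where \<kappa>: "\<kappa> \<in> Homs D k x" "ShM D \<kappa> = h \<cdot> \<iota>"
    using ShM_full[OF ko triaD(4)[OF t] cmp_in[OF triaD(1)[OF d(1)] triaD(3)[OF t]]] .
  have ker: "is_kernel A \<kappa> f" by (rule cone_kernel[OF t f(2,3) d \<kappa>])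
  note ker' = ker[unfolded is_kernel_full_subcat[OF f(1) \<kappa>(1) d(2) f(2,3)]]
  have z: "Zer D k x \<in> Homs D k x" by (rule zer_in[OF ko triaD(4)[OF t]])
  have "f \<cdot> \<kappa> = f \<cdot> Zer D k x" using ker' cmp_zer[OF f(1) ko] by simp
  then have \<kappa>0: "\<kappa> = Zer D k x"
    by (rule monicD[OF m f \<kappa>(1) z d(2)])
  have "\<exists>!s. s \<in> Homs D k k \<and> \<kappa> \<cdot> s = Zer D k x"
    using ker' d(2) z cmp_zer[OF f(1) ko] by blast
  moreover have "\<kappa> \<cdot> Ident D k = Zer D k x" "\<kappa> \<cdot> Zer D k k = Zer D k x"
    using \<kappa>0 cmp_ident_right[OF \<kappa>(1)] cmp_zer[OF \<kappa>(1) ko] by simp_all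
  ultimately have id: "Ident D k = Zer D k k" using ident_in[OF ko] zer_in[OF ko ko] by blast
  have "hom0 D k k"
    by (rule hom0I[OF ko ko]) (metis id cmp_ident_right cmp_zer ko)
  then have "zero_object D (Sh D k)" using zero_object_iff zero_Sh_iff[OF ko] by simp
  then have "isomorphic D c r" using dtri_zero_first[OF tria_dtri[OF d(1)]] by blast
  then have "c \<in> heart" using heart_iso[OF d(3)] isomorphic_sym by blast
  then show ?thesis using that t by blast
qed

lemma epic_cocone:
  assumes m: "epic A f" and f: "f \<in> Homs D x y" "x \<in> heart" "y \<in> heart"
  obtains k g h where "tria D k x y g f h" "k \<in> heart"
proof -
  obtain c g h where t: "tria D x y c f g h" using tria_ex[OF f(1)] .
  obtain k r \<iota> \<rho> \<delta> where d: "tria D (Sh D k) c r \<iota> \<rho> \<delta>" "k \<in> heart" "r \<in> heart"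
    using cone_decomp[OF t f(2,3)] .
  have ko: "k \<in> Ob D" "r \<in> Ob D" using d heart_Ob by blast+
  have \<rho>g: "\<rho> \<cdot> g \<in> Homs D y r" by (rule cmp_in[OF triaD(2)[OF t] triaD(2)[OF d(1)]])
  note cok = cone_cokernel[OF t f(2,3) d, unfolded is_cokernel_full_subcat[OF f(1) \<rho>g f(2,3) d(3)]]
  have z: "Zer D y r \<in> Homs D y r" by (rule zer_in[OF triaD(5)[OF t] ko(2)])
  have "\<rho> \<cdot> g \<cdot> f = Zer D y r \<cdot> f" using cok zer_cmp[OF f(1) ko(2)] by simp
  then have \<rho>0: "\<rho> \<cdot> g = Zer D y r"
    by (rule epicD[OF m f \<rho>g z d(3)])
  have "\<exists>!s. s \<in> Homs D r r \<and> s \<cdot> (\<rho> \<cdot> g) = Zer D y r"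
    using cok d(3) z zer_cmp[OF f(1) ko(2)] by blast
  moreover have "Ident D r \<cdot> (\<rho> \<cdot> g) = Zer D y r" "Zer D r r \<cdot> (\<rho> \<cdot> g) = Zer D y r"
    using \<rho>0 cmp_ident_left[OF \<rho>g] zer_cmp[OF \<rho>g ko(2)] by simp_all
  ultimately have id: "Ident D r = Zer D r r" using ident_in[OF ko(2)] zer_in[OF ko(2) ko(2)] by blast
  have "hom0 D r r"
    by (rule hom0I[OF ko(2) ko(2)]) (metis id cmp_ident_right cmp_zer ko(2))
  then have "iso_arr D \<iota>" using tria_zero_third[OF d(1)] zero_object_iff by blast
  then obtain \<iota>' where i: "\<iota>' \<in> Homs D c (Sh D k)" "\<iota>' \<cdot> \<iota> = Ident D (Sh D k)" "\<iota> \<cdot> \<iota>' = Ident D c"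
    using iso_arrE triaD(1)[OF d(1)] by blast
  have "tria D x y (Sh D k) f (\<iota>' \<cdot> g) (h \<cdot> \<iota>)"
    by (rule tria_iso_third[OF t i(1) triaD(1)[OF d(1)] i(3,2)])
  from tria_rotate_back[OF this ko(1)] obtain f' where "tria D k x y f' f (\<iota>' \<cdot> g)" .
  then show ?thesis using that d(2) by blast
qed

lemma heart_abelian: "abelian_category A"
proof (rule abelian_category.intro[OF heart_additive], rule abelian_category_axioms.intro)
  fix f assume "f \<in> Arr A"
  then obtain x y where f: "f \<in> Homs D x y" "x \<in> heart" "y \<in> heart" by (rule ArrA)
  obtain c g h where t: "tria D x y c f g h" using tria_ex[OF f(1)] .
  obtain k r \<iota> \<rho> \<delta> where d: "tria D (Sh D k) c r \<iota> \<rho> \<delta>" "k \<in> heart" "r \<in> heart"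
    using cone_decomp[OF t f(2,3)] .
  show "\<exists>c. is_cokernel A c f" using cone_cokernel[OF t f(2,3) d] by blast
  obtain \<kappa> where \<kappa>: "\<kappa> \<in> Homs D k x" "ShM D \<kappa> = h \<cdot> \<iota>"
    using ShM_full[OF heart_Ob[OF d(2)] triaD(4)[OF t] cmp_in[OF triaD(1)[OF d(1)] triaD(3)[OF t]]] .
  show "\<exists>k. is_kernel A k f" using cone_kernel[OF t f(2,3) d \<kappa>] by blast
next
  fix f assume m: "monic A f"
  then have "f \<in> Arr A" by (simp add: monic_def)
  then obtain x y where f: "f \<in> Homs D x y" "x \<in> heart" "y \<in> heart" by (rule ArrA)
  obtain c g h where t: "tria D x y c f g h" "c \<in> heart" using monic_cone[OF m f] .
  show "\<exists>g. is_kernel A f g" using tria_short_exact[OF t(1) f(2,3) t(2)] by (auto simp: short_exact_def)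
next
  fix f assume m: "epic A f"
  then have "f \<in> Arr A" by (simp add: epic_def)
  then obtain x y where f: "f \<in> Homs D x y" "x \<in> heart" "y \<in> heart" by (rule ArrA)
  obtain k g h where t: "tria D k x y g f h" "k \<in> heart" using epic_cocone[OF m f] .
  show "\<exists>g. is_cokernel A f g" using tria_short_exact[OF t f(2,3)] by (auto simp: short_exact_def)
qed

lemma kernel_monic:
  assumes "is_kernel A f g" "f \<in> Homs D x y" "g \<in> Homs D y z" "x \<in> heart" "y \<in> heart" "z \<in> heart"
  shows "monic A f"
proof -
  note ker = assms(1)[unfolded is_kernel_full_subcat[OF assms(3,2,4-6)]]
  have d: "Dom D f = x" "f \<in> Arr A" using assms by (auto simp: Homs_def Arr_full_subcat)
  have "p = q" if p: "p \<in> Homs D w x" "q \<in> Homs D w x" "f \<cdot> p = f \<cdot> q" and w: "w \<in> heart" for w p q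
  proof -
    have "g \<cdot> (f \<cdot> p) = Zer D w z"
      using cmp_assoc[OF p(1) assms(2,3)] ker zer_cmp[OF p(1) heart_Ob[OF assms(6)]] by simp
    then have "\<exists>!s. s \<in> Homs D w x \<and> f \<cdot> s = f \<cdot> p" using ker w cmp_in[OF p(1) assms(2)] by blast
    then show ?thesis using p by (metis (no_types))
  qed
  then show ?thesis using d by (auto simp: monic_def Homs_full_subcat)
qed

lemma tria_monic: "tria D a b c f g h \<Longrightarrow> a \<in> heart \<Longrightarrow> b \<in> heart \<Longrightarrow> c \<in> heart \<Longrightarrow> monic A f"
  using kernel_monic[of f g a b c] tria_short_exact triaD by (auto simp: short_exact_def)

text \<open>The cone of \<open>f\<close> supplies one cokernel of \<open>f\<close>, and
  \<open>g\<close> is another. The isomorphism between them carries the triangle over to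
  \<open>g\<close>.\<close>

lemma short_exact_tria:
  assumes se: "short_exact A f g" and f: "f \<in> Homs D a b" "g \<in> Homs D b c" "a \<in> heart" "b \<in> heart" "c \<in> heart"
  obtains h where "tria D a b c f g h"
proof -
  have ker: "is_kernel A f g" and cok: "is_cokernel A g f" using se by (auto simp: short_exact_def)
  obtain c' g' h' where t: "tria D a b c' f g' h'" "c' \<in> heart"
    using monic_cone[OF kernel_monic[OF ker f] f(1,3,4)] .
  note g' = triaD(2)[OF t(1)]
  have "is_cokernel A g' f" using tria_short_exact[OF t(1) f(3,4) t(2)] by (simp add: short_exact_def)
  note c1 = this[unfolded is_cokernel_full_subcat[OF f(1) g' f(3,4) t(2)]]
  note c2 = cok[unfolded is_cokernel_full_subcat[OF f]]
  obtain p where p: "p \<in> Homs D c' c" "p \<cdot> g' = g" using c1 c2 f by blast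
  obtain q where q: "q \<in> Homs D c c'" "q \<cdot> g = g'" using c1 c2 g' t(2) by blast
  have "\<exists>!s. s \<in> Homs D c' c' \<and> s \<cdot> g' = g'" using c1 g' t(2) by blast
  moreover have "q \<cdot> p \<cdot> g' = g'" using cmp_assoc[OF g' p(1) q(1)] p q by simp
  ultimately have 1: "q \<cdot> p = Ident D c'"
    using cmp_in[OF p(1) q(1)] ident_in[OF triaD(6)[OF t(1)]] cmp_ident_left[OF g'] by blast
  have "\<exists>!s. s \<in> Homs D c c \<and> s \<cdot> g = g" using c2 f by blast
  moreover have "p \<cdot> q \<cdot> g = g" using cmp_assoc[OF f(2) q(1) p(1)] p q by simp
  ultimately have 2: "p \<cdot> q = Ident D c"
    using cmp_in[OF q(1) p(1)] ident_in[OF heart_Ob[OF f(5)]] cmp_ident_left[OF f(2)] by blast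
  have "tria D a b c f g (h' \<cdot> q)" using tria_iso_third[OF t(1) p(1) q(1) 1 2] p(2) by simp
  then show ?thesis by (rule that)
qed

text \<open>From here on exact sequences in a heart are manipulated as triangles, so that octahedra
  replace diagram chases.\<close>

lemma ses_iff: "ses A a b c \<longleftrightarrow> a \<in> heart \<and> b \<in> heart \<and> c \<in> heart \<and> dtri D a b c"
proof
  assume "ses A a b c"
  then obtain f g where f: "short_exact A f g" "f \<in> Homs D a b" "g \<in> Homs D b c" "a \<in> heart" "b \<in> heart" "c \<in> heart"
    by (auto simp: ses_def Homs_full_subcat)
  obtain h where "tria D a b c f g h" using short_exact_tria[OF f] .
  then show "a \<in> heart \<and> b \<in> heart \<and> c \<in> heart \<and> dtri D a b c" using f tria_dtri by blast
next
  assume r: "a \<in> heart \<and> b \<in> heart \<and> c \<in> heart \<and> dtri D a b c"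
  then obtain f g h where t: "tria D a b c f g h" by (auto simp: dtri_def)
  then have "short_exact A f g" using tria_short_exact r by blast
  then show "ses A a b c" using r triaD[OF t] unfolding ses_def Homs_full_subcat by blast
qed

text \<open>The image is the kernel of the cokernel: \<open>i\<close> is the desuspended cone of the
  arrow \<open>y\<close> to \<open>r\<close>. The octahedral axiom for \<open>y\<close> to
  \<open>c\<close> to \<open>r\<close> relates it to \<open>x\<close> and \<open>k\<close>.\<close>

lemma image:
  assumes \<phi>: "\<phi> \<in> Homs D x y" "\<phi> \<noteq> Zer D x y" and K: "x \<in> heart" "y \<in> heart"
  obtains c g h k i r where "tria D x y c \<phi> g h" "dtri D (Sh D k) c r" "dtri D k x i" "dtri D i y r"
    "k \<in> heart" "i \<in> heart" "r \<in> heart" "\<not> zero_object D i"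
proof -
  obtain c g h where t: "tria D x y c \<phi> g h" using tria_ex[OF \<phi>(1)] .
  obtain k r \<iota> \<rho> \<delta> where d: "tria D (Sh D k) c r \<iota> \<rho> \<delta>" "k \<in> heart" "r \<in> heart"
    using cone_decomp[OF t K] .
  note fgh = triaD[OF t] and iod = triaD[OF d(1)]
  have \<rho>g: "\<rho> \<cdot> g \<in> Homs D y r" by (rule cmp_in[OF fgh(2) iod(2)])
  obtain M l1 l2 where M: "tria D y r M (\<rho> \<cdot> g) l1 l2" using tria_ex[OF \<rho>g] .
  note Mo = triaD(6)[OF M]
  obtain u v w where "tria D (Sh D x) M (Sh D (Sh D k)) u v w"
    using tria_octahedral[OF tria_rotate[OF t] tria_rotate[OF d(1)] M] .
  then have 1: "dtri D (Sh D x) M (Sh D (Sh D k))" by (rule tria_dtri)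
  let ?i = "desusp D M"
  note i = desusp[OF Mo]
  have ko: "k \<in> Ob D" "x \<in> Ob D" using d heart_Ob fgh by auto
  have "dtri D (Sh D x) (Sh D ?i) (Sh D (Sh D k))"
    by (rule dtri_iso[OF 1 isomorphic_refl isomorphic_sym[OF i(2)] isomorphic_refl]) (intro Sh_Ob ko)+
  then have "dtri D x ?i (Sh D k)" by (rule dtri_unshift[OF _ ko(2) i(1) Sh_Ob[OF ko(1)]])
  then have a: "dtri D k x ?i" by (rule dtri_rotate_back[OF _ ko(1)])
  have b: "dtri D ?i y r" by (rule dtri_back[OF tria_dtri[OF M]])
  have ih: "?i \<in> heart" using U_cone[OF a] V_fibre[OF b] K d by blast
  \<comment> \<open>A zero image makes the cokernel arrow \<open>y\<close> to \<open>r\<close>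
    invertible; as it kills \<phi>, this would force \<phi> to be zero.\<close>
  have "\<not> zero_object D ?i"
  proof
    assume "zero_object D ?i"
    then have "zero_object D M" using zero_object_iso[OF _ i(2)] zero_Sh_iff[OF i(1)] by blast
    then obtain e where e: "e \<in> Homs D r y" "e \<cdot> (\<rho> \<cdot> g) = Ident D y"
      using iso_arrE[OF tria_zero_third[OF M] \<rho>g] by blast
    have "\<rho> \<cdot> g \<cdot> \<phi> = Zer D x r"
      using cmp_assoc[OF fgh(1,2) iod(2)] tria_comp_zero[OF t] cmp_zer[OF iod(2) fgh(4)] by simp
    then have "\<phi> = Zer D x y"
      using cmp_assoc[OF \<phi>(1) \<rho>g e(1)] e(2) cmp_ident_left[OF \<phi>(1)] cmp_zer[OF e(1) ko(2)] by simp
    then show False using \<phi> by simp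
  qed
  then show ?thesis using that[OF t tria_dtri[OF d(1)] a b d(2) ih d(3)] by blast
qed

definition simple :: "'o \<Rightarrow> bool" where
  "simple s \<longleftrightarrow> s \<in> heart \<and> \<not> zero_object D s \<and>
     (\<forall>i \<in> heart. \<forall>r \<in> heart. dtri D i s r \<longrightarrow> zero_object D i \<or> zero_object D r)"

text \<open>The diamond of the Jordan-Hoelder argument. If the composite \<open>a\<close> to
  \<open>b\<close> to \<open>s'\<close> is zero, then \<open>a\<close> maps into \<open>a'\<close>
  and simplicity makes the two equal. Otherwise it is onto \<open>s'\<close>, and its kernel
  \<open>k\<close> is the intersection of \<open>a\<close> and \<open>a'\<close>.\<close>

lemma maximal_subobjects:
  assumes "dtri D a b s" "dtri D a' b s'" "simple s" "simple s'" "a \<in> heart" "b \<in> heart" "a' \<in> heart"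
  shows "(isomorphic D a a' \<and> isomorphic D s s') \<or> (\<exists>k \<in> heart. dtri D k a s' \<and> dtri D k a' s)"
proof -
  obtain f g h where t: "tria D a b s f g h" using assms(1) by (rule dtriE)
  obtain f' g' h' where t': "tria D a' b s' f' g' h'" using assms(2) by (rule dtriE)
  have K: "s \<in> heart" "s' \<in> heart" using assms by (auto simp: simple_def)
  have \<phi>: "g' \<cdot> f \<in> Homs D a s'" by (rule cmp_in[OF triaD(1)[OF t] triaD(2)[OF t']])
  show ?thesis
  proof (cases "g' \<cdot> f = Zer D a s'")
    case True
    obtain j where j: "dtri D a a' j" "dtri D j s s'" using tria_lift[OF t' t True] .
    have "j \<in> heart" using U_cone[OF j(1)] V_fibre[OF j(2)] assms K by blast
    then have "zero_object D j" using j assms K by (auto simp: simple_def)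
    then show ?thesis using dtri_zero_third[OF j(1)] dtri_zero_first[OF j(2)] by blast
  next
    case False
    obtain c g1 h1 k i r where c: "tria D a s' c (g' \<cdot> f) g1 h1" "dtri D (Sh D k) c r" "dtri D k a i" "dtri D i s' r"
      "k \<in> heart" "i \<in> heart" "r \<in> heart" "\<not> zero_object D i"
      using image[OF \<phi> False assms(5) K(2)] .
    have "zero_object D r" using c assms(4) by (auto simp: simple_def)
    then have kc: "isomorphic D c (Sh D k)" using dtri_zero_third[OF c(2)] isomorphic_sym by blast
    have ob: "a \<in> Ob D" "s' \<in> Ob D" "s \<in> Ob D" "a' \<in> Ob D" "k \<in> Ob D" using assms K c heart_Ob by auto
    have "dtri D a s' (Sh D k)"
      by (rule dtri_iso[OF tria_dtri[OF c(1)] isomorphic_refl isomorphic_refl kc]) (use ob in auto)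
    then have 1: "dtri D k a s'" by (rule dtri_rotate_back[OF _ ob(5)])
    obtain u v w where "tria D s c (Sh D a') u v w" using tria_octahedral[OF t tria_rotate[OF t'] c(1)] .
    then have "dtri D s (Sh D k) (Sh D a')"
      using dtri_iso[OF tria_dtri isomorphic_refl kc isomorphic_refl] ob Sh_Ob by blast
    then have "dtri D k a' s" using dtri_rotate_back ob by blast
    then show ?thesis using 1 c by blast
  qed
qed

end

section \<open>Extending additive functions from a heart\<close>

text \<open>These functions on objects stand for the homomorphisms from K(D) to the reals; cosets
  enter only where the given definition of the cones is unfolded.\<close>

definition (in triangulated_category) tri_additive :: "('o \<Rightarrow> real) \<Rightarrow> bool" where
  "tri_additive \<psi> \<longleftrightarrow> (\<forall>a b c. dtri D a b c \<longrightarrow> \<psi> b = \<psi> a + \<psi> c)"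

definition ses_additive :: "('o, 'm, 'x) additive_data_scheme \<Rightarrow> ('o \<Rightarrow> real) \<Rightarrow> bool" where
  "ses_additive A \<phi> \<longleftrightarrow> (\<forall>a b c. ses A a b c \<longrightarrow> \<phi> b = \<phi> a + \<phi> c)"

context triangulated_category
begin

lemma tri_additiveD: "tri_additive \<psi> \<Longrightarrow> dtri D a b c \<Longrightarrow> \<psi> b = \<psi> a + \<psi> c"
  by (auto simp: tri_additive_def)

lemma dtri_of_iso: assumes "isomorphic D a b" "zero_object D z" shows "dtri D a b z"
proof -
  have ob: "a \<in> Ob D" "z \<in> Ob D" using isomorphic_Ob assms by (auto simp: zero_object_def)
  show ?thesis
    by (rule dtri_iso[OF dtri_ident[OF ob(1) assms(2)] isomorphic_refl[OF ob(1)] assms(1) isomorphic_refl[OF ob(2)]])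
qed

lemma tri_additive_zero: "tri_additive \<psi> \<Longrightarrow> zero_object D z \<Longrightarrow> \<psi> z = 0"
  using tri_additiveD[OF _ dtri_ident, of \<psi> z z] by (auto simp: zero_object_def)

lemma tri_additive_iso: assumes "tri_additive \<psi>" "isomorphic D a b" shows "\<psi> a = \<psi> b"
proof -
  obtain z where z: "zero_object D z" using ex_zero by blast
  show ?thesis using tri_additiveD[OF assms(1) dtri_of_iso[OF assms(2) z]] tri_additive_zero[OF assms(1) z] by simp
qed

lemma tri_additive_Sh: assumes "tri_additive \<psi>" "x \<in> Ob D" shows "\<psi> (Sh D x) = - \<psi> x"
proof -
  obtain z where z: "zero_object D z" using ex_zero by blast
  have "dtri D x z (Sh D x)" by (rule dtri_rotate[OF dtri_ident[OF assms(2) z]])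
  then show ?thesis using tri_additiveD[OF assms(1)] tri_additive_zero[OF assms(1) z] by force
qed

end

context bounded_t
begin

lemma ses_additiveD:
  "ses_additive A \<phi> \<Longrightarrow> dtri D a b c \<Longrightarrow> a \<in> heart \<Longrightarrow> b \<in> heart \<Longrightarrow> c \<in> heart \<Longrightarrow> \<phi> b = \<phi> a + \<phi> c"
  by (simp add: ses_additive_def ses_iff)

lemma ses_additive_zero: assumes "ses_additive A \<phi>" "zero_object D z" shows "\<phi> z = 0"
proof -
  have "z \<in> Ob D" using assms(2) by (simp add: zero_object_def)
  then show ?thesis using ses_additiveD[OF assms(1) dtri_ident[OF _ assms(2)]] zero_heart[OF assms(2)] by simp
qed

lemma ses_additive_iso: assumes "ses_additive A \<phi>" "isomorphic D a b" "a \<in> heart" shows "\<phi> a = \<phi> b"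
proof -
  obtain z where z: "zero_object D z" using ex_zero by blast
  show ?thesis
    using ses_additiveD[OF assms(1) dtri_of_iso[OF assms(2) z] assms(3) heart_iso[OF assms(3,2)] zero_heart[OF z]]
      ses_additive_zero[OF assms(1) z] by simp
qed

text \<open>An arbitrary choice; by \<open>trunc_unique\<close> it does not affect quantities that
  are invariant under isomorphism.\<close>

definition chosen_trunc :: "'o \<Rightarrow> 'o \<times> 'o" where
  "chosen_trunc x = (SOME (k, w). dtri D k x w \<and> k \<in> heart \<and> w \<in> Ob D \<and> Sh D w \<in> V)"

lemma chosen_trunc:
  assumes "x \<in> V" "chosen_trunc x = (k, w)"
  shows "dtri D k x w" "k \<in> heart" "w \<in> Ob D" "Sh D w \<in> V"
proof -
  obtain k' w' where "dtri D k' x w'" "k' \<in> heart" "w' \<in> Ob D" "Sh D w' \<in> V" using trunc[OF assms(1)] .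
  then have "\<exists>p. case p of (k, w) \<Rightarrow> dtri D k x w \<and> k \<in> heart \<and> w \<in> Ob D \<and> Sh D w \<in> V" by blast
  from someI_ex[OF this] show "dtri D k x w" "k \<in> heart" "w \<in> Ob D" "Sh D w \<in> V"
    using assms(2) unfolding chosen_trunc_def by (auto split: prod.splits)
qed

text \<open>The alternating sum of \<open>\<phi>\<close> over the cohomology objects in the degrees \<open>0, \<dots>, n - 1\<close>.\<close>

primrec euler :: "('o \<Rightarrow> real) \<Rightarrow> nat \<Rightarrow> 'o \<Rightarrow> real" where
  "euler \<phi> 0 x = 0"
| "euler \<phi> (Suc n) x = \<phi> (fst (chosen_trunc x)) - euler \<phi> n (Sh D (snd (chosen_trunc x)))"

lemma euler_iso:
  assumes "ses_additive A \<phi>"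
  shows "x \<in> V \<Longrightarrow> isomorphic D x y \<Longrightarrow> euler \<phi> n x = euler \<phi> n y"
proof (induction n arbitrary: x y)
  case (Suc n)
  obtain k w where x: "chosen_trunc x = (k, w)" by fastforce
  obtain k' w' where y: "chosen_trunc y = (k', w')" by fastforce
  note tx = chosen_trunc[OF Suc.prems(1) x] and ty = chosen_trunc[OF V_iso[OF Suc.prems] y]
  have "dtri D k y w"
    by (rule dtri_iso[OF tx(1) isomorphic_refl Suc.prems(2) isomorphic_refl]) (use tx heart_Ob in auto)
  then have "isomorphic D k k'" "isomorphic D w w'"
    using trunc_unique[of k y w k' w'] tx ty by blast+
  then show ?case
    using ses_additive_iso[OF assms _ tx(2)] Suc.IH[OF tx(4) isomorphic_Sh] x y by simp
qed simp

lemma euler_step: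
  assumes "ses_additive A \<phi>" "x \<in> V" "dtri D k x w" "k \<in> heart" "w \<in> Ob D" "Sh D w \<in> V"
  shows "euler \<phi> (Suc n) x = \<phi> k - euler \<phi> n (Sh D w)"
proof -
  obtain k' w' where x: "chosen_trunc x = (k', w')" by fastforce
  note tx = chosen_trunc[OF assms(2) x]
  have "isomorphic D k k'" "isomorphic D w w'"
    using trunc_unique[OF assms(3) _ assms(5,6) tx(1) _ tx(3,4)] assms(4) tx(2) by blast+
  then show ?thesis
    using ses_additive_iso[OF assms(1) _ assms(4)] euler_iso[OF assms(1) assms(6) isomorphic_Sh] x by simp
qed

lemma euler_Suc: assumes "ses_additive A \<phi>" shows "amp n x \<Longrightarrow> euler \<phi> (Suc n) x = euler \<phi> n x"
proof (induction n arbitrary: x)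
  case 0
  then have z: "zero_object D x" by (rule amp_0)
  then have xo: "x \<in> Ob D" "zero_object D (Sh D x)" using zero_Sh_iff by (auto simp: zero_object_def)
  show ?case
    using euler_step[OF assms _ dtri_ident[OF xo(1) z], of 0] zero_heart[OF z] zero_heart[OF xo(2)] xo
      ses_additive_zero[OF assms z] by simp
next
  case (Suc n)
  have xV: "x \<in> V" using Suc.prems by (simp add: amp_def)
  obtain k w where kw: "dtri D k x w" "k \<in> heart" "w \<in> Ob D" "Sh D w \<in> V" using trunc[OF xV] .
  have "amp n (Sh D w)" using amp_trunc[OF Suc.prems kw(1)] kw by blast
  then show ?case
    using Suc.IH[of "Sh D w"] euler_step[OF assms xV kw, of n] euler_step[OF assms xV kw, of "Suc n"]
    by (simp del: euler.simps)
qed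

lemma euler_eq:
  assumes "ses_additive A \<phi>" "amp n x" "amp m x" shows "euler \<phi> n x = euler \<phi> m x"
proof -
  have "euler \<phi> (n + d) x = euler \<phi> n x" if "amp n x" for n d
    by (induction d) (use euler_Suc[OF assms(1) amp_mono[OF that]] in auto)
  then show ?thesis using assms(2,3) by (metis le_add_diff_inverse nle_le)
qed

text \<open>Any number of degrees that suffices for \<open>x\<close> gives the same sum
  (\<open>euler_eq\<close>); the least is taken merely to have a definite one.\<close>

definition euler_V :: "('o \<Rightarrow> real) \<Rightarrow> 'o \<Rightarrow> real" where
  "euler_V \<phi> x = euler \<phi> (LEAST n. amp n x) x"

lemma euler_V_eq: "ses_additive A \<phi> \<Longrightarrow> amp n x \<Longrightarrow> euler_V \<phi> x = euler \<phi> n x"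
  unfolding euler_V_def by (rule euler_eq) (auto intro: LeastI)

lemma euler_V_zero: assumes "ses_additive A \<phi>" "zero_object D z" shows "euler_V \<phi> z = 0"
proof -
  have "amp 0 z" using zero_hom0[OF assms(2)] V_Ob zero_heart[OF assms(2)] by (simp add: amp_def)
  then show ?thesis using euler_V_eq[OF assms(1)] by fastforce
qed

lemma euler_V_iso: assumes "ses_additive A \<phi>" "x \<in> V" "isomorphic D x y" shows "euler_V \<phi> x = euler_V \<phi> y"
proof -
  obtain n where n: "amp n x" using amp_ex[OF assms(2)] .
  obtain m where m: "amp m y" using amp_ex[OF V_iso[OF assms(2,3)]] .
  have "euler_V \<phi> x = euler \<phi> (max n m) x" "euler_V \<phi> y = euler \<phi> (max n m) y"
    using euler_V_eq[OF assms(1)] amp_mono[OF n] amp_mono[OF m] by simp_all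
  then show ?thesis using euler_iso[OF assms] by simp
qed

lemma euler_V_step:
  assumes "ses_additive A \<phi>" "x \<in> V" "dtri D k x w" "k \<in> heart" "w \<in> Ob D" "Sh D w \<in> V"
  shows "euler_V \<phi> x = \<phi> k - euler_V \<phi> (Sh D w)"
proof -
  obtain n where n: "amp n x" using amp_ex[OF assms(2)] .
  have "amp n (Sh D w)" using amp_trunc[OF amp_Suc[OF n] assms(3) _ assms(6)] assms(4) by blast
  then show ?thesis
    using euler_step[OF assms, of n] euler_V_eq[OF assms(1)] amp_Suc[OF n] by metis
qed

text \<open>Truncating the triangle \<open>x \<rightarrow> y \<rightarrow> z\<close> in degree \<open>0\<close> yields a triangle
  \<open>z' \<rightarrow> x\<^sub>1[1] \<rightarrow> y\<^sub>1[1]\<close> of objects of total amplitude smaller by up to two.\<close>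

lemma euler_V_additive:
  assumes \<phi>: "ses_additive A \<phi>"
  shows "\<lbrakk>amp a x; amp b y; amp c z; dtri D x y z\<rbrakk> \<Longrightarrow> euler_V \<phi> y = euler_V \<phi> x + euler_V \<phi> z"
proof (induction "a + b + c" arbitrary: a b c x y z rule: less_induct)
  case less
  show ?case
  proof (cases "a = 0 \<and> b = 0")
    case True
    then have "zero_object D x" "zero_object D y" using less.prems amp_0 by blast+
    moreover from this have "zero_object D z" using dtri_zero_first[OF less.prems(4)] zero_object_iso by blast
    ultimately show ?thesis using euler_V_zero[OF \<phi>] by simp
  next
    case False
    have V: "x \<in> V" "y \<in> V" "z \<in> V" using less.prems by (auto simp: amp_def)
    obtain x0 x1 where x: "dtri D x0 x x1" "x0 \<in> heart" "x1 \<in> Ob D" "Sh D x1 \<in> V" using trunc[OF V(1)] .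
    obtain y0 y1 where y: "dtri D y0 y y1" "y0 \<in> heart" "y1 \<in> Ob D" "Sh D y1 \<in> V" using trunc[OF V(2)] .
    obtain z0 z1 where z: "dtri D z0 z z1" "z0 \<in> heart" "z1 \<in> Ob D" "Sh D z1 \<in> V" using trunc[OF V(3)] .
    have V1: "x1 \<in> V" "y1 \<in> V" "z1 \<in> V" using V_fall x y z by auto
    obtain p where p: "dtri D x0 y p" "dtri D x1 p z" using dtri_octahedral[OF x(1) less.prems(4)] .
    have "hom0 D x0 y1" using hom0_UV' x y by blast
    \<comment> \<open>Here \<open>i\<close> is the image of the lowest cohomology of
      \<open>y\<close> in that of \<open>z\<close>, and \<open>j\<close> below is the cokernel
      \<open>z0/i\<close>. The values at \<open>i\<close> and \<open>j\<close> cancel at the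
      end.\<close>
    then obtain i where i: "dtri D x0 y0 i" "dtri D i p y1" using dtri_lift[OF y(1) p(1)] by blast
    have "p \<in> V" using V_ext[OF p(2)] V1 V by blast
    then have ih: "i \<in> heart" using U_cone[OF i(1)] V_fibre[OF i(2)] x y V1 by blast
    obtain z' where z': "dtri D i z z'" "dtri D y1 z' (Sh D x1)"
      using dtri_octahedral[OF i(2) dtri_rotate[OF p(2)]] .
    have z'V: "z' \<in> V" using V_ext[OF z'(2)] V1 x by blast
    have "hom0 D i z1" using hom0_UV' ih z by blast
    then obtain j where j: "dtri D i z0 j" "dtri D j z' z1" using dtri_lift[OF z(1) z'(1)] by blast
    have jh: "j \<in> heart" using U_cone[OF j(1)] V_fibre[OF j(2)] ih z V1 z'V by blast
    have A1: "amp (n - 1) (Sh D w)" if "amp n v" "dtri D k v w" "k \<in> heart" "Sh D w \<in> V" for n k v w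
    proof -
      have "amp (Suc (n - 1)) v" using that(1) amp_Suc by (cases n) auto
      then show ?thesis using amp_trunc[OF _ that(2)] that(3,4) by blast
    qed
    have "amp c z'"
      unfolding amp_def
    proof (intro conjI ballI z'V)
      fix v assume v: "v \<in> V"
      show "hom0 D ((Sh D ^^ c) z') v"
      proof (rule hom0_mid_left[OF dtri_Sh_pow[OF dtri_rotate[OF z'(1)]]])
        show "hom0 D ((Sh D ^^ c) z) v" using less.prems v by (simp add: amp_def)
        show "hom0 D ((Sh D ^^ c) (Sh D i)) v"
          using hom0_UV_pow[of i v "Suc c"] ih v by (simp add: funpow_swap1)
      qed
    qed
    \<comment> \<open>The objects \<open>x1[1]\<close> and \<open>y1[1]\<close> each lose a degree
      if they have one, whereas \<open>z'\<close> keeps the bound \<open>c\<close>. This is why the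
      case in which both \<open>a\<close> and \<open>b\<close> are 0 was split off.\<close>
    moreover have "c + (a - 1) + (b - 1) < a + b + c" using False by auto
    ultimately have "euler_V \<phi> (Sh D x1) = euler_V \<phi> z' + euler_V \<phi> (Sh D y1)"
      using less.hyps A1[OF less.prems(1) x(1,2,4)] A1[OF less.prems(2) y(1,2,4)] dtri_rotate[OF z'(2)]
      by blast
    then show ?thesis
      using euler_V_step[OF \<phi> V(1) x] euler_V_step[OF \<phi> V(2) y] euler_V_step[OF \<phi> V(3) z]
        euler_V_step[OF \<phi> z'V j(2) jh z(3,4)] ses_additiveD[OF \<phi> i(1) x(2) y(2) ih]
        ses_additiveD[OF \<phi> j(1) ih z(2) jh] by simp
  qed
qed

lemma euler_V_desusp: assumes "ses_additive A \<phi>" "y \<in> V" shows "euler_V \<phi> y = - euler_V \<phi> (desusp D y)"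
proof -
  obtain z where z: "zero_object D z" using ex_zero by blast
  note d = V_desusp[OF assms(2)]
  have "euler_V \<phi> (desusp D y) = \<phi> z - euler_V \<phi> (Sh D (desusp D y))"
    by (rule euler_V_step[OF assms(1) d(1) dtri_zero_left[OF d(3) z] zero_heart[OF z] d(3,2)])
  then show ?thesis
    using ses_additive_zero[OF assms(1) z] euler_V_iso[OF assms(1) d(2) desusp(2)[OF V_Ob[OF assms(2)]]] by simp
qed

lemma euler_V_heart: assumes "ses_additive A \<phi>" "k \<in> heart" shows "euler_V \<phi> k = \<phi> k"
proof -
  obtain z where z: "zero_object D z" "z \<in> Ob D" using ex_zero by blast
  then have z': "zero_object D (Sh D z)" using zero_Sh_iff by blast
  have "euler_V \<phi> k = \<phi> k - euler_V \<phi> (Sh D z)"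
    using euler_V_step[OF assms(1) _ dtri_ident[OF heart_Ob[OF assms(2)] z(1)] assms(2) z(2)] assms(2)
      zero_heart[OF z'] by blast
  then show ?thesis using euler_V_zero[OF assms(1) z'] by simp
qed

text \<open>After sufficiently many desuspensions every object lies in the co-aisle, where the
  alternating sum is available; each desuspension changes the sign, so the number used does not
  matter. This is the part of K(H) = K(D) that the cones need.\<close>

theorem extend_additive:
  assumes \<phi>: "ses_additive A \<phi>"
  obtains \<psi> where "tri_additive \<psi>" "\<And>k. k \<in> heart \<Longrightarrow> \<psi> k = \<phi> k"
proof -
  define g where "g n x = (- 1) ^ n * euler_V \<phi> ((desusp D ^^ n) x)" for n x
  define \<psi> where "\<psi> x = g (LEAST n. (desusp D ^^ n) x \<in> V) x" for x
  have gS: "g (n + d) x = g n x" if "(desusp D ^^ n) x \<in> V" for n d x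
  proof (induction d)
    case (Suc d)
    have "(desusp D ^^ (d + n)) x \<in> V" using V_desusp_pow[OF that, of d] by (simp add: funpow_add)
    then have "g (Suc (d + n)) x = g (d + n) x" using euler_V_desusp[OF \<phi>] by (simp add: g_def)
    then show ?case using Suc by (simp add: add.commute)
  qed simp
  have mono: "(desusp D ^^ m) x \<in> V" if "(desusp D ^^ n) x \<in> V" "n \<le> m" for n m x
    using V_desusp_pow[OF that(1), of "m - n"] that(2) by (metis comp_apply funpow_add le_add_diff_inverse2)
  have \<psi>: "\<psi> x = g n x" if "(desusp D ^^ n) x \<in> V" for n x
  proof -
    let ?l = "LEAST n. (desusp D ^^ n) x \<in> V"
    have "?l \<le> n" "(desusp D ^^ ?l) x \<in> V" using that by (auto intro: Least_le LeastI)
    then show ?thesis using gS[of ?l x "n - ?l"] by (simp add: \<psi>_def)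
  qed
  show ?thesis
  proof
    show "tri_additive \<psi>"
      unfolding tri_additive_def
    proof (intro allI impI)
      fix a b c assume t: "dtri D a b c"
      then obtain n1 n2 n3 where n: "(desusp D ^^ n1) a \<in> V" "(desusp D ^^ n2) b \<in> V" "(desusp D ^^ n3) c \<in> V"
        using bound_below dtri_Ob by metis
      define N where "N = max n1 (max n2 n3)"
      have V: "(desusp D ^^ N) a \<in> V" "(desusp D ^^ N) b \<in> V" "(desusp D ^^ N) c \<in> V"
        using mono[OF n(1)] mono[OF n(2)] mono[OF n(3)] by (auto simp: N_def)
      obtain p where p: "amp p ((desusp D ^^ N) a)" using amp_ex[OF V(1)] .
      obtain q where q: "amp q ((desusp D ^^ N) b)" using amp_ex[OF V(2)] .
      obtain r where r: "amp r ((desusp D ^^ N) c)" using amp_ex[OF V(3)] .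
      show "\<psi> b = \<psi> a + \<psi> c"
        using euler_V_additive[OF \<phi> p q r dtri_desusp_pow[OF t]] \<psi>[OF V(1)] \<psi>[OF V(2)] \<psi>[OF V(3)]
        by (simp add: g_def algebra_simps)
    qed
    show "\<psi> k = \<phi> k" if "k \<in> heart" for k
      using \<psi>[of 0 k] that euler_V_heart[OF \<phi> that] by (simp add: g_def)
  qed
qed

end

section \<open>Intermediate hearts and torsion classes\<close>

definition perp :: "('o, 'm, 'x) additive_data_scheme \<Rightarrow> 'o set \<Rightarrow> 'o set" where
  "perp A T = {f \<in> Ob A. \<forall>t \<in> T. hom0 A t f}"

text \<open>Only the torsion class is recorded, the torsion-free class being its right orthogonal.
  The formulation uses the abelian category alone, so it can be transported to another ambient
  category.\<close>

definition torsion_class :: "('o, 'm, 'x) additive_data_scheme \<Rightarrow> 'o set \<Rightarrow> bool" where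
  "torsion_class A T \<longleftrightarrow> T \<subseteq> Ob A \<and> (\<forall>h \<in> Ob A. (\<forall>f \<in> perp A T. hom0 A h f) \<longrightarrow> h \<in> T) \<and>
     (\<forall>h \<in> Ob A. \<exists>t \<in> T. \<exists>f \<in> perp A T. ses A t h f)"

context bounded_t
begin

lemma perp_heart: "T \<subseteq> heart \<Longrightarrow> perp A T = {f \<in> heart. \<forall>t \<in> T. hom0 D t f}"
  by (auto simp: perp_def hom0_full_subcat subset_iff)

lemma torsion_class_heart:
  "torsion_class A T \<longleftrightarrow> T \<subseteq> heart \<and> (\<forall>h \<in> heart. (\<forall>f \<in> perp A T. hom0 D h f) \<longrightarrow> h \<in> T) \<and>
     (\<forall>h \<in> heart. \<exists>t \<in> T. \<exists>f \<in> perp A T. dtri D t h f)"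
proof -
  have p: "perp A T \<subseteq> heart" by (auto simp: perp_def)
  have "(\<forall>f \<in> perp A T. hom0 A h f) \<longleftrightarrow> (\<forall>f \<in> perp A T. hom0 D h f)" if "h \<in> heart" for h
    using p that by (meson hom0_full_subcat subsetD)
  moreover have "(\<exists>t \<in> T. \<exists>f \<in> perp A T. ses A t h f) \<longleftrightarrow> (\<exists>t \<in> T. \<exists>f \<in> perp A T. dtri D t h f)"
    if "h \<in> heart" "T \<subseteq> heart" for h
    using p that by (meson ses_iff subsetD)
  ultimately show ?thesis unfolding torsion_class_def by (simp cong: conj_cong)
qed

text \<open>In this form, U[1] \<subseteq> U' \<subseteq> U, the order can be applied to
  truncations, whereas the order on hearts speaks about heart objects only.\<close>

lemma intermediate_iff:
  "K \<in> intermediate_hearts D heart \<longleftrightarrow>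
     (\<exists>U' V'. bounded_t_structure D U' V' \<and> K = U' \<inter> V' \<and> U' \<subseteq> U \<and> (\<forall>x \<in> U. Sh D x \<in> U'))"
proof
  assume K: "K \<in> intermediate_hearts D heart"
  then obtain U' V' where B: "bounded_t_structure D U' V'" and K': "K = U' \<inter> V'"
    by (auto simp: intermediate_hearts_def bounded_heart_def)
  interpret B: bounded_t D U' V' by unfold_locales (rule B)
  have sub: "K \<subseteq> Ob D" "heart \<subseteq> Ob D" "shift_sub D heart 1 \<subseteq> Ob D"
    using B.heart_Ob heart_Ob K' by (auto simp: shift_sub_def)
  have g1: "hom0 D ((Sh D ^^ n) k) h" if "1 \<le> n" "k \<in> U' \<inter> V'" "h \<in> heart" for n k h
    using K heart_ge_iff[OF sub(1,2)] that K' by (auto simp: intermediate_hearts_def)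
  have g2: "hom0 D ((Sh D ^^ n) h) k" if "2 \<le> n" "h \<in> heart" "k \<in> U' \<inter> V'" for n k h
  proof -
    obtain m where m: "n = Suc m" "1 \<le> m" using \<open>2 \<le> n\<close> by (cases n) auto
    have "Sh D h \<in> shift_sub D heart 1"
      using isomorphic_refl[OF Sh_Ob[OF heart_Ob[OF that(2)]]] Sh_Ob[OF heart_Ob[OF that(2)]] that(2)
      by (auto simp: shift_sub_def)
    then have "hom0 D ((Sh D ^^ m) (Sh D h)) k"
      using K heart_ge_iff[OF sub(3,1)] that m K' by (auto simp: intermediate_hearts_def)
    then show ?thesis by (simp add: m funpow_swap1)
  qed
  have "x \<in> U" if x: "x \<in> U'" for x
    unfolding U_iff using hearts_hom0[where m = 1, OF B bounded g1 x] B.U_Ob[OF x] by auto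
  moreover have "Sh D x \<in> U'" if x: "x \<in> U" for x
    unfolding B.U_iff using hearts_hom0[where m = 2, OF bounded B g2 x] Sh_Ob[OF U_Ob[OF x]]
    by (auto simp: numeral_2_eq_2)
  ultimately show "\<exists>U' V'. bounded_t_structure D U' V' \<and> K = U' \<inter> V' \<and> U' \<subseteq> U \<and> (\<forall>x \<in> U. Sh D x \<in> U')"
    using B K' by blast
next
  assume "\<exists>U' V'. bounded_t_structure D U' V' \<and> K = U' \<inter> V' \<and> U' \<subseteq> U \<and> (\<forall>x \<in> U. Sh D x \<in> U')"
  then obtain U' V' where B: "bounded_t_structure D U' V'" and K': "K = U' \<inter> V'" and s: "U' \<subseteq> U" "\<And>x. x \<in> U \<Longrightarrow> Sh D x \<in> U'"
    by blast
  interpret B: bounded_t D U' V' by unfold_locales (rule B)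
  have sub: "K \<subseteq> Ob D" "heart \<subseteq> Ob D" "shift_sub D heart 1 \<subseteq> Ob D"
    using B.heart_Ob heart_Ob K' by (auto simp: shift_sub_def)
  have "bounded_heart D K" using B K' by (auto simp: bounded_heart_def)
  moreover have "heart_ge D K heart"
    unfolding heart_ge_iff[OF sub(1,2)] using hom0_UV_pow s(1) K' by auto
  moreover have "heart_ge D (shift_sub D heart 1) K"
    unfolding heart_ge_iff[OF sub(3,1)]
  proof (intro allI impI ballI)
    fix n :: nat and x k assume a: "1 \<le> n" "x \<in> shift_sub D heart 1" "k \<in> K"
    then obtain h where h: "h \<in> heart" "isomorphic D x (Sh D h)" by (auto simp: shift_sub_def)
    then have "x \<in> U'" using B.U_iso s(2) isomorphic_sym by blast
    then show "hom0 D ((Sh D ^^ n) x) k" using B.hom0_UV_pow a K' by simp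
  qed
  ultimately show "K \<in> intermediate_hearts D heart" by (simp add: intermediate_hearts_def)
qed

lemma heart_intermediate: "heart \<in> intermediate_hearts D heart"
  unfolding intermediate_iff using bounded U_Sh by blast

text \<open>Because U[1] \<subseteq> U' \<subseteq> U, truncating an object of H by the second
  t-structure stays inside H, which gives the torsion decomposition. Truncating an object of K by
  the first t-structure gives the description of K.\<close>

lemma intermediate_torsion:
  assumes "K \<in> intermediate_hearts D heart"
  shows "torsion_class A (heart \<inter> K)"
    and "perp A (heart \<inter> K) = {f \<in> heart. Sh D f \<in> K}"
    and "K = {k. \<exists>f \<in> perp A (heart \<inter> K). \<exists>t \<in> heart \<inter> K. dtri D (Sh D f) k t}"
proof -
  obtain U' V' where B: "bounded_t_structure D U' V'" and K': "K = U' \<inter> V'" and s: "U' \<subseteq> U" "\<And>x. x \<in> U \<Longrightarrow> Sh D x \<in> U'"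
    using assms unfolding intermediate_iff by blast
  interpret B: bounded_t D U' V' by unfold_locales (rule B)
  have VV: "v \<in> V'" if "v \<in> V" for v
    unfolding B.V_iff using hom0_UV that s V_Ob by blast
  have T: "heart \<inter> K = heart \<inter> U'" using VV K' by blast
  have inV: "w \<in> V" if "w \<in> Ob D" "Sh D w \<in> V'" for w
    unfolding V_iff using B.hom0_UV' s(2) that by blast
  have FK: "Sh D f \<in> K \<longleftrightarrow> Sh D f \<in> V'" if "f \<in> heart" for f using s(2) that K' by blast
  have dec: "\<exists>u \<in> heart \<inter> U'. \<exists>w \<in> heart. Sh D w \<in> V' \<and> dtri D u h w" if h: "h \<in> heart" for h
  proof -
    obtain u w where uw: "dtri D u h w" "u \<in> U'" "w \<in> Ob D" "Sh D w \<in> V'" using B.decomp[OF heart_Ob[OF h]] .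
    have "w \<in> V" using inV uw by blast
    moreover from this have "u \<in> V" using V_fibre[OF uw(1)] h by blast
    moreover have "w \<in> U" using U_cone[OF uw(1)] uw s h by blast
    ultimately show ?thesis using uw s by blast
  qed
  show P: "perp A (heart \<inter> K) = {f \<in> heart. Sh D f \<in> K}"
  proof (intro equalityI subsetI)
    fix f assume "f \<in> {f \<in> heart. Sh D f \<in> K}"
    then have f: "f \<in> heart" "Sh D f \<in> V'" using FK by auto
    then show "f \<in> perp A (heart \<inter> K)"
      using B.hom0_UV' heart_Ob[OF f(1)] K' unfolding perp_heart[OF Int_lower1] by blast
  next
    fix f assume "f \<in> perp A (heart \<inter> K)"
    then have f: "f \<in> heart" "\<And>t. t \<in> heart \<inter> U' \<Longrightarrow> hom0 D t f"
      unfolding T perp_heart[OF Int_lower1] by blast+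
    obtain u w where uw: "u \<in> heart \<inter> U'" "w \<in> heart" "Sh D w \<in> V'" "dtri D u f w" using dec[OF f(1)] by blast
    have "w \<in> V'" using B.V_fall heart_Ob uw by blast
    then have "hom0 D u (desusp D w)" using B.hom0_UV' B.V_desusp uw by blast
    then have "hom0 D u u" using hom0_mid_right[OF dtri_back[OF uw(4)]] f(2) uw(1) by blast
    then have "isomorphic D f w" using dtri_zero_first[OF uw(4)] zero_object_iff by blast
    then have "Sh D f \<in> V'" using B.V_iso[OF uw(3)] isomorphic_Sh isomorphic_sym by blast
    then show "f \<in> {f \<in> heart. Sh D f \<in> K}" using FK f by blast
  qed
  show "torsion_class A (heart \<inter> K)"
    unfolding torsion_class_heart
  proof (intro conjI ballI impI)
    fix h assume h: "h \<in> heart" "\<forall>f \<in> perp A (heart \<inter> K). hom0 D h f"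
    obtain u w where uw: "u \<in> heart \<inter> U'" "w \<in> heart" "Sh D w \<in> V'" "dtri D u h w" using dec[OF h(1)] by blast
    have "hom0 D h w" using h(2) P FK uw by blast
    then have "hom0 D w w" using hom0_mid_left[OF dtri_rotate[OF uw(4)]] hom0_heart uw by blast
    then have "isomorphic D u h" using dtri_zero_third[OF uw(4)] zero_object_iff by blast
    then show "h \<in> heart \<inter> K" using T B.U_iso uw h by blast
  next
    fix h assume h: "h \<in> heart"
    show "\<exists>t \<in> heart \<inter> K. \<exists>f \<in> perp A (heart \<inter> K). dtri D t h f" using dec[OF h] P FK T by blast
  qed auto
  show "K = {k. \<exists>f \<in> perp A (heart \<inter> K). \<exists>t \<in> heart \<inter> K. dtri D (Sh D f) k t}"
  proof (intro equalityI subsetI)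
    fix k assume k: "k \<in> K"
    obtain u t where ut: "dtri D (Sh D u) k t" "u \<in> U" "t \<in> heart" using cotrunc[of k] k K' s by blast
    have "t \<in> U'" using B.U_cone[OF ut(1)] s(2) ut k K' by blast
    moreover have su: "Sh D u \<in> V'" using B.V_ext[OF dtri_back[OF ut(1)]] VV V_desusp ut k K' by blast
    moreover have "u \<in> V" using inV[OF U_Ob[OF ut(2)] su] .
    ultimately show "k \<in> {k. \<exists>f \<in> perp A (heart \<inter> K). \<exists>t \<in> heart \<inter> K. dtri D (Sh D f) k t}"
      using ut P FK T by blast
  next
    fix k assume "k \<in> {k. \<exists>f \<in> perp A (heart \<inter> K). \<exists>t \<in> heart \<inter> K. dtri D (Sh D f) k t}"
    then obtain f t where "Sh D f \<in> K" "t \<in> K" "dtri D (Sh D f) k t" using P by blast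
    then show "k \<in> K" using B.heart_ext K' by blast
  qed
qed

text \<open>Happel-Reiten-Smalo tilting: \<open>U'\<close> consists of the objects of the aisle
  whose cohomology in degree 0 lies in \<open>T\<close>, and \<open>V'\<close> is forced by
  orthogonality.\<close>

lemma torsion_intermediate:
  assumes "torsion_class A T"
  obtains K where "K \<in> intermediate_hearts D heart" "heart \<inter> K = T"
proof -
  have T: "T \<subseteq> heart" and T2: "\<And>h. h \<in> heart \<Longrightarrow> (\<And>f. f \<in> perp A T \<Longrightarrow> hom0 D h f) \<Longrightarrow> h \<in> T"
    and T3: "\<And>h. h \<in> heart \<Longrightarrow> \<exists>t \<in> T. \<exists>f \<in> perp A T. dtri D t h f"
    using assms unfolding torsion_class_heart by blast+
  have F: "perp A T = {f \<in> heart. \<forall>t \<in> T. hom0 D t f}" by (rule perp_heart[OF T])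
  define U' where "U' = {x \<in> Ob D. \<exists>u \<in> U. \<exists>t \<in> T. dtri D (Sh D u) x t}"
  define V' where "V' = {x \<in> Ob D. \<forall>u \<in> U'. hom0 D (Sh D u) x}"
  have U'U: "x \<in> U" if "x \<in> U'" for x using that U_ext U_Sh T by (auto simp: U'_def)
  obtain z where z: "zero_object D z" "z \<in> Ob D" by (rule ex_zero)
  have zF: "hom0 D z f" if "f \<in> heart" for f using zero_hom0[OF z(1)] heart_Ob that by blast
  have zT: "z \<in> T" using T2[OF zero_heart[OF z(1)] zF] F by blast
  have ShU: "Sh D x \<in> U'" if "x \<in> U" for x
  proof -
    have "dtri D (Sh D x) (Sh D x) z" by (rule dtri_ident[OF Sh_Ob[OF U_Ob[OF that]] z(1)])
    then show ?thesis using that zT Sh_Ob U_Ob by (auto simp: U'_def)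
  qed
  have TU': "t \<in> U'" if "t \<in> T" for t
  proof -
    have zz: "zero_object D (Sh D z)" using z zero_Sh_iff by blast
    have "dtri D (Sh D z) t t" using dtri_zero_left[OF _ zz] heart_Ob T that by blast
    then show ?thesis using that zero_heart[OF z(1)] heart_Ob T by (auto simp: U'_def)
  qed
  have VV': "v \<in> V'" if "v \<in> V" for v using that V_Ob hom0_UV U'U by (auto simp: V'_def)
  have shV': "shift_sub D V' (- 1) = {x \<in> Ob D. \<forall>u \<in> U'. hom0 D u x}"
  proof -
    have "shift_sub D V' (- 1) = {x \<in> Ob D. \<forall>u \<in> U'. hom0 D (Sh D u) (Sh D x)}"
      using Sh_Ob by (auto simp: shift_sub_def V'_def)
    then show ?thesis using hom0_shift U_Ob[OF U'U] by auto
  qed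
  have ts': "t_structure D U' V'"
    unfolding t_structure_def
  proof (intro conjI ballI)
    show "iso_closed D U'"
      unfolding iso_closed_def
    proof (intro conjI ballI impI)
      fix x y assume a: "x \<in> U'" "y \<in> Ob D" "isomorphic D x y"
      then obtain u t where ut: "u \<in> U" "t \<in> T" "dtri D (Sh D u) x t" by (auto simp: U'_def)
      have "dtri D (Sh D u) y t"
        by (rule dtri_iso[OF ut(3) isomorphic_refl a(3) isomorphic_refl]) (use ut(3) dtri_Ob in auto)
      then show "y \<in> U'" using a ut by (auto simp: U'_def)
    qed (auto simp: U'_def)
    show "iso_closed D V'"
      unfolding iso_closed_def V'_def using hom0_iso_right by blast
    show "shift_sub D U' 1 \<subseteq> U'"
    proof
      fix x assume "x \<in> shift_sub D U' 1"
      then obtain s where s: "x \<in> Ob D" "s \<in> U'" "isomorphic D x (Sh D s)" by (auto simp: shift_sub_def)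
      have "dtri D (Sh D s) x z" by (rule dtri_of_iso[OF isomorphic_sym[OF s(3)] z(1)])
      moreover have "s \<in> U" by (rule U'U[OF s(2)])
      ultimately show "x \<in> U'" using s(1) zT unfolding U'_def by blast
    qed
    show "shift_sub D V' (- 1) \<subseteq> V'"
      unfolding shV' using ShU U'U by (auto simp: V'_def)
    show "homs_vanish D U' (shift_sub D V' (- 1))"
      unfolding shV' homs_vanish_def by (auto simp: hom0_def)
    fix x assume x: "x \<in> Ob D"
    \<comment> \<open>The new truncation refines the old one: \<open>h\<close> is the top cohomology
      of the old truncation \<open>u\<close>, \<open>t\<close> is the torsion part of
      \<open>h\<close>, and \<open>m\<close> is the preimage of \<open>t\<close> in
      \<open>u\<close>. The other end \<open>q\<close> is then an extension of \<open>v\<close> by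
      the torsion-free part \<open>f\<close>.\<close>
    obtain u v where uv: "dtri D u x v" "u \<in> U" "v \<in> Ob D" "Sh D v \<in> V" using decomp[OF x] .
    obtain u1 h where u1: "dtri D (Sh D u1) u h" "u1 \<in> U" "h \<in> heart" using cotrunc[OF uv(2)] .
    obtain t f where tf: "t \<in> T" "f \<in> perp A T" "dtri D t h f" using T3[OF u1(3)] by blast
    obtain m where m: "dtri D (Sh D u1) m t" "dtri D m u f" using dtri_pullback[OF u1(1) tf(3)] .
    have mU: "m \<in> U'" using m u1 tf dtri_Ob by (auto simp: U'_def)
    obtain q where q: "dtri D m x q" "dtri D f q v" using dtri_octahedral[OF m(2) uv(1)] .
    have fh: "f \<in> heart" and fT: "\<And>t. t \<in> T \<Longrightarrow> hom0 D t f" using tf(2) F by auto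
    have "hom0 D y q" if y: "y \<in> U'" for y
    proof (rule hom0_mid_right[OF q(2)])
      obtain u t where ut: "u \<in> U" "t \<in> T" "dtri D (Sh D u) y t" using y by (auto simp: U'_def)
      show "hom0 D y f" using hom0_mid_left[OF ut(3)] hom0_UV[OF ut(1)] fh fT[OF ut(2)] by blast
      show "hom0 D y v" using hom0_UV' U'U y uv by blast
    qed
    then have qV: "q \<in> shift_sub D V' (- 1)" unfolding shV' using q dtri_Ob by blast
    obtain a b c where abc: "tria D m x q a b c" using q(1) by (rule dtriE)
    then have "(a, b, c) \<in> Tri D" "Dom D a = m" "Cod D a = x" "Cod D b = q"
      by (auto simp: tria_def Homs_def)
    then show "\<exists>(f, g, h) \<in> Tri D. Dom D f \<in> U' \<and> Cod D f = x \<and> Cod D g \<in> shift_sub D V' (- 1)"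
      using mU qV by (intro bexI[of _ "(a, b, c)"]) auto
  qed
  have "bounded_t_structure D U' V'"
    unfolding bounded_t_structure_def
  proof (intro conjI ballI ts')
    fix x assume x: "x \<in> Ob D"
    obtain n where n: "(Sh D ^^ n) x \<in> U" using bound_above[OF x] .
    \<comment> \<open>One shift more than for the original aisle, since only U[1] is contained in
      \<open>U'\<close>.\<close>
    have "x \<in> shift_sub D U' (- int (Suc n))" using ShU[OF n] x by (simp add: shift_sub_def nat_add_distrib)
    moreover obtain k where "x \<in> shift_sub D V k" using bounded x by (auto simp: bounded_t_structure_def)
    then have "x \<in> shift_sub D V' k" using VV' by (auto simp: shift_sub_def split: if_splits)
    ultimately show "\<exists>m n. x \<in> shift_sub D U' m \<and> x \<in> shift_sub D V' n" by blast
  qed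
  then have "U' \<inter> V' \<in> intermediate_hearts D heart" unfolding intermediate_iff using U'U ShU by blast
  moreover have "heart \<inter> (U' \<inter> V') = T"
  proof (intro equalityI subsetI)
    fix h assume "h \<in> heart \<inter> (U' \<inter> V')"
    then obtain u t where ut: "u \<in> U" "t \<in> T" "dtri D (Sh D u) h t" and h: "h \<in> heart" by (auto simp: U'_def)
    show "h \<in> T"
    proof (rule T2[OF h])
      fix f assume f: "f \<in> perp A T"
      show "hom0 D h f" using hom0_mid_left[OF ut(3)] hom0_UV[OF ut(1)] ut(2) f F by blast
    qed
  qed (use T TU' VV' in blast)
  ultimately show ?thesis using that by blast
qed

text \<open>Injectivity comes from the last part of \<open>intermediate_torsion\<close>, which
  rebuilds a heart from its torsion class as the extensions of torsion objects by shifted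
  torsion-free ones.\<close>

theorem tilting_bij: "bij_betw (\<lambda>K. heart \<inter> K) (intermediate_hearts D heart) {T. torsion_class A T}"
proof (rule bij_betw_imageI)
  show "inj_on (\<lambda>K. heart \<inter> K) (intermediate_hearts D heart)"
  proof (rule inj_onI)
    fix K L assume a: "K \<in> intermediate_hearts D heart" "L \<in> intermediate_hearts D heart" "heart \<inter> K = heart \<inter> L"
    define E where "E T = {k. \<exists>f \<in> perp A T. \<exists>t \<in> T. dtri D (Sh D f) k t}" for T
    have "K = E (heart \<inter> K)" "L = E (heart \<inter> L)"
      unfolding E_def by (rule intermediate_torsion(3)[OF a(1)], rule intermediate_torsion(3)[OF a(2)])
    then show "K = L" using a(3) by metis
  qed
  show "(\<lambda>K. heart \<inter> K) ` intermediate_hearts D heart = {T. torsion_class A T}"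
  proof (intro equalityI subsetI)
    fix T assume "T \<in> {T. torsion_class A T}"
    then have "torsion_class A T" by simp
    from torsion_intermediate[OF this] obtain K where "K \<in> intermediate_hearts D heart" "heart \<inter> K = T" .
    then show "T \<in> (\<lambda>K. heart \<inter> K) ` intermediate_hearts D heart" by (intro image_eqI[of _ _ K]) simp_all
  qed (use intermediate_torsion(1) in blast)
qed

end

section \<open>Grothendieck groups and their real duals\<close>

lemma real_group_simps [simp]:
  "carrier real_group = UNIV" "x \<otimes>\<^bsub>real_group\<^esub> y = x + y" "\<one>\<^bsub>real_group\<^esub> = 0"
  by (auto simp: real_group_def)

lemma hom_real_group: "h \<in> hom G real_group \<longleftrightarrow> (\<forall>x \<in> carrier G. \<forall>y \<in> carrier G. h (x \<otimes>\<^bsub>G\<^esub> y) = h x + h y)"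
  by (auto simp: hom_def)

definition lin :: "('a \<Rightarrow> real) \<Rightarrow> ('a \<Rightarrow>\<^sub>0 int) \<Rightarrow> real" where
  "lin \<phi> c = (\<Sum>x \<in> Poly_Mapping.keys c. of_int (Poly_Mapping.lookup c x) * \<phi> x)"

lemma lin_superset:
  "finite A \<Longrightarrow> Poly_Mapping.keys c \<subseteq> A \<Longrightarrow> lin \<phi> c = (\<Sum>x \<in> A. of_int (Poly_Mapping.lookup c x) * \<phi> x)"
  unfolding lin_def by (rule sum.mono_neutral_left) (auto simp: in_keys_iff)

lemma lin_add: "lin \<phi> (c + d) = lin \<phi> c + lin \<phi> d"
proof -
  let ?A = "Poly_Mapping.keys c \<union> Poly_Mapping.keys d"
  have "Poly_Mapping.keys (c + d) \<subseteq> ?A" by (rule Poly_Mapping.keys_add)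
  then show ?thesis
    using lin_superset[of ?A "c + d" \<phi>] lin_superset[of ?A c \<phi>] lin_superset[of ?A d \<phi>]
    by (simp add: Poly_Mapping.lookup_add algebra_simps sum.distrib)
qed

lemma lin_0 [simp]: "lin \<phi> 0 = 0"
  by (simp add: lin_def)

lemma lin_minus [simp]: "lin \<phi> (- c) = - lin \<phi> c"
  using lin_add[of \<phi> c "- c"] by simp

lemma lin_diff [simp]: "lin \<phi> (c - d) = lin \<phi> c - lin \<phi> d"
  using lin_add[of \<phi> c "- d"] by simp

lemma lin_frag_of [simp]: "lin \<phi> (frag_of x) = \<phi> x"
  by (simp add: lin_def)

lemma lin_cong: "(\<And>x. x \<in> Poly_Mapping.keys c \<Longrightarrow> \<phi> x = \<psi> x) \<Longrightarrow> lin \<phi> c = lin \<psi> c"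
  by (simp add: lin_def)

lemma lin_hom: "lin \<phi> \<in> hom (free_Abelian_group S) real_group"
  by (simp add: hom_real_group lin_add)

lemma hom_eq_lin:
  assumes "h \<in> hom (free_Abelian_group S) real_group" "Poly_Mapping.keys c \<subseteq> S"
  shows "h c = lin (\<lambda>x. h (frag_of x)) c"
proof (rule free_Abelian_group_induct[OF assms(2)])
  have h: "h (x + y) = h x + h y" if "Poly_Mapping.keys x \<subseteq> S" "Poly_Mapping.keys y \<subseteq> S" for x y
    using assms(1) that by (simp add: hom_real_group)
  have "h (0 + 0) = h 0 + h 0" by (rule h) simp_all
  then show "h 0 = lin (\<lambda>x. h (frag_of x)) 0" by simp
  fix x y :: "'a \<Rightarrow>\<^sub>0 int"
  assume xy: "Poly_Mapping.keys x \<subseteq> S" "Poly_Mapping.keys y \<subseteq> S"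
    "h x = lin (\<lambda>x. h (frag_of x)) x" "h y = lin (\<lambda>x. h (frag_of x)) y"
  have "Poly_Mapping.keys (x - y) \<subseteq> S" using xy keys_diff[of x y] by blast
  then have "h (x - y + y) = h (x - y) + h y" using xy(2) by (rule h)
  then show "h (x - y) = lin (\<lambda>x. h (frag_of x)) (x - y)" using xy by simp
qed simp

lemma sum_fun_apply: "(\<Sum>b \<in> B. f b) x = (\<Sum>b \<in> B. f b x)"
  by (induction B rule: infinite_finite_induct) auto

context
  fixes S :: "'a set" and R :: "('a \<Rightarrow>\<^sub>0 int) set"
  assumes R: "R \<subseteq> carrier (free_Abelian_group S)"
begin

abbreviation (input) FS where "FS \<equiv> free_Abelian_group S"
abbreviation (input) NR where "NR \<equiv> generate FS R"

lemma rel_subgroup: "subgroup NR FS"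
  using group.generate_is_subgroup[OF group_free_Abelian_group R] .

lemma rel_normal: "NR \<lhd> FS"
  by (rule comm_group.subgroup_imp_normal[OF abelian_free_Abelian_group rel_subgroup])

lemma presented_carrier: "X \<in> carrier (presented_group S R) \<longleftrightarrow> (\<exists>c. Poly_Mapping.keys c \<subseteq> S \<and> X = NR #>\<^bsub>FS\<^esub> c)"
  by (simp add: presented_group_def carrier_FactGroup image_iff Bex_def)

lemma rel_coset: "NR #>\<^bsub>FS\<^esub> c = {n + c | n. n \<in> NR}"
  by (auto simp: r_coset_def)

lemma rel_coset_self: "c \<in> NR #>\<^bsub>FS\<^esub> c"
  using subgroup.one_closed[OF rel_subgroup] by (auto simp: rel_coset intro!: exI[of _ 0])

lemma rel_coset_eq:
  assumes "d \<in> NR #>\<^bsub>FS\<^esub> c" "Poly_Mapping.keys c \<subseteq> S" shows "NR #>\<^bsub>FS\<^esub> c = NR #>\<^bsub>FS\<^esub> d"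
  using group.repr_independence[OF group_free_Abelian_group assms(1) _ rel_subgroup] assms(2) by simp

lemma rel_coset_eqI:
  assumes "c - d \<in> NR" "Poly_Mapping.keys d \<subseteq> S" shows "NR #>\<^bsub>FS\<^esub> c = NR #>\<^bsub>FS\<^esub> d"
  using rel_coset_eq[of c d] assms by (force simp: rel_coset)

lemma rel_closed:
  "r \<in> R \<Longrightarrow> r \<in> NR" "\<lbrakk>c \<in> NR; d \<in> NR\<rbrakk> \<Longrightarrow> c - d \<in> NR"
proof -
  show "r \<in> R \<Longrightarrow> r \<in> NR" by (rule generate.incl)
  assume a: "c \<in> NR" "d \<in> NR"
  have k: "Poly_Mapping.keys d \<subseteq> S" using subgroup.mem_carrier[OF rel_subgroup a(2)] by simp
  have "c \<otimes>\<^bsub>FS\<^esub> inv\<^bsub>FS\<^esub> d \<in> NR"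
    by (rule subgroup.m_closed[OF rel_subgroup a(1) subgroup.m_inv_closed[OF rel_subgroup a(2)]])
  then show "c - d \<in> NR" using k by simp
qed

lemma lin_rel: assumes "\<And>r. r \<in> R \<Longrightarrow> lin \<phi> r = 0" "c \<in> NR" shows "lin \<phi> c = 0"
  using assms(2)
proof (induction rule: generate.induct)
  case (inv h)
  then have "Poly_Mapping.keys h \<subseteq> S" using subsetD[OF R] by simp
  then show ?case using assms(1)[OF inv] by simp
qed (use assms(1) in \<open>auto simp: lin_add\<close>)

lemma lin_coset:
  assumes "\<And>r. r \<in> R \<Longrightarrow> lin \<phi> r = 0" "d \<in> NR #>\<^bsub>FS\<^esub> c" shows "lin \<phi> d = lin \<phi> c"
  using assms(2) lin_rel[OF assms(1)] by (auto simp: rel_coset lin_add)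

lemma presented_dual_ex:
  assumes "\<And>r. r \<in> R \<Longrightarrow> lin \<phi> r = 0"
  obtains v where "v \<in> real_dual (presented_group S R)"
    "\<And>c. Poly_Mapping.keys c \<subseteq> S \<Longrightarrow> v (NR #>\<^bsub>FS\<^esub> c) = lin \<phi> c"
proof -
  have "lin \<phi> x = lin \<phi> y" if "NR #>\<^bsub>FS\<^esub> x = NR #>\<^bsub>FS\<^esub> y" for x y
    using lin_coset[OF assms, of y x] rel_coset_self[of y] that by simp
  then obtain g where g: "g \<in> hom (FS Mod NR) real_group" "\<And>x. x \<in> carrier FS \<Longrightarrow> g (NR #>\<^bsub>FS\<^esub> x) = lin \<phi> x"
    using FactGroup_universal[OF lin_hom rel_normal] by metis
  define v where "v X = (if X \<in> carrier (presented_group S R) then g X else 0)" for X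
  have grp: "group (presented_group S R)"
    unfolding presented_group_def by (rule normal.factorgroup_is_group[OF rel_normal])
  have "v \<in> real_dual (presented_group S R)"
    using g(1) group.is_monoid[OF grp, THEN monoid.m_closed]
    by (auto simp: real_dual_def hom_real_group v_def presented_group_def)
  moreover have "v (NR #>\<^bsub>FS\<^esub> c) = lin \<phi> c" if "Poly_Mapping.keys c \<subseteq> S" for c
    using g(2) that by (auto simp: v_def presented_carrier)
  ultimately show ?thesis by (rule that)
qed

lemma presented_dual_lin:
  assumes v: "v \<in> real_dual (presented_group S R)" and c: "Poly_Mapping.keys c \<subseteq> S"
  shows "v (NR #>\<^bsub>FS\<^esub> c) = lin (\<lambda>x. v (NR #>\<^bsub>FS\<^esub> frag_of x)) c"
proof -
  have "(\<lambda>c. v (NR #>\<^bsub>FS\<^esub> c)) \<in> hom FS real_group"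
    unfolding hom_real_group
  proof (intro ballI)
    fix x y assume xy: "x \<in> carrier FS" "y \<in> carrier FS"
    then have "NR #>\<^bsub>FS\<^esub> (x \<otimes>\<^bsub>FS\<^esub> y) = (NR #>\<^bsub>FS\<^esub> x) \<otimes>\<^bsub>presented_group S R\<^esub> (NR #>\<^bsub>FS\<^esub> y)"
      using normal.rcos_sum[OF rel_normal] by (simp add: presented_group_def)
    moreover have "NR #>\<^bsub>FS\<^esub> x \<in> carrier (presented_group S R)" "NR #>\<^bsub>FS\<^esub> y \<in> carrier (presented_group S R)"
      using xy by (auto simp: presented_carrier)
    ultimately show "v (NR #>\<^bsub>FS\<^esub> (x \<otimes>\<^bsub>FS\<^esub> y)) = v (NR #>\<^bsub>FS\<^esub> x) + v (NR #>\<^bsub>FS\<^esub> y)"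
      using v by (simp add: real_dual_def hom_real_group)
  qed
  from hom_eq_lin[OF this c] show ?thesis .
qed

lemma presented_dual_rel:
  assumes "v \<in> real_dual (presented_group S R)" "r \<in> R"
  shows "lin (\<lambda>x. v (NR #>\<^bsub>FS\<^esub> frag_of x)) r = 0"
proof -
  have k: "Poly_Mapping.keys r \<subseteq> S" using subsetD[OF R assms(2)] by simp
  have "NR #>\<^bsub>FS\<^esub> r = NR #>\<^bsub>FS\<^esub> 0" by (rule rel_coset_eqI) (use rel_closed(1)[OF assms(2)] in auto)
  then show ?thesis using presented_dual_lin[OF assms(1) k] presented_dual_lin[OF assms(1), of 0] by simp
qed

lemma presented_dual_eqI:
  assumes v: "v \<in> real_dual (presented_group S R)" "w \<in> real_dual (presented_group S R)"
    and "\<And>x. x \<in> S \<Longrightarrow> v (NR #>\<^bsub>FS\<^esub> frag_of x) = w (NR #>\<^bsub>FS\<^esub> frag_of x)"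
  shows "v = w"
proof
  fix X
  show "v X = w X"
  proof (cases "X \<in> carrier (presented_group S R)")
    case True
    then obtain c where c: "Poly_Mapping.keys c \<subseteq> S" "X = NR #>\<^bsub>FS\<^esub> c" by (auto simp: presented_carrier)
    show ?thesis
      unfolding c(2) presented_dual_lin[OF v(1) c(1)] presented_dual_lin[OF v(2) c(1)]
      by (rule lin_cong) (use assms(3) c in auto)
  qed (use v in \<open>auto simp: real_dual_def\<close>)
qed

text \<open>Distinct cosets are disjoint, so \<open>\<phi> c\<close> determines the coset and the
  definite description in \<open>coset_map\<close> has a unique solution.\<close>

lemma coset_map_coset:
  assumes c: "Poly_Mapping.keys (\<phi> c) \<subseteq> S" "c \<in> X" and s: "\<phi> ` X \<subseteq> NR #>\<^bsub>FS\<^esub> \<phi> c"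
  shows "coset_map (presented_group S R) \<phi> X = NR #>\<^bsub>FS\<^esub> \<phi> c"
  unfolding coset_map_def
proof (rule the_equality)
  show "NR #>\<^bsub>FS\<^esub> \<phi> c \<in> carrier (presented_group S R) \<and> \<phi> ` X \<subseteq> NR #>\<^bsub>FS\<^esub> \<phi> c"
    using c s by (auto simp: presented_carrier)
  fix Y assume Y: "Y \<in> carrier (presented_group S R) \<and> \<phi> ` X \<subseteq> Y"
  then obtain d where d: "Poly_Mapping.keys d \<subseteq> S" "Y = NR #>\<^bsub>FS\<^esub> d" by (auto simp: presented_carrier)
  have "\<phi> c \<in> NR #>\<^bsub>FS\<^esub> d" using Y c d by blast
  then show "Y = NR #>\<^bsub>FS\<^esub> \<phi> c" using rel_coset_eq d by blast
qed

end

abbreviation K0N :: "('o, 'm, 'x) additive_data_scheme \<Rightarrow> ('o \<Rightarrow>\<^sub>0 int) set" where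
  "K0N A \<equiv> generate (free_Abelian_group (Ob A)) (K0_rels A)"

lemma K0_rels_iff: "r \<in> K0_rels A \<longleftrightarrow> (\<exists>a b c. ses A a b c \<and> r = frag_of b - frag_of a - frag_of c)"
proof
  assume "r \<in> K0_rels A"
  then obtain f g where "short_exact A f g" "r = frag_of (Cod A f) - frag_of (Dom A f) - frag_of (Cod A g)"
    by (auto simp: K0_rels_def)
  then show "\<exists>a b c. ses A a b c \<and> r = frag_of b - frag_of a - frag_of c"
    by (intro exI[of _ "Dom A f"] exI[of _ "Cod A f"] exI[of _ "Cod A g"]) (simp add: short_exact_ses)
next
  assume "\<exists>a b c. ses A a b c \<and> r = frag_of b - frag_of a - frag_of c"
  then obtain a b c f g where "short_exact A f g" "f \<in> Homs A a b" "g \<in> Homs A b c"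
    and r: "r = frag_of b - frag_of a - frag_of c" by (auto simp: ses_def)
  then show "r \<in> K0_rels A" unfolding K0_rels_def by (auto simp: Homs_def)
qed

lemma frag_rel_keys:
  "a \<in> S \<Longrightarrow> b \<in> S \<Longrightarrow> c \<in> S \<Longrightarrow> frag_of b - frag_of a - frag_of c \<in> carrier (free_Abelian_group S)"
  using keys_diff[of "frag_of b - frag_of a" "frag_of c"] keys_diff[of "frag_of b" "frag_of a"] by auto

context additive_category
begin

lemma K0_rels_carrier: "K0_rels C \<subseteq> carrier (free_Abelian_group (Ob C))"
proof
  fix r assume "r \<in> K0_rels C"
  then obtain a b c where "ses C a b c" and r: "r = frag_of b - frag_of a - frag_of c" by (auto simp: K0_rels_iff)
  then have "a \<in> Ob C" "b \<in> Ob C" "c \<in> Ob C" using Homs_Ob by (auto simp: ses_def)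
  then show "r \<in> carrier (free_Abelian_group (Ob C))" unfolding r by (intro frag_rel_keys)
qed

lemma K0_dual_ex:
  assumes "ses_additive C \<phi>"
  obtains v where "v \<in> real_dual (K0 C)" "\<And>x. x \<in> Ob C \<Longrightarrow> v (K0_class C x) = \<phi> x"
proof -
  have "lin \<phi> r = 0" if "r \<in> K0_rels C" for r
    using that assms by (auto simp: K0_rels_iff ses_additive_def)
  from presented_dual_ex[OF K0_rels_carrier this]
  obtain v where "v \<in> real_dual (presented_group (Ob C) (K0_rels C))"
    "\<And>c. Poly_Mapping.keys c \<subseteq> Ob C \<Longrightarrow> v (K0N C #>\<^bsub>free_Abelian_group (Ob C)\<^esub> c) = lin \<phi> c" by blast
  then show ?thesis using that by (simp add: K0_def K0_class_def)
qed

lemma K0_dual_lin: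
  assumes "v \<in> real_dual (K0 C)" "Poly_Mapping.keys c \<subseteq> Ob C"
  shows "v (K0N C #>\<^bsub>free_Abelian_group (Ob C)\<^esub> c) = lin (\<lambda>x. v (K0_class C x)) c"
  using presented_dual_lin[OF K0_rels_carrier] assms by (simp add: K0_def K0_class_def)

lemma K0_dual_additive: assumes "v \<in> real_dual (K0 C)" shows "ses_additive C (\<lambda>x. v (K0_class C x))"
  unfolding ses_additive_def
proof (intro allI impI)
  fix a b c assume "ses C a b c"
  then have r: "frag_of b - frag_of a - frag_of c \<in> K0_rels C" by (auto simp: K0_rels_iff)
  have "lin (\<lambda>x. v (K0_class C x)) (frag_of b - frag_of a - frag_of c) = 0"
    using presented_dual_rel[OF K0_rels_carrier assms[unfolded K0_def] r] unfolding K0_class_def .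
  then show "v (K0_class C b) = v (K0_class C a) + v (K0_class C c)" by simp
qed

lemma K0_dual_eqI:
  assumes "v \<in> real_dual (K0 C)" "w \<in> real_dual (K0 C)" "\<And>x. x \<in> Ob C \<Longrightarrow> v (K0_class C x) = w (K0_class C x)"
  shows "v = w"
  using presented_dual_eqI[OF K0_rels_carrier] assms by (simp add: K0_def K0_class_def)

lemma K0_carrier:
  assumes "X \<in> carrier (K0 C)"
  obtains c where "Poly_Mapping.keys c \<subseteq> Ob C" "X = K0N C #>\<^bsub>free_Abelian_group (Ob C)\<^esub> c"
  using assms unfolding K0_def presented_carrier[OF K0_rels_carrier] by blast

lemma K0_cosetI: "Poly_Mapping.keys c \<subseteq> Ob C \<Longrightarrow> K0N C #>\<^bsub>free_Abelian_group (Ob C)\<^esub> c \<in> carrier (K0 C)"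
  unfolding K0_def presented_carrier[OF K0_rels_carrier] by blast

end

lemma subspace_real_dual: "subspace (real_dual G)"
  unfolding subspace_def real_dual_def hom_real_group by (auto simp: scaleR_fun_def algebra_simps)

text \<open>The coordinate functions of an isomorphism with a free group. Their integrality is what
  produces integral functionals later on, and that they separate points makes the map from K(H) to
  K(D) injective.\<close>

lemma free_dual_basis:
  assumes "free_of_finite_rank G" "group G"
  obtains Bs where "finite Bs" "Bs \<subseteq> real_dual G" "\<And>\<beta> X. \<beta> \<in> Bs \<Longrightarrow> \<beta> X \<in> \<int>" "real_dual G \<subseteq> span Bs"
    "\<And>X Y. \<lbrakk>X \<in> carrier G; Y \<in> carrier G; \<And>\<beta>. \<beta> \<in> Bs \<Longrightarrow> \<beta> X = \<beta> Y\<rbrakk> \<Longrightarrow> X = Y"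
proof -
  obtain B :: "nat set" and i where B: "finite B" and i: "i \<in> iso G (free_Abelian_group B)"
    using assms(1) by (auto simp: free_of_finite_rank_def is_iso_def)
  have ih: "i \<in> hom G (free_Abelian_group B)" and ib: "bij_betw i (carrier G) (carrier (free_Abelian_group B))"
    using i by (auto simp: iso_def)
  define \<beta> where "\<beta> b X = (if X \<in> carrier G then real_of_int (Poly_Mapping.lookup (i X) b) else 0)" for b X
  have keys: "Poly_Mapping.keys (i X) \<subseteq> B" if "X \<in> carrier G" for X
    using hom_in_carrier[OF ih that] by simp
  have 1: "\<beta> b \<in> real_dual G" for b
    using ih group.is_monoid[OF assms(2), THEN monoid.m_closed]
    by (auto simp: real_dual_def hom_real_group \<beta>_def hom_mult[OF ih] Poly_Mapping.lookup_add)
  have 2: "v \<in> span (\<beta> ` B)" if v: "v \<in> real_dual G" for v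
  proof -
    define j where "j = inv_into (carrier G) i"
    have jc: "j c \<in> carrier G" "i (j c) = c" if "c \<in> carrier (free_Abelian_group B)" for c
      using bij_betw_inv_into_right[OF ib that] bij_betwE[OF bij_betw_inv_into[OF ib]] that by (auto simp: j_def)
    have "j \<in> iso (free_Abelian_group B) G" unfolding j_def by (rule group.iso_set_sym[OF assms(2) i])
    then have "j \<in> hom (free_Abelian_group B) G" by (simp add: iso_def)
    then have "(\<lambda>c. v (j c)) \<in> hom (free_Abelian_group B) real_group"
      using v jc(1) by (auto simp: real_dual_def hom_real_group hom_def)
    then have l: "v (j c) = lin (\<lambda>b. v (j (frag_of b))) c" if "Poly_Mapping.keys c \<subseteq> B" for c
      by (rule hom_eq_lin[OF _ that])
    have "v = (\<Sum>b \<in> B. v (j (frag_of b)) *\<^sub>R \<beta> b)"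
    proof
      fix X
      show "v X = (\<Sum>b \<in> B. v (j (frag_of b)) *\<^sub>R \<beta> b) X"
      proof (cases "X \<in> carrier G")
        case True
        have "j (i X) = X" using bij_betw_inv_into_left[OF ib True] by (simp add: j_def)
        then have "v X = (\<Sum>b \<in> B. of_int (Poly_Mapping.lookup (i X) b) * v (j (frag_of b)))"
          using l[OF keys[OF True]] lin_superset[OF B keys[OF True]] by simp
        then show ?thesis using True by (simp add: sum_fun_apply scaleR_fun_def \<beta>_def mult.commute)
      next
        case False
        then show ?thesis using v by (simp add: real_dual_def sum_fun_apply scaleR_fun_def \<beta>_def)
      qed
    qed
    also have "\<dots> \<in> span (\<beta> ` B)" by (intro span_sum span_scale span_base) auto
    finally show ?thesis .
  qed
  have 3: "X = Y" if X: "X \<in> carrier G" "Y \<in> carrier G" and e: "\<And>b. b \<in> B \<Longrightarrow> \<beta> b X = \<beta> b Y" for X Y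
  proof -
    have "Poly_Mapping.lookup (i X) b = Poly_Mapping.lookup (i Y) b" for b
    proof (cases "b \<in> B")
      case True
      then show ?thesis using e[OF True] X by (simp add: \<beta>_def)
    next
      case False
      then show ?thesis using keys[OF X(1)] keys[OF X(2)] by (metis in_keys_iff subsetD)
    qed
    then have "i X = i Y" by (rule poly_mapping_eqI)
    then show ?thesis using ib X by (auto simp: bij_betw_def inj_on_def)
  qed
  show ?thesis
  proof (rule that[of "\<beta> ` B"])
    show "X = Y" if "X \<in> carrier G" "Y \<in> carrier G" "\<And>\<beta>'. \<beta>' \<in> \<beta> ` B \<Longrightarrow> \<beta>' X = \<beta>' Y" for X Y
      by (rule 3[OF that(1,2)]) (use that(3) in blast)
  qed (use B 1 2 in \<open>auto simp: \<beta>_def\<close>)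
qed

section \<open>Functionals on K(H) evaluated at all objects of D\<close>

context bounded_t
begin

lemma tri_additive_Sh_pow: "tri_additive \<psi> \<Longrightarrow> x \<in> Ob D \<Longrightarrow> \<psi> ((Sh D ^^ n) x) = (- 1) ^ n * \<psi> x"
  by (induction n) (auto simp: tri_additive_Sh Sh_pow_Ob)

text \<open>Up to shift every object lies in the aisle, which is built from shifted objects of the
  heart; a shift only changes the sign.\<close>

lemma tri_additive_unique:
  assumes a: "tri_additive \<psi>" "tri_additive \<psi>'" and h: "\<And>h. h \<in> heart \<Longrightarrow> \<psi> h = \<psi>' h" and x: "x \<in> Ob D"
  shows "\<psi> x = \<psi>' x"
proof -
  obtain n where n: "(Sh D ^^ n) x \<in> U" using bound_above[OF x] .
  have "\<psi> y = \<psi>' y" if "y \<in> U" for y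
  proof (rule aisle_induct[OF that])
    show "zero_object D z \<Longrightarrow> \<psi> z = \<psi>' z" for z
      using tri_additive_zero[OF a(1)] tri_additive_zero[OF a(2)] by simp
    fix u y k assume s: "dtri D (Sh D u) y k" "u \<in> U" "k \<in> heart" "\<psi> u = \<psi>' u"
    show "\<psi> y = \<psi>' y"
      using tri_additiveD[OF a(1) s(1)] tri_additiveD[OF a(2) s(1)] tri_additive_Sh[OF a(1) U_Ob[OF s(2)]]
        tri_additive_Sh[OF a(2) U_Ob[OF s(2)]] h[OF s(3)] s(4) by simp
  qed
  from this[OF n] show ?thesis using tri_additive_Sh_pow[OF a(1) x] tri_additive_Sh_pow[OF a(2) x] by simp
qed

abbreviation W :: "(('o \<Rightarrow>\<^sub>0 int) set \<Rightarrow> real) set" where "W \<equiv> heart_dual D heart"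

text \<open>\<open>ev v x\<close> is the value of \<open>v\<close> on the class of \<open>x\<close> under \<open>K(D) = K(H)\<close>.\<close>

definition ev :: "(('o \<Rightarrow>\<^sub>0 int) set \<Rightarrow> real) \<Rightarrow> 'o \<Rightarrow> real" where
  "ev v = (SOME \<psi>. tri_additive \<psi> \<and> (\<forall>h \<in> heart. \<psi> h = v (K0_class A h)))"

lemma ev: assumes "v \<in> W" shows "tri_additive (ev v)" "\<And>h. h \<in> heart \<Longrightarrow> ev v h = v (K0_class A h)"
proof -
  have "ses_additive A (\<lambda>h. v (K0_class A h))"
    using additive_category.K0_dual_additive[OF heart_additive] assms by (simp add: heart_dual_def)
  then obtain \<psi> where "tri_additive \<psi>" "\<And>k. k \<in> heart \<Longrightarrow> \<psi> k = v (K0_class A k)" using extend_additive by blast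
  then have "\<exists>\<psi>. tri_additive \<psi> \<and> (\<forall>h \<in> heart. \<psi> h = v (K0_class A h))" by (intro exI[of _ \<psi>]) simp
  from someI_ex[OF this, folded ev_def]
  show "tri_additive (ev v)" "\<And>h. h \<in> heart \<Longrightarrow> ev v h = v (K0_class A h)" by blast+
qed

lemma ev_eq:
  assumes "v \<in> W" "tri_additive \<psi>" "\<And>h. h \<in> heart \<Longrightarrow> \<psi> h = v (K0_class A h)" "x \<in> Ob D"
  shows "ev v x = \<psi> x"
  by (rule tri_additive_unique[OF ev(1)[OF assms(1)] assms(2) _ assms(4)]) (simp add: ev(2)[OF assms(1)] assms(3))

lemma subspace_W: "subspace W"
  unfolding heart_dual_def by (rule subspace_real_dual)

lemma ev_add: assumes "v \<in> W" "w \<in> W" "x \<in> Ob D" shows "ev (v + w) x = ev v x + ev w x"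
  by (rule ev_eq[OF subspace_add[OF subspace_W assms(1,2)] _ _ assms(3)])
    (use ev[OF assms(1)] ev[OF assms(2)] in \<open>auto simp: tri_additive_def\<close>)

lemma ev_scale: assumes "v \<in> W" "x \<in> Ob D" shows "ev (c *\<^sub>R v) x = c * ev v x"
  by (rule ev_eq[OF subspace_scale[OF subspace_W assms(1)] _ _ assms(2)])
    (use ev[OF assms(1)] in \<open>auto simp: tri_additive_def scaleR_fun_def algebra_simps\<close>)

lemma W_of_tri_additive:
  assumes "tri_additive \<psi>" obtains v where "v \<in> W" "\<And>x. x \<in> Ob D \<Longrightarrow> ev v x = \<psi> x"
proof -
  have "ses_additive A \<psi>" using assms by (simp add: ses_additive_def ses_iff tri_additive_def)
  from additive_category.K0_dual_ex[OF heart_additive this]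
  obtain v where v: "v \<in> real_dual (K0 A)" "\<And>x. x \<in> Ob A \<Longrightarrow> v (K0_class A x) = \<psi> x" by blast
  then have vW: "v \<in> W" by (simp add: heart_dual_def)
  have "ev v x = \<psi> x" if "x \<in> Ob D" for x
    by (rule ev_eq[OF vW assms _ that]) (use v in auto)
  then show ?thesis using that vW by blast
qed

lemma W_eqI: assumes "v \<in> W" "w \<in> W" "\<And>h. h \<in> heart \<Longrightarrow> ev v h = ev w h" shows "v = w"
  by (rule additive_category.K0_dual_eqI[OF heart_additive])
    (use assms ev(2) in \<open>auto simp: heart_dual_def\<close>)

end

context triangulated_category
begin

abbreviation "tri_rels \<equiv> {frag_of (Cod D f) - frag_of (Dom D f) - frag_of (Cod D g) | f g h. (f, g, h) \<in> Tri D}"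

lemma tri_rels_iff: "r \<in> tri_rels \<longleftrightarrow> (\<exists>a b c. dtri D a b c \<and> r = frag_of b - frag_of a - frag_of c)"
proof
  assume "\<exists>a b c. dtri D a b c \<and> r = frag_of b - frag_of a - frag_of c"
  then obtain a b c f g h where "tria D a b c f g h" and r: "r = frag_of b - frag_of a - frag_of c"
    by (auto simp: dtri_def)
  then have "(f, g, h) \<in> Tri D" "Dom D f = a" "Cod D f = b" "Cod D g = c" by (auto simp: tria_def Homs_def)
  then show "r \<in> tri_rels" unfolding r by blast
qed (use dtri_Tri in blast)

lemma tri_rels_carrier: "tri_rels \<subseteq> carrier (free_Abelian_group (Ob D))"
proof
  fix r assume "r \<in> tri_rels"
  then obtain a b c where "dtri D a b c" and r: "r = frag_of b - frag_of a - frag_of c"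
    unfolding tri_rels_iff by blast
  then show "r \<in> carrier (free_Abelian_group (Ob D))" unfolding r by (intro frag_rel_keys) (use dtri_Ob in blast)+
qed

abbreviation "ND \<equiv> generate (free_Abelian_group (Ob D)) tri_rels"

lemma dtri_rel: "dtri D a b c \<Longrightarrow> frag_of b - frag_of a - frag_of c \<in> ND"
  by (rule rel_closed(1)[OF tri_rels_carrier]) (use tri_rels_iff in blast)

lemma lin_tri_coset:
  assumes "tri_additive \<psi>" "d \<in> ND #>\<^bsub>free_Abelian_group (Ob D)\<^esub> c" shows "lin \<psi> d = lin \<psi> c"
proof (rule lin_coset[OF tri_rels_carrier _ assms(2)])
  fix r assume "r \<in> tri_rels"
  then obtain a b c where "dtri D a b c" and r: "r = frag_of b - frag_of a - frag_of c"
    unfolding tri_rels_iff by blast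
  then show "lin \<psi> r = 0" using tri_additiveD[OF assms(1)] by simp
qed

end

context bounded_t
begin

lemma heart_to_K0_tri:
  assumes "Poly_Mapping.keys c \<subseteq> heart"
  shows "coset_map (K0_tri D) id (K0N A #>\<^bsub>free_Abelian_group heart\<^esub> c) = ND #>\<^bsub>free_Abelian_group (Ob D)\<^esub> c"
proof -
  have sub: "n \<in> ND" if "n \<in> generate (free_Abelian_group heart) (K0_rels A)" for n
    using that
  proof (induction rule: generate.induct)
    case one
    then show ?case using subgroup.one_closed[OF rel_subgroup[OF tri_rels_carrier]] by simp
  next
    case (incl r)
    then show ?case using dtri_rel by (auto simp: K0_rels_iff ses_iff)
  next
    case (inv r)
    then have "r \<in> ND" using dtri_rel by (auto simp: K0_rels_iff ses_iff)
    moreover have "Poly_Mapping.keys r \<subseteq> heart"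
      using subsetD[OF additive_category.K0_rels_carrier[OF heart_additive] inv] by simp
    ultimately have r: "r \<in> ND" "Poly_Mapping.keys r \<subseteq> heart" by auto
    then show ?case
      using rel_closed(2)[OF tri_rels_carrier subgroup.one_closed[OF rel_subgroup[OF tri_rels_carrier]] r(1)]
      by simp
  next
    case (eng a b)
    then show ?case using subgroup.m_closed[OF rel_subgroup[OF tri_rels_carrier], of a b] by simp
  qed
  have c': "Poly_Mapping.keys c \<subseteq> Ob D" using assms heart_Ob by blast
  note co = rel_coset[OF additive_category.K0_rels_carrier[OF heart_additive], unfolded full_subcat_simps]
  have 1: "c \<in> K0N A #>\<^bsub>free_Abelian_group heart\<^esub> c"
    using rel_coset_self[OF additive_category.K0_rels_carrier[OF heart_additive], of c] by simp
  have 2: "K0N A #>\<^bsub>free_Abelian_group heart\<^esub> c \<subseteq> ND #>\<^bsub>free_Abelian_group (Ob D)\<^esub> c"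
    unfolding rel_coset[OF tri_rels_carrier] full_subcat_simps co using sub by blast
  show ?thesis
    using coset_map_coset[OF tri_rels_carrier, of id c, OF _ 1] c' 2 by (simp add: K0_tri_def)
qed

lemma dtri_heart_coset:
  assumes "dtri D (Sh D f) k t" "f \<in> Ob D"
  shows "ND #>\<^bsub>free_Abelian_group (Ob D)\<^esub> frag_of k = ND #>\<^bsub>free_Abelian_group (Ob D)\<^esub> (frag_of t - frag_of f)"
proof (rule rel_coset_eqI[OF tri_rels_carrier])
  obtain z where z: "zero_object D z" "z \<in> Ob D" by (rule ex_zero)
  have "dtri D f z (Sh D f)" by (rule dtri_rotate[OF dtri_ident[OF assms(2) z(1)]])
  then have r2: "frag_of z - frag_of f - frag_of (Sh D f) \<in> ND" by (rule dtri_rel)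
  have r3: "frag_of z - frag_of z - frag_of z \<in> ND" by (rule dtri_rel[OF dtri_ident[OF z(2,1)]])
  \<comment> \<open>The triangle on \<open>f\<close>, \<open>z\<close>, \<open>f[1]\<close>
    eliminates the class of \<open>f[1]\<close> but leaves that of the zero object \<open>z\<close>,
    which the triangle on \<open>z\<close> alone cancels.\<close>
  have e: "frag_of k - (frag_of t - frag_of f) =
      frag_of k - frag_of (Sh D f) - frag_of t - (frag_of z - frag_of f - frag_of (Sh D f)) - (frag_of z - frag_of z - frag_of z)"
    by simp
  show "frag_of k - (frag_of t - frag_of f) \<in> ND"
    unfolding e by (intro rel_closed(2)[OF tri_rels_carrier] dtri_rel[OF assms(1)] r2 r3)
  show "Poly_Mapping.keys (frag_of t - frag_of f) \<subseteq> Ob D"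
    using keys_diff[of "frag_of t" "frag_of f"] assms dtri_Ob by auto
qed

end

locale free_heart = bounded_t +
  assumes free: "free_of_finite_rank (K0 (full_subcat D (U \<inter> V)))"
begin

lemma K0_group: "group (K0 A)"
  unfolding K0_def presented_group_def
  by (rule normal.factorgroup_is_group[OF rel_normal[OF additive_category.K0_rels_carrier[OF heart_additive]]])

lemma K0_separated:
  assumes "X \<in> carrier (K0 A)" "Y \<in> carrier (K0 A)" "\<And>v. v \<in> W \<Longrightarrow> v X = v Y" shows "X = Y"
  using free_dual_basis[OF free K0_group] assms unfolding heart_dual_def by (metis subsetD)

end

text \<open>Hypothesis \<open>K0_sep\<close> says that the real-valued homomorphisms separate the points of \<open>K(H)\<close>;
  it makes the map to \<open>K(D)\<close> injective.\<close>

locale separated_heart = bounded_t +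
  assumes K0_sep: "\<And>X Y. \<lbrakk>X \<in> carrier (K0 (full_subcat D (U \<inter> V))); Y \<in> carrier (K0 (full_subcat D (U \<inter> V)));
    \<And>v. v \<in> real_dual (K0 (full_subcat D (U \<inter> V))) \<Longrightarrow> v X = v Y\<rbrakk> \<Longrightarrow> X = Y"
begin

text \<open>Every functional on K(H) extends to D, so it takes equal values on elements that become
  equal in K(D); by \<open>K0_sep\<close> such elements coincide.\<close>

lemma K0_tri_inj: "inj_on (coset_map (K0_tri D) id) (carrier (K0 A))"
proof (rule inj_onI)
  fix X Y assume X: "X \<in> carrier (K0 A)" and Y: "Y \<in> carrier (K0 A)"
    and e: "coset_map (K0_tri D) id X = coset_map (K0_tri D) id Y"
  obtain c where c: "Poly_Mapping.keys c \<subseteq> heart" "X = K0N A #>\<^bsub>free_Abelian_group heart\<^esub> c"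
    using additive_category.K0_carrier[OF heart_additive X] by auto
  obtain d where d: "Poly_Mapping.keys d \<subseteq> heart" "Y = K0N A #>\<^bsub>free_Abelian_group heart\<^esub> d"
    using additive_category.K0_carrier[OF heart_additive Y] by auto
  have "ND #>\<^bsub>free_Abelian_group (Ob D)\<^esub> c = ND #>\<^bsub>free_Abelian_group (Ob D)\<^esub> d"
    using e c d heart_to_K0_tri by simp
  then have dc: "d \<in> ND #>\<^bsub>free_Abelian_group (Ob D)\<^esub> c"
    using rel_coset_self[OF tri_rels_carrier] by simp
  show "X = Y"
  proof (rule K0_sep[OF X Y])
    fix v assume v: "v \<in> real_dual (K0 A)"
    then have vW: "v \<in> W" by (simp add: heart_dual_def)
    have l: "v (K0N A #>\<^bsub>free_Abelian_group heart\<^esub> c) = lin (ev v) c" if "Poly_Mapping.keys c \<subseteq> heart" for c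
    proof -
      have "v (K0N A #>\<^bsub>free_Abelian_group heart\<^esub> c) = lin (\<lambda>x. v (K0_class A x)) c"
        using additive_category.K0_dual_lin[OF heart_additive v, of c] that by simp
      also have "\<dots> = lin (ev v) c"
        by (rule lin_cong, rule ev(2)[OF vW, symmetric]) (use that in blast)
      finally show ?thesis .
    qed
    show "v X = v Y"
      using lin_tri_coset[OF ev(1)[OF vW] dc] l c d by simp
  qed
qed

text \<open>The triangle exhibits [\<open>t\<close>] - [\<open>f\<close>] as a preimage of the class
  of \<open>k\<close>, and injectivity forces the inverse function to return it. After this, cosets
  can be replaced by \<open>ev\<close>.\<close>

lemma heart_ident_class:
  assumes K: "bounded_heart D K" "k \<in> K" and t: "dtri D (Sh D f) k t" "f \<in> heart" "t \<in> heart" and v: "v \<in> W"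
  shows "v (heart_ident D heart (K0_class (full_subcat D K) k)) = ev v k"
proof -
  obtain U' V' where B: "bounded_t_structure D U' V'" and K': "K = U' \<inter> V'" using K by (auto simp: bounded_heart_def)
  interpret B: bounded_t D U' V' by unfold_locales (rule B)
  have keys: "Poly_Mapping.keys (frag_of t - frag_of f) \<subseteq> heart"
    using keys_diff[of "frag_of t" "frag_of f"] t by auto
  let ?X = "K0N A #>\<^bsub>free_Abelian_group heart\<^esub> (frag_of t - frag_of f)"
  have X: "?X \<in> carrier (K0 A)" using additive_category.K0_cosetI[OF heart_additive] keys by simp
  have "coset_map (K0_tri D) id (K0_class (full_subcat D K) k) = ND #>\<^bsub>free_Abelian_group (Ob D)\<^esub> frag_of k"
    using B.heart_to_K0_tri[of "frag_of k"] K K' by (simp add: K0_class_def)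
  also have "\<dots> = coset_map (K0_tri D) id ?X"
    using dtri_heart_coset[OF t(1) heart_Ob[OF t(2)]] heart_to_K0_tri[OF keys] by simp
  finally have "heart_ident D heart (K0_class (full_subcat D K) k) = ?X"
    unfolding heart_ident_def using inv_into_f_f[OF K0_tri_inj X] by simp
  moreover have "v ?X = lin (\<lambda>x. v (K0_class A x)) (frag_of t - frag_of f)"
    using additive_category.K0_dual_lin[OF heart_additive, of v "frag_of t - frag_of f"] v keys
    by (simp add: heart_dual_def)
  moreover have "ev v k = ev v t - ev v f"
    using tri_additiveD[OF ev(1)[OF v] t(1)] tri_additive_Sh[OF ev(1)[OF v] heart_Ob[OF t(2)]] by simp
  ultimately show ?thesis using ev(2)[OF v] t by simp
qed

lemma heart_cone_eq:
  assumes K: "K \<in> intermediate_hearts D heart"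
  shows "heart_cone D heart K = {v \<in> W. \<forall>k \<in> K. 0 \<le> ev v k}"
proof -
  have b: "bounded_heart D K" using K by (simp add: intermediate_hearts_def)
  have "v (heart_ident D heart (K0_class (full_subcat D K) k)) = ev v k" if v: "v \<in> W" and k: "k \<in> K" for v k
  proof -
    obtain f t where "f \<in> perp A (heart \<inter> K)" "t \<in> heart \<inter> K" "dtri D (Sh D f) k t"
      using intermediate_torsion(3)[OF K] k by blast
    then show ?thesis using heart_ident_class[OF b k _ _ _ v] by (auto simp: perp_def)
  qed
  then show ?thesis by (auto simp: heart_cone_def)
qed

lemma heart_cone_torsion:
  assumes K: "K \<in> intermediate_hearts D heart"
  shows "heart_cone D heart K = {v \<in> W. (\<forall>t \<in> heart \<inter> K. 0 \<le> ev v t) \<and> (\<forall>f \<in> perp A (heart \<inter> K). ev v f \<le> 0)}"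
  unfolding heart_cone_eq[OF K]
proof (intro Collect_cong conj_cong refl iffI conjI ballI)
  fix v f assume v: "v \<in> W" and a: "\<forall>k \<in> K. 0 \<le> ev v k" "f \<in> perp A (heart \<inter> K)"
  then show "ev v f \<le> 0"
    using intermediate_torsion(2)[OF K] tri_additive_Sh[OF ev(1)[OF v]] heart_Ob by fastforce
next
  fix v k assume v: "v \<in> W" and k: "k \<in> K"
    and a: "(\<forall>t \<in> heart \<inter> K. 0 \<le> ev v t) \<and> (\<forall>f \<in> perp A (heart \<inter> K). ev v f \<le> 0)"
  obtain f t where ft: "f \<in> perp A (heart \<inter> K)" "t \<in> heart \<inter> K" "dtri D (Sh D f) k t"
    using intermediate_torsion(3)[OF K] k by blast
  have "f \<in> Ob D" using ft heart_Ob by (auto simp: perp_def)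
  then have "ev v k = ev v t - ev v f"
    using tri_additiveD[OF ev(1)[OF v] ft(3)] tri_additive_Sh[OF ev(1)[OF v]] by simp
  then show "0 \<le> ev v k" using a ft by force
qed auto

end

sublocale free_heart \<subseteq> separated_heart D U V
  by unfold_locales (use K0_separated in \<open>auto simp: heart_dual_def\<close>)

section \<open>Independence of the ambient category\<close>

lemma is_kernel_iff:
  assumes C: "category C" and f: "f \<in> Homs C b c" and k: "k \<in> Homs C a b"
  shows "is_kernel C k f \<longleftrightarrow> f \<cdot>\<^bsub>C\<^esub> k = Zer C a c \<and>
    (\<forall>w \<in> Ob C. \<forall>t \<in> Homs C w b. f \<cdot>\<^bsub>C\<^esub> t = Zer C w c \<longrightarrow> (\<exists>!s. s \<in> Homs C w a \<and> k \<cdot>\<^bsub>C\<^esub> s = t))"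
proof -
  have d: "Dom C f = b" "Cod C f = c" "f \<in> Arr C" "Dom C k = a" "Cod C k = b" "k \<in> Arr C"
    using f k by (auto simp: Homs_def)
  have "(\<forall>w. \<forall>t \<in> Homs C w b. P w t) \<longleftrightarrow> (\<forall>w \<in> Ob C. \<forall>t \<in> Homs C w b. P w t)" for P
    using category.Homs_Ob[OF C] by blast
  then show ?thesis unfolding is_kernel_def by (simp add: d)
qed

lemma is_cokernel_iff:
  assumes C: "category C" and f: "f \<in> Homs C a b" and g: "g \<in> Homs C b c"
  shows "is_cokernel C g f \<longleftrightarrow> g \<cdot>\<^bsub>C\<^esub> f = Zer C a c \<and>
    (\<forall>w \<in> Ob C. \<forall>t \<in> Homs C b w. t \<cdot>\<^bsub>C\<^esub> f = Zer C a w \<longrightarrow> (\<exists>!s. s \<in> Homs C c w \<and> s \<cdot>\<^bsub>C\<^esub> g = t))"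
proof -
  have d: "Dom C f = a" "Cod C f = b" "f \<in> Arr C" "Dom C g = b" "Cod C g = c" "g \<in> Arr C"
    using f g by (auto simp: Homs_def)
  have "(\<forall>w. \<forall>t \<in> Homs C b w. P w t) \<longleftrightarrow> (\<forall>w \<in> Ob C. \<forall>t \<in> Homs C b w. P w t)" for P
    using category.Homs_Ob[OF C] by blast
  then show ?thesis unfolding is_cokernel_def by (simp add: d)
qed

locale additive_equivalence = A: additive_category A + B: additive_category B
  for A :: "('o, 'm, 'x) additive_data_scheme" and B :: "('p, 'n, 'y) additive_data_scheme" +
  fixes Fo :: "'o \<Rightarrow> 'p" and Fm :: "'m \<Rightarrow> 'n"
  assumes equivalence: "is_equivalence A B Fo Fm"
begin

lemma Fo_Ob: "x \<in> Ob A \<Longrightarrow> Fo x \<in> Ob B"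
  using equivalence by (simp add: is_equivalence_def is_functor_def)

lemma Fm_in: "f \<in> Homs A x y \<Longrightarrow> Fm f \<in> Homs B (Fo x) (Fo y)"
  using equivalence by (simp add: is_equivalence_def is_functor_def)

lemma Fm_cmp: "f \<in> Homs A x y \<Longrightarrow> g \<in> Homs A y z \<Longrightarrow> Fm (g \<cdot>\<^bsub>A\<^esub> f) = Fm g \<cdot>\<^bsub>B\<^esub> Fm f"
  using equivalence by (simp add: is_equivalence_def is_functor_def)

lemma Fm_bij: "x \<in> Ob A \<Longrightarrow> y \<in> Ob A \<Longrightarrow> bij_betw Fm (Homs A x y) (Homs B (Fo x) (Fo y))"
  using equivalence by (simp add: is_equivalence_def)

lemma Fm_full:
  assumes "x \<in> Ob A" "y \<in> Ob A" "g \<in> Homs B (Fo x) (Fo y)"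
  obtains f where "f \<in> Homs A x y" "Fm f = g"
proof -
  have "g \<in> Fm ` Homs A x y" using bij_betw_imp_surj_on[OF Fm_bij[OF assms(1,2)]] assms(3) by simp
  then show ?thesis using that by (elim imageE) simp
qed

lemma Fm_faithful: assumes "f \<in> Homs A x y" "g \<in> Homs A x y" "Fm f = Fm g" shows "f = g"
proof -
  have "inj_on Fm (Homs A x y)" using bij_betw_imp_inj_on[OF Fm_bij] A.Homs_Ob[OF assms(1)] by blast
  then show ?thesis using assms by (simp add: inj_on_def)
qed

lemma ess_surj: assumes "y \<in> Ob B" obtains x where "x \<in> Ob A" "isomorphic B (Fo x) y"
  using equivalence assms by (auto simp: is_equivalence_def)

lemma hom0_Fo: assumes "x \<in> Ob A" "y \<in> Ob A" shows "hom0 B (Fo x) (Fo y) \<longleftrightarrow> hom0 A x y"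
proof
  assume h: "hom0 B (Fo x) (Fo y)"
  show "hom0 A x y"
  proof (rule A.hom0I[OF assms])
    fix f assume f: "f \<in> Homs A x y"
    have z: "Zer A x y \<in> Homs A x y" by (rule A.zer_in[OF assms])
    show "f = Zer A x y"
      by (rule Fm_faithful[OF f z]) (use B.hom0D[OF h Fm_in[OF f]] B.hom0D[OF h Fm_in[OF z]] in simp)
  qed
next
  assume h: "hom0 A x y"
  have "f = g" if fg: "f \<in> Homs B (Fo x) (Fo y)" "g \<in> Homs B (Fo x) (Fo y)" for f g
  proof -
    obtain f' where f': "f' \<in> Homs A x y" "Fm f' = f" using Fm_full[OF assms fg(1)] .
    obtain g' where g': "g' \<in> Homs A x y" "Fm g' = g" using Fm_full[OF assms fg(2)] .
    show ?thesis using A.hom0D[OF h f'(1)] A.hom0D[OF h g'(1)] f' g' by simp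
  qed
  then show "hom0 B (Fo x) (Fo y)"
    by (intro B.hom0I Fo_Ob assms) (simp add: B.zer_in Fo_Ob assms)
qed

text \<open>An equivalence is given without additivity, so zero arrows must be recognised
  categorically: they factor through a zero object, and \<open>Fm\<close> is bijective on the
  one-element Hom sets involved.\<close>

lemma Fm_Zer: assumes "x \<in> Ob A" "y \<in> Ob A" shows "Fm (Zer A x y) = Zer B (Fo x) (Fo y)"
proof -
  obtain z where z: "zero_object A z" using A.zero_object_ex by blast
  have zo: "z \<in> Ob A" using z by (simp add: zero_object_def)
  have xz: "Zer A x z \<in> Homs A x z" and zy: "Zer A z y \<in> Homs A z y" using A.zer_in assms zo by auto
  have "hom0 B (Fo x) (Fo z)" using hom0_Fo[OF assms(1) zo] A.zero_hom0[OF z assms(1)] by simp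
  then have "Fm (Zer A x z) = Zer B (Fo x) (Fo z)" using B.hom0D Fm_in[OF xz] by blast
  moreover have "Zer A x y = Zer A z y \<cdot>\<^bsub>A\<^esub> Zer A x z" using A.cmp_zer[OF zy assms(1)] by simp
  ultimately show ?thesis using Fm_cmp[OF xz zy] B.cmp_zer[OF Fm_in[OF zy] Fo_Ob[OF assms(1)]] by simp
qed

lemma Fm_cmp_zero_iff:
  assumes "f \<in> Homs A x y" "g \<in> Homs A y z"
  shows "Fm g \<cdot>\<^bsub>B\<^esub> Fm f = Zer B (Fo x) (Fo z) \<longleftrightarrow> g \<cdot>\<^bsub>A\<^esub> f = Zer A x z"
proof -
  have o: "x \<in> Ob A" "z \<in> Ob A" using A.Homs_Ob assms by blast+
  show ?thesis
    using Fm_cmp[OF assms] Fm_Zer[OF o] Fm_faithful[OF A.cmp_in[OF assms] A.zer_in[OF o]] by metis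
qed

lemma kernel_Fm:
  assumes "f \<in> Homs A b c" "k \<in> Homs A a b"
  shows "is_kernel B (Fm k) (Fm f) \<longleftrightarrow> is_kernel A k f"
proof
  have o: "a \<in> Ob A" "b \<in> Ob A" "c \<in> Ob A" using A.Homs_Ob assms by blast+
  note iff = is_kernel_iff[OF A.category_axioms assms] is_kernel_iff[OF B.category_axioms Fm_in[OF assms(1)] Fm_in[OF assms(2)]]
  {
    assume k: "is_kernel B (Fm k) (Fm f)"
    show "is_kernel A k f"
      unfolding iff(1)
    proof (intro conjI ballI impI)
      show "f \<cdot>\<^bsub>A\<^esub> k = Zer A a c" using k Fm_cmp_zero_iff[OF assms(2,1)] by (simp add: iff(2))
      fix w t assume w: "w \<in> Ob A" and t: "t \<in> Homs A w b" "f \<cdot>\<^bsub>A\<^esub> t = Zer A w c"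
      have "Fm f \<cdot>\<^bsub>B\<^esub> Fm t = Zer B (Fo w) (Fo c)" using Fm_cmp_zero_iff[OF t(1) assms(1)] t(2) by simp
      then have u: "\<exists>!s. s \<in> Homs B (Fo w) (Fo a) \<and> Fm k \<cdot>\<^bsub>B\<^esub> s = Fm t"
        using k Fo_Ob[OF w] Fm_in[OF t(1)] by (simp add: iff(2))
      then obtain s' where s': "s' \<in> Homs B (Fo w) (Fo a)" "Fm k \<cdot>\<^bsub>B\<^esub> s' = Fm t" by blast
      obtain s where s: "s \<in> Homs A w a" "Fm s = s'" using Fm_full[OF w o(1) s'(1)] .
      show "\<exists>!s. s \<in> Homs A w a \<and> k \<cdot>\<^bsub>A\<^esub> s = t"
      proof (rule ex1I[of _ s])
        have "Fm (k \<cdot>\<^bsub>A\<^esub> s) = Fm t" using Fm_cmp[OF s(1) assms(2)] s s' by simp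
        then show "s \<in> Homs A w a \<and> k \<cdot>\<^bsub>A\<^esub> s = t" using Fm_faithful[OF A.cmp_in[OF s(1) assms(2)] t(1)] s by simp
        fix r assume r: "r \<in> Homs A w a \<and> k \<cdot>\<^bsub>A\<^esub> r = t"
        then have "Fm r \<in> Homs B (Fo w) (Fo a) \<and> Fm k \<cdot>\<^bsub>B\<^esub> Fm r = Fm t" using Fm_in Fm_cmp[OF _ assms(2)] by metis
        then have "Fm r = Fm s" using u s s' by blast
        then show "r = s" using Fm_faithful[of r w a s] r s by simp
      qed
    qed
  }
  {
    assume k: "is_kernel A k f"
    show "is_kernel B (Fm k) (Fm f)"
      unfolding iff(2)
    proof (intro conjI ballI impI)
      show "Fm f \<cdot>\<^bsub>B\<^esub> Fm k = Zer B (Fo a) (Fo c)" using k Fm_cmp_zero_iff[OF assms(2,1)] by (simp add: iff(1))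
      fix w' t' assume w': "w' \<in> Ob B" and t': "t' \<in> Homs B w' (Fo b)" "Fm f \<cdot>\<^bsub>B\<^esub> t' = Zer B w' (Fo c)"
      \<comment> \<open>A test object of \<open>B\<close> need not be a value of \<open>Fo\<close>.
        It is exchanged for an isomorphic one that is, and the factorisation is carried back along
        \<open>j\<close>.\<close>
      obtain w where w: "w \<in> Ob A" "isomorphic B (Fo w) w'" using ess_surj[OF w'] .
      obtain i j where i: "i \<in> Homs B (Fo w) w'" "j \<in> Homs B w' (Fo w)" "j \<cdot>\<^bsub>B\<^esub> i = Ident B (Fo w)" "i \<cdot>\<^bsub>B\<^esub> j = Ident B w'"
        using w(2) by (rule B.isomorphicE)
      obtain t where t: "t \<in> Homs A w b" "Fm t = t' \<cdot>\<^bsub>B\<^esub> i" using Fm_full[OF w(1) o(2) B.cmp_in[OF i(1) t'(1)]] .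
      have "Fm f \<cdot>\<^bsub>B\<^esub> Fm t = Zer B (Fo w) (Fo c)"
        using B.cmp_assoc[OF i(1) t'(1) Fm_in[OF assms(1)]] t'(2) t(2) B.zer_cmp[OF i(1) Fo_Ob[OF o(3)]] by simp
      then have u: "\<exists>!s. s \<in> Homs A w a \<and> k \<cdot>\<^bsub>A\<^esub> s = t"
        using k w(1) t(1) Fm_cmp_zero_iff[OF t(1) assms(1)] by (simp add: iff(1))
      then obtain s where s: "s \<in> Homs A w a" "k \<cdot>\<^bsub>A\<^esub> s = t" by blast
      show "\<exists>!s. s \<in> Homs B w' (Fo a) \<and> Fm k \<cdot>\<^bsub>B\<^esub> s = t'"
      proof (rule ex1I[of _ "Fm s \<cdot>\<^bsub>B\<^esub> j"], rule conjI)
        show "Fm s \<cdot>\<^bsub>B\<^esub> j \<in> Homs B w' (Fo a)" by (rule B.cmp_in[OF i(2) Fm_in[OF s(1)]])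
        have "Fm k \<cdot>\<^bsub>B\<^esub> (Fm s \<cdot>\<^bsub>B\<^esub> j) = t' \<cdot>\<^bsub>B\<^esub> i \<cdot>\<^bsub>B\<^esub> j"
          using B.cmp_assoc[OF i(2) Fm_in[OF s(1)] Fm_in[OF assms(2)]] Fm_cmp[OF s(1) assms(2)] s t by simp
        then show "Fm k \<cdot>\<^bsub>B\<^esub> (Fm s \<cdot>\<^bsub>B\<^esub> j) = t'"
          using B.cmp_assoc[OF i(2,1) t'(1)] i(4) B.cmp_ident_right[OF t'(1)] by simp
        fix r' assume r': "r' \<in> Homs B w' (Fo a) \<and> Fm k \<cdot>\<^bsub>B\<^esub> r' = t'"
        obtain r where r: "r \<in> Homs A w a" "Fm r = r' \<cdot>\<^bsub>B\<^esub> i" using Fm_full[OF w(1) o(1) B.cmp_in[OF i(1)]] r' by blast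
        have "Fm (k \<cdot>\<^bsub>A\<^esub> r) = Fm t"
          using Fm_cmp[OF r(1) assms(2)] r(2) B.cmp_assoc[OF i(1) _ Fm_in[OF assms(2)], of r'] r' t(2) by simp
        then have "k \<cdot>\<^bsub>A\<^esub> r = t" by (rule Fm_faithful[OF A.cmp_in[OF r(1) assms(2)] t(1)])
        then have "r = s" using u r(1) s by blast
        then have "Fm s \<cdot>\<^bsub>B\<^esub> j = r' \<cdot>\<^bsub>B\<^esub> i \<cdot>\<^bsub>B\<^esub> j" using r by simp
        then show "r' = Fm s \<cdot>\<^bsub>B\<^esub> j"
          using B.cmp_assoc[OF i(2,1), of r' "Fo a"] i(4) B.cmp_ident_right[of r' w' "Fo a"] r' by simp
      qed
    qed
  }
qed

lemma cokernel_Fm: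
  assumes "f \<in> Homs A a b" "g \<in> Homs A b c"
  shows "is_cokernel B (Fm g) (Fm f) \<longleftrightarrow> is_cokernel A g f"
proof
  have o: "a \<in> Ob A" "b \<in> Ob A" "c \<in> Ob A" using A.Homs_Ob assms by blast+
  note iff = is_cokernel_iff[OF A.category_axioms assms] is_cokernel_iff[OF B.category_axioms Fm_in[OF assms(1)] Fm_in[OF assms(2)]]
  {
    assume k: "is_cokernel B (Fm g) (Fm f)"
    show "is_cokernel A g f"
      unfolding iff(1)
    proof (intro conjI ballI impI)
      show "g \<cdot>\<^bsub>A\<^esub> f = Zer A a c" using k Fm_cmp_zero_iff[OF assms] by (simp add: iff(2))
      fix w t assume w: "w \<in> Ob A" and t: "t \<in> Homs A b w" "t \<cdot>\<^bsub>A\<^esub> f = Zer A a w"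
      have "Fm t \<cdot>\<^bsub>B\<^esub> Fm f = Zer B (Fo a) (Fo w)" using Fm_cmp_zero_iff[OF assms(1) t(1)] t(2) by simp
      then have u: "\<exists>!s. s \<in> Homs B (Fo c) (Fo w) \<and> s \<cdot>\<^bsub>B\<^esub> Fm g = Fm t"
        using k Fo_Ob[OF w] Fm_in[OF t(1)] by (simp add: iff(2))
      then obtain s' where s': "s' \<in> Homs B (Fo c) (Fo w)" "s' \<cdot>\<^bsub>B\<^esub> Fm g = Fm t" by blast
      obtain s where s: "s \<in> Homs A c w" "Fm s = s'" using Fm_full[OF o(3) w s'(1)] .
      show "\<exists>!s. s \<in> Homs A c w \<and> s \<cdot>\<^bsub>A\<^esub> g = t"
      proof (rule ex1I[of _ s])
        have "Fm (s \<cdot>\<^bsub>A\<^esub> g) = Fm t" using Fm_cmp[OF assms(2) s(1)] s s' by simp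
        then show "s \<in> Homs A c w \<and> s \<cdot>\<^bsub>A\<^esub> g = t" using Fm_faithful[OF A.cmp_in[OF assms(2) s(1)] t(1)] s by simp
        fix r assume r: "r \<in> Homs A c w \<and> r \<cdot>\<^bsub>A\<^esub> g = t"
        then have "Fm r \<in> Homs B (Fo c) (Fo w) \<and> Fm r \<cdot>\<^bsub>B\<^esub> Fm g = Fm t" using Fm_in Fm_cmp[OF assms(2)] by metis
        then have "Fm r = Fm s" using u s s' by blast
        then show "r = s" using Fm_faithful[of r c w s] r s by simp
      qed
    qed
  }
  {
    assume k: "is_cokernel A g f"
    show "is_cokernel B (Fm g) (Fm f)"
      unfolding iff(2)
    proof (intro conjI ballI impI)
      show "Fm g \<cdot>\<^bsub>B\<^esub> Fm f = Zer B (Fo a) (Fo c)" using k Fm_cmp_zero_iff[OF assms] by (simp add: iff(1))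
      fix w' t' assume w': "w' \<in> Ob B" and t': "t' \<in> Homs B (Fo b) w'" "t' \<cdot>\<^bsub>B\<^esub> Fm f = Zer B (Fo a) w'"
      obtain w where w: "w \<in> Ob A" "isomorphic B (Fo w) w'" using ess_surj[OF w'] .
      obtain i j where i: "i \<in> Homs B (Fo w) w'" "j \<in> Homs B w' (Fo w)" "j \<cdot>\<^bsub>B\<^esub> i = Ident B (Fo w)" "i \<cdot>\<^bsub>B\<^esub> j = Ident B w'"
        using w(2) by (rule B.isomorphicE)
      obtain t where t: "t \<in> Homs A b w" "Fm t = j \<cdot>\<^bsub>B\<^esub> t'" using Fm_full[OF o(2) w(1) B.cmp_in[OF t'(1) i(2)]] .
      have "Fm t \<cdot>\<^bsub>B\<^esub> Fm f = Zer B (Fo a) (Fo w)"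
        using B.cmp_assoc[OF Fm_in[OF assms(1)] t'(1) i(2)] t'(2) t(2) B.cmp_zer[OF i(2) Fo_Ob[OF o(1)]] by simp
      then have u: "\<exists>!s. s \<in> Homs A c w \<and> s \<cdot>\<^bsub>A\<^esub> g = t"
        using k w(1) t(1) Fm_cmp_zero_iff[OF assms(1) t(1)] by (simp add: iff(1))
      then obtain s where s: "s \<in> Homs A c w" "s \<cdot>\<^bsub>A\<^esub> g = t" by blast
      show "\<exists>!s. s \<in> Homs B (Fo c) w' \<and> s \<cdot>\<^bsub>B\<^esub> Fm g = t'"
      proof (rule ex1I[of _ "i \<cdot>\<^bsub>B\<^esub> Fm s"], rule conjI)
        show "i \<cdot>\<^bsub>B\<^esub> Fm s \<in> Homs B (Fo c) w'" by (rule B.cmp_in[OF Fm_in[OF s(1)] i(1)])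
        have "i \<cdot>\<^bsub>B\<^esub> Fm s \<cdot>\<^bsub>B\<^esub> Fm g = i \<cdot>\<^bsub>B\<^esub> (j \<cdot>\<^bsub>B\<^esub> t')"
          using B.cmp_assoc[OF Fm_in[OF assms(2)] Fm_in[OF s(1)] i(1)] Fm_cmp[OF assms(2) s(1)] s t by simp
        then show "i \<cdot>\<^bsub>B\<^esub> Fm s \<cdot>\<^bsub>B\<^esub> Fm g = t'"
          using B.cmp_assoc[OF t'(1) i(2,1)] i(4) B.cmp_ident_left[OF t'(1)] by simp
        fix r' assume r': "r' \<in> Homs B (Fo c) w' \<and> r' \<cdot>\<^bsub>B\<^esub> Fm g = t'"
        obtain r where r: "r \<in> Homs A c w" "Fm r = j \<cdot>\<^bsub>B\<^esub> r'" using Fm_full[OF o(3) w(1) B.cmp_in[OF _ i(2)]] r' by blast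
        have "Fm (r \<cdot>\<^bsub>A\<^esub> g) = Fm t"
          using Fm_cmp[OF assms(2) r(1)] r(2) B.cmp_assoc[OF Fm_in[OF assms(2)] _ i(2), of r'] r' t(2) by simp
        then have "r \<cdot>\<^bsub>A\<^esub> g = t" by (rule Fm_faithful[OF A.cmp_in[OF assms(2) r(1)] t(1)])
        then have "r = s" using u r(1) s by blast
        then have "i \<cdot>\<^bsub>B\<^esub> Fm s = i \<cdot>\<^bsub>B\<^esub> (j \<cdot>\<^bsub>B\<^esub> r')" using r by simp
        then show "r' = i \<cdot>\<^bsub>B\<^esub> Fm s"
          using B.cmp_assoc[OF _ i(2,1), of r' "Fo c"] i(4) B.cmp_ident_left[of r' "Fo c" w'] r' by simp
      qed
    qed
  }
qed

lemma ses_Fo: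
  assumes "a \<in> Ob A" "b \<in> Ob A" "c \<in> Ob A"
  shows "ses B (Fo a) (Fo b) (Fo c) \<longleftrightarrow> ses A a b c"
proof
  assume "ses A a b c"
  then obtain f g where "short_exact A f g" "f \<in> Homs A a b" "g \<in> Homs A b c" by (auto simp: ses_def)
  then have "short_exact B (Fm f) (Fm g)" "Fm f \<in> Homs B (Fo a) (Fo b)" "Fm g \<in> Homs B (Fo b) (Fo c)"
    using kernel_Fm cokernel_Fm Fm_in by (auto simp: short_exact_def)
  then show "ses B (Fo a) (Fo b) (Fo c)" unfolding ses_def by blast
next
  assume "ses B (Fo a) (Fo b) (Fo c)"
  then obtain f' g' where fg: "short_exact B f' g'" "f' \<in> Homs B (Fo a) (Fo b)" "g' \<in> Homs B (Fo b) (Fo c)"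
    by (auto simp: ses_def)
  obtain f where f: "f \<in> Homs A a b" "Fm f = f'" using Fm_full[OF assms(1,2) fg(2)] .
  obtain g where g: "g \<in> Homs A b c" "Fm g = g'" using Fm_full[OF assms(2,3) fg(3)] .
  have "short_exact A f g" using fg(1) kernel_Fm[OF g(1) f(1)] cokernel_Fm[OF f(1) g(1)] f g by (simp add: short_exact_def)
  then show "ses A a b c" using f g unfolding ses_def by blast
qed

end

definition torsion_cone :: "('o, 'm, 'x) additive_data_scheme \<Rightarrow> 'o set \<Rightarrow> (('o \<Rightarrow>\<^sub>0 int) set \<Rightarrow> real) set" where
  "torsion_cone A T = {v \<in> real_dual (K0 A). (\<forall>t \<in> T. 0 \<le> v (K0_class A t)) \<and> (\<forall>f \<in> perp A T. v (K0_class A f) \<le> 0)}"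

lemma (in separated_heart) heart_fan_torsion:
  "heart_fan D heart = (\<Union>T \<in> {T. torsion_class A T}. faces (torsion_cone A T))"
proof -
  have "heart_cone D heart K = torsion_cone A (heart \<inter> K)" if "K \<in> intermediate_hearts D heart" for K
    unfolding heart_cone_torsion[OF that] torsion_cone_def heart_dual_def[symmetric]
    using ev(2) by (auto simp: perp_def)
  then have "heart_fan D heart = (\<Union>K \<in> intermediate_hearts D heart. faces (torsion_cone A (heart \<inter> K)))"
    by (simp add: heart_fan_def)
  also have "\<dots> = (\<Union>T \<in> (\<lambda>K. heart \<inter> K) ` intermediate_hearts D heart. faces (torsion_cone A T))" by simp
  finally show ?thesis using bij_betw_imp_surj_on[OF tilting_bij] by simp
qed

lemma faces_image:
  assumes add: "\<And>a b. a \<in> C \<Longrightarrow> b \<in> C \<Longrightarrow> \<Phi> (a + b) = \<Phi> a + \<Phi> b"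
    and cl: "\<And>a b. a \<in> C \<Longrightarrow> b \<in> C \<Longrightarrow> a + b \<in> C" and inj: "inj_on \<Phi> C"
  shows "faces (\<Phi> ` C) = (\<lambda>\<tau>. \<Phi> ` \<tau>) ` faces C"
proof (intro equalityI subsetI)
  fix \<sigma> assume \<sigma>: "\<sigma> \<in> faces (\<Phi> ` C)"
  define \<tau> where "\<tau> = {a \<in> C. \<Phi> a \<in> \<sigma>}"
  have s: "\<sigma> = \<Phi> ` \<tau>" using \<sigma> by (auto simp: faces_def \<tau>_def)
  have "\<sigma> \<noteq> {}" and \<sigma>2: "\<And>a b. a \<in> C \<Longrightarrow> b \<in> C \<Longrightarrow> \<Phi> a + \<Phi> b \<in> \<sigma> \<longleftrightarrow> \<Phi> a \<in> \<sigma> \<and> \<Phi> b \<in> \<sigma>"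
    using \<sigma> unfolding faces_def by blast+
  then have "\<tau> \<noteq> {}" using s by blast
  moreover have "a + b \<in> \<tau> \<longleftrightarrow> a \<in> \<tau> \<and> b \<in> \<tau>" if "a \<in> C" "b \<in> C" for a b
    using \<sigma>2[OF that] add[OF that] cl[OF that] that by (simp add: \<tau>_def)
  moreover have "\<tau> \<subseteq> C" by (simp add: \<tau>_def)
  ultimately have "\<tau> \<in> faces C" unfolding faces_def by blast
  then show "\<sigma> \<in> (\<lambda>\<tau>. \<Phi> ` \<tau>) ` faces C" using s by blast
next
  fix \<sigma> assume "\<sigma> \<in> (\<lambda>\<tau>. \<Phi> ` \<tau>) ` faces C"
  then obtain \<tau> where \<tau>: "\<tau> \<in> faces C" and s: "\<sigma> = \<Phi> ` \<tau>" by blast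
  have m: "\<Phi> a \<in> \<sigma> \<longleftrightarrow> a \<in> \<tau>" if "a \<in> C" for a
    using \<tau> inj that by (auto simp: s faces_def inj_on_def)
  have t: "\<tau> \<noteq> {}" "\<tau> \<subseteq> C" "\<And>a b. a \<in> C \<Longrightarrow> b \<in> C \<Longrightarrow> a + b \<in> \<tau> \<longleftrightarrow> a \<in> \<tau> \<and> b \<in> \<tau>"
    using \<tau> unfolding faces_def by blast+
  have "\<Phi> a + \<Phi> b \<in> \<sigma> \<longleftrightarrow> \<Phi> a \<in> \<sigma> \<and> \<Phi> b \<in> \<sigma>" if "a \<in> C" "b \<in> C" for a b
    using t(3)[OF that] m[OF cl[OF that]] m[OF that(1)] m[OF that(2)] add[OF that] by simp
  moreover have "\<sigma> \<noteq> {}" "\<sigma> \<subseteq> \<Phi> ` C" using t s by auto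
  ultimately show "\<sigma> \<in> faces (\<Phi> ` C)" unfolding faces_def by blast
qed

section \<open>The fans of equivalent hearts in two ambient categories\<close>

locale heart_equivalence = H: separated_heart D U V + H': bounded_t D' U' V' +
  E: additive_equivalence "full_subcat D (U \<inter> V)" "full_subcat D' (U' \<inter> V')" Fo Fm
  for D :: "('o, 'm, 'x) triangulated_data_scheme" and U V
    and D' :: "('p, 'n, 'y) triangulated_data_scheme" and U' V' and Fo Fm
begin

abbreviation "B \<equiv> full_subcat D (U \<inter> V)"
abbreviation "B' \<equiv> full_subcat D' (U' \<inter> V')"

lemma isomorphic_B': "isomorphic B' x y \<Longrightarrow> x \<in> U' \<inter> V' \<and> y \<in> U' \<inter> V' \<and> isomorphic D' x y"
proof -
  assume i: "isomorphic B' x y"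
  obtain f g where "f \<in> Homs B' x y" "g \<in> Homs B' y x" "g \<cdot>\<^bsub>B'\<^esub> f = Ident B' x" "f \<cdot>\<^bsub>B'\<^esub> g = Ident B' y"
    using i by (rule E.B.isomorphicE)
  then show ?thesis using H'.isomorphicI by (auto simp: Homs_full_subcat)
qed

lemma ses_iso:
  assumes "ses B' a b c" "isomorphic B' a a'" "isomorphic B' b b'" "isomorphic B' c c'" shows "ses B' a' b' c'"
  using assms isomorphic_B' H'.dtri_iso unfolding H'.ses_iff by blast

lemma class_iso:
  assumes "v \<in> real_dual (K0 B')" "isomorphic B' x y" shows "v (K0_class B' x) = v (K0_class B' y)"
  using H'.ses_additive_iso[OF E.B.K0_dual_additive[OF assms(1)]] isomorphic_B'[OF assms(2)] by blast

abbreviation \<phi> where "\<phi> \<equiv> frag_extend (\<lambda>x. frag_of (Fo x))"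
abbreviation cos where "cos c \<equiv> K0N B #>\<^bsub>free_Abelian_group (Ob B)\<^esub> c"
abbreviation cos' where "cos' c \<equiv> K0N B' #>\<^bsub>free_Abelian_group (Ob B')\<^esub> c"

lemma \<phi>_keys: "Poly_Mapping.keys c \<subseteq> Ob B \<Longrightarrow> Poly_Mapping.keys (\<phi> c) \<subseteq> Ob B'"
  using keys_frag_extend[of "\<lambda>x. frag_of (Fo x)" c] E.Fo_Ob by fastforce

lemma lin_\<phi>: "lin \<psi> (\<phi> c) = lin (\<lambda>x. \<psi> (Fo x)) c"
proof (rule free_Abelian_group_induct[of c UNIV])
  fix x y :: "'o \<Rightarrow>\<^sub>0 int" assume "lin \<psi> (\<phi> x) = lin (\<lambda>x. \<psi> (Fo x)) x" "lin \<psi> (\<phi> y) = lin (\<lambda>x. \<psi> (Fo x)) y"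
  then show "lin \<psi> (\<phi> (x - y)) = lin (\<lambda>x. \<psi> (Fo x)) (x - y)" by (simp add: frag_extend_diff)
qed simp_all

lemma \<phi>_rel: "n \<in> K0N B \<Longrightarrow> \<phi> n \<in> K0N B'"
proof (induction rule: generate.induct)
  case one
  then show ?case using subgroup.one_closed[OF rel_subgroup[OF E.B.K0_rels_carrier]] by simp
next
  case (incl r)
  then obtain a b c where s: "ses B a b c" and r: "r = frag_of b - frag_of a - frag_of c" by (auto simp: K0_rels_iff)
  then have "a \<in> Ob B" "b \<in> Ob B" "c \<in> Ob B" unfolding H.ses_iff by auto
  then have "ses B' (Fo a) (Fo b) (Fo c)" using E.ses_Fo s by blast
  then have "\<phi> r \<in> K0_rels B'" unfolding K0_rels_iff r by (auto simp: frag_extend_diff)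
  then show ?case by (rule rel_closed(1)[OF E.B.K0_rels_carrier])
next
  case (inv r)
  then obtain a b c where s: "ses B a b c" and r: "r = frag_of b - frag_of a - frag_of c" by (auto simp: K0_rels_iff)
  then have "a \<in> Ob B" "b \<in> Ob B" "c \<in> Ob B" unfolding H.ses_iff by auto
  then have "ses B' (Fo a) (Fo b) (Fo c)" using E.ses_Fo s by blast
  then have "\<phi> r \<in> K0_rels B'" unfolding K0_rels_iff r by (auto simp: frag_extend_diff)
  then have p: "\<phi> r \<in> K0N B'" by (rule rel_closed(1)[OF E.B.K0_rels_carrier])
  have "Poly_Mapping.keys r \<subseteq> Ob B" using subsetD[OF E.A.K0_rels_carrier inv] by simp
  then show ?case
    using rel_closed(2)[OF E.B.K0_rels_carrier subgroup.one_closed[OF rel_subgroup[OF E.B.K0_rels_carrier]] p]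
    by (simp add: frag_extend_minus)
next
  case (eng a b)
  then show ?case
    using subgroup.m_closed[OF rel_subgroup[OF E.B.K0_rels_carrier], of "\<phi> a" "\<phi> b"] by (simp add: frag_extend_add)
qed

lemma K0_map_coset: assumes "Poly_Mapping.keys c \<subseteq> Ob B" shows "K0_map B' Fo (cos c) = cos' (\<phi> c)"
proof -
  have 1: "c \<in> cos c" by (rule rel_coset_self[OF E.A.K0_rels_carrier])
  have 2: "\<phi> ` cos c \<subseteq> cos' (\<phi> c)"
    unfolding rel_coset[OF E.A.K0_rels_carrier] rel_coset[OF E.B.K0_rels_carrier]
    using \<phi>_rel by (auto simp: frag_extend_add)
  show ?thesis
    using coset_map_coset[OF E.B.K0_rels_carrier \<phi>_keys[OF assms] 1 2] by (simp add: K0_map_def K0_def)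
qed

abbreviation pull where "pull \<equiv> dual_pullback (K0 B) (K0_map B' Fo)"

lemma pull:
  assumes v: "v \<in> real_dual (K0 B')"
  shows "pull v \<in> real_dual (K0 B)" "\<And>x. x \<in> Ob B \<Longrightarrow> pull v (K0_class B x) = v (K0_class B' (Fo x))"
    "\<And>c. Poly_Mapping.keys c \<subseteq> Ob B \<Longrightarrow> pull v (cos c) = v (cos' (\<phi> c))"
proof -
  have add: "ses_additive B (\<lambda>x. v (K0_class B' (Fo x)))"
    unfolding ses_additive_def
  proof (intro allI impI)
    fix a b c assume s: "ses B a b c"
    then have "a \<in> Ob B" "b \<in> Ob B" "c \<in> Ob B" unfolding H.ses_iff by auto
    then have "ses B' (Fo a) (Fo b) (Fo c)" using E.ses_Fo s by blast
    then show "v (K0_class B' (Fo b)) = v (K0_class B' (Fo a)) + v (K0_class B' (Fo c))"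
      using E.B.K0_dual_additive[OF v] by (simp add: ses_additive_def)
  qed
  obtain w where w: "w \<in> real_dual (K0 B)" "\<And>x. x \<in> Ob B \<Longrightarrow> w (K0_class B x) = v (K0_class B' (Fo x))"
    using E.A.K0_dual_ex[OF add] by blast
  show 3: "pull v (cos c) = v (cos' (\<phi> c))" if "Poly_Mapping.keys c \<subseteq> Ob B" for c
    using E.A.K0_cosetI[OF that] K0_map_coset[OF that] by (simp add: dual_pullback_def)
  have "pull v = w"
  proof
    fix X
    show "pull v X = w X"
    proof (cases "X \<in> carrier (K0 B)")
      case True
      then obtain c where c: "Poly_Mapping.keys c \<subseteq> Ob B" "X = cos c" by (rule E.A.K0_carrier)
      have "pull v X = v (cos' (\<phi> c))" unfolding c(2) by (rule 3[OF c(1)])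
      also have "\<dots> = lin (\<lambda>y. v (K0_class B' y)) (\<phi> c)" by (rule E.B.K0_dual_lin[OF v \<phi>_keys[OF c(1)]])
      also have "\<dots> = lin (\<lambda>x. v (K0_class B' (Fo x))) c" by (rule lin_\<phi>)
      also have "\<dots> = lin (\<lambda>x. w (K0_class B x)) c"
        by (rule lin_cong, rule w(2)[symmetric]) (use c in blast)
      also have "\<dots> = w X" unfolding c(2) by (rule E.A.K0_dual_lin[OF w(1) c(1), symmetric])
      finally show ?thesis .
    next
      case False
      then show ?thesis using w by (simp add: dual_pullback_def real_dual_def)
    qed
  qed
  then show "pull v \<in> real_dual (K0 B)" "\<And>x. x \<in> Ob B \<Longrightarrow> pull v (K0_class B x) = v (K0_class B' (Fo x))"
    using w by simp_all
qed

text \<open>A quasi-inverse \<open>q\<close> on objects suffices, because exactness of a sequence,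
  and hence additivity, depends only on the isomorphism classes of its terms.\<close>

lemma pull_surj:
  assumes w: "w \<in> real_dual (K0 B)" obtains v where "v \<in> real_dual (K0 B')" "pull v = w"
proof -
  define q where "q y = (SOME x. x \<in> Ob B \<and> isomorphic B' (Fo x) y)" for y
  have q: "q y \<in> Ob B" "isomorphic B' (Fo (q y)) y" if "y \<in> Ob B'" for y
  proof -
    have "\<exists>x. x \<in> Ob B \<and> isomorphic B' (Fo x) y" using E.ess_surj[OF that] by blast
    from someI_ex[OF this, folded q_def] show "q y \<in> Ob B" "isomorphic B' (Fo (q y)) y" by blast+
  qed
  have add: "ses_additive B' (\<lambda>y. w (K0_class B (q y)))"
    unfolding ses_additive_def
  proof (intro allI impI)
    fix a b c assume s: "ses B' a b c"
    then have o: "a \<in> Ob B'" "b \<in> Ob B'" "c \<in> Ob B'" unfolding H'.ses_iff by auto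
    have "ses B' (Fo (q a)) (Fo (q b)) (Fo (q c))"
      by (rule ses_iso[OF s E.B.isomorphic_sym[OF q(2)[OF o(1)]] E.B.isomorphic_sym[OF q(2)[OF o(2)]]
            E.B.isomorphic_sym[OF q(2)[OF o(3)]]])
    then have "ses B (q a) (q b) (q c)" using E.ses_Fo q(1) o by blast
    then show "w (K0_class B (q b)) = w (K0_class B (q a)) + w (K0_class B (q c))"
      using E.A.K0_dual_additive[OF w] by (simp add: ses_additive_def)
  qed
  obtain v where v: "v \<in> real_dual (K0 B')" "\<And>y. y \<in> Ob B' \<Longrightarrow> v (K0_class B' y) = w (K0_class B (q y))"
    using E.B.K0_dual_ex[OF add] by blast
  have "pull v = w"
  proof (rule E.A.K0_dual_eqI[OF pull(1)[OF v(1)] w])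
    fix x assume x: "x \<in> Ob B"
    have Fx: "Fo x \<in> Ob B'" by (rule E.Fo_Ob[OF x])
    obtain z where z: "zero_object D z" using H.ex_zero by blast
    obtain z' where z': "zero_object D' z'" using H'.ex_zero by blast
    have zz: "z \<in> Ob B" using H.zero_heart[OF z] by simp
    have "hom0 B' (Fo z) (Fo z)"
      using E.hom0_Fo[OF zz zz] hom0_full_subcat[of z "U \<inter> V" z D] zz z H.zero_object_iff by simp
    then have Fz: "zero_object D' (Fo z)"
      using hom0_full_subcat[of "Fo z" "U' \<inter> V'" "Fo z" D'] E.Fo_Ob[OF zz] H'.zero_object_iff by simp
    \<comment> \<open>The isomorphism between \<open>Fo (q (Fo x))\<close> and \<open>Fo x\<close>
      is written as a short exact sequence with zero quotient, so that it can be reflected along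
      \<open>Fo\<close> with \<open>ses_Fo\<close>.\<close>
    have "ses B' (Fo (q (Fo x))) (Fo x) (Fo z)"
      unfolding H'.ses_iff
      using H'.dtri_of_iso[OF _ Fz] isomorphic_B'[OF q(2)[OF Fx]] E.Fo_Ob[OF zz] by simp
    then have "ses B (q (Fo x)) x z" using E.ses_Fo[OF q(1)[OF Fx] x zz] by blast
    moreover have "ses B z z z" using H.dtri_ident[OF H.heart_Ob z] zz by (simp add: H.ses_iff)
    moreover have "w (K0_class B b) = w (K0_class B a) + w (K0_class B c)" if "ses B a b c" for a b c
      using E.A.K0_dual_additive[OF w] that by (simp add: ses_additive_def)
    ultimately have "w (K0_class B x) = w (K0_class B (q (Fo x))) + w (K0_class B z)"
      "w (K0_class B z) = w (K0_class B z) + w (K0_class B z)" by blast+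
    then have "w (K0_class B x) = w (K0_class B (q (Fo x)))" by simp
    then show "pull v (K0_class B x) = w (K0_class B x)" using pull(2)[OF v(1) x] v(2)[OF Fx] by simp
  qed
  then show ?thesis using that v by blast
qed

lemma pull_inj: "inj_on pull (real_dual (K0 B'))"
proof (rule inj_onI)
  fix v v' assume v: "v \<in> real_dual (K0 B')" "v' \<in> real_dual (K0 B')" and e: "pull v = pull v'"
  show "v = v'"
  proof (rule E.B.K0_dual_eqI[OF v])
    fix y assume "y \<in> Ob B'"
    then obtain x where x: "x \<in> Ob B" "isomorphic B' (Fo x) y" by (rule E.ess_surj)
    show "v (K0_class B' y) = v' (K0_class B' y)"
      using class_iso[OF v(1) x(2)] class_iso[OF v(2) x(2)] pull(2)[OF v(1) x(1)] pull(2)[OF v(2) x(1)] e by simp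
  qed
qed

text \<open>Essential surjectivity in terms of generators: isomorphic objects have the same class,
  so modulo relations every chain comes from objects \<open>Fo x\<close>.\<close>

lemma coset_surj:
  assumes "Poly_Mapping.keys c' \<subseteq> Ob B'" shows "\<exists>c. Poly_Mapping.keys c \<subseteq> Ob B \<and> c' - \<phi> c \<in> K0N B'"
proof (rule free_Abelian_group_induct[OF assms])
  show "\<exists>c. Poly_Mapping.keys c \<subseteq> Ob B \<and> 0 - \<phi> c \<in> K0N B'"
    by (rule exI[of _ 0]) (use subgroup.one_closed[OF rel_subgroup[OF E.B.K0_rels_carrier]] in simp)
next
  fix x y assume "\<exists>c. Poly_Mapping.keys c \<subseteq> Ob B \<and> x - \<phi> c \<in> K0N B'" "\<exists>c. Poly_Mapping.keys c \<subseteq> Ob B \<and> y - \<phi> c \<in> K0N B'"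
  then obtain c d where c: "Poly_Mapping.keys c \<subseteq> Ob B" "x - \<phi> c \<in> K0N B'" and d: "Poly_Mapping.keys d \<subseteq> Ob B" "y - \<phi> d \<in> K0N B'"
    by blast
  have "x - \<phi> c - (y - \<phi> d) \<in> K0N B'" by (rule rel_closed(2)[OF E.B.K0_rels_carrier c(2) d(2)])
  moreover have "x - \<phi> c - (y - \<phi> d) = x - y - \<phi> (c - d)" by (simp add: frag_extend_diff)
  moreover have "Poly_Mapping.keys (c - d) \<subseteq> Ob B" using keys_diff[of c d] c d by blast
  ultimately show "\<exists>c. Poly_Mapping.keys c \<subseteq> Ob B \<and> x - y - \<phi> c \<in> K0N B'" by metis
next
  fix y assume "y \<in> Ob B'"
  then obtain x where x: "x \<in> Ob B" "isomorphic B' (Fo x) y" by (rule E.ess_surj)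
  obtain z where z: "zero_object D' z" using H'.ex_zero by blast
  have "ses B' (Fo x) y z" "ses B' z z z"
    using H'.dtri_of_iso[OF _ z] isomorphic_B'[OF x(2)] H'.zero_heart[OF z] H'.dtri_ident[OF H'.heart_Ob z]
    by (simp_all add: H'.ses_iff)
  then have "frag_of y - frag_of (Fo x) - frag_of z \<in> K0N B'" "frag_of z - frag_of z - frag_of z \<in> K0N B'"
    using rel_closed(1)[OF E.B.K0_rels_carrier] unfolding K0_rels_iff by blast+
  from rel_closed(2)[OF E.B.K0_rels_carrier this] have "frag_of y - \<phi> (frag_of x) \<in> K0N B'" by simp
  then show "\<exists>c. Poly_Mapping.keys c \<subseteq> Ob B \<and> frag_of y - \<phi> c \<in> K0N B'"
    using x by (intro exI[of _ "frag_of x"]) simp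
qed

text \<open>Separation of points is known for the heart in \<open>D\<close> and has to reach the one
  in \<open>D'\<close> before the cones there can be computed. Classes of the second heart come from
  the first, and functionals on the first are pulled back from the second.\<close>

lemma separated': "separated_heart D' U' V'"
proof
  fix X Y assume X: "X \<in> carrier (K0 B')" and Y: "Y \<in> carrier (K0 B')" and e: "\<And>v. v \<in> real_dual (K0 B') \<Longrightarrow> v X = v Y"
  have ex: "\<exists>c. Poly_Mapping.keys c \<subseteq> Ob B \<and> X = cos' (\<phi> c)" if Xc: "X \<in> carrier (K0 B')" for X
  proof -
    obtain c' where c': "Poly_Mapping.keys c' \<subseteq> Ob B'" "X = cos' c'" using E.B.K0_carrier[OF Xc] by blast
    obtain c where c: "Poly_Mapping.keys c \<subseteq> Ob B" "c' - \<phi> c \<in> K0N B'" using coset_surj[OF c'(1)] by blast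
    then show ?thesis using rel_coset_eqI[OF E.B.K0_rels_carrier c(2) \<phi>_keys[OF c(1)]] c'(2) by blast
  qed
  obtain c where c: "Poly_Mapping.keys c \<subseteq> Ob B" "X = cos' (\<phi> c)" using ex[OF X] by blast
  obtain d where d: "Poly_Mapping.keys d \<subseteq> Ob B" "Y = cos' (\<phi> d)" using ex[OF Y] by blast
  have "cos c = cos d"
  proof (rule H.K0_sep[OF E.A.K0_cosetI[OF c(1)] E.A.K0_cosetI[OF d(1)]])
    fix w assume "w \<in> real_dual (K0 B)"
    then obtain v where v: "v \<in> real_dual (K0 B')" "pull v = w" by (rule pull_surj)
    show "w (cos c) = w (cos d)" using pull(3)[OF v(1) c(1)] pull(3)[OF v(1) d(1)] v(2) e[OF v(1)] c d by simp
  qed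
  then show "X = Y" using K0_map_coset c d by metis
qed

lemma torsion_iso:
  assumes T': "torsion_class B' T'" and y: "y \<in> T'" and i: "isomorphic B' y y'" shows "y' \<in> T'"
proof -
  have "hom0 B' y' f" if "f \<in> perp B' T'" for f
    by (rule E.B.hom0_iso_left[OF _ i]) (use that y in \<open>simp add: perp_def\<close>)
  then show ?thesis using T' E.B.isomorphic_Ob[OF i] unfolding torsion_class_def by blast
qed

lemma torsion_pullback:
  assumes T': "torsion_class B' T'"
  defines "T \<equiv> {x \<in> Ob B. Fo x \<in> T'}"
  shows "torsion_class B T" "perp B T = {x \<in> Ob B. Fo x \<in> perp B' T'}" "pull ` torsion_cone B' T' = torsion_cone B T"
proof -
  have T'o: "T' \<subseteq> Ob B'" using T' by (simp add: torsion_class_def)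
  have rep: "\<exists>x \<in> T. isomorphic B' (Fo x) y" if y: "y \<in> T'" for y
  proof -
    obtain x where x: "x \<in> Ob B" "isomorphic B' (Fo x) y" using E.ess_surj y T'o by blast
    then show ?thesis using torsion_iso[OF T' y E.B.isomorphic_sym] by (auto simp: T_def)
  qed
  show P: "perp B T = {x \<in> Ob B. Fo x \<in> perp B' T'}"
  proof (intro equalityI subsetI)
    fix f assume f: "f \<in> perp B T"
    then have fo: "f \<in> Ob B" by (simp add: perp_def)
    have "hom0 B' y (Fo f)" if y: "y \<in> T'" for y
    proof -
      obtain x where x: "x \<in> T" "isomorphic B' (Fo x) y" using rep[OF y] by blast
      have "hom0 B x f" using f x by (simp add: perp_def)
      then have "hom0 B' (Fo x) (Fo f)" using E.hom0_Fo[of x f] x fo by (simp add: T_def)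
      then show ?thesis by (rule E.B.hom0_iso_left[OF _ x(2)])
    qed
    then show "f \<in> {x \<in> Ob B. Fo x \<in> perp B' T'}" using fo E.Fo_Ob[OF fo] by (simp add: perp_def)
  next
    fix f assume "f \<in> {x \<in> Ob B. Fo x \<in> perp B' T'}"
    then show "f \<in> perp B T" using E.hom0_Fo by (auto simp: perp_def T_def)
  qed
  have repF: "\<exists>x \<in> perp B T. isomorphic B' (Fo x) y" if y: "y \<in> perp B' T'" for y
  proof -
    have yo: "y \<in> Ob B'" using y by (simp add: perp_def)
    obtain x where x: "x \<in> Ob B" "isomorphic B' (Fo x) y" using E.ess_surj[OF yo] .
    have "Fo x \<in> perp B' T'"
      using y E.B.hom0_iso_right[OF _ E.B.isomorphic_sym[OF x(2)]] E.Fo_Ob[OF x(1)] by (simp add: perp_def)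
    then show ?thesis using x P by blast
  qed
  show "torsion_class B T"
    unfolding torsion_class_def
  proof (intro conjI ballI impI)
    fix h assume h: "h \<in> Ob B" "\<forall>f \<in> perp B T. hom0 B h f"
    have "hom0 B' (Fo h) y" if y: "y \<in> perp B' T'" for y
    proof -
      obtain f where f: "f \<in> perp B T" "isomorphic B' (Fo f) y" using repF[OF y] by blast
      have "hom0 B' (Fo h) (Fo f)" using E.hom0_Fo[of h f] h f by (simp add: perp_def)
      then show ?thesis by (rule E.B.hom0_iso_right[OF _ f(2)])
    qed
    then show "h \<in> T" using T' h E.Fo_Ob[OF h(1)] by (simp add: torsion_class_def T_def)
  next
    fix h assume h: "h \<in> Ob B"
    obtain t' f' where tf: "t' \<in> T'" "f' \<in> perp B' T'" "ses B' t' (Fo h) f'"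
      using T' E.Fo_Ob[OF h] unfolding torsion_class_def by blast
    obtain t where t: "t \<in> T" "isomorphic B' (Fo t) t'" using rep[OF tf(1)] by blast
    obtain f where f: "f \<in> perp B T" "isomorphic B' (Fo f) f'" using repF[OF tf(2)] by blast
    have "ses B' (Fo t) (Fo h) (Fo f)"
      by (rule ses_iso[OF tf(3) E.B.isomorphic_sym[OF t(2)] E.B.isomorphic_refl[OF E.Fo_Ob[OF h]] E.B.isomorphic_sym[OF f(2)]])
    then have "ses B t h f" using E.ses_Fo[of t h f] t f h by (simp add: T_def perp_def)
    then show "\<exists>t \<in> T. \<exists>f \<in> perp B T. ses B t h f" using t f by blast
  qed (auto simp: T_def)
  have c: "pull v \<in> torsion_cone B T \<longleftrightarrow> v \<in> torsion_cone B' T'" if v: "v \<in> real_dual (K0 B')" for v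
  proof -
    have "(\<forall>t \<in> T. 0 \<le> pull v (K0_class B t)) \<longleftrightarrow> (\<forall>t \<in> T. 0 \<le> v (K0_class B' (Fo t)))"
      using pull(2)[OF v] by (simp add: T_def)
    also have "\<dots> \<longleftrightarrow> (\<forall>t \<in> T'. 0 \<le> v (K0_class B' t))"
      using rep class_iso[OF v] by (fastforce simp: T_def)
    finally have 1: "(\<forall>t \<in> T. 0 \<le> pull v (K0_class B t)) \<longleftrightarrow> (\<forall>t \<in> T'. 0 \<le> v (K0_class B' t))" .
    have "(\<forall>t \<in> perp B T. pull v (K0_class B t) \<le> 0) \<longleftrightarrow> (\<forall>t \<in> perp B T. v (K0_class B' (Fo t)) \<le> 0)"
      using pull(2)[OF v] by (simp add: perp_def)
    also have "\<dots> \<longleftrightarrow> (\<forall>t \<in> perp B' T'. v (K0_class B' t) \<le> 0)"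
      using repF class_iso[OF v] P by fastforce
    finally show ?thesis using 1 v pull(1)[OF v] by (simp add: torsion_cone_def)
  qed
  show "pull ` torsion_cone B' T' = torsion_cone B T"
  proof (intro equalityI subsetI)
    fix w assume "w \<in> pull ` torsion_cone B' T'"
    then obtain v where v: "v \<in> torsion_cone B' T'" "w = pull v" by (rule imageE)
    have "v \<in> real_dual (K0 B')" using v(1) by (simp add: torsion_cone_def)
    from c[OF this] show "w \<in> torsion_cone B T" using v by simp
  next
    fix w assume w: "w \<in> torsion_cone B T"
    then have "w \<in> real_dual (K0 B)" by (simp add: torsion_cone_def)
    then obtain v where v: "v \<in> real_dual (K0 B')" "pull v = w" by (rule pull_surj)
    then show "w \<in> pull ` torsion_cone B' T'" using c w by blast
  qed
qed

lemma torsion_pushforward: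
  assumes T: "torsion_class B T"
  obtains T' where "torsion_class B' T'" "T = {x \<in> Ob B. Fo x \<in> T'}"
proof -
  define T' where "T' = {y \<in> Ob B'. \<exists>x \<in> T. isomorphic B' (Fo x) y}"
  have To: "T \<subseteq> Ob B" and Th: "\<And>h. h \<in> Ob B \<Longrightarrow> (\<And>f. f \<in> perp B T \<Longrightarrow> hom0 B h f) \<Longrightarrow> h \<in> T"
    using T by (auto simp: torsion_class_def)
  have P: "Fo f \<in> perp B' T' \<longleftrightarrow> f \<in> perp B T" if f: "f \<in> Ob B" for f
  proof
    assume a: "Fo f \<in> perp B' T'"
    have "hom0 B x f" if x: "x \<in> T" for x
    proof -
      have xo: "x \<in> Ob B" using x To by blast
      have "Fo x \<in> T'" using x E.B.isomorphic_refl[OF E.Fo_Ob[OF xo]] E.Fo_Ob[OF xo] by (auto simp: T'_def)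
      then have "hom0 B' (Fo x) (Fo f)" using a by (simp add: perp_def)
      then show ?thesis using E.hom0_Fo[OF xo f] by simp
    qed
    then show "f \<in> perp B T" using f by (simp add: perp_def)
  next
    assume a: "f \<in> perp B T"
    have "hom0 B' y (Fo f)" if y: "y \<in> T'" for y
    proof -
      obtain x where x: "x \<in> T" "isomorphic B' (Fo x) y" using y by (auto simp: T'_def)
      have "hom0 B' (Fo x) (Fo f)" using E.hom0_Fo[of x f] x a To f by (auto simp: perp_def)
      then show ?thesis by (rule E.B.hom0_iso_left[OF _ x(2)])
    qed
    then show "Fo f \<in> perp B' T'" using E.Fo_Ob[OF f] by (simp add: perp_def)
  qed
  have 1: "torsion_class B' T'"
    unfolding torsion_class_def
  proof (intro conjI ballI impI)
    fix y assume y: "y \<in> Ob B'" "\<forall>f \<in> perp B' T'. hom0 B' y f"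
    obtain h where h: "h \<in> Ob B" "isomorphic B' (Fo h) y" using E.ess_surj[OF y(1)] .
    have "h \<in> T"
    proof (rule Th[OF h(1)])
      fix f assume f: "f \<in> perp B T"
      then have fo: "f \<in> Ob B" by (simp add: perp_def)
      then have "hom0 B' y (Fo f)" using y P f by blast
      then have "hom0 B' (Fo h) (Fo f)" by (rule E.B.hom0_iso_left[OF _ E.B.isomorphic_sym[OF h(2)]])
      then show "hom0 B h f" using E.hom0_Fo[OF h(1) fo] by simp
    qed
    then show "y \<in> T'" using h y by (auto simp: T'_def)
  next
    fix y assume y: "y \<in> Ob B'"
    obtain h where h: "h \<in> Ob B" "isomorphic B' (Fo h) y" using E.ess_surj[OF y] .
    obtain t f where tf: "t \<in> T" "f \<in> perp B T" "ses B t h f" using T h(1) unfolding torsion_class_def by blast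
    have o: "t \<in> Ob B" "f \<in> Ob B" using tf To by (auto simp: perp_def)
    have "ses B' (Fo t) (Fo h) (Fo f)" using E.ses_Fo[OF o(1) h(1) o(2)] tf by blast
    then have "ses B' (Fo t) y (Fo f)"
      by (rule ses_iso[OF _ E.B.isomorphic_refl[OF E.Fo_Ob[OF o(1)]] h(2) E.B.isomorphic_refl[OF E.Fo_Ob[OF o(2)]]])
    moreover have "Fo t \<in> T'" using tf E.B.isomorphic_refl[OF E.Fo_Ob[OF o(1)]] E.Fo_Ob[OF o(1)] by (auto simp: T'_def)
    moreover have "Fo f \<in> perp B' T'" using P[OF o(2)] tf by simp
    ultimately show "\<exists>t \<in> T'. \<exists>f \<in> perp B' T'. ses B' t y f" by blast
  qed (auto simp: T'_def)
  have 2: "T = {x \<in> Ob B. Fo x \<in> T'}"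
  proof (intro equalityI subsetI)
    fix x assume x: "x \<in> T"
    then have xo: "x \<in> Ob B" using To by blast
    then show "x \<in> {x \<in> Ob B. Fo x \<in> T'}"
      using x E.B.isomorphic_refl[OF E.Fo_Ob[OF xo]] E.Fo_Ob[OF xo] by (auto simp: T'_def)
  next
    fix x assume "x \<in> {x \<in> Ob B. Fo x \<in> T'}"
    then obtain x0 where x: "x \<in> Ob B" "x0 \<in> T" "isomorphic B' (Fo x0) (Fo x)" by (auto simp: T'_def)
    show "x \<in> T"
    proof (rule Th[OF x(1)])
      fix f assume f: "f \<in> perp B T"
      then have fo: "f \<in> Ob B" and h: "hom0 B x0 f" using x by (auto simp: perp_def)
      have "x0 \<in> Ob B" using x To by blast
      then have "hom0 B' (Fo x0) (Fo f)" using E.hom0_Fo fo h by blast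
      then have "hom0 B' (Fo x) (Fo f)" by (rule E.B.hom0_iso_left[OF _ x(3)])
      then show "hom0 B x f" using E.hom0_Fo[OF x(1) fo] by simp
    qed
  qed
  show ?thesis by (rule that[OF 1 2])
qed

lemma pull_faces:
  assumes T': "torsion_class B' T'"
  shows "(\<lambda>\<tau>. pull ` \<tau>) ` faces (torsion_cone B' T') = faces (torsion_cone B {x \<in> Ob B. Fo x \<in> T'})"
proof -
  have i: "inj_on pull (torsion_cone B' T')"
    using pull_inj unfolding inj_on_def torsion_cone_def by blast
  have c: "a + b \<in> torsion_cone B' T'" if "a \<in> torsion_cone B' T'" "b \<in> torsion_cone B' T'" for a b
    using that subspace_add[OF subspace_real_dual] by (auto simp: torsion_cone_def add_nonpos_nonpos)
  have add: "pull (a + b) = pull a + pull b" for a b by (rule ext) (simp add: dual_pullback_def)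
  have "faces (pull ` torsion_cone B' T') = (\<lambda>\<tau>. pull ` \<tau>) ` faces (torsion_cone B' T')"
    by (rule faces_image) (simp add: add, simp add: c, rule i)
  then show ?thesis using torsion_pullback(3)[OF T'] by simp
qed

theorem heart_fan_equivalence: "(\<lambda>\<tau>. pull ` \<tau>) ` heart_fan D' (U' \<inter> V') = heart_fan D (U \<inter> V)"
proof (intro equalityI subsetI)
  fix \<sigma> assume "\<sigma> \<in> (\<lambda>\<tau>. pull ` \<tau>) ` heart_fan D' (U' \<inter> V')"
  then obtain \<tau> where \<tau>: "\<tau> \<in> heart_fan D' (U' \<inter> V')" "\<sigma> = pull ` \<tau>" by (rule imageE)
  then obtain T' where T': "torsion_class B' T'" "\<tau> \<in> faces (torsion_cone B' T')"
    unfolding separated_heart.heart_fan_torsion[OF separated'] by blast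
  have "\<sigma> \<in> (\<lambda>\<tau>. pull ` \<tau>) ` faces (torsion_cone B' T')" unfolding \<tau>(2) by (rule imageI[OF T'(2)])
  then have "\<sigma> \<in> faces (torsion_cone B {x \<in> Ob B. Fo x \<in> T'})" unfolding pull_faces[OF T'(1)] .
  then show "\<sigma> \<in> heart_fan D (U \<inter> V)"
    unfolding H.heart_fan_torsion using torsion_pullback(1)[OF T'(1)] by blast
next
  fix \<sigma> assume "\<sigma> \<in> heart_fan D (U \<inter> V)"
  then obtain T where T: "torsion_class B T" "\<sigma> \<in> faces (torsion_cone B T)"
    unfolding H.heart_fan_torsion by blast
  obtain T' where T': "torsion_class B' T'" "T = {x \<in> Ob B. Fo x \<in> T'}" using torsion_pushforward[OF T(1)] .
  have "\<sigma> \<in> (\<lambda>\<tau>. pull ` \<tau>) ` faces (torsion_cone B' T')" unfolding pull_faces[OF T'(1)] using T(2) T'(2) by simp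
  then obtain \<tau> where \<tau>: "\<tau> \<in> faces (torsion_cone B' T')" "\<sigma> = pull ` \<tau>" by (rule imageE)
  have "\<tau> \<in> heart_fan D' (U' \<inter> V')"
    unfolding separated_heart.heart_fan_torsion[OF separated'] using T'(1) \<tau>(1) by blast
  then show "\<sigma> \<in> (\<lambda>\<tau>. pull ` \<tau>) ` heart_fan D' (U' \<inter> V')" unfolding \<tau>(2) by (rule imageI)
qed

end

section \<open>Length categories\<close>

context bounded_t
begin

text \<open>\<open>comp_series \<phi> x n r\<close>: there is a composition series of \<open>x\<close> with \<open>n\<close> simple factors, over
  which \<open>\<phi>\<close> sums up to \<open>r\<close>.\<close>

inductive comp_series :: "('o \<Rightarrow> real) \<Rightarrow> 'o \<Rightarrow> nat \<Rightarrow> real \<Rightarrow> bool" for \<phi> where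
  zero: "zero_object D z \<Longrightarrow> comp_series \<phi> z 0 0"
| step: "\<lbrakk>comp_series \<phi> a n r; dtri D a b s; simple s; b \<in> heart\<rbrakk> \<Longrightarrow> comp_series \<phi> b (Suc n) (r + \<phi> s)"

text \<open>The zero weight is a placeholder: only the existence of a series matters, and
  \<open>comp_series_any\<close> exchanges the weight.\<close>

definition finite_length :: bool where
  "finite_length \<longleftrightarrow> (\<forall>x \<in> heart. \<exists>n r. comp_series (\<lambda>_. 0) x n r)"

lemma simple_heart: "simple s \<Longrightarrow> s \<in> heart" and simple_nonzero: "simple s \<Longrightarrow> \<not> zero_object D s"
  by (auto simp: simple_def)

lemma simple_iso: assumes "simple s" "isomorphic D s s'" shows "simple s'"
  unfolding simple_def
proof (intro conjI ballI impI)
  have so: "s \<in> heart" by (rule simple_heart[OF assms(1)])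
  show "s' \<in> heart" by (rule heart_iso[OF so assms(2)])
  show "\<not> zero_object D s'" using zero_object_iso[OF _ isomorphic_sym[OF assms(2)]] simple_nonzero[OF assms(1)] by blast
  fix i r assume a: "i \<in> heart" "r \<in> heart" "dtri D i s' r"
  have "dtri D i s r"
    by (rule dtri_iso[OF a(3) isomorphic_refl isomorphic_sym[OF assms(2)] isomorphic_refl]) (use a heart_Ob in auto)
  then show "zero_object D i \<or> zero_object D r" using assms(1) a unfolding simple_def by blast
qed

lemma comp_series_heart: "comp_series \<phi> x n r \<Longrightarrow> x \<in> heart"
  by (induction rule: comp_series.induct) (use zero_heart in auto)

lemma comp_series_iso: assumes "comp_series \<phi> x n r" "isomorphic D x y" shows "comp_series \<phi> y n r"
  using assms(1)
proof (cases rule: comp_series.cases)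
  case zero
  then show ?thesis using comp_series.zero zero_object_iso assms(2) by simp
next
  case (step a m r' s)
  have "dtri D a y s"
    by (rule dtri_iso[OF step(4) isomorphic_refl assms(2) isomorphic_refl]) (use step(4) dtri_Ob in auto)
  then show ?thesis using comp_series.step[OF step(3) _ step(5)] heart_iso[OF step(6) assms(2)] step(1,2) by simp
qed

lemma comp_series_any: "comp_series \<phi> x n r \<Longrightarrow> \<exists>r'. comp_series \<phi>' x n r'"
proof (induction rule: comp_series.induct)
  case (zero z)
  then show ?case using comp_series.zero by blast
next
  case (step a n r b s)
  then obtain r' where "comp_series \<phi>' a n r'" by blast
  from comp_series.step[OF this step(2-4)] show ?case by blast
qed

lemma dtri_zero_mid_heart:
  assumes "dtri D a b c" "a \<in> heart" "c \<in> heart" "zero_object D b" shows "zero_object D a" "zero_object D c"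
proof -
  have i: "isomorphic D c (Sh D a)" by (rule dtri_zero_mid[OF assms(1,4)])
  have "hom0 D c c" by (rule hom0_iso_left[OF hom0_heart[OF assms(2,3)] isomorphic_sym[OF i]])
  then show c: "zero_object D c" using zero_object_iff by simp
  show "zero_object D a"
    using zero_object_iso[OF assms(4) isomorphic_sym[OF dtri_zero_third[OF assms(1) c]]] .
qed

lemma comp_series_zero: assumes "comp_series \<phi> x n r" "zero_object D x" shows "n = 0 \<and> r = 0"
  using assms(1)
proof (cases rule: comp_series.cases)
  case (step a m r' s)
  then have "zero_object D s"
    using dtri_zero_mid_heart(2)[OF step(4) comp_series_heart[OF step(3)] simple_heart[OF step(5)] assms(2)] by simp
  then show ?thesis using simple_nonzero[OF step(5)] by simp
qed simp

text \<open>Induction on the first length. When the last steps of the two series differ, a series of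
  the common subobject \<open>k\<close> extends to both \<open>a\<close> and \<open>a'\<close>, and
  the induction hypothesis applies to each; \<open>finite_length\<close> supplies the series of
  \<open>k\<close>.\<close>

lemma comp_series_unique:
  assumes fl: finite_length and inv: "\<And>s s'. simple s \<Longrightarrow> isomorphic D s s' \<Longrightarrow> \<phi> s = \<phi> s'"
  shows "comp_series \<phi> x n r \<Longrightarrow> comp_series \<phi> x n' r' \<Longrightarrow> n = n' \<and> r = r'"
proof (induction n arbitrary: x r n' r')
  case 0
  then have "zero_object D x" "r = 0" by (auto elim: comp_series.cases)
  then show ?case using comp_series_zero[OF 0(2)] by simp
next
  case (Suc m)
  obtain a s r0 where a: "comp_series \<phi> a m r0" "dtri D a x s" "simple s" "x \<in> heart" "r = r0 + \<phi> s"
    using Suc.prems(1) by (auto elim: comp_series.cases)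
  have nz: "\<not> zero_object D x" using comp_series_zero[OF Suc.prems(1)] by auto
  obtain m' a' s' r0' where b: "n' = Suc m'" "comp_series \<phi> a' m' r0'" "dtri D a' x s'" "simple s'" "r' = r0' + \<phi> s'"
    using Suc.prems(2) nz by (auto elim: comp_series.cases)
  note ah = comp_series_heart[OF a(1)] comp_series_heart[OF b(2)]
  consider "isomorphic D a a'" "isomorphic D s s'" | k where "k \<in> heart" "dtri D k a s'" "dtri D k a' s"
    using maximal_subobjects[OF a(2) b(3) a(3) b(4) ah(1) a(4) ah(2)] by blast
  then show ?case
  proof cases
    case 1
    then show ?thesis using Suc.IH[OF comp_series_iso[OF a(1) 1(1)] b(2)] inv[OF a(3) 1(2)] a(5) b(1,5) by simp
  next
    case 2
    obtain p q0 where "comp_series (\<lambda>_. 0) k p q0" using fl 2(1) unfolding finite_length_def by blast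
    then obtain q where q: "comp_series \<phi> k p q" using comp_series_any by blast
    have 1: "m = Suc p \<and> r0 = q + \<phi> s'"
      by (rule Suc.IH[OF a(1) comp_series.step[OF q 2(2) b(4) ah(1)]])
    then have "comp_series \<phi> a' m (q + \<phi> s)" using comp_series.step[OF q 2(3) a(3) ah(2)] by simp
    then have "m = m' \<and> q + \<phi> s = r0'" by (rule Suc.IH[OF _ b(2)])
    then show ?thesis using 1 a(5) b(1,5) by simp
  qed
qed

lemma comp_series_ext:
  assumes "comp_series \<phi> z m t" shows "comp_series \<phi> x n r \<Longrightarrow> dtri D x y z \<Longrightarrow> comp_series \<phi> y (n + m) (r + t)"
  using assms
proof (induction arbitrary: y rule: comp_series.induct)
  case (zero z)
  then show ?case using comp_series_iso dtri_zero_third by simp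
next
  case (step z0 m t z s)
  obtain w where w: "dtri D x w z0" "dtri D w y s" using dtri_pullback[OF step.prems(2) step.hyps(2)] .
  have y: "y \<in> heart" by (rule heart_ext[OF step.prems(2) comp_series_heart[OF step.prems(1)] step.hyps(4)])
  have "comp_series \<phi> y (Suc (n + m)) (r + t + \<phi> s)"
    by (rule comp_series.step[OF step.IH[OF step.prems(1) w(1)] w(2) step.hyps(3) y])
  then show ?case by (simp add: add.assoc)
qed

text \<open>This is the Jordan-Hoelder theorem: \<open>K(A)\<close> is free on the simple objects.\<close>

lemma additive_from_simples:
  assumes fl: finite_length and inv: "\<And>s s'. simple s \<Longrightarrow> isomorphic D s s' \<Longrightarrow> \<phi> s = \<phi> s'"
  obtains f where "ses_additive A f" "\<And>s. simple s \<Longrightarrow> f s = \<phi> s"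
proof -
  define f where "f x = (THE r. \<exists>n. comp_series \<phi> x n r)" for x
  have ex: "\<exists>n r. comp_series \<phi> x n r" if x: "x \<in> heart" for x
  proof -
    obtain n r where "comp_series (\<lambda>_. 0) x n r" using fl x unfolding finite_length_def by blast
    then show ?thesis using comp_series_any by blast
  qed
  have f: "f x = r" if "comp_series \<phi> x n r" for x n r
    unfolding f_def
  proof (rule the_equality)
    fix r' assume "\<exists>n. comp_series \<phi> x n r'"
    then obtain n' where n': "comp_series \<phi> x n' r'" by blast
    show "r' = r" using comp_series_unique[OF fl inv n' that] by simp
  qed (use that in blast)
  show ?thesis
  proof
    show "ses_additive A f"
      unfolding ses_additive_def ses_iff
    proof (intro allI impI)
      fix a b c assume s: "a \<in> heart \<and> b \<in> heart \<and> c \<in> heart \<and> dtri D a b c"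
      obtain n r where a: "comp_series \<phi> a n r" using ex s by blast
      obtain m t where c: "comp_series \<phi> c m t" using ex s by blast
      have "comp_series \<phi> b (n + m) (r + t)" using comp_series_ext[OF c a] s by blast
      then show "f b = f a + f c" using f a c by metis
    qed
    fix s assume s: "simple s"
    obtain z where z: "zero_object D z" using ex_zero by blast
    have "comp_series \<phi> s (Suc 0) (0 + \<phi> s)"
      by (rule comp_series.step[OF comp_series.zero[OF z] dtri_zero_left[OF _ z] s]) (use simple_heart[OF s] heart_Ob in auto)
    then show "f s = \<phi> s" using f by fastforce
  qed
qed

lemma length_induct_heart:
  assumes fl: finite_length and x: "x \<in> heart" and zero: "\<And>z. zero_object D z \<Longrightarrow> P z"
    and step: "\<And>a b s. \<lbrakk>dtri D a b s; simple s; a \<in> heart; b \<in> heart; P a\<rbrakk> \<Longrightarrow> P b"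
  shows "P x"
proof -
  have "P y" if "comp_series (\<lambda>_. 0) y n r" for y n r
    using that
  proof (induction rule: comp_series.induct)
    case (step a n r b s)
    then show ?case using assms(4) comp_series_heart by blast
  qed (rule zero)
  then show ?thesis using fl x unfolding finite_length_def by blast
qed

lemma simple_quotient:
  assumes fl: finite_length and x: "x \<in> heart" "\<not> zero_object D x"
  obtains a s where "dtri D a x s" "simple s" "a \<in> heart"
proof -
  obtain n r where "comp_series (\<lambda>_. 0) x n r" using fl x unfolding finite_length_def by blast
  then obtain a s where "dtri D a x s" "simple s" "a \<in> heart"
    by (rule comp_series.cases) (use x comp_series_heart in blast)+
  then show ?thesis by (rule that)
qed

lemma simple_subobject:
  assumes fl: finite_length and x: "x \<in> heart" "\<not> zero_object D x"
  obtains s c where "dtri D s x c" "simple s" "c \<in> heart"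
proof -
  obtain z where z: "zero_object D z" using ex_zero by blast
  have "zero_object D x \<or> (\<exists>s c. dtri D s x c \<and> simple s \<and> c \<in> heart)"
  proof (rule length_induct_heart[OF fl x(1)])
    fix a b s
    assume s: "dtri D a b s" "simple s" and IH: "zero_object D a \<or> (\<exists>s c. dtri D s a c \<and> simple s \<and> c \<in> heart)"
    show "zero_object D b \<or> (\<exists>s c. dtri D s b c \<and> simple s \<and> c \<in> heart)"
    proof (cases "zero_object D a")
      case True
      then have "isomorphic D b s" using dtri_zero_first[OF s(1)] by blast
      then have "dtri D s b z" using dtri_of_iso[OF isomorphic_sym z] by blast
      then show ?thesis using s zero_heart[OF z] by blast
    next
      case False
      then obtain s0 c where c: "dtri D s0 a c" "simple s0" "c \<in> heart" using IH by blast
      obtain q where q: "dtri D s0 b q" "dtri D c q s" using dtri_octahedral[OF c(1) s(1)] .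
      have "q \<in> heart" by (rule heart_ext[OF q(2) c(3) simple_heart[OF s(2)]])
      then show ?thesis using q c by blast
    qed
  qed blast
  then show ?thesis using that x by blast
qed

section \<open>Chain conditions and composition series\<close>

lemma monic_Homs: assumes "monic A f" shows "f \<in> Homs D (Dom D f) (Cod D f)" "Dom D f \<in> heart" "Cod D f \<in> heart"
  using assms Arr_full_subcat[of f D heart] by (auto simp: monic_def Homs_def)

lemma monicI:
  assumes "f \<in> Homs D x y" "x \<in> heart" "y \<in> heart"
    and "\<And>w p q. \<lbrakk>w \<in> heart; p \<in> Homs D w x; q \<in> Homs D w x; f \<cdot> p = f \<cdot> q\<rbrakk> \<Longrightarrow> p = q"
  shows "monic A f"
proof -
  have d: "Dom D f = x" "f \<in> Arr A" using assms(1-3) unfolding Arr_full_subcat by (auto simp: Homs_def)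
  show ?thesis
    unfolding monic_def full_subcat_simps d(1)
  proof (intro conjI allI ballI impI d(2))
    fix w p q assume "p \<in> Homs A w x" "q \<in> Homs A w x" "f \<cdot> p = f \<cdot> q"
    then show "p = q" using assms(4)[of w p q] by (simp add: Homs_full_subcat)
  qed
qed

lemma subobj_leD:
  assumes "subobj_le A f g" "monic A f" "monic A g" "Cod D f = x" "Cod D g = x"
  obtains h where "h \<in> Homs D (Dom D f) (Dom D g)" "f = g \<cdot> h" "monic A h"
proof -
  obtain h where h: "h \<in> Homs D (Dom D f) (Dom D g)" "f = g \<cdot> h"
    using assms(1) by (auto simp: subobj_le_def Homs_full_subcat)
  have f: "f \<in> Homs D (Dom D f) x" "Dom D f \<in> heart" "x \<in> heart" and g: "g \<in> Homs D (Dom D g) x" "Dom D g \<in> heart"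
    using monic_Homs[OF assms(2)] monic_Homs[OF assms(3)] assms(4,5) by auto
  have "monic A h"
  proof (rule monicI[OF h(1) f(2) g(2)])
    fix w p q assume p: "w \<in> heart" "p \<in> Homs D w (Dom D f)" "q \<in> Homs D w (Dom D f)" "h \<cdot> p = h \<cdot> q"
    have "g \<cdot> h \<cdot> p = g \<cdot> h \<cdot> q"
      using cmp_assoc[OF p(2) h(1) g(1)] cmp_assoc[OF p(3) h(1) g(1)] p(4) by simp
    then show "p = q" using monicD[OF assms(2) f p(2,3,1)] h(2) by simp
  qed
  then show ?thesis using that h by blast
qed

text \<open>Along an inclusion the value of \<open>l\<close> grows by its value at the quotient, and
  equality makes the quotient zero. As subobjects of \<open>x\<close> have value at most
  \<open>l x\<close>, ascending and descending chains become stationary.\<close>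

lemma length_categoryI:
  assumes add: "ses_additive A \<phi>" and int: "\<And>x. x \<in> heart \<Longrightarrow> \<phi> x = real (l x)"
    and pos: "\<And>x. x \<in> heart \<Longrightarrow> l x = 0 \<Longrightarrow> zero_object D x"
  shows "length_category A"
proof -
  have lext: "l b = l a + l c" if "dtri D a b c" "a \<in> heart" "b \<in> heart" "c \<in> heart" for a b c
    using ses_additiveD[OF add that] int that(2-4) by (metis of_nat_add of_nat_eq_iff)
  have mono: "l (Dom D f) \<le> l (Dom D g)" and eq: "l (Dom D f) = l (Dom D g) \<Longrightarrow> subobj_le A g f"
    if fg: "subobj_le A f g" "monic A f" "monic A g" "Cod D f = x" "Cod D g = x" for f g x
  proof -
    have f: "Dom D f \<in> heart" "x \<in> heart" and g: "g \<in> Homs D (Dom D g) x" "Dom D g \<in> heart"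
      using monic_Homs[OF fg(2)] monic_Homs[OF fg(3)] fg(4,5) by auto
    obtain h where h: "h \<in> Homs D (Dom D f) (Dom D g)" "f = g \<cdot> h" "monic A h" using subobj_leD[OF fg] .
    obtain c g' h' where t: "tria D (Dom D f) (Dom D g) c h g' h'" "c \<in> heart"
      using monic_cone[OF h(3,1) f(1) g(2)] .
    have l: "l (Dom D g) = l (Dom D f) + l c" by (rule lext[OF tria_dtri[OF t(1)] f(1) g(2) t(2)])
    then show "l (Dom D f) \<le> l (Dom D g)" by simp
    assume "l (Dom D f) = l (Dom D g)"
    then have "zero_object D c" using pos[OF t(2)] l by simp
    then obtain k where k: "k \<in> Homs D (Dom D g) (Dom D f)" "h \<cdot> k = Ident D (Dom D g)"
      using iso_arrE[OF tria_zero_third[OF t(1)] h(1)] by blast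
    have "g = f \<cdot> k" using cmp_assoc[OF k(1) h(1) g(1)] h(2) k(2) cmp_ident_right[OF g(1)] by simp
    then show "subobj_le A g f" using k(1) f g by (auto simp: subobj_le_def Homs_full_subcat)
  qed
  have bound: "l (Dom D f) \<le> l x" if mf: "monic A f" "Cod D f = x" for f x
  proof -
    have f: "f \<in> Homs D (Dom D f) x" "Dom D f \<in> heart" "x \<in> heart" using monic_Homs[OF mf(1)] mf(2) by auto
    obtain c g' h' where t: "tria D (Dom D f) x c f g' h'" "c \<in> heart" using monic_cone[OF mf(1) f] .
    then show ?thesis using lext[OF tria_dtri[OF t(1)] f(2,3) t(2)] by simp
  qed
  have "noetherian_category A"
    unfolding noetherian_category_def full_subcat_simps
  proof (intro ballI allI impI)
    fix x and m :: "nat \<Rightarrow> 'm"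
    assume m: "(\<forall>n. monic A (m n) \<and> Cod D (m n) = x) \<and> (\<forall>n. subobj_le A (m n) (m (Suc n)))"
    obtain N where N: "\<And>n. l (Dom D (m n)) \<le> l (Dom D (m N))"
      using ex_has_greatest_nat[of "\<lambda>_. True" 0 "\<lambda>n. l (Dom D (m n))" "Suc (l x)"] bound m by (auto simp: less_Suc_eq_le)
    have up: "l (Dom D (m N)) \<le> l (Dom D (m n))" if "N \<le> n" for n
      using that
    proof (induction n rule: dec_induct)
      case (step n)
      then show ?case using mono[of "m n" "m (Suc n)" x] m by fastforce
    qed simp
    have "subobj_le A (m (Suc n)) (m n)" if "n \<ge> N" for n
      using eq[of "m n" "m (Suc n)" x] m N[of n] N[of "Suc n"] up[OF that] up[of "Suc n"] that
      by (metis le_SucI le_antisym)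
    then show "\<exists>N. \<forall>n \<ge> N. subobj_le A (m (Suc n)) (m n)" by blast
  qed
  moreover have "artinian_category A"
    unfolding artinian_category_def full_subcat_simps
  proof (intro ballI allI impI)
    fix x and m :: "nat \<Rightarrow> 'm"
    assume m: "(\<forall>n. monic A (m n) \<and> Cod D (m n) = x) \<and> (\<forall>n. subobj_le A (m (Suc n)) (m n))"
    obtain N where N: "\<And>n. l (Dom D (m N)) \<le> l (Dom D (m n))"
      using ex_has_least_nat[of "\<lambda>_. True" 0 "\<lambda>n. l (Dom D (m n))"] by auto
    have dn: "l (Dom D (m n)) \<le> l (Dom D (m N))" if "N \<le> n" for n
      using that
    proof (induction n rule: dec_induct)
      case (step n)
      then show ?case using mono[of "m (Suc n)" "m n" x] m by fastforce
    qed simp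
    have "subobj_le A (m n) (m (Suc n))" if "n \<ge> N" for n
      using eq[of "m (Suc n)" "m n" x] m N[of n] N[of "Suc n"] dn[OF that] dn[of "Suc n"] that
      by (metis le_SucI le_antisym)
    then show "\<exists>N. \<forall>n \<ge> N. subobj_le A (m n) (m (Suc n))" by blast
  qed
  ultimately show ?thesis using heart_abelian by (simp add: length_category_def)
qed

text \<open>If no subobject were simple, each non-zero one would properly contain another non-zero
  one; dependent choice would give an infinite descending chain.\<close>

lemma artinian_simple_subobject:
  assumes art: "artinian_category A" and x: "x \<in> heart" "\<not> zero_object D x"
  obtains s c where "dtri D s x c" "simple s" "c \<in> heart"
proof (rule ccontr)
  assume "\<not> thesis"
  then have no: "\<not> (dtri D s x c \<and> simple s \<and> c \<in> heart)" for s c using that by blast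
  define P where "P m \<longleftrightarrow> monic A m \<and> Cod D m = x \<and> \<not> zero_object D (Dom D m)" for m
  have step: "\<exists>m'. P m' \<and> subobj_le A m' m \<and> \<not> subobj_le A m m'" if m: "P m" for m
  proof -
    let ?a = "Dom D m"
    have mm: "monic A m" and nz: "\<not> zero_object D ?a" using m by (auto simp: P_def)
    have h: "m \<in> Homs D ?a x" "?a \<in> heart" using m monic_Homs[OF mm] by (auto simp: P_def)
    obtain c g k where t: "tria D ?a x c m g k" "c \<in> heart" using monic_cone[OF mm h x(1)] .
    then have "\<not> simple ?a" using no tria_dtri by blast
    then obtain i r where ir: "i \<in> heart" "r \<in> heart" "dtri D i ?a r" "\<not> zero_object D i" "\<not> zero_object D r"
      using h nz unfolding simple_def by blast
    obtain j g' k' where j: "tria D i ?a r j g' k'" using ir(3) by (rule dtriE)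
    note jh = triaD(1)[OF j]
    have mj: "monic A j" by (rule tria_monic[OF j ir(1) h(2) ir(2)])
    have mjh: "m \<cdot> j \<in> Homs D i x" by (rule cmp_in[OF jh h(1)])
    then have d: "Dom D (m \<cdot> j) = i" "Cod D (m \<cdot> j) = x" by (auto simp: Homs_def)
    have "monic A (m \<cdot> j)"
    proof (rule monicI[OF mjh ir(1) x(1)])
      fix w p q assume p: "w \<in> heart" "p \<in> Homs D w i" "q \<in> Homs D w i" "m \<cdot> j \<cdot> p = m \<cdot> j \<cdot> q"
      have "m \<cdot> (j \<cdot> p) = m \<cdot> (j \<cdot> q)" using p(4) cmp_assoc[OF p(2) jh h(1)] cmp_assoc[OF p(3) jh h(1)] by simp
      then have "j \<cdot> p = j \<cdot> q" by (rule monicD[OF mm h x(1) cmp_in[OF p(2) jh] cmp_in[OF p(3) jh] p(1)])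
      then show "p = q" by (rule monicD[OF mj jh ir(1) h(2) p(2,3,1)])
    qed
    then have "P (m \<cdot> j)" using d ir by (simp add: P_def)
    moreover have "subobj_le A (m \<cdot> j) m"
      unfolding subobj_le_def full_subcat_simps d(1) using jh ir h by (auto simp: Homs_full_subcat)
    \<comment> \<open>A factorisation would give \<open>j\<close> a right inverse \<open>e\<close>.
      Then the quotient arrow \<open>g'\<close>, which kills \<open>j\<close>, would be zero, and
      with it \<open>r\<close>.\<close>
    moreover have "\<not> subobj_le A m (m \<cdot> j)"
    proof
      assume "subobj_le A m (m \<cdot> j)"
      then obtain e where e: "e \<in> Homs D ?a i" "m = m \<cdot> j \<cdot> e" by (auto simp: subobj_le_def Homs_full_subcat d)
      have ao: "?a \<in> Ob D" using heart_Ob h by blast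
      have je: "j \<cdot> e \<in> Homs D ?a ?a" by (rule cmp_in[OF e(1) jh])
      have "m \<cdot> (j \<cdot> e) = m \<cdot> Ident D ?a" using e(2) cmp_assoc[OF e(1) jh h(1)] cmp_ident_right[OF h(1)] by simp
      then have "j \<cdot> e = Ident D ?a" by (rule monicD[OF mm h x(1) je ident_in[OF ao] h(2)])
      then have "g' = g' \<cdot> j \<cdot> e" using cmp_assoc[OF e(1) jh triaD(2)[OF j]] cmp_ident_right[OF triaD(2)[OF j]] by simp
      then have "g' = Zer D ?a r" using tria_comp_zero[OF j] zer_cmp[OF e(1) triaD(6)[OF j]] by simp
      then have "Ident D r \<cdot> g' = Zer D ?a r" using cmp_ident_left[OF triaD(2)[OF j]] by simp
      then have id: "Ident D r = Zer D r r"
        by (rule epic_part[OF j ident_in[OF triaD(6)[OF j]] _ hom0_heart[OF ir(1,2)]])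
      have "hom0 D r r"
      proof (rule hom0I[OF triaD(6)[OF j] triaD(6)[OF j]])
        fix u assume u: "u \<in> Homs D r r"
        show "u = Zer D r r" using cmp_ident_right[OF u] id cmp_zer[OF u triaD(6)[OF j]] by simp
      qed
      then show False using ir zero_object_iff by blast
    qed
    ultimately show ?thesis by blast
  qed
  have P0: "P (Ident D x)"
  proof -
    have i: "Ident D x \<in> Homs D x x" by (rule ident_in[OF heart_Ob[OF x(1)]])
    have "monic A (Ident D x)"
      by (rule monicI[OF i x(1) x(1)]) (use cmp_ident_left in metis)
    then show ?thesis using i x by (simp add: P_def Homs_def)
  qed
  obtain m where m: "\<And>n. P (m n)" "\<And>n. subobj_le A (m (Suc n)) (m n) \<and> \<not> subobj_le A (m n) (m (Suc n))"
    using dependent_nat_choice[of "\<lambda>_. P" "\<lambda>_ f g. subobj_le A g f \<and> \<not> subobj_le A f g"] P0 step by blast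
  have "\<exists>N. \<forall>n \<ge> N. subobj_le A (m n) (m (Suc n))"
    using art m(1) m(2) x(1) unfolding artinian_category_def full_subcat_simps P_def by blast
  then show False using m(2) by blast
qed

text \<open>If \<open>x\<close> has no composition series, a subobject that has one is proper.
  Adding a simple subobject of the quotient enlarges it, which would produce an infinite ascending
  chain.\<close>

lemma length_category_finite_length: assumes len: "length_category A" shows finite_length
  unfolding finite_length_def
proof (rule ballI, rule ccontr)
  fix x assume x: "x \<in> heart" and no: "\<nexists>n r. comp_series (\<lambda>_. 0) x n r"
  have art: "artinian_category A" and noe: "noetherian_category A" using len by (auto simp: length_category_def)
  define P where "P m \<longleftrightarrow> monic A m \<and> Cod D m = x \<and> (\<exists>n r. comp_series (\<lambda>_. 0) (Dom D m) n r)" for m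
  have step: "\<exists>m'. P m' \<and> subobj_le A m m' \<and> \<not> subobj_le A m' m" if m: "P m" for m
  proof -
    let ?a = "Dom D m"
    have mm: "monic A m" and cs: "\<exists>n r. comp_series (\<lambda>_. 0) ?a n r" using m by (auto simp: P_def)
    have h: "m \<in> Homs D ?a x" "?a \<in> heart" using m monic_Homs[OF mm] by (auto simp: P_def)
    obtain c g k where t: "tria D ?a x c m g k" "c \<in> heart" using monic_cone[OF mm h x] .
    have "\<not> zero_object D c"
      using dtri_zero_third[OF tria_dtri[OF t(1)]] cs no comp_series_iso by blast
    then obtain s d where sd: "dtri D s c d" "simple s" "d \<in> heart"
      using artinian_simple_subobject[OF art t(2)] by blast
    obtain \<sigma> g2 k2 where s: "tria D s c d \<sigma> g2 k2" using sd(1) by (rule dtriE)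
    have sh: "s \<in> heart" by (rule simple_heart[OF sd(2)])
    note T = triaD[OF t(1)] and S = triaD[OF s]
    \<comment> \<open>The enlarged subobject is the preimage in \<open>x\<close> of the simple
      subobject \<open>s\<close> of \<open>c\<close>, obtained as the kernel of the composite
      \<open>x\<close> to \<open>c\<close> to \<open>d\<close>.\<close>
    have gg: "g2 \<cdot> g \<in> Homs D x d" by (rule cmp_in[OF T(2) S(2)])
    obtain M l1 l2 where M: "tria D x d M (g2 \<cdot> g) l1 l2" using tria_ex[OF gg] .
    note Mo = triaD(6)[OF M]
    obtain u v w where "tria D (Sh D ?a) M (Sh D s) u v w"
      using tria_octahedral[OF tria_rotate[OF t(1)] tria_rotate[OF s] M] .
    then have o: "dtri D (Sh D ?a) M (Sh D s)" by (rule tria_dtri)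
    let ?y = "desusp D M"
    note y = desusp[OF Mo]
    have "dtri D (Sh D ?a) (Sh D ?y) (Sh D s)"
      by (rule dtri_iso[OF o isomorphic_refl isomorphic_sym[OF y(2)] isomorphic_refl]) (intro Sh_Ob T S)+
    then have ays: "dtri D ?a ?y s" by (rule dtri_unshift[OF _ T(4) y(1) S(4)])
    have yh: "?y \<in> heart" by (rule heart_ext[OF ays h(2) sh])
    obtain r r' where r: "r \<in> Homs D M (Sh D ?y)" "r' \<in> Homs D (Sh D ?y) M" "r' \<cdot> r = Ident D M" "r \<cdot> r' = Ident D (Sh D ?y)"
      using isomorphic_sym[OF y(2)] by (rule isomorphicE)
    from tria_rotate_back[OF tria_iso_third[OF M r] y(1)]
    obtain m' where m': "tria D ?y x d m' (g2 \<cdot> g) (r \<cdot> l1)" by blast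
    note M' = triaD[OF m']
    have mm': "monic A m'" by (rule tria_monic[OF m' yh x sd(3)])
    have d': "Dom D m' = ?y" "Cod D m' = x" using M'(1) by (auto simp: Homs_def)
    obtain n0 r0 where "comp_series (\<lambda>_. 0) ?a n0 r0" using cs by blast
    from comp_series.step[OF this ays sd(2) yh] have "P m'" using mm' d' by (auto simp: P_def)
    moreover have "subobj_le A m m'"
    proof -
      have "g2 \<cdot> g \<cdot> m = Zer D ?a d"
        using cmp_assoc[OF h(1) T(2) S(2)] tria_comp_zero[OF t(1)] cmp_zer[OF S(2) T(4)] by simp
      then obtain j where "j \<in> Homs D ?a ?y" "m' \<cdot> j = m" using weak_kernel[OF m' h(1)] by blast
      then show ?thesis using h yh unfolding subobj_le_def full_subcat_simps d'(1) by (auto simp: Homs_full_subcat)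
    qed
    \<comment> \<open>Otherwise \<open>g\<close> kills \<open>m'\<close>, hence factors through
      \<open>g2 \<cdot> g\<close>. Cancelling the epimorphism \<open>g\<close> makes
      \<open>g2\<close> split, so its kernel \<open>s\<close> would be zero.\<close>
    moreover have "\<not> subobj_le A m' m"
    proof
      assume "subobj_le A m' m"
      then obtain e where e: "e \<in> Homs D ?y ?a" "m' = m \<cdot> e" by (auto simp: subobj_le_def Homs_full_subcat d')
      have "g \<cdot> m' = Zer D ?y c"
        using e(2) cmp_assoc[OF e(1) h(1) T(2)] tria_comp_zero[OF t(1)] zer_cmp[OF e(1) T(6)] by simp
      then obtain e' where e': "e' \<in> Homs D d c" "e' \<cdot> (g2 \<cdot> g) = g" using weak_cokernel[OF m' T(2)] by blast
      have e'g: "e' \<cdot> g2 \<in> Homs D c c" by (rule cmp_in[OF S(2) e'(1)])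
      have "e' \<cdot> g2 = Ident D c"
      proof (rule right_cancel_test[OF T(2) e'g ident_in[OF T(6)]])
        show "e' \<cdot> g2 \<cdot> g = Ident D c \<cdot> g"
          using cmp_assoc[OF T(2) S(2) e'(1)] e'(2) cmp_ident_left[OF T(2)] by simp
        show "u = Zer D c c" if "u \<in> Homs D c c" "u \<cdot> g = Zer D x c" for u
          by (rule epic_part[OF t(1) that hom0_heart[OF h(2) t(2)]])
      qed
      then have "\<sigma> = e' \<cdot> (g2 \<cdot> \<sigma>)" using cmp_assoc[OF S(1,2) e'(1)] cmp_ident_left[OF S(1)] by simp
      then have "\<sigma> \<cdot> Ident D s = Zer D s c"
        using tria_comp_zero[OF s] cmp_zer[OF e'(1) S(4)] cmp_ident_right[OF S(1)] by simp
      then have id: "Ident D s = Zer D s s"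
        by (rule monic_part[OF s ident_in[OF S(4)] _ hom0_heart[OF sh sd(3)]])
      have "hom0 D s s"
      proof (rule hom0I[OF S(4) S(4)])
        fix u assume u: "u \<in> Homs D s s"
        show "u = Zer D s s" using cmp_ident_right[OF u] id cmp_zer[OF u S(4)] by simp
      qed
      then show False using simple_nonzero[OF sd(2)] zero_object_iff by blast
    qed
    ultimately show ?thesis by blast
  qed
  obtain z where z: "zero_object D z" using ex_zero by blast
  have P0: "P (Zer D z x)"
  proof -
    have zo: "z \<in> heart" "z \<in> Ob D" "x \<in> Ob D" using zero_heart[OF z] heart_Ob x by auto
    have i: "Zer D z x \<in> Homs D z x" by (rule zer_in[OF zo(2,3)])
    have "monic A (Zer D z x)"
      by (rule monicI[OF i zo(1) x]) (use zero_hom0[OF z] heart_Ob hom0D in metis)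
    then show ?thesis using i comp_series.zero[OF z] by (auto simp: P_def Homs_def)
  qed
  obtain m where m: "\<And>n. P (m n)" "\<And>n. subobj_le A (m n) (m (Suc n)) \<and> \<not> subobj_le A (m (Suc n)) (m n)"
    using dependent_nat_choice[of "\<lambda>_. P" "\<lambda>_ f g. subobj_le A f g \<and> \<not> subobj_le A g f"] P0 step by blast
  have "\<exists>N. \<forall>n \<ge> N. subobj_le A (m (Suc n)) (m n)"
    using noe m(1) m(2) x unfolding noetherian_category_def full_subcat_simps P_def by blast
  then show False using m(2) by blast
qed

end

section \<open>Cones, faces and fans\<close>

lemma facesD:
  assumes "\<tau> \<in> faces \<sigma>"
  shows "\<tau> \<subseteq> \<sigma>" "\<tau> \<noteq> {}" "\<And>a b. a \<in> \<sigma> \<Longrightarrow> b \<in> \<sigma> \<Longrightarrow> a + b \<in> \<tau> \<longleftrightarrow> a \<in> \<tau> \<and> b \<in> \<tau>"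
  using assms by (auto simp: faces_def)

lemma facesI:
  "\<lbrakk>\<tau> \<subseteq> \<sigma>; \<tau> \<noteq> {}; \<And>a b. \<lbrakk>a \<in> \<sigma>; b \<in> \<sigma>\<rbrakk> \<Longrightarrow> a + b \<in> \<tau> \<longleftrightarrow> a \<in> \<tau> \<and> b \<in> \<tau>\<rbrakk> \<Longrightarrow> \<tau> \<in> faces \<sigma>"
  by (simp add: faces_def)

text \<open>Only sums occur in the definition of a face. A real multiple is reached by splitting an
  integral one: \<open>n\<close> times \<open>x\<close> is \<open>c\<close> times \<open>x\<close>
  plus another vector of \<sigma>, and faces contain the summands of their elements.\<close>

lemma face_convex_cone: assumes "convex_cone \<sigma>" "\<tau> \<in> faces \<sigma>" shows "convex_cone \<tau>"
  unfolding convex_cone_iff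
proof (intro conjI ballI allI impI)
  note s = assms(1)[unfolded convex_cone_iff] and t = facesD[OF assms(2)]
  obtain a where a: "a \<in> \<tau>" "a \<in> \<sigma>" using t(1,2) by blast
  show z: "0 \<in> \<tau>" using t(3)[OF a(2), of 0] s a by simp
  show add: "x + y \<in> \<tau>" if "x \<in> \<tau>" "y \<in> \<tau>" for x y using t that by blast
  fix x and c :: real assume x: "x \<in> \<tau>" and c: "0 \<le> c"
  have x': "x \<in> \<sigma>" using x t(1) by blast
  obtain n :: nat where n: "c \<le> real n" using real_arch_simple by blast
  have "real k *\<^sub>R x \<in> \<tau>" for k by (induction k) (use add x z in \<open>auto simp: algebra_simps\<close>)
  moreover have "real n *\<^sub>R x = c *\<^sub>R x + (real n - c) *\<^sub>R x" by (simp flip: scaleR_add_left)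
  moreover have "c *\<^sub>R x \<in> \<sigma>" "(real n - c) *\<^sub>R x \<in> \<sigma>" using s x' c n by auto
  ultimately show "c *\<^sub>R x \<in> \<tau>" using t(3) by metis
qed

lemma face_trans: assumes "\<tau> \<in> faces \<sigma>" "\<rho> \<in> faces \<tau>" shows "\<rho> \<in> faces \<sigma>"
proof (rule facesI)
  show "\<rho> \<subseteq> \<sigma>" "\<rho> \<noteq> {}" using facesD[OF assms(1)] facesD[OF assms(2)] by auto
  fix a b assume "a \<in> \<sigma>" "b \<in> \<sigma>"
  then show "a + b \<in> \<rho> \<longleftrightarrow> a \<in> \<rho> \<and> b \<in> \<rho>"
    using facesD[OF assms(1)] facesD[OF assms(2)] by (meson subsetD)
qed

lemma face_Int:
  assumes "convex_cone \<sigma>" "\<tau> \<in> faces \<sigma>" "\<rho> \<in> faces \<sigma>" shows "\<tau> \<inter> \<rho> \<in> faces \<sigma>"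
proof (rule facesI)
  show "\<tau> \<inter> \<rho> \<noteq> {}"
    using convex_cone_contains_0[OF face_convex_cone[OF assms(1,2)]] convex_cone_contains_0[OF face_convex_cone[OF assms(1,3)]] by blast
qed (use facesD[OF assms(2)] facesD[OF assms(3)] in auto)

lemma face_restrict: assumes "\<rho> \<in> faces \<sigma>" "\<rho> \<subseteq> \<tau>" "\<tau> \<subseteq> \<sigma>" shows "\<rho> \<in> faces \<tau>"
proof (rule facesI[OF assms(2) facesD(2)[OF assms(1)]])
  fix a b assume "a \<in> \<tau>" "b \<in> \<tau>"
  then have "a \<in> \<sigma>" "b \<in> \<sigma>" using assms(3) by auto
  then show "a + b \<in> \<rho> \<longleftrightarrow> a \<in> \<rho> \<and> b \<in> \<rho>" by (rule facesD(3)[OF assms(1)])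
qed

lemma face_self: "convex_cone \<sigma> \<Longrightarrow> \<sigma> \<in> faces \<sigma>"
  using convex_cone_contains_0 convex_cone_add by (intro facesI) auto

text \<open>It suffices to control intersections of the generating cones. Faces of \<open>C\<close>
  and \<open>C'\<close> are both cut down to faces of the common face of \<open>C\<close> and
  \<open>C'\<close>, where they can be intersected, and transitivity returns to either cone.\<close>

lemma fan_of_cones:
  assumes c: "\<And>C. C \<in> \<C> \<Longrightarrow> convex_cone C \<and> C \<subseteq> W"
    and i: "\<And>C C'. C \<in> \<C> \<Longrightarrow> C' \<in> \<C> \<Longrightarrow> C \<inter> C' \<in> faces C"
  shows "fan_in W (\<Union>C \<in> \<C>. faces C)"
  unfolding fan_in_def
proof (intro conjI ballI)
  fix \<sigma> assume "\<sigma> \<in> (\<Union>C \<in> \<C>. faces C)"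
  then obtain C where C: "C \<in> \<C>" "\<sigma> \<in> faces C" by blast
  show "convex_cone \<sigma>" by (rule face_convex_cone[OF _ C(2)]) (use c C in blast)
  show "\<sigma> \<subseteq> W" using facesD(1)[OF C(2)] c C(1) by blast
  show "faces \<sigma> \<subseteq> (\<Union>C \<in> \<C>. faces C)" using face_trans[OF C(2)] C(1) by blast
next
  have main: "\<sigma> \<inter> \<tau> \<in> faces \<sigma>" if C: "C \<in> \<C>" "\<sigma> \<in> faces C" and C': "C' \<in> \<C>" "\<tau> \<in> faces C'" for \<sigma> \<tau> C C'
  proof -
    have cc: "convex_cone C" "convex_cone C'" using c C C' by auto
    have M: "C \<inter> C' \<in> faces C" "C \<inter> C' \<in> faces C'" using i[OF C(1) C'(1)] i[OF C'(1) C(1)] by (auto simp: Int_commute)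
    have "\<sigma> \<inter> (C \<inter> C') \<in> faces (C \<inter> C')" by (rule face_restrict[OF face_Int[OF cc(1) C(2) M(1)]]) auto
    moreover have "\<tau> \<inter> (C \<inter> C') \<in> faces (C \<inter> C')" by (rule face_restrict[OF face_Int[OF cc(2) C'(2) M(2)]]) auto
    ultimately have "\<sigma> \<inter> (C \<inter> C') \<inter> (\<tau> \<inter> (C \<inter> C')) \<in> faces (C \<inter> C')"
      by (rule face_Int[OF face_convex_cone[OF cc(1) M(1)]])
    moreover have "\<sigma> \<inter> (C \<inter> C') \<inter> (\<tau> \<inter> (C \<inter> C')) = \<sigma> \<inter> \<tau>" using facesD(1)[OF C(2)] facesD(1)[OF C'(2)] by blast
    ultimately have "\<sigma> \<inter> \<tau> \<in> faces C" using face_trans[OF M(1)] by simp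
    then show ?thesis by (rule face_restrict) (use facesD(1)[OF C(2)] in auto)
  qed
  fix \<sigma> \<tau> assume "\<sigma> \<in> (\<Union>C \<in> \<C>. faces C)" "\<tau> \<in> (\<Union>C \<in> \<C>. faces C)"
  then obtain C C' where C: "C \<in> \<C>" "\<sigma> \<in> faces C" "C' \<in> \<C>" "\<tau> \<in> faces C'" by blast
  show "\<sigma> \<inter> \<tau> \<in> faces \<sigma>" by (rule main[OF C])
  show "\<sigma> \<inter> \<tau> \<in> faces \<tau>" using main[OF C(3,4,1,2)] by (simp add: Int_commute)
qed

text \<open>A real vector space is not a finite union of proper subspaces. On the line
  \<open>y + c *\<^sub>R x\<close> with \<open>x\<close> in \<open>P\<close> and \<open>y\<close>
  outside, the subspace \<open>P\<close> is never met and every other member at most once.\<close>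

lemma subspaces_avoid:
  fixes W :: "'a::real_vector set"
  assumes "finite \<P>" "subspace W" "\<And>P. P \<in> \<P> \<Longrightarrow> subspace P \<and> \<not> W \<subseteq> P"
  shows "\<exists>x \<in> W. \<forall>P \<in> \<P>. x \<notin> P"
  using assms(1,3)
proof (induction rule: finite_induct)
  case empty
  then show ?case using subspace_0[OF assms(2)] by blast
next
  case (insert P \<P>)
  then obtain x where x: "x \<in> W" "\<And>Q. Q \<in> \<P> \<Longrightarrow> x \<notin> Q" by blast
  show ?case
  proof (cases "x \<in> P")
    case True
    have P: "subspace P" using insert.prems by blast
    obtain y where y: "y \<in> W" "y \<notin> P" using insert.prems by blast
    have one: "finite {c :: real. y + c *\<^sub>R x \<in> Q}" if Q: "Q \<in> \<P>" for Q
    proof -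
      have sQ: "subspace Q" using insert.prems Q by blast
      have uniq: "c = d" if "y + c *\<^sub>R x \<in> Q" "y + d *\<^sub>R x \<in> Q" for c d
      proof (rule ccontr)
        assume "c \<noteq> d"
        have "(c - d) *\<^sub>R x \<in> Q" using subspace_diff[OF sQ that] by (simp add: algebra_simps)
        then have "(1 / (c - d)) *\<^sub>R ((c - d) *\<^sub>R x) \<in> Q" by (rule subspace_scale[OF sQ])
        then show False using \<open>c \<noteq> d\<close> x(2)[OF Q] by simp
      qed
      show ?thesis
      proof (cases "\<exists>c. y + c *\<^sub>R x \<in> Q")
        case True
        then obtain c where "y + c *\<^sub>R x \<in> Q" by blast
        then have "{c. y + c *\<^sub>R x \<in> Q} \<subseteq> {c}" using uniq by blast
        then show ?thesis by (rule finite_subset) simp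
      qed simp
    qed
    have "finite (\<Union>Q \<in> \<P>. {c :: real. y + c *\<^sub>R x \<in> Q})" using one insert.hyps by blast
    then obtain c :: real where c: "c \<notin> (\<Union>Q \<in> \<P>. {c. y + c *\<^sub>R x \<in> Q})"
      using ex_new_if_finite[OF infinite_UNIV_char_0] by blast
    have "y + c *\<^sub>R x \<notin> P"
    proof
      assume "y + c *\<^sub>R x \<in> P"
      then have "y + c *\<^sub>R x - c *\<^sub>R x \<in> P" by (rule subspace_diff[OF P _ subspace_scale[OF P True]])
      then show False using y by simp
    qed
    moreover have "y + c *\<^sub>R x \<in> W" using subspace_add[OF assms(2) y(1) subspace_scale[OF assms(2) x(1)]] .
    ultimately show ?thesis using c by blast
  qed (use x in blast)
qed

section \<open>Torsion classes and the heart fan\<close>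

context bounded_t
begin

lemma ex_zero_heart: obtains z where "zero_object D z" "z \<in> heart"
  using ex_zero zero_heart by blast

lemma hom0_kernel:
  assumes "dtri D a b c" "hom0 D x b" "x \<in> heart" "c \<in> heart" shows "hom0 D x a"
proof -
  have "hom0 D x (desusp D c)" using hom0_UV' V_desusp assms(3,4) by blast
  then show ?thesis using hom0_mid_right[OF dtri_back[OF assms(1)]] assms(2) by blast
qed

lemma hom0_cokernel:
  assumes "dtri D a b c" "hom0 D b x" "a \<in> heart" "x \<in> heart" shows "hom0 D c x"
  using hom0_mid_left[OF dtri_rotate[OF assms(1)] assms(2) hom0_heart[OF assms(3,4)]] .

lemma heart_kernel_ext:
  assumes "dtri D a b q" "dtri D i q r" "a \<in> heart" "i \<in> heart"
  obtains m where "dtri D a m i" "dtri D m b r" "m \<in> heart"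
  using dtri_pullback[OF assms(1,2)] heart_ext assms(3,4) by metis

lemma perpD: "f \<in> perp A T \<Longrightarrow> T \<subseteq> heart \<Longrightarrow> f \<in> heart" "\<lbrakk>f \<in> perp A T; T \<subseteq> heart; t \<in> T\<rbrakk> \<Longrightarrow> hom0 D t f"
  by (auto simp: perp_heart)

lemma torsion_sub: "torsion_class A T \<Longrightarrow> T \<subseteq> heart"
  by (simp add: torsion_class_heart)

lemma torsion_memI:
  "\<lbrakk>torsion_class A T; h \<in> heart; \<And>f. f \<in> perp A T \<Longrightarrow> hom0 D h f\<rbrakk> \<Longrightarrow> h \<in> T"
  by (simp add: torsion_class_heart)

lemma torsion_decomp:
  assumes "torsion_class A T" "h \<in> heart"
  obtains t f where "t \<in> T" "f \<in> perp A T" "dtri D t h f" "t \<in> heart" "f \<in> heart"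
proof -
  obtain t f where "t \<in> T" "f \<in> perp A T" "dtri D t h f" using assms unfolding torsion_class_heart by blast
  then show ?thesis using that torsion_sub[OF assms(1)] perpD(1) by blast
qed

lemma torsion_quotient:
  assumes T: "torsion_class A T" and t: "dtri D a t q" "t \<in> T" "a \<in> heart" "q \<in> heart" shows "q \<in> T"
  by (rule torsion_memI[OF T t(4)]) (meson hom0_cokernel perpD torsion_sub[OF T] t)

lemma torsion_ext:
  assumes T: "torsion_class A T" and t: "dtri D a b c" "a \<in> T" "c \<in> T" shows "b \<in> T"
proof (rule torsion_memI[OF T])
  note s = torsion_sub[OF T]
  show "b \<in> heart" using heart_ext[OF t(1)] t s by blast
  show "hom0 D b f" if "f \<in> perp A T" for f
    by (rule hom0_mid_left[OF t(1) perpD(2)[OF that s t(2)] perpD(2)[OF that s t(3)]])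
qed

lemma torsion_zero: assumes "torsion_class A T" "zero_object D z" shows "z \<in> T"
  by (rule torsion_memI[OF assms(1) zero_heart[OF assms(2)]])
    (meson zero_hom0[OF assms(2)] heart_Ob perpD(1) torsion_sub[OF assms(1)])

lemma torsion_iso_closed: assumes T: "torsion_class A T" and "t \<in> T" "isomorphic D t t'" shows "t' \<in> T"
proof -
  obtain z where z: "zero_object D z" using ex_zero by blast
  show ?thesis
    by (rule torsion_ext[OF T dtri_of_iso[OF assms(3) z] assms(2) torsion_zero[OF T z]])
qed

lemma perp_subobject:
  assumes T: "T \<subseteq> heart" and f: "dtri D s f c" "f \<in> perp A T" "s \<in> heart" "c \<in> heart" shows "s \<in> perp A T"
  using hom0_kernel[OF f(1) _ _ f(4)] f(3) perpD[OF f(2) T] T unfolding perp_heart[OF T] by blast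

lemma torsion_perp_zero: "\<lbrakk>T \<subseteq> heart; x \<in> T; x \<in> perp A T\<rbrakk> \<Longrightarrow> zero_object D x"
  using perpD zero_object_iff by blast

lemma image_object:
  assumes "\<not> hom0 D x y" "x \<in> heart" "y \<in> heart"
  obtains k i r where "dtri D k x i" "dtri D i y r" "k \<in> heart" "i \<in> heart" "r \<in> heart" "\<not> zero_object D i"
proof -
  obtain \<phi> where "\<phi> \<in> Homs D x y" "\<phi> \<noteq> Zer D x y"
    using assms hom0I[OF heart_Ob heart_Ob] by blast
  then show ?thesis using image[OF _ _ assms(2,3)] that by metis
qed

section \<open>Torsion classes in a heart of finite length\<close>

lemma length_function:
  assumes fl: finite_length
  obtains l :: "'o \<Rightarrow> nat" where "ses_additive A (\<lambda>x. real (l x))" "\<And>x. \<lbrakk>x \<in> heart; l x = 0\<rbrakk> \<Longrightarrow> zero_object D x"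
    "\<And>a b c. \<lbrakk>dtri D a b c; a \<in> heart; b \<in> heart; c \<in> heart\<rbrakk> \<Longrightarrow> l b = l a + l c"
proof -
  obtain f where f: "ses_additive A f" "\<And>s. simple s \<Longrightarrow> f s = 1"
    using additive_from_simples[OF fl, of "\<lambda>_. 1"] by auto
  have n: "f x \<in> \<nat> \<and> (f x = 0 \<longrightarrow> zero_object D x)" if "x \<in> heart" for x
  proof (rule length_induct_heart[OF fl that])
    show "f z \<in> \<nat> \<and> (f z = 0 \<longrightarrow> zero_object D z)" if "zero_object D z" for z
      using ses_additive_zero[OF f(1) that] that by simp
    fix a b s assume s: "dtri D a b s" "simple s" "a \<in> heart" "b \<in> heart" and IH: "f a \<in> \<nat> \<and> (f a = 0 \<longrightarrow> zero_object D a)"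
    have "f b = f a + 1" using ses_additiveD[OF f(1) s(1,3,4) simple_heart[OF s(2)]] f(2)[OF s(2)] by simp
    moreover have "0 \<le> f a" using IH Nats_altdef2 by (auto elim: Nats_cases)
    ultimately show "f b \<in> \<nat> \<and> (f b = 0 \<longrightarrow> zero_object D b)" using IH by simp
  qed
  define l where "l x = nat \<lfloor>f x\<rfloor>" for x
  have l: "real (l x) = f x" if "x \<in> heart" for x using n[OF that] by (auto simp: l_def elim: Nats_cases)
  have add: "l b = l a + l c" if "dtri D a b c" "a \<in> heart" "b \<in> heart" "c \<in> heart" for a b c
    using ses_additiveD[OF f(1) that] l that(2-4) by (metis of_nat_add of_nat_eq_iff)
  show ?thesis
  proof (rule that)
    show "ses_additive A (\<lambda>x. real (l x))"
      unfolding ses_additive_def ses_iff using add by (metis of_nat_add)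
    show "zero_object D x" if "x \<in> heart" "l x = 0" for x using n l that by fastforce
  qed (rule add)
qed

text \<open>Decompose \<open>h\<close> by a subobject from \<open>T\<close> of maximal length.\<close>

lemma torsion_classI:
  assumes fl: finite_length and T: "T \<subseteq> heart" and z: "\<And>z. zero_object D z \<Longrightarrow> z \<in> T"
    and quot: "\<And>a t q. \<lbrakk>dtri D a t q; t \<in> T; a \<in> heart; q \<in> heart\<rbrakk> \<Longrightarrow> q \<in> T"
    and ext: "\<And>a b c. \<lbrakk>dtri D a b c; a \<in> T; c \<in> T\<rbrakk> \<Longrightarrow> b \<in> T"
  shows "torsion_class A T"
proof -
  obtain l :: "'o \<Rightarrow> nat" where l: "\<And>x. \<lbrakk>x \<in> heart; l x = 0\<rbrakk> \<Longrightarrow> zero_object D x"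
    "\<And>a b c. \<lbrakk>dtri D a b c; a \<in> heart; b \<in> heart; c \<in> heart\<rbrakk> \<Longrightarrow> l b = l a + l c"
    using length_function[OF fl] by metis
  have dec: "\<exists>t \<in> T. \<exists>f \<in> perp A T. dtri D t h f" if h: "h \<in> heart" for h
  proof -
    define P where "P t \<longleftrightarrow> t \<in> T \<and> (\<exists>q \<in> heart. dtri D t h q)" for t
    obtain z0 where z0: "zero_object D z0" "z0 \<in> heart" by (rule ex_zero_heart)
    have "P z0" using dtri_zero_left[OF heart_Ob[OF h] z0(1)] z[OF z0(1)] h by (auto simp: P_def)
    moreover have "\<forall>t. P t \<longrightarrow> l t < Suc (l h)" using l(2) T h by (force simp: P_def)
    ultimately obtain t where t: "P t" "\<And>y. P y \<Longrightarrow> l y \<le> l t" using ex_has_greatest_nat[of P z0 l "Suc (l h)"] by blast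
    then obtain q where q: "t \<in> T" "q \<in> heart" "dtri D t h q" by (auto simp: P_def)
    have th: "t \<in> heart" using q T by blast
    have "hom0 D x q" if x: "x \<in> T" for x
    proof (rule ccontr)
      assume "\<not> hom0 D x q"
      then obtain k i r where i: "dtri D k x i" "dtri D i q r" "k \<in> heart" "i \<in> heart" "r \<in> heart" "\<not> zero_object D i"
        using image_object x T q(2) by blast
      \<comment> \<open>The preimage \<open>m\<close> of a non-zero torsion subobject
        \<open>i\<close> of \<open>q\<close> would be a torsion subobject of \<open>h\<close> longer
        than \<open>t\<close>.\<close>
      obtain m where m: "dtri D t m i" "dtri D m h r" "m \<in> heart" using heart_kernel_ext[OF q(3) i(2) th i(4)] .
      have "i \<in> T" by (rule quot[OF i(1) x i(3,4)])
      then have "P m" using ext[OF m(1) q(1)] m i(5) by (auto simp: P_def)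
      then have "l m \<le> l t" by (rule t(2))
      then have "l i = 0" using l(2)[OF m(1) th m(3) i(4)] by simp
      then show False using l(1) i by blast
    qed
    then have "q \<in> perp A T" using q by (simp add: perp_heart[OF T])
    then show ?thesis using q by blast
  qed
  show ?thesis
    unfolding torsion_class_heart
  proof (intro conjI ballI impI T)
    fix h assume h: "h \<in> heart" "\<forall>f \<in> perp A T. hom0 D h f"
    obtain t f where tf: "t \<in> T" "f \<in> perp A T" "dtri D t h f" using dec[OF h(1)] by blast
    have "f \<in> heart" "t \<in> heart" using tf T perpD(1) by auto
    then have "hom0 D f f" using hom0_cokernel[OF tf(3)] h(2) tf(2) by blast
    then have "zero_object D f" using zero_object_iff by blast
    then show "h \<in> T" using ext[OF tf(3) tf(1)] z by blast
  qed (use dec in blast)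
qed

lemma stability_torsion_class:
  assumes fl: finite_length and g: "ses_additive A g"
  obtains T where "torsion_class A T" "\<And>t. t \<in> T \<Longrightarrow> 0 \<le> g t" "\<And>f. f \<in> perp A T \<Longrightarrow> g f \<le> 0"
proof -
  obtain l :: "'o \<Rightarrow> nat" where l: "\<And>x. \<lbrakk>x \<in> heart; l x = 0\<rbrakk> \<Longrightarrow> zero_object D x"
    "\<And>a b c. \<lbrakk>dtri D a b c; a \<in> heart; b \<in> heart; c \<in> heart\<rbrakk> \<Longrightarrow> l b = l a + l c"
    using length_function[OF fl] by metis
  define T where "T = {h \<in> heart. \<forall>a \<in> heart. \<forall>q \<in> heart. dtri D a h q \<longrightarrow> 0 \<le> g q}"
  have T: "T \<subseteq> heart" by (auto simp: T_def)
  obtain z0 where z0: "zero_object D z0" "z0 \<in> heart" by (rule ex_zero_heart)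
  have Tpos: "0 \<le> g t" if "t \<in> T" for t
    using that dtri_zero_left[OF heart_Ob z0(1)] z0(2) by (auto simp: T_def)
  have quot: "q \<in> T" if "dtri D a t q" "t \<in> T" "a \<in> heart" "q \<in> heart" for a t q
  proof -
    have "0 \<le> g r" if b: "b \<in> heart" "r \<in> heart" "dtri D b q r" for b r
    proof -
      obtain m where "dtri D a m b" "dtri D m t r" "m \<in> heart"
        using heart_kernel_ext[OF \<open>dtri D a t q\<close> b(3) \<open>a \<in> heart\<close> b(1)] .
      then show ?thesis using \<open>t \<in> T\<close> b by (auto simp: T_def)
    qed
    then show ?thesis using that by (simp add: T_def)
  qed
  have "torsion_class A T"
  proof (rule torsion_classI[OF fl T _ quot])
    fix z assume z: "zero_object D z"
    have "g q = 0" if "a \<in> heart" "q \<in> heart" "dtri D a z q" for a q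
      using dtri_zero_mid_heart(2)[OF that(3,1,2) z] ses_additive_zero[OF g] by blast
    then show "z \<in> T" using zero_heart[OF z] by (simp add: T_def)
  next
    fix t x t' assume x: "dtri D t x t'" "t \<in> T" "t' \<in> T"
    have h: "t \<in> heart" "t' \<in> heart" "x \<in> heart" using x T heart_ext[OF x(1)] by blast+
    \<comment> \<open>If Hom(\<open>t\<close>, \<open>q\<close>) is zero, then \<open>q\<close> is
      already a quotient of \<open>t'\<close>. Otherwise the image \<open>i\<close> of
      \<open>t\<close> in \<open>q\<close> lies in \<open>T\<close>, and the shorter quotient
      \<open>r\<close> of \<open>q\<close> is again one of \<open>x\<close>.\<close>
    have "0 \<le> g q" if "a \<in> heart" "q \<in> heart" "dtri D a x q" for a q
      using that
    proof (induction "l q" arbitrary: a q rule: less_induct)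
      case less
      show ?case
      proof (cases "hom0 D t q")
        case True
        obtain j where j: "dtri D t a j" "dtri D j t' q" using dtri_lift[OF less.prems(3) x(1) True] .
        have "j \<in> heart" using U_cone[OF j(1)] V_fibre[OF j(2)] h less.prems by blast
        then show ?thesis using x(3) j less.prems by (auto simp: T_def)
      next
        case False
        then obtain k i r where i: "dtri D k t i" "dtri D i q r" "k \<in> heart" "i \<in> heart" "r \<in> heart" "\<not> zero_object D i"
          using image_object h(1) less.prems(2) by blast
        obtain m where m: "dtri D a m i" "dtri D m x r" "m \<in> heart"
          using heart_kernel_ext[OF less.prems(3) i(2) less.prems(1) i(4)] .
        have "l q = l i + l r" "l i \<noteq> 0" using l i less.prems by blast+
        then have "0 \<le> g r" using less.hyps[OF _ m(3) i(5) m(2)] by simp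
        moreover have "0 \<le> g i" by (rule Tpos[OF quot[OF i(1) x(2) i(3,4)]])
        ultimately show ?thesis using ses_additiveD[OF g i(2,4) less.prems(2) i(5)] by simp
      qed
    qed
    then show "x \<in> T" using h by (simp add: T_def)
  qed
  moreover have "g f \<le> 0" if "f \<in> perp A T" for f
    using that
  proof (induction "l f" arbitrary: f rule: less_induct)
    case less
    show ?case
    proof (rule ccontr)
      assume pos: "\<not> g f \<le> 0"
      have fh: "f \<in> heart" by (rule perpD(1)[OF less.prems T])
      \<comment> \<open>Being torsion-free and non-zero, \<open>f\<close> has a quotient
        \<open>q\<close> with negative value. Its kernel \<open>a\<close> is torsion-free, shorter,
        and would have a positive value, against the induction hypothesis.\<close>
      have "f \<notin> T" using torsion_perp_zero[OF T _ less.prems] ses_additive_zero[OF g] pos by fastforce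
      then obtain a q where aq: "a \<in> heart" "q \<in> heart" "dtri D a f q" "g q < 0" using fh by (force simp: T_def)
      have a: "a \<in> perp A T" by (rule perp_subobject[OF T aq(3) less.prems aq(1,2)])
      have "\<not> zero_object D q" using ses_additive_zero[OF g] aq(4) by fastforce
      then have "l a < l f" using l(1)[OF aq(2)] l(2)[OF aq(3,1) fh aq(2)] by fastforce
      then have "g a \<le> 0" by (rule less.hyps[OF _ a])
      then show False using ses_additiveD[OF g aq(3,1) fh aq(2)] aq(4) pos by simp
    qed
  qed
  ultimately show ?thesis using that Tpos by blast
qed

end

section \<open>Intersections of heart cones and completeness of the fan\<close>

context separated_heart
begin

abbreviation C :: "'a set \<Rightarrow> (('a \<Rightarrow>\<^sub>0 int) set \<Rightarrow> real) set" where
  "C K \<equiv> heart_cone D heart K"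

lemma intermediate_Ob: "K \<in> intermediate_hearts D heart \<Longrightarrow> k \<in> K \<Longrightarrow> k \<in> Ob D"
  using bounded_t.heart_Ob[OF bounded_t.intro] triangulated_category_axioms
  by (force simp: intermediate_hearts_def bounded_heart_def bounded_t_axioms_def)

lemma ev_0: "x \<in> Ob D \<Longrightarrow> ev 0 x = 0"
  using ev_scale[OF subspace_0[OF subspace_W], of x 0] by simp

lemma C_convex_cone: assumes "K \<in> intermediate_hearts D heart" shows "convex_cone (C K)" "C K \<subseteq> W"
proof -
  note Ob = intermediate_Ob[OF assms]
  show "C K \<subseteq> W" unfolding heart_cone_eq[OF assms] by blast
  show "convex_cone (C K)"
    unfolding convex_cone_iff heart_cone_eq[OF assms]
    using subspace_0[OF subspace_W] subspace_add[OF subspace_W] subspace_scale[OF subspace_W] ev_0 ev_add ev_scale Ob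
    by simp
qed

text \<open>If \<open>v, w \<in> C(K)\<close> and \<open>v + w \<in> C(L)\<close>, then \<open>v\<close> vanishes on the \<open>K\<close>-torsion-free quotient of an
  \<open>L\<close>-torsion object, because both \<open>v\<close> and \<open>w\<close> are non-positive there while their sum is
  non-negative.\<close>

lemma C_Int_face:
  assumes K: "K \<in> intermediate_hearts D heart" and L: "L \<in> intermediate_hearts D heart"
  shows "C K \<inter> C L \<in> faces (C K)"
proof (rule facesI)
  note cK = C_convex_cone[OF K] and cL = C_convex_cone[OF L]
  show "C K \<inter> C L \<noteq> {}" using convex_cone_contains_0 cK cL by blast
  note TK = intermediate_torsion(1)[OF K] and TL = intermediate_torsion(1)[OF L]
  have main: "v \<in> C L" if v: "v \<in> C K" and w: "w \<in> C K" and vw: "v + w \<in> C L" for v w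
  proof -
    have W: "v \<in> W" "w \<in> W" using v w cK by auto
    have vK: "\<And>t. t \<in> heart \<inter> K \<Longrightarrow> 0 \<le> ev v t" "\<And>f. f \<in> perp A (heart \<inter> K) \<Longrightarrow> ev v f \<le> 0"
      and wK: "\<And>t. t \<in> heart \<inter> K \<Longrightarrow> 0 \<le> ev w t" "\<And>f. f \<in> perp A (heart \<inter> K) \<Longrightarrow> ev w f \<le> 0"
      using v w unfolding heart_cone_torsion[OF K] by auto
    have L': "\<And>t. t \<in> heart \<inter> L \<Longrightarrow> 0 \<le> ev (v + w) t" "\<And>f. f \<in> perp A (heart \<inter> L) \<Longrightarrow> ev (v + w) f \<le> 0"
      using vw unfolding heart_cone_torsion[OF L] by auto
    have "0 \<le> ev v t" if t: "t \<in> heart \<inter> L" for t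
    proof -
      obtain a f where af: "a \<in> heart \<inter> K" "f \<in> perp A (heart \<inter> K)" "dtri D a t f" "a \<in> heart" "f \<in> heart"
        using torsion_decomp[OF TK, of t] t by blast
      have "f \<in> heart \<inter> L" by (rule torsion_quotient[OF TL af(3) t af(4,5)])
      then have "0 \<le> ev v f" using L'(1)[of f] ev_add[OF W heart_Ob[OF af(5)]] wK(2)[OF af(2)] by simp
      then show ?thesis using vK(1)[OF af(1)] tri_additiveD[OF ev(1)[OF W(1)] af(3)] by simp
    qed
    moreover have "ev v f \<le> 0" if f: "f \<in> perp A (heart \<inter> L)" for f
    proof -
      have fh: "f \<in> heart" using f by (simp add: perp_def)
      obtain t b where tb: "t \<in> heart \<inter> K" "b \<in> perp A (heart \<inter> K)" "dtri D t f b" "t \<in> heart" "b \<in> heart"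
        using torsion_decomp[OF TK fh] .
      have "t \<in> perp A (heart \<inter> L)" by (rule perp_subobject[OF Int_lower1 tb(3) f tb(4,5)])
      then have "ev v t \<le> 0" using L'(2)[of t] ev_add[OF W heart_Ob[OF tb(4)]] wK(1)[OF tb(1)] by simp
      then show ?thesis using vK(2)[OF tb(2)] tri_additiveD[OF ev(1)[OF W(1)] tb(3)] by simp
    qed
    ultimately show ?thesis unfolding heart_cone_torsion[OF L] using W by simp
  qed
  fix v w assume vw: "v \<in> C K" "w \<in> C K"
  show "v + w \<in> C K \<inter> C L \<longleftrightarrow> v \<in> C K \<inter> C L \<and> w \<in> C K \<inter> C L"
  proof
    assume "v + w \<in> C K \<inter> C L"
    then have "v + w \<in> C L" "w + v \<in> C L" by (auto simp: add.commute)
    then show "v \<in> C K \<inter> C L \<and> w \<in> C K \<inter> C L" using main vw by blast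
  next
    assume "v \<in> C K \<inter> C L \<and> w \<in> C K \<inter> C L"
    then show "v + w \<in> C K \<inter> C L" using convex_cone_add[OF cK(1)] convex_cone_add[OF cL(1)] by blast
  qed
qed blast

theorem heart_fan_is_fan: "fan_in W (heart_fan D heart)"
proof -
  have "heart_fan D heart = (\<Union>\<sigma> \<in> C ` intermediate_hearts D heart. faces \<sigma>)" by (simp add: heart_fan_def)
  moreover have "fan_in W (\<Union>\<sigma> \<in> C ` intermediate_hearts D heart. faces \<sigma>)"
  proof (rule fan_of_cones)
    fix \<sigma> assume "\<sigma> \<in> C ` intermediate_hearts D heart"
    then obtain K where "K \<in> intermediate_hearts D heart" "\<sigma> = C K" by blast
    then show "convex_cone \<sigma> \<and> \<sigma> \<subseteq> W" using C_convex_cone[of K] by simp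
  next
    fix \<sigma> \<tau> assume "\<sigma> \<in> C ` intermediate_hearts D heart" "\<tau> \<in> C ` intermediate_hearts D heart"
    then obtain K L where "K \<in> intermediate_hearts D heart" "\<sigma> = C K" "L \<in> intermediate_hearts D heart" "\<tau> = C L" by blast
    then show "\<sigma> \<inter> \<tau> \<in> faces \<sigma>" using C_Int_face[of K L] by simp
  qed
  ultimately show ?thesis by simp
qed

text \<open>Each inequality evaluates at a single class and is closed for pointwise convergence. If
  \<open>v\<close> and \<open>- v\<close> both satisfy all of them, then \<open>v\<close> vanishes
  on the classes of heart objects, which determine it.\<close>

theorem heart_cone_self:
  "C heart = {v \<in> W. \<forall>h \<in> heart. 0 \<le> v (K0_class A h)}"
  "convex_cone (C heart)" "closedin (top_of_set W) (C heart)" "strictly_convex (C heart)"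
proof -
  show e: "C heart = {v \<in> W. \<forall>h \<in> heart. 0 \<le> v (K0_class A h)}"
    unfolding heart_cone_eq[OF heart_intermediate] using ev(2) by auto
  show "convex_cone (C heart)" by (rule C_convex_cone[OF heart_intermediate])
  have "closed {v :: ('a \<Rightarrow>\<^sub>0 int) set \<Rightarrow> real. 0 \<le> v X}" for X
    by (intro closed_Collect_le continuous_on_const continuous_on_product_coordinates)
  then have "closed (\<Inter>h \<in> heart. {v :: ('a \<Rightarrow>\<^sub>0 int) set \<Rightarrow> real. 0 \<le> v (K0_class A h)})"
    by (intro closed_INT ballI)
  moreover have "C heart = W \<inter> (\<Inter>h \<in> heart. {v. 0 \<le> v (K0_class A h)})" unfolding e by blast
  ultimately show "closedin (top_of_set W) (C heart)" using closedin_closed by blast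
  show "strictly_convex (C heart)"
    unfolding strictly_convex_def
  proof (intro allI impI)
    fix S :: "(('a \<Rightarrow>\<^sub>0 int) set \<Rightarrow> real) set" assume S: "subspace S \<and> S \<subseteq> C heart"
    have "v = 0" if v: "v \<in> S" for v
    proof (rule W_eqI)
      have m: "- v \<in> S" using S v subspace_neg by blast
      then show vW: "v \<in> W" "0 \<in> W" using S v e subspace_0[OF subspace_W] by auto
      fix h assume h: "h \<in> heart"
      have "0 \<le> ev v h" "0 \<le> ev (- v) h" using S v m h unfolding heart_cone_eq[OF heart_intermediate] by auto
      moreover have "ev (- v) h = - ev v h" using ev_scale[OF vW(1) heart_Ob[OF h], of "- 1"] by simp
      ultimately show "ev v h = ev 0 h" using ev_0[OF heart_Ob[OF h]] by simp
    qed
    then show "S = {0}" using S subspace_0 by blast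
  qed
qed

theorem heart_fan_complete: assumes fl: finite_length shows "complete_fan_in W (heart_fan D heart)"
proof -
  have "v \<in> \<Union> (heart_fan D heart)" if v: "v \<in> W" for v
  proof -
    have "ses_additive A (ev v)" using ev(1)[OF v] by (simp add: ses_additive_def ses_iff tri_additive_def)
    then obtain T where T: "torsion_class A T" "\<And>t. t \<in> T \<Longrightarrow> 0 \<le> ev v t" "\<And>f. f \<in> perp A T \<Longrightarrow> ev v f \<le> 0"
      using stability_torsion_class[OF fl] by blast
    obtain K where K: "K \<in> intermediate_hearts D heart" "heart \<inter> K = T" using torsion_intermediate[OF T(1)] .
    have "v \<in> C K" unfolding heart_cone_torsion[OF K(1)] K(2) using v T by blast
    then show ?thesis using face_self[OF C_convex_cone(1)[OF K(1)]] K(1) by (auto simp: heart_fan_def)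
  qed
  moreover have "\<Union> (heart_fan D heart) \<subseteq> W" using heart_fan_is_fan by (auto simp: fan_in_def)
  ultimately show ?thesis using heart_fan_is_fan by (auto simp: complete_fan_in_def)
qed

end

section \<open>Cones of hearts of finite length\<close>

text \<open>The coefficients of \<open>N \<Sum>S\<close> with respect to \<open>Bs\<close> may be rounded without leaving the interior of the
  cone over \<open>S\<close>, if \<open>N\<close> is large.\<close>

lemma integral_interior:
  fixes C :: "'a::real_vector set"
  assumes Bs: "finite Bs" "Bs \<subseteq> span C" "C \<subseteq> span Bs"
  obtains S and m :: "'a \<Rightarrow> real" and n :: "'a \<Rightarrow> int" where "finite S" "S \<subseteq> C" "Bs \<subseteq> span S"
    "\<And>a. a \<in> S \<Longrightarrow> 0 < m a" "(\<Sum>a \<in> S. m a *\<^sub>R a) = (\<Sum>b \<in> Bs. of_int (n b) *\<^sub>R b)"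
proof -
  have "\<exists>S. finite S \<and> S \<subseteq> C \<and> b \<in> span S" if "b \<in> Bs" for b
  proof -
    have "b \<in> span C" using Bs(2) that by blast
    then obtain S r where S: "finite S" "S \<subseteq> C" and b: "b = (\<Sum>a \<in> S. r a *\<^sub>R a)" unfolding span_explicit by blast
    have "b \<in> span S" unfolding b by (intro span_sum span_scale span_base)
    then show ?thesis using S by blast
  qed
  then obtain S where S: "\<And>b. b \<in> Bs \<Longrightarrow> finite (S b) \<and> S b \<subseteq> C \<and> b \<in> span (S b)" by metis
  let ?S = "\<Union>b \<in> Bs. S b"
  have fin: "finite ?S" and sub: "?S \<subseteq> C" using S Bs(1) by auto
  have spn: "Bs \<subseteq> span ?S" using S span_mono[of "S _" ?S] by blast
  have "\<exists>q. b = (\<Sum>a \<in> ?S. q a *\<^sub>R a)" if "b \<in> Bs" for b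
    using spn that unfolding span_finite[OF fin] by blast
  then obtain q where q: "\<And>b. b \<in> Bs \<Longrightarrow> b = (\<Sum>a \<in> ?S. q b a *\<^sub>R a)" by metis
  have "\<Sum>?S \<in> span Bs" by (rule span_sum) (use sub Bs(3) in blast)
  then obtain c where c: "\<Sum>?S = (\<Sum>b \<in> Bs. c b *\<^sub>R b)" unfolding span_finite[OF Bs(1)] by blast
  \<comment> \<open>Rounding subtracts from the weight of \<open>a\<close> a combination of the
    numbers \<open>q b a\<close> with coefficients in [0, 1), hence at most \<open>N - 1\<close>.
    The weights \<open>m a\<close> stay positive.\<close>
  define N where "N = 1 + (\<Sum>b \<in> Bs. \<Sum>a \<in> ?S. \<bar>q b a\<bar>)"
  define m where "m a = N - (\<Sum>b \<in> Bs. frac (N * c b) * q b a)" for a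
  have pos: "0 < m a" if a: "a \<in> ?S" for a
  proof -
    have "(\<Sum>b \<in> Bs. frac (N * c b) * q b a) \<le> (\<Sum>b \<in> Bs. \<Sum>a \<in> ?S. \<bar>q b a\<bar>)"
    proof (rule sum_mono)
      fix b
      have "frac (N * c b) * q b a \<le> \<bar>frac (N * c b)\<bar> * \<bar>q b a\<bar>" by (metis abs_ge_self abs_mult)
      also have "\<dots> \<le> 1 * \<bar>q b a\<bar>"
        by (rule mult_right_mono) (use frac_lt_1[of "N * c b"] frac_ge_0[of "N * c b"] in auto)
      also have "\<dots> \<le> (\<Sum>a \<in> ?S. \<bar>q b a\<bar>)" using member_le_sum[OF a _ fin, of "\<lambda>a. \<bar>q b a\<bar>"] by simp
      finally show "frac (N * c b) * q b a \<le> (\<Sum>a \<in> ?S. \<bar>q b a\<bar>)" .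
    qed
    then show ?thesis by (simp add: m_def N_def)
  qed
  have 1: "(\<Sum>a \<in> ?S. (\<Sum>b \<in> Bs. frac (N * c b) * q b a) *\<^sub>R a) = (\<Sum>b \<in> Bs. frac (N * c b) *\<^sub>R b)"
  proof -
    have "(\<Sum>a \<in> ?S. (\<Sum>b \<in> Bs. frac (N * c b) * q b a) *\<^sub>R a) = (\<Sum>a \<in> ?S. \<Sum>b \<in> Bs. (frac (N * c b) * q b a) *\<^sub>R a)"
      by (simp only: scaleR_sum_left)
    also have "\<dots> = (\<Sum>b \<in> Bs. \<Sum>a \<in> ?S. (frac (N * c b) * q b a) *\<^sub>R a)" by (rule sum.swap)
    also have "\<dots> = (\<Sum>b \<in> Bs. frac (N * c b) *\<^sub>R b)"
    proof (rule sum.cong[OF refl])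
      fix b assume b: "b \<in> Bs"
      have "(\<Sum>a \<in> ?S. (frac (N * c b) * q b a) *\<^sub>R a) = frac (N * c b) *\<^sub>R (\<Sum>a \<in> ?S. q b a *\<^sub>R a)"
        by (simp only: scaleR_sum_right scaleR_scaleR)
      then show "(\<Sum>a \<in> ?S. (frac (N * c b) * q b a) *\<^sub>R a) = frac (N * c b) *\<^sub>R b" using q[OF b] by simp
    qed
    finally show ?thesis .
  qed
  have 2: "(\<Sum>a \<in> ?S. N *\<^sub>R a) = (\<Sum>b \<in> Bs. (N * c b) *\<^sub>R b)"
    using c by (simp only: scaleR_sum_right[symmetric] scaleR_scaleR[symmetric])
  have "(\<Sum>a \<in> ?S. m a *\<^sub>R a) = (\<Sum>a \<in> ?S. N *\<^sub>R a) - (\<Sum>a \<in> ?S. (\<Sum>b \<in> Bs. frac (N * c b) * q b a) *\<^sub>R a)"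
    by (simp only: m_def scaleR_diff_left sum_subtractf)
  also have "\<dots> = (\<Sum>b \<in> Bs. (N * c b - frac (N * c b)) *\<^sub>R b)"
    unfolding 1 2 by (simp only: scaleR_diff_left sum_subtractf)
  also have "\<dots> = (\<Sum>b \<in> Bs. of_int \<lfloor>N * c b\<rfloor> *\<^sub>R b)" by (simp add: frac_def)
  finally show ?thesis using that[OF fin sub spn, of m "\<lambda>b. \<lfloor>N * c b\<rfloor>"] pos by blast
qed

context bounded_t
begin

lemma subspace_ev_kernel: "x \<in> Ob D \<Longrightarrow> subspace {v \<in> W. ev v x = 0}"
  using subspace_0[OF subspace_W] subspace_add[OF subspace_W] subspace_scale[OF subspace_W] ev_add ev_scale
    ev_scale[OF subspace_0[OF subspace_W], of x 0]
  by (simp add: subspace_def)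

lemma ev_sum: assumes "x \<in> Ob D" "f ` I \<subseteq> W" shows "ev (\<Sum>i \<in> I. c i *\<^sub>R f i) x = (\<Sum>i \<in> I. c i * ev (f i) x)"
proof -
  have z: "ev 0 x = 0" using ev_scale[OF subspace_0[OF subspace_W] assms(1), of 0] by simp
  have "(\<Sum>i \<in> I. c i *\<^sub>R f i) \<in> W \<and> ev (\<Sum>i \<in> I. c i *\<^sub>R f i) x = (\<Sum>i \<in> I. c i * ev (f i) x)"
    using assms(2)
  proof (induction I rule: infinite_finite_induct)
    case (insert i I)
    have i: "f i \<in> W" "c i *\<^sub>R f i \<in> W" using insert.prems subspace_scale[OF subspace_W] by auto
    have IH: "(\<Sum>i \<in> I. c i *\<^sub>R f i) \<in> W" "ev (\<Sum>i \<in> I. c i *\<^sub>R f i) x = (\<Sum>i \<in> I. c i * ev (f i) x)"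
      using insert.IH insert.prems by auto
    have "ev (c i *\<^sub>R f i + (\<Sum>i \<in> I. c i *\<^sub>R f i)) x = c i * ev (f i) x + (\<Sum>i \<in> I. c i * ev (f i) x)"
      unfolding ev_add[OF i(2) IH(1) assms(1)] IH(2) ev_scale[OF i(1) assms(1)] ..
    then show ?case
      unfolding sum.insert[OF insert.hyps] using subspace_add[OF subspace_W i(2) IH(1)] by blast
  qed (use z subspace_0[OF subspace_W] in auto)
  then show ?thesis by blast
qed

text \<open>The length of objects is itself a functional in \<open>W\<close>, and it is non-zero at
  every non-zero object.\<close>

lemma W_vanishing_zero:
  assumes fl: finite_length and x: "x \<in> heart" "\<And>v. v \<in> W \<Longrightarrow> ev v x = 0" shows "zero_object D x"
proof -
  obtain l :: "'o \<Rightarrow> nat" where l: "ses_additive A (\<lambda>x. real (l x))" "\<And>x. \<lbrakk>x \<in> heart; l x = 0\<rbrakk> \<Longrightarrow> zero_object D x"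
    using length_function[OF fl] by metis
  obtain \<psi> where \<psi>: "tri_additive \<psi>" "\<And>k. k \<in> heart \<Longrightarrow> \<psi> k = real (l k)" using extend_additive[OF l(1)] by blast
  obtain v where "v \<in> W" "\<And>x. x \<in> Ob D \<Longrightarrow> ev v x = \<psi> x" using W_of_tri_additive[OF \<psi>(1)] by blast
  then have "real (l x) = 0" using x \<psi>(2) heart_Ob by metis
  then show ?thesis using l(2) x by simp
qed

end

section \<open>A heart K between H and H[1] and its cone\<close>

locale tilted_heart = free_heart D U V + B: bounded_t D U' V'
  for D :: "('o, 'm, 'x) triangulated_data_scheme" and U V U' V' +
  assumes inter: "U' \<inter> V' \<in> intermediate_hearts D (U \<inter> V)"
begin

abbreviation "tors \<equiv> heart \<inter> B.heart"
abbreviation "tfree \<equiv> perp A tors"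

lemma tors: "torsion_class A tors"
  by (rule intermediate_torsion(1)[OF inter])

lemma tfree: "f \<in> tfree \<longleftrightarrow> f \<in> heart \<and> Sh D f \<in> B.heart"
  using intermediate_torsion(2)[OF inter] by blast

lemma decomp_K: assumes "k \<in> B.heart"
  obtains f t where "f \<in> tfree" "t \<in> tors" "dtri D (Sh D f) k t" "f \<in> heart" "t \<in> heart" "Sh D f \<in> B.heart" "t \<in> B.heart"
proof -
  obtain f t where "f \<in> tfree" "t \<in> tors" "dtri D (Sh D f) k t" using intermediate_torsion(3)[OF inter] assms by blast
  then show ?thesis using that tfree by blast
qed

lemma ev_decomp:
  assumes "dtri D (Sh D f) k t" "f \<in> heart" "v \<in> W" shows "ev v k = ev v t - ev v f"
  using tri_additiveD[OF ev(1)[OF assms(3)] assms(1)] tri_additive_Sh[OF ev(1)[OF assms(3)] heart_Ob[OF assms(2)]] by simp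

text \<open>An additive function on K is extended to D and then restricted to H. This makes it
  possible to prescribe functionals on K although \<open>W\<close> is the dual of K(H).\<close>

lemma extend_W: assumes "ses_additive B.A \<phi>" obtains v where "v \<in> W" "\<And>k. k \<in> B.heart \<Longrightarrow> ev v k = \<phi> k"
proof -
  obtain \<psi> where \<psi>: "tri_additive \<psi>" "\<And>k. k \<in> B.heart \<Longrightarrow> \<psi> k = \<phi> k" using B.extend_additive[OF assms] by blast
  obtain v where "v \<in> W" "\<And>x. x \<in> Ob D \<Longrightarrow> ev v x = \<psi> x" using W_of_tri_additive[OF \<psi>(1)] by blast
  then show ?thesis using that \<psi>(2) B.heart_Ob by metis
qed

lemma ev_ses_additive: "v \<in> W \<Longrightarrow> ses_additive B.A (ev v)"
  using ev(1)[of v] by (simp add: ses_additive_def B.ses_iff tri_additive_def)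

lemma in_cone: "v \<in> C B.heart \<longleftrightarrow> v \<in> W \<and> (\<forall>k \<in> B.heart. 0 \<le> ev v k)"
  unfolding heart_cone_eq[OF inter] by blast

text \<open>A combination of the spanning set \<open>S\<close> with positive coefficients vanishes
  at an object of K only if all of \<open>S\<close>, hence all of \<open>W\<close>, does. That it
  also has integral coordinates in \<open>Bs\<close> makes its values integers.\<close>

lemma integral_positive:
  assumes fl: finite_length and sp: "W \<subseteq> span (C B.heart)"
  obtains w where "w \<in> C B.heart" "\<And>k. k \<in> B.heart \<Longrightarrow> ev w k \<in> \<int>"
    "\<And>k. \<lbrakk>k \<in> B.heart; ev w k = 0\<rbrakk> \<Longrightarrow> zero_object D k"
proof -
  obtain Bs where Bs: "finite Bs" "Bs \<subseteq> W" "\<And>\<beta> X. \<beta> \<in> Bs \<Longrightarrow> \<beta> X \<in> \<int>" "W \<subseteq> span Bs"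
    using free_dual_basis[OF free K0_group] unfolding heart_dual_def by metis
  have CW: "C B.heart \<subseteq> W" using in_cone by blast
  obtain S m n where S: "finite S" "S \<subseteq> C B.heart" "Bs \<subseteq> span S" "\<And>a. a \<in> S \<Longrightarrow> 0 < (m a :: real)"
    and e: "(\<Sum>a \<in> S. m a *\<^sub>R a) = (\<Sum>b \<in> Bs. of_int (n b) *\<^sub>R b)"
    using integral_interior[OF Bs(1) subset_trans[OF Bs(2) sp] subset_trans[OF CW Bs(4)]] by blast
  define w where "w = (\<Sum>a \<in> S. m a *\<^sub>R a)"
  have SW: "S \<subseteq> W" using S(2) CW by blast
  have ww: "w \<in> W" unfolding w_def by (intro subspace_sum[OF subspace_W] subspace_scale[OF subspace_W]) (use SW in blast)
  have w1: "ev w k = (\<Sum>a \<in> S. m a * ev a k)" if "k \<in> Ob D" for k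
    using ev_sum[OF that, of "\<lambda>a. a" S m] SW by (simp add: w_def)
  have w2: "ev w k = (\<Sum>b \<in> Bs. of_int (n b) * ev b k)" if "k \<in> Ob D" for k
    using ev_sum[OF that, of "\<lambda>a. a" Bs "\<lambda>b. of_int (n b)"] Bs(2) by (simp add: w_def e)
  have pos: "0 \<le> ev a k" if "a \<in> S" "k \<in> B.heart" for a k using S(2) that in_cone by blast
  have wpos: "0 \<le> ev w k" if k: "k \<in> B.heart" for k
    unfolding w1[OF B.heart_Ob[OF k]] by (intro sum_nonneg mult_nonneg_nonneg) (use pos S(4) k less_imp_le in blast)+
  have vanish: "ev v k = 0" if k: "k \<in> B.heart" "ev w k = 0" and v: "v \<in> W" for k v
  proof -
    have ko: "k \<in> Ob D" by (rule B.heart_Ob[OF k(1)])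
    have "0 \<le> m a * ev a k" if "a \<in> S" for a
      by (rule mult_nonneg_nonneg[OF less_imp_le[OF S(4)[OF that]] pos[OF that k(1)]])
    then have z: "m a * ev a k = 0" if "a \<in> S" for a
      using k(2) w1[OF ko] sum_nonneg_eq_0_iff[OF S(1), of "\<lambda>a. m a * ev a k"] that by simp
    have "ev a k = 0" if "a \<in> S" for a using z[OF that] S(4)[OF that] by simp
    then have "S \<subseteq> {v \<in> W. ev v k = 0}" using SW by blast
    then have "span S \<subseteq> {v \<in> W. ev v k = 0}" by (rule span_minimal[OF _ subspace_ev_kernel[OF ko]])
    then have "span Bs \<subseteq> {v \<in> W. ev v k = 0}" using S(3) by (intro span_minimal[OF _ subspace_ev_kernel[OF ko]]) blast
    then show ?thesis using v Bs(4) by blast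
  qed
  show ?thesis
  proof
    show "w \<in> C B.heart" using ww wpos in_cone by blast
    fix k assume k: "k \<in> B.heart"
    obtain f t where ft: "f \<in> tfree" "t \<in> tors" "dtri D (Sh D f) k t" "f \<in> heart" "t \<in> heart" "Sh D f \<in> B.heart" "t \<in> B.heart"
      using decomp_K[OF k] .
    have "ev b h \<in> \<int>" if "b \<in> Bs" "h \<in> heart" for b h
      using ev(2)[of b h] that Bs(2,3) by force
    then have "ev w t \<in> \<int>" "ev w f \<in> \<int>"
      unfolding w2[OF heart_Ob[OF ft(4)]] w2[OF heart_Ob[OF ft(5)]] using ft by (auto intro!: Ints_sum Ints_mult)
    then show "ev w k \<in> \<int>" unfolding ev_decomp[OF ft(3,4) ww] by (rule Ints_diff)
    assume z: "ev w k = 0"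
    have Shf: "ev w (Sh D f) = - ev w f" by (rule tri_additive_Sh[OF ev(1)[OF ww] heart_Ob[OF ft(4)]])
    \<comment> \<open>Both \<open>t\<close> and \<open>f[1]\<close> belong to K, so two non-negative
      values add up to zero. This moves the question to \<open>t\<close> and \<open>f\<close> in H,
      where finite length is known.\<close>
    have "ev w t = 0" "ev w (Sh D f) = 0"
      using z wpos[OF ft(6)] wpos[OF ft(7)] ev_decomp[OF ft(3,4) ww] Shf by simp_all
    then have "ev v t = 0 \<and> ev v (Sh D f) = 0" if "v \<in> W" for v using vanish ft that by blast
    then have "ev v t = 0 \<and> ev v f = 0" if "v \<in> W" for v
      using tri_additive_Sh[OF ev(1)[OF that] heart_Ob[OF ft(4)]] that by simp
    then have "zero_object D t" "zero_object D f" using W_vanishing_zero[OF fl] ft(4,5) by blast+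
    then have "zero_object D t" "zero_object D (Sh D f)" using zero_Sh_iff heart_Ob ft(4) by blast+
    then show "zero_object D k" using dtri_zero_first[OF ft(3)] zero_object_iso isomorphic_sym by blast
  qed
qed

lemma spanning_length:
  assumes fl: finite_length and sp: "W \<subseteq> span (C B.heart)" shows "length_category B.A"
proof -
  obtain w where w: "w \<in> C B.heart" "\<And>k. k \<in> B.heart \<Longrightarrow> ev w k \<in> \<int>" "\<And>k. \<lbrakk>k \<in> B.heart; ev w k = 0\<rbrakk> \<Longrightarrow> zero_object D k"
    using integral_positive[OF fl sp] by blast
  have l: "ev w k = real (nat \<lfloor>ev w k\<rfloor>)" if "k \<in> B.heart" for k
    using w(1) w(2)[OF that] that unfolding in_cone by (auto elim!: Ints_cases)
  show ?thesis
  proof (rule B.length_categoryI[OF ev_ses_additive l])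
    show "w \<in> W" using w(1) in_cone by blast
    fix k assume k: "k \<in> B.heart" "nat \<lfloor>ev w k\<rfloor> = 0"
    have "ev w k = 0" by (subst l[OF k(1)]) (simp add: k(2))
    then show "zero_object D k" by (rule w(3)[OF k(1)])
  qed
qed

lemma cone_simples:
  assumes fl: B.finite_length and v: "v \<in> W" and s: "\<And>s. B.simple s \<Longrightarrow> 0 \<le> ev v s" shows "v \<in> C B.heart"
  unfolding in_cone
proof (intro conjI ballI v)
  fix k assume "k \<in> B.heart"
  then show "0 \<le> ev v k"
  proof (rule B.length_induct_heart[OF fl])
    show "0 \<le> ev v z" if "zero_object D z" for z using tri_additive_zero[OF ev(1)[OF v] that] by simp
    show "0 \<le> ev v b" if "dtri D a b t" "B.simple t" "0 \<le> ev v a" for a b t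
      using tri_additiveD[OF ev(1)[OF v] that(1)] s[OF that(2)] that(3) by simp
  qed
qed

lemma W_from_simples:
  assumes fl: B.finite_length and inv: "\<And>s s'. B.simple s \<Longrightarrow> isomorphic D s s' \<Longrightarrow> \<phi> s = \<phi> s'"
  obtains v where "v \<in> W" "\<And>s. B.simple s \<Longrightarrow> ev v s = \<phi> s"
proof -
  obtain f where f: "ses_additive B.A f" "\<And>s. B.simple s \<Longrightarrow> f s = \<phi> s" using B.additive_from_simples[OF fl, of \<phi>] inv by blast
  obtain v where v: "v \<in> W" "\<And>k. k \<in> B.heart \<Longrightarrow> ev v k = f k" using extend_W[OF f(1)] by blast
  show ?thesis by (rule that[OF v(1)]) (simp add: v(2)[OF B.simple_heart] f(2))
qed

text \<open>Every \<open>v\<close> is the difference of \<open>p\<close>, its positive part on the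
  simple objects, and \<open>p - v\<close>; both lie in the cone.\<close>

lemma length_spanning: assumes fl: B.finite_length shows "W \<subseteq> span (C B.heart)"
proof
  fix v assume v: "v \<in> W"
  have inv: "ev v s = ev v s'" if "B.simple s" "isomorphic D s s'" for s s'
    using tri_additive_iso[OF ev(1)[OF v] that(2)] .
  obtain p where p: "p \<in> W" "\<And>s. B.simple s \<Longrightarrow> ev p s = max 0 (ev v s)"
    using W_from_simples[OF fl, of "\<lambda>s. max 0 (ev v s)"] inv by auto
  have pv: "p - v \<in> W" by (rule subspace_diff[OF subspace_W p(1) v])
  have "ev (p - v) s = ev p s - ev v s" if "s \<in> Ob D" for s
    using ev_add[OF pv v that] by simp
  then have "p - v \<in> C B.heart" by (intro cone_simples[OF fl pv]) (use p(2) B.simple_heart B.heart_Ob in force)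
  moreover have "p \<in> C B.heart" by (rule cone_simples[OF fl p(1)]) (use p(2) in simp)
  ultimately have "p - (p - v) \<in> span (C B.heart)" by (intro span_diff span_base)
  then show "v \<in> span (C B.heart)" by simp
qed

lemma simple_cases:
  assumes "B.simple s" obtains f where "f \<in> tfree" "isomorphic D s (Sh D f)" | "s \<in> tors"
proof -
  obtain f t where ft: "f \<in> tfree" "t \<in> tors" "dtri D (Sh D f) s t" "f \<in> heart" "t \<in> heart" "Sh D f \<in> B.heart" "t \<in> B.heart"
    using decomp_K[OF B.simple_heart[OF assms]] .
  have "zero_object D (Sh D f) \<or> zero_object D t" using assms ft unfolding B.simple_def by blast
  then show ?thesis
  proof
    assume "zero_object D (Sh D f)"
    then have "isomorphic D s t" using dtri_zero_first[OF ft(3)] by blast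
    then show ?thesis using that(2) torsion_iso_closed[OF tors ft(2)] isomorphic_sym by blast
  next
    assume "zero_object D t"
    then have "isomorphic D s (Sh D f)" using dtri_zero_third[OF ft(3)] isomorphic_sym by blast
    then show ?thesis using that(1) ft by blast
  qed
qed

lemma hom0_Sh_heart: "f \<in> heart \<Longrightarrow> h \<in> heart \<Longrightarrow> hom0 D (Sh D f) h"
  using hom0_UV by blast

text \<open>An object of \<open>L\<close> outside the torsion class has a non-zero torsion-free
  quotient \<open>f\<close>, again in \<open>L\<close>. A simple quotient of \<open>f[1]\<close> in
  K is not in H, because Hom(H[1], H) = 0, so it has the form \<open>s[1]\<close>. In the triangle
  on \<open>f\<close>, \<open>s\<close>, \<open>b\<close> neither \<open>f\<close> nor
  \<open>b\<close> maps to the torsion-free class of \<open>L\<close>, so \<open>s\<close> is in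
  \<open>L\<close>.\<close>

lemma simple_tfree_above:
  assumes fl: B.finite_length and L: "torsion_class A L" "tors \<subset> L"
  obtains s where "s \<in> tfree" "s \<in> L" "B.simple (Sh D s)"
proof -
  note Lh = torsion_sub[OF L(1)]
  obtain t where t: "t \<in> L" "t \<notin> tors" using L(2) by blast
  have th: "t \<in> heart" using t Lh by blast
  obtain a f where af: "a \<in> tors" "f \<in> tfree" "dtri D a t f" "a \<in> heart" "f \<in> heart"
    using torsion_decomp[OF tors th] .
  have fL: "f \<in> L" by (rule torsion_quotient[OF L(1) af(3) t(1) af(4,5)])
  have "\<not> zero_object D f" using dtri_zero_third[OF af(3)] torsion_iso_closed[OF tors af(1)] t(2) by blast
  then have nz: "\<not> zero_object D (Sh D f)" using zero_Sh_iff heart_Ob af(5) by blast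
  have Shf: "Sh D f \<in> B.heart" using af(2) tfree by blast
  obtain b \<sigma> where b: "dtri D b (Sh D f) \<sigma>" "B.simple \<sigma>" "b \<in> B.heart" using B.simple_quotient[OF fl Shf nz] .
  have \<sigma>: "\<not> hom0 D (Sh D f) \<sigma>"
    using B.hom0_cokernel[OF b(1) _ b(3) B.simple_heart[OF b(2)]] B.simple_nonzero[OF b(2)] zero_object_iff by blast
  then have "\<sigma> \<notin> tors" using hom0_Sh_heart af(5) by blast
  then obtain s where s: "s \<in> tfree" "isomorphic D \<sigma> (Sh D s)" using simple_cases[OF b(2)] by blast
  have sh: "s \<in> heart" using s(1) tfree by blast
  have bo: "b \<in> Ob D" by (rule B.heart_Ob[OF b(3)])
  have "dtri D b (Sh D f) (Sh D s)"
    by (rule dtri_iso[OF b(1) isomorphic_refl[OF bo] isomorphic_refl s(2)]) (use Shf B.heart_Ob in blast)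
  then have "dtri D (Sh D f) (Sh D s) (Sh D b)" by (rule dtri_rotate)
  then have fsb: "dtri D f s b" using dtri_unshift heart_Ob af(5) sh bo by blast
  obtain f' t' where ft: "f' \<in> tfree" "t' \<in> tors" "dtri D (Sh D f') b t'" "f' \<in> heart" "t' \<in> heart" "Sh D f' \<in> B.heart" "t' \<in> B.heart"
    using decomp_K[OF b(3)] .
  have "s \<in> L"
  proof (rule torsion_memI[OF L(1) sh])
    fix g assume g: "g \<in> perp A L"
    have gh: "g \<in> heart" and gL: "\<And>x. x \<in> L \<Longrightarrow> hom0 D x g" using perpD[OF g Lh] by blast+
    have "t' \<in> L" using ft(2) L(2) by blast
    then have "hom0 D b g" using hom0_mid_left[OF ft(3) hom0_Sh_heart[OF ft(4) gh] gL] by blast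
    then show "hom0 D s g" by (rule hom0_mid_left[OF fsb gL[OF fL]])
  qed
  then show ?thesis using that s(1) B.simple_iso[OF b(2) s(2)] by blast
qed

text \<open>The two cones impose opposite signs on an object that is torsion for one heart and
  torsion-free for the other.\<close>

lemma ev_zero_on_overlap:
  assumes L: "L \<in> intermediate_hearts D heart" and w: "w \<in> C B.heart" "w \<in> C L"
  shows "g \<in> tors \<Longrightarrow> g \<in> perp A (heart \<inter> L) \<Longrightarrow> ev w g = 0"
    and "g \<in> tfree \<Longrightarrow> g \<in> heart \<inter> L \<Longrightarrow> ev w g = 0"
  using w unfolding heart_cone_torsion[OF L] heart_cone_torsion[OF inter] by force+

text \<open>Some \<open>w \<in> C(K)\<close> is strictly positive on the non-zero objects of \<open>K\<close>. As also \<open>w \<in> C(L)\<close>, it vanishes on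
  the \<open>L\<close>-torsion-free quotient of a \<open>K\<close>-torsion object and vice versa, so these quotients are zero.\<close>

lemma spanning_unique:
  assumes fl: finite_length and sp: "W \<subseteq> span (C B.heart)" and L: "L \<in> intermediate_hearts D heart"
    and sub: "C B.heart \<subseteq> C L"
  shows "L = B.heart"
proof -
  obtain w where wC: "w \<in> C B.heart" and "\<And>k. k \<in> B.heart \<Longrightarrow> ev w k \<in> \<int>"
    and w: "\<And>k. \<lbrakk>k \<in> B.heart; ev w k = 0\<rbrakk> \<Longrightarrow> zero_object D k"
    using integral_positive[OF fl sp] by blast
  have wL: "w \<in> C L" and wW: "w \<in> W" using wC sub in_cone by blast+
  note TL = intermediate_torsion(1)[OF L]
  have "t \<in> heart \<inter> L" if t: "t \<in> tors" for t
  proof -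
    have th: "t \<in> heart" using t by blast
    obtain a g where g: "a \<in> heart \<inter> L" "g \<in> perp A (heart \<inter> L)" "dtri D a t g" "a \<in> heart" "g \<in> heart"
      using torsion_decomp[OF TL th] .
    have gt: "g \<in> tors" by (rule torsion_quotient[OF tors g(3) t g(4,5)])
    have "zero_object D g" by (rule w[OF _ ev_zero_on_overlap(1)[OF L wC wL gt g(2)]]) (use gt in blast)
    then show ?thesis using torsion_iso_closed[OF TL g(1) dtri_zero_third[OF g(3)]] by blast
  qed
  moreover have "t \<in> tors" if t: "t \<in> heart \<inter> L" for t
  proof -
    have th: "t \<in> heart" using t by blast
    obtain a g where g: "a \<in> tors" "g \<in> tfree" "dtri D a t g" "a \<in> heart" "g \<in> heart"
      using torsion_decomp[OF tors th] .
    have gt: "g \<in> heart \<inter> L" by (rule torsion_quotient[OF TL g(3) t g(4,5)])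
    have "ev w g = 0" by (rule ev_zero_on_overlap(2)[OF L wC wL g(2) gt])
    then have "ev w (Sh D g) = 0" using tri_additive_Sh[OF ev(1)[OF wW] heart_Ob[OF g(5)]] by simp
    then have "zero_object D (Sh D g)" using w g(2) tfree by blast
    then have "zero_object D g" using zero_Sh_iff heart_Ob g(5) by blast
    then show ?thesis using torsion_iso_closed[OF tors g(1) dtri_zero_third[OF g(3)]] by blast
  qed
  ultimately have "heart \<inter> L = tors" by blast
  then show ?thesis using tilting_bij inter L unfolding bij_betw_def inj_on_def by blast
qed

text \<open>\<open>w\<close> vanishes exactly on the objects whose composition factors are all isomorphic to \<open>\<sigma>\<close>.\<close>

lemma simple_face:
  assumes fl: B.finite_length and \<sigma>: "B.simple \<sigma>"
  obtains w where "w \<in> C B.heart" "ev w \<sigma> = 0"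
    "\<And>k. \<lbrakk>k \<in> B.heart; ev w k = 0; hom0 D \<sigma> k\<rbrakk> \<Longrightarrow> zero_object D k"
proof -
  define \<phi> where "\<phi> s = (if isomorphic D s \<sigma> then 0 else 1 :: real)" for s
  have "\<phi> s = \<phi> s'" if "isomorphic D s s'" for s s'
    unfolding \<phi>_def using isomorphic_trans isomorphic_sym that by (metis (full_types))
  then obtain w where w: "w \<in> W" "\<And>s. B.simple s \<Longrightarrow> ev w s = \<phi> s" using W_from_simples[OF fl, of \<phi>] by blast
  have wC: "w \<in> C B.heart" by (rule cone_simples[OF fl w(1)]) (simp add: w(2) \<phi>_def)
  show ?thesis
  proof (rule that[OF wC])
    show "ev w \<sigma> = 0" using w(2)[OF \<sigma>] isomorphic_refl B.heart_Ob[OF B.simple_heart[OF \<sigma>]] by (simp add: \<phi>_def)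
    fix k assume k: "k \<in> B.heart" "ev w k = 0" "hom0 D \<sigma> k"
    show "zero_object D k"
    proof (rule ccontr)
      assume "\<not> zero_object D k"
      then obtain s c where s: "dtri D s k c" "B.simple s" "c \<in> B.heart" using B.simple_subobject[OF fl k(1)] by blast
      have "0 \<le> ev w c" using wC s(3) in_cone by blast
      then have "ev w s \<le> 0" using tri_additiveD[OF ev(1)[OF w(1)] s(1)] k(2) by simp
      then have "isomorphic D s \<sigma>" using w(2)[OF s(2)] by (simp add: \<phi>_def split: if_splits)
      then have "hom0 D s k" using hom0_iso_left[OF k(3)] isomorphic_sym by blast
      then have "hom0 D s s" by (rule B.hom0_kernel[OF s(1) _ B.simple_heart[OF s(2)] s(3)])
      then show False using B.simple_nonzero[OF s(2)] zero_object_iff by blast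
    qed
  qed
qed

text \<open>The functionals that are 1 on one isomorphism class of simple objects and 0 on the
  others are linearly independent, and \<open>W\<close> has finite dimension.\<close>

lemma finite_simples:
  assumes fl: B.finite_length
  obtains \<Sigma> where "finite \<Sigma>" "\<Sigma> \<subseteq> {s. B.simple s}" "\<And>s. B.simple s \<Longrightarrow> \<exists>\<sigma> \<in> \<Sigma>. isomorphic D s \<sigma>"
proof -
  obtain Bs where Bs: "finite Bs" "Bs \<subseteq> W" "W \<subseteq> span Bs"
    using free_dual_basis[OF free K0_group] unfolding heart_dual_def by metis
  \<comment> \<open>The predicate depends only on the isomorphism class of \<open>s\<close>, so
    isomorphic objects receive the same representative.\<close>
  define rep where "rep s = (SOME r. isomorphic D s r)" for s
  have rep: "isomorphic D s (rep s)" if "B.simple s" for s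
    unfolding rep_def by (rule someI[of _ s]) (rule isomorphic_refl[OF B.heart_Ob[OF B.simple_heart[OF that]]])
  have rep_eq: "rep s = rep s'" if "isomorphic D s s'" for s s'
  proof -
    have "isomorphic D s r \<longleftrightarrow> isomorphic D s' r" for r using isomorphic_trans isomorphic_sym that by meson
    then show ?thesis by (simp add: rep_def)
  qed
  define \<Sigma> where "\<Sigma> = rep ` {s. B.simple s}"
  have sub: "B.simple \<sigma>" if "\<sigma> \<in> \<Sigma>" for \<sigma> using that B.simple_iso rep unfolding \<Sigma>_def by blast
  have eqI: "\<sigma> = \<tau>" if "\<sigma> \<in> \<Sigma>" "\<tau> \<in> \<Sigma>" "isomorphic D \<sigma> \<tau>" for \<sigma> \<tau>
  proof -
    have "rep \<sigma> = \<sigma>" if "\<sigma> \<in> \<Sigma>" for \<sigma> using that rep rep_eq unfolding \<Sigma>_def by force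
    then show ?thesis using that rep_eq by metis
  qed
  have "\<exists>v \<in> W. \<forall>s. B.simple s \<longrightarrow> ev v s = (if isomorphic D s \<sigma> then 1 else 0)" for \<sigma>
  proof -
    have "isomorphic D s \<sigma> \<longleftrightarrow> isomorphic D s' \<sigma>" if "isomorphic D s s'" for s s'
      using isomorphic_trans isomorphic_sym that by meson
    then show ?thesis using W_from_simples[OF fl, of "\<lambda>s. if isomorphic D s \<sigma> then 1 else 0"] by metis
  qed
  then obtain d where d: "\<And>\<sigma>. d \<sigma> \<in> W" "\<And>\<sigma> s. B.simple s \<Longrightarrow> ev (d \<sigma>) s = (if isomorphic D s \<sigma> then 1 else 0)" by metis
  have one: "ev (d \<sigma>) \<sigma> = 1" if "\<sigma> \<in> \<Sigma>" for \<sigma>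
    using d(2)[OF sub[OF that]] isomorphic_refl B.heart_Ob[OF B.simple_heart[OF sub[OF that]]] by simp
  have zero: "ev (d \<tau>) \<sigma> = 0" if "\<sigma> \<in> \<Sigma>" "\<tau> \<in> \<Sigma>" "\<tau> \<noteq> \<sigma>" for \<sigma> \<tau>
  proof -
    have "\<not> isomorphic D \<sigma> \<tau>" using eqI[OF that(1,2)] that(3) by blast
    then show ?thesis using d(2)[OF sub[OF that(1)]] by simp
  qed
  have inj: "inj_on d \<Sigma>" by (rule inj_onI) (metis one zero zero_neq_one)
  have "independent (d ` \<Sigma>)"
    unfolding dependent_def
  proof
    assume "\<exists>a \<in> d ` \<Sigma>. a \<in> span (d ` \<Sigma> - {a})"
    then obtain \<sigma> where \<sigma>: "\<sigma> \<in> \<Sigma>" "d \<sigma> \<in> span (d ` \<Sigma> - {d \<sigma>})" by blast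
    have "d ` \<Sigma> - {d \<sigma>} \<subseteq> {v \<in> W. ev v \<sigma> = 0}" using zero[OF \<sigma>(1)] d(1) by blast
    then have "d \<sigma> \<in> {v \<in> W. ev v \<sigma> = 0}"
      using span_minimal[OF _ subspace_ev_kernel[OF B.heart_Ob[OF B.simple_heart[OF sub[OF \<sigma>(1)]]]]] \<sigma>(2) by blast
    then show False using one[OF \<sigma>(1)] by simp
  qed
  moreover have "d ` \<Sigma> \<subseteq> span Bs" using d(1) Bs(3) by blast
  ultimately have "finite (d ` \<Sigma>)" using independent_span_bound[OF Bs(1)] by blast
  then have "finite \<Sigma>" using inj by (simp add: finite_image_iff)
  moreover have "\<exists>\<sigma> \<in> \<Sigma>. isomorphic D s \<sigma>" if "B.simple s" for s using rep[OF that] that unfolding \<Sigma>_def by blast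
  ultimately show ?thesis using that sub by blast
qed

text \<open>A face is determined by the simple objects on which it vanishes.\<close>

lemma finite_faces: assumes fl: B.finite_length shows "finite (faces (C B.heart))"
proof -
  obtain \<Sigma> where \<Sigma>: "finite \<Sigma>" "\<Sigma> \<subseteq> {s. B.simple s}" "\<And>s. B.simple s \<Longrightarrow> \<exists>\<sigma> \<in> \<Sigma>. isomorphic D s \<sigma>"
    using finite_simples[OF fl] by blast
  note cone = C_convex_cone[OF inter]
  have so: "\<sigma> \<in> B.heart" "\<sigma> \<in> Ob D" if "\<sigma> \<in> \<Sigma>" for \<sigma> using that \<Sigma>(2) B.simple_heart B.heart_Ob by blast+
  define Z where "Z \<tau> = {\<sigma> \<in> \<Sigma>. \<forall>a \<in> \<tau>. ev a \<sigma> = 0}" for \<tau>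
  have le: "\<tau> \<subseteq> \<tau>'" if t: "\<tau> \<in> faces (C B.heart)" "\<tau>' \<in> faces (C B.heart)" "Z \<tau>' \<subseteq> Z \<tau>" for \<tau> \<tau>'
  proof
    fix a assume a: "a \<in> \<tau>"
    have aC: "a \<in> C B.heart" using a facesD(1)[OF t(1)] by blast
    have aW: "a \<in> W" using aC cone(2) by blast
    note cc = face_convex_cone[OF cone(1) t(2)]
    have t'C: "\<tau>' \<subseteq> C B.heart" by (rule facesD(1)[OF t(2)])
    have "\<exists>b \<in> \<tau>'. 0 < ev b \<sigma>" if "\<sigma> \<in> \<Sigma> - Z \<tau>" for \<sigma>
    proof -
      have s: "\<sigma> \<in> \<Sigma>" "\<sigma> \<notin> Z \<tau>'" using that t(3) by auto
      then obtain b where b: "b \<in> \<tau>'" "ev b \<sigma> \<noteq> 0" unfolding Z_def by blast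
      have "0 \<le> ev b \<sigma>" using b(1) t'C so(1)[OF s(1)] in_cone by blast
      then show ?thesis using b by (intro bexI[of _ b]) auto
    qed
    then obtain b where b: "\<And>\<sigma>. \<sigma> \<in> \<Sigma> - Z \<tau> \<Longrightarrow> b \<sigma> \<in> \<tau>' \<and> 0 < ev (b \<sigma>) \<sigma>" by metis
    \<comment> \<open>The coefficients are such that \<open>b'\<close> is at least \<open>a\<close>
      on every simple object: the summand for \<sigma> already equals \<open>a\<close> there, and
      \<open>a\<close> vanishes on the simple objects left out. So \<open>a\<close> is a summand of
      an element of \<tau>'.\<close>
    define b' where "b' = (\<Sum>\<sigma> \<in> \<Sigma> - Z \<tau>. (ev a \<sigma> / ev (b \<sigma>) \<sigma>) *\<^sub>R b \<sigma>)"
    have bC: "b \<sigma> \<in> C B.heart" "b \<sigma> \<in> W" if "\<sigma> \<in> \<Sigma> - Z \<tau>" for \<sigma> using b[OF that] t'C cone(2) by blast+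
    have apos: "0 \<le> ev a \<sigma>" if "\<sigma> \<in> \<Sigma>" for \<sigma> using aC so(1)[OF that] in_cone by blast
    have quot: "0 \<le> ev a \<sigma> / ev (b \<sigma>) \<sigma>" if s: "\<sigma> \<in> \<Sigma> - Z \<tau>" for \<sigma>
    proof -
      have "\<sigma> \<in> \<Sigma>" using s by blast
      then show ?thesis using apos b[OF s] by (intro divide_nonneg_pos) auto
    qed
    have b't: "b' \<in> \<tau>'"
    proof -
      have "(\<Sum>\<sigma> \<in> S. (ev a \<sigma> / ev (b \<sigma>) \<sigma>) *\<^sub>R b \<sigma>) \<in> \<tau>'" if "finite S" "S \<subseteq> \<Sigma> - Z \<tau>" for S
        using that
      proof (induction S rule: finite_induct)
        case empty
        show ?case unfolding sum.empty by (rule convex_cone_contains_0[OF cc])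
      next
        case (insert \<sigma> S)
        have s: "\<sigma> \<in> \<Sigma> - Z \<tau>" using insert.prems by blast
        have "(ev a \<sigma> / ev (b \<sigma>) \<sigma>) *\<^sub>R b \<sigma> \<in> \<tau>'"
          using convex_cone_scaleR[OF cc quot[OF s]] b[OF s] by blast
        moreover have "(\<Sum>\<sigma> \<in> S. (ev a \<sigma> / ev (b \<sigma>) \<sigma>) *\<^sub>R b \<sigma>) \<in> \<tau>'" using insert.IH insert.prems by blast
        ultimately show ?case unfolding sum.insert[OF insert.hyps] by (rule convex_cone_add[OF cc])
      qed
      then show ?thesis unfolding b'_def using \<Sigma>(1) by blast
    qed
    then have b'C: "b' \<in> C B.heart" and b'W: "b' \<in> W" using t'C cone(2) by blast+
    have dW: "b' - a \<in> W" by (rule subspace_diff[OF subspace_W b'W aW])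
    have e: "ev (b' - a) k = ev b' k - ev a k" if "k \<in> Ob D" for k using ev_add[OF dW aW that] by simp
    have main: "0 \<le> ev (b' - a) \<sigma>" if s: "\<sigma> \<in> \<Sigma>" for \<sigma>
    proof (cases "\<sigma> \<in> Z \<tau>")
      case True
      then have "ev a \<sigma> = 0" using a by (simp add: Z_def)
      moreover have "0 \<le> ev b' \<sigma>" using b'C so(1)[OF s] in_cone by blast
      ultimately show ?thesis using e[OF so(2)[OF s]] by simp
    next
      case False
      then have s': "\<sigma> \<in> \<Sigma> - Z \<tau>" using s by blast
      have sb: "ev b' \<sigma> = (\<Sum>\<rho> \<in> \<Sigma> - Z \<tau>. (ev a \<rho> / ev (b \<rho>) \<rho>) * ev (b \<rho>) \<sigma>)"
        unfolding b'_def by (rule ev_sum[OF so(2)[OF s]]) (use bC in blast)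
      have pos: "0 \<le> (ev a \<rho> / ev (b \<rho>) \<rho>) * ev (b \<rho>) \<sigma>" if r: "\<rho> \<in> \<Sigma> - Z \<tau>" for \<rho>
      proof (rule mult_nonneg_nonneg[OF quot[OF r]])
        show "0 \<le> ev (b \<rho>) \<sigma>" using bC(1)[OF r] so(1)[OF s] in_cone by blast
      qed
      have "ev a \<sigma> = (ev a \<sigma> / ev (b \<sigma>) \<sigma>) * ev (b \<sigma>) \<sigma>" using b[OF s'] by simp
      also have "\<dots> \<le> ev b' \<sigma>"
        unfolding sb by (rule member_le_sum[OF s']) (use pos \<Sigma>(1) in auto)
      finally show ?thesis using e[OF so(2)[OF s]] by simp
    qed
    have "b' - a \<in> C B.heart"
    proof (rule cone_simples[OF fl dW])
      fix s assume "B.simple s"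
      then obtain \<sigma> where \<sigma>: "\<sigma> \<in> \<Sigma>" "isomorphic D s \<sigma>" using \<Sigma>(3) by blast
      show "0 \<le> ev (b' - a) s" using main[OF \<sigma>(1)] tri_additive_iso[OF ev(1)[OF dW] \<sigma>(2)] by simp
    qed
    then have "a + (b' - a) \<in> \<tau>' \<longleftrightarrow> a \<in> \<tau>' \<and> b' - a \<in> \<tau>'" by (rule facesD(3)[OF t(2) aC])
    then show "a \<in> \<tau>'" using b't by simp
  qed
  have "inj_on Z (faces (C B.heart))"
  proof (rule inj_onI)
    fix \<tau> \<tau>' assume "\<tau> \<in> faces (C B.heart)" "\<tau>' \<in> faces (C B.heart)" "Z \<tau> = Z \<tau>'"
    then show "\<tau> = \<tau>'" using le[of \<tau> \<tau>'] le[of \<tau>' \<tau>] by simp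
  qed
  moreover have "Z ` faces (C B.heart) \<subseteq> Pow \<Sigma>" by (auto simp: Z_def)
  ultimately show ?thesis using \<Sigma>(1) by (meson finite_Pow_iff inj_on_finite)
qed

end

section \<open>Finiteness of the fan\<close>

context free_heart
begin

abbreviation "\<K> \<equiv> intermediate_hearts D heart"

lemma tilted: assumes "K \<in> \<K>" obtains U' V' where "tilted_heart D U V U' V'" "K = U' \<inter> V'"
proof -
  obtain U' V' where B: "bounded_t_structure D U' V'" and K: "K = U' \<inter> V'" using assms intermediate_iff by blast
  have "tilted_heart D U V U' V'" by unfold_locales (use B assms K in auto)
  then show ?thesis using that K by blast
qed

lemma cones_cover: assumes "finite_length" "v \<in> W" obtains K where "K \<in> \<K>" "v \<in> C K"
proof -
  have "v \<in> \<Union> (heart_fan D heart)" using heart_fan_complete assms by (simp add: complete_fan_in_def)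
  then obtain K \<tau> where "K \<in> \<K>" "\<tau> \<in> faces (C K)" "v \<in> \<tau>" by (auto simp: heart_fan_def)
  then show ?thesis using that facesD(1) by blast
qed

text \<open>Infinitely many of the points \<open>w + \<delta> / (n + 1)\<close> lie in one of the finitely many cones, which
  therefore contains \<open>w\<close> and has \<open>\<delta>\<close> in its span. A generic \<open>\<delta>\<close> lies in no proper subspace spanned by a cone.\<close>

lemma generic_cone:
  assumes fl: finite_length and fin: "finite (C ` \<K>)" and w: "w \<in> W" and s: "s \<in> heart" "\<not> zero_object D s"
  obtains K \<delta> and e :: real where "K \<in> \<K>" "W \<subseteq> span (C K)" "w \<in> C K" "\<delta> \<in> W" "0 < ev \<delta> s" "0 < e" "w + e *\<^sub>R \<delta> \<in> C K"
proof -
  have so: "s \<in> Ob D" by (rule heart_Ob[OF s(1)])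
  \<comment> \<open>Avoiding the first subspace makes \<delta> non-zero at \<open>s\<close>;
    avoiding the others means that a cone with \<delta> in its span spans everything.\<close>
  let ?P = "insert {v \<in> W. ev v s = 0} (span ` {c \<in> C ` \<K>. \<not> W \<subseteq> span c})"
  have nW: "\<not> W \<subseteq> {v \<in> W. ev v s = 0}" using W_vanishing_zero[OF fl s(1)] s(2) by blast
  have sub: "subspace P \<and> \<not> W \<subseteq> P" if P: "P \<in> ?P" for P
  proof -
    consider "P = {v \<in> W. ev v s = 0}" | c where "P = span c" "\<not> W \<subseteq> span c" using P by blast
    then show ?thesis
    proof cases
      case 1
      show ?thesis unfolding 1 using nW subspace_ev_kernel[OF so] by blast
    next
      case (2 c)
      then show ?thesis using subspace_span by blast
    qed
  qed
  have "finite ?P" using fin by (intro finite.insertI finite_imageI) simp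
  have "\<exists>x \<in> W. \<forall>P \<in> ?P. x \<notin> P"
    by (rule subspaces_avoid) (rule \<open>finite ?P\<close>, rule subspace_W, rule sub)
  then obtain x where xW: "x \<in> W" and xP: "\<forall>P \<in> ?P. x \<notin> P" by (rule bexE)
  note x = xW bspec[OF xP]
  define \<delta> where "\<delta> = (if 0 < ev x s then x else - x)"
  have mx: "- x \<in> W" "ev (- x) s = - ev x s" using subspace_neg[OF subspace_W x(1)] ev_scale[OF x(1) so, of "- 1"] by auto
  have "ev x s \<noteq> 0" using x(2)[of "{v \<in> W. ev v s = 0}"] x(1) by blast
  then have \<delta>: "\<delta> \<in> W" "0 < ev \<delta> s" using x(1) mx by (auto simp: \<delta>_def)
  have gen: "W \<subseteq> span c" if "c \<in> C ` \<K>" "\<delta> \<in> span c" for c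
  proof (rule ccontr)
    assume "\<not> W \<subseteq> span c"
    then have "x \<notin> span c" using x(2)[of "span c"] that(1) by blast
    moreover have "x = \<delta> \<or> x = - \<delta>" by (simp add: \<delta>_def)
    ultimately show False using that(2) span_neg by metis
  qed
  define p where "p n = w + (1 / real (Suc n)) *\<^sub>R \<delta>" for n
  have pW: "p n \<in> W" for n unfolding p_def by (rule subspace_add[OF subspace_W w subspace_scale[OF subspace_W \<delta>(1)]])
  have "\<forall>n. \<exists>c \<in> C ` \<K>. p n \<in> c"
  proof
    fix n
    obtain K where "K \<in> \<K>" "p n \<in> C K" using cones_cover[OF fl pW] .
    then show "\<exists>c \<in> C ` \<K>. p n \<in> c" by blast
  qed
  then obtain c where c: "\<And>n. c n \<in> C ` \<K>" "\<And>n. p n \<in> c n" by metis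
  have "finite (range c)" using fin c(1) by (metis finite_subset image_subsetI)
  then obtain n0 where n0: "infinite {n. c n = c n0}" using pigeonhole_infinite[of UNIV c] by auto
  obtain K where K: "K \<in> \<K>" "c n0 = C K" using c(1) by blast
  have big: "\<exists>n \<ge> N. p n \<in> C K" for N
  proof -
    obtain n where "n > N" "c n = c n0" using n0 unfolding infinite_nat_iff_unbounded by blast
    then show ?thesis using c(2)[of n] K(2) by (intro exI[of _ n]) auto
  qed
  obtain n where n: "p n \<in> C K" using big by blast
  obtain m where m: "m \<ge> Suc n" "p m \<in> C K" using big by blast
  note cone = C_convex_cone[OF K(1)]
  have "W \<subseteq> span (C K)"
  proof -
    define r where "r = 1 / real (Suc n) - 1 / real (Suc m)"
    have "1 / real (Suc m) < 1 / real (Suc n)" using m(1) by (intro divide_strict_left_mono) auto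
    then have r: "r \<noteq> 0" unfolding r_def by linarith
    have "p n - p m \<in> span (C K)" using n m(2) by (intro span_diff span_base)
    moreover have "p n - p m = r *\<^sub>R \<delta>" by (simp only: p_def r_def scaleR_diff_left add_diff_cancel_left)
    ultimately have "(1 / r) *\<^sub>R (r *\<^sub>R \<delta>) \<in> span (C K)" by (metis span_scale)
    then have "\<delta> \<in> span (C K)" using r by simp
    then show ?thesis using gen K c(1) by metis
  qed
  moreover have "w \<in> C K"
    unfolding heart_cone_eq[OF K(1)]
  proof (intro CollectI conjI ballI w)
    fix k assume k: "k \<in> K"
    have ko: "k \<in> Ob D" by (rule intermediate_Ob[OF K(1) k])
    show "0 \<le> ev w k"
    proof (rule field_le_epsilon)
      fix \<epsilon> :: real assume \<epsilon>: "0 < \<epsilon>"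
      obtain N :: nat where N: "\<bar>ev \<delta> k\<bar> / \<epsilon> < real N" using reals_Archimedean2 by blast
      obtain n where n: "n \<ge> N" "p n \<in> C K" using big by blast
      have "ev (p n) k = ev w k + ev \<delta> k / real (Suc n)"
        unfolding p_def ev_add[OF w subspace_scale[OF subspace_W \<delta>(1)] ko] ev_scale[OF \<delta>(1) ko] by simp
      moreover have "0 \<le> ev (p n) k" using n(2) k unfolding heart_cone_eq[OF K(1)] by blast
      moreover have "ev \<delta> k / real (Suc n) \<le> \<epsilon>"
      proof -
        have "\<bar>ev \<delta> k\<bar> < real N * \<epsilon>" using N \<epsilon> by (simp add: pos_divide_less_eq)
        also have "\<dots> \<le> real (Suc n) * \<epsilon>" using n(1) \<epsilon> by (intro mult_right_mono) auto
        finally show ?thesis by (simp add: field_simps)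
      qed
      ultimately show "0 \<le> ev w k + \<epsilon>" by simp
    qed
  qed
  ultimately show ?thesis using that[OF K(1) _ _ \<delta>, of "1 / real (Suc n)"] n by (simp add: p_def)
qed

lemma eq_of_torsion: "K \<in> \<K> \<Longrightarrow> L \<in> \<K> \<Longrightarrow> heart \<inter> K = heart \<inter> L \<Longrightarrow> K = L"
  using tilting_bij unfolding bij_betw_def inj_on_def by blast

lemma finite_spanning:
  assumes fl: finite_length and fin: "finite (C ` \<K>)" shows "finite {K \<in> \<K>. W \<subseteq> span (C K)}"
proof -
  have "inj_on C {K \<in> \<K>. W \<subseteq> span (C K)}"
  proof (rule inj_onI)
    fix K L assume K: "K \<in> {K \<in> \<K>. W \<subseteq> span (C K)}" and L: "L \<in> {K \<in> \<K>. W \<subseteq> span (C K)}" and e: "C K = C L"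
    obtain U' V' where t: "tilted_heart D U V U' V'" "K = U' \<inter> V'" using tilted K by blast
    show "K = L" using tilted_heart.spanning_unique[OF t(1) fl] t(2) K L e by blast
  qed
  moreover have "finite (C ` {K \<in> \<K>. W \<subseteq> span (C K)})" by (rule finite_subset[OF _ fin]) blast
  ultimately show ?thesis by (rule finite_imageD[rotated])
qed

lemma trivial_torsion_class: assumes fl: finite_length shows "torsion_class A {z. zero_object D z}"
proof (rule torsion_classI[OF fl])
  show "{z. zero_object D z} \<subseteq> heart" using zero_heart by blast
  show "q \<in> {z. zero_object D z}" if "dtri D a t q" "t \<in> {z. zero_object D z}" "a \<in> heart" "q \<in> heart" for a t q
    using dtri_zero_mid_heart(2)[OF that(1,3,4)] that(2) by blast
  show "b \<in> {z. zero_object D z}" if "dtri D a b c" "a \<in> {z. zero_object D z}" "c \<in> {z. zero_object D z}" for a b c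
    using zero_object_iso[OF _ dtri_zero_third[OF that(1)]] that(2,3) by blast
qed blast

text \<open>The heart with zero torsion class is H[1]. Its cone contains the negatives of C(H),
  which span since H has finite length. Its torsion class lies below every other, so there is
  something to maximise.\<close>

lemma ex_spanning:
  assumes fl: finite_length obtains K where "K \<in> \<K>" "W \<subseteq> span (C K)" "heart \<inter> K = {z. zero_object D z}"
proof -
  obtain K where K: "K \<in> \<K>" "heart \<inter> K = {z. zero_object D z}"
    using torsion_intermediate[OF trivial_torsion_class[OF fl]] .
  interpret H: tilted_heart D U V U V by unfold_locales (rule heart_intermediate)
  have neg: "- v \<in> C K" if v: "v \<in> C heart" for v
  proof -
    have vW: "v \<in> W" and pos: "\<And>h. h \<in> heart \<Longrightarrow> 0 \<le> ev v h" using v H.in_cone by blast+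
    have mW: "- v \<in> W" by (rule subspace_neg[OF subspace_W vW])
    have m: "ev (- v) x = - ev v x" if "x \<in> Ob D" for x using ev_scale[OF vW that, of "- 1"] by simp
    have "0 \<le> ev (- v) t" if "t \<in> heart \<inter> K" for t
      using tri_additive_zero[OF ev(1)[OF mW]] that K(2) by auto
    moreover have "ev (- v) f \<le> 0" if "f \<in> perp A (heart \<inter> K)" for f
    proof -
      have f: "f \<in> heart" by (rule perpD(1)[OF that]) blast
      show ?thesis using m[OF heart_Ob[OF f]] pos[OF f] by simp
    qed
    ultimately show ?thesis unfolding heart_cone_torsion[OF K(1)] using mW by blast
  qed
  have "C heart \<subseteq> span (C K)"
  proof
    fix v assume "v \<in> C heart"
    then have "- (- v) \<in> span (C K)" using neg by (intro span_neg span_base)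
    then show "v \<in> span (C K)" by simp
  qed
  then have "span (C heart) \<subseteq> span (C K)" by (rule span_minimal) (rule subspace_span)
  then show ?thesis using that K H.length_spanning[OF fl] by blast
qed

text \<open>Crossing from \<open>C(K)\<close> through the facet on which \<open>s[1]\<close> vanishes leads to a spanning cone \<open>C(L)\<close>
  whose torsion class is larger, but still contained in that of \<open>M\<close>.\<close>

lemma spanning_above:
  assumes fl: finite_length and fin: "finite (C ` \<K>)" and K: "K \<in> \<K>" "W \<subseteq> span (C K)"
    and M: "M \<in> \<K>" "heart \<inter> K \<subset> heart \<inter> M"
  obtains L where "L \<in> \<K>" "W \<subseteq> span (C L)" "heart \<inter> K \<subset> heart \<inter> L" "heart \<inter> L \<subseteq> heart \<inter> M"
proof -
  obtain U' V' where tK: "tilted_heart D U V U' V'" and KK: "K = U' \<inter> V'" using tilted[OF K(1)] .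
  interpret K: tilted_heart D U V U' V' by (rule tK)
  have flK: K.B.finite_length using K.B.length_category_finite_length K.spanning_length[OF fl] K(2) KK by blast
  note TM = intermediate_torsion(1)[OF M(1)]
  obtain s where s: "s \<in> K.tfree" "s \<in> heart \<inter> M" "K.B.simple (Sh D s)"
    using K.simple_tfree_above[OF flK TM] M(2) KK by blast
  have sh: "s \<in> heart" "s \<in> Ob D" using s(2) heart_Ob by blast+
  have snz: "\<not> zero_object D s" using K.B.simple_nonzero[OF s(3)] zero_Sh_iff sh(2) by blast
  obtain w where w: "w \<in> C K" "ev w (Sh D s) = 0"
    "\<And>k. \<lbrakk>k \<in> K; ev w k = 0; hom0 D (Sh D s) k\<rbrakk> \<Longrightarrow> zero_object D k"
    using K.simple_face[OF flK s(3)] KK by blast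
  have wW: "w \<in> W" using w(1) C_convex_cone(2)[OF K(1)] by blast
  obtain L \<delta> e where L: "L \<in> \<K>" "W \<subseteq> span (C L)" "w \<in> C L" "\<delta> \<in> W" "0 < ev \<delta> s" "0 < (e::real)" "w + e *\<^sub>R \<delta> \<in> C L"
    using generic_cone[OF fl fin wW sh(1) snz] by blast
  note TL = intermediate_torsion(1)[OF L(1)] and TK = K.tors
  have KL: "t \<in> heart \<inter> L" if t: "t \<in> heart \<inter> K" for t
  proof -
    have th: "t \<in> heart" using t by blast
    obtain a g where g: "a \<in> heart \<inter> L" "g \<in> perp A (heart \<inter> L)" "dtri D a t g" "a \<in> heart" "g \<in> heart"
      using torsion_decomp[OF TL th] .
    have gK: "g \<in> K.tors" by (rule torsion_quotient[OF TK g(3) _ g(4,5)]) (use t KK in blast)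
    have "ev w g = 0" using K.ev_zero_on_overlap(1)[OF L(1) _ L(3) gK g(2)] w(1) KK by blast
    \<comment> \<open>Since \<open>s\<close> and \<open>g\<close> both lie in H, there is no arrow
      from \<open>s[1]\<close> to \<open>g\<close>, so the facet condition on \<open>w\<close>
      applies.\<close>
    then have "zero_object D g" using w(3) K.hom0_Sh_heart[OF sh(1) g(5)] gK KK by blast
    then show ?thesis using torsion_iso_closed[OF TL g(1) dtri_zero_third[OF g(3)]] by blast
  qed
  have LM: "t \<in> heart \<inter> M" if t: "t \<in> heart \<inter> L" for t
  proof -
    have th: "t \<in> heart" using t by blast
    obtain a g where g: "a \<in> heart \<inter> M" "g \<in> perp A (heart \<inter> M)" "dtri D a t g" "a \<in> heart" "g \<in> heart"
      using torsion_decomp[OF TM th] .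
    have gL: "g \<in> heart \<inter> L" by (rule torsion_quotient[OF TL g(3) t g(4,5)])
    have gM: "hom0 D x g" if "x \<in> heart \<inter> M" for x by (rule perpD(2)[OF g(2) _ that]) blast
    \<comment> \<open>As \<open>g\<close> is torsion-free for \<open>M\<close>, it is so for the
      smaller torsion class of K, hence \<open>g[1]\<close> is in K. Moreover Hom(\<open>s\<close>,
      \<open>g\<close>) = 0, because \<open>s\<close> is torsion for \<open>M\<close>; this is how
      the choice of \<open>s\<close> keeps \<open>L\<close> below \<open>M\<close>.\<close>
    have "g \<in> K.tfree" unfolding perp_heart[OF Int_lower1] using gM g(5) M(2) KK by blast
    then have gK: "g \<in> K.tfree" "Sh D g \<in> K" using K.tfree KK by blast+
    have "ev w g = 0" using K.ev_zero_on_overlap(2)[OF L(1) _ L(3) gK(1) gL] w(1) KK by blast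
    then have "ev w (Sh D g) = 0" using tri_additive_Sh[OF ev(1)[OF wW] heart_Ob[OF g(5)]] by simp
    moreover have "hom0 D (Sh D s) (Sh D g)" using hom0_shift[OF sh(2) heart_Ob[OF g(5)]] gM[OF s(2)] by blast
    ultimately have "zero_object D (Sh D g)" using w(3) gK(2) by blast
    then have "zero_object D g" using zero_Sh_iff heart_Ob g(5) by blast
    then show ?thesis using torsion_iso_closed[OF TM g(1) dtri_zero_third[OF g(3)]] by blast
  qed
  \<comment> \<open>With equal torsion classes \<open>s\<close> would be torsion-free for
    \<open>L\<close>, but \<delta> is positive at \<open>s\<close> while \<open>w\<close> vanishes
    there.\<close>
  have "heart \<inter> K \<noteq> heart \<inter> L"
  proof
    assume e': "heart \<inter> K = heart \<inter> L"
    then have "s \<in> perp A (heart \<inter> L)" using s(1) KK by simp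
    then have "ev (w + e *\<^sub>R \<delta>) s \<le> 0" using L(7) unfolding heart_cone_torsion[OF L(1)] by blast
    moreover have "ev w s = 0" using w(2) tri_additive_Sh[OF ev(1)[OF wW] sh(2)] by simp
    ultimately have "e * ev \<delta> s \<le> 0"
      unfolding ev_add[OF wW subspace_scale[OF subspace_W L(4)] sh(2)] ev_scale[OF L(4) sh(2)] by simp
    then show False using mult_pos_pos[OF L(6,5)] by simp
  qed
  then have "heart \<inter> K \<subset> heart \<inter> L" using KL by blast
  then show ?thesis using that[OF L(1,2)] LM by blast
qed

lemma finite_cones_spanning:
  assumes fl: finite_length and fin: "finite (C ` \<K>)" and M: "M \<in> \<K>" shows "W \<subseteq> span (C M)"
proof -
  define S where "S = {K \<in> \<K>. W \<subseteq> span (C K) \<and> heart \<inter> K \<subseteq> heart \<inter> M}"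
  have finS: "finite ((\<inter>) heart ` S)"
    by (rule finite_imageI, rule finite_subset[OF _ finite_spanning[OF fl fin]]) (auto simp: S_def)
  obtain K0 where K0: "K0 \<in> \<K>" "W \<subseteq> span (C K0)" "heart \<inter> K0 = {z. zero_object D z}" using ex_spanning[OF fl] .
  have "{z. zero_object D z} \<subseteq> heart \<inter> M" using torsion_zero[OF intermediate_torsion(1)[OF M]] by blast
  then have "K0 \<in> S" using K0 by (simp add: S_def)
  then have "(\<inter>) heart ` S \<noteq> {}" by blast
  then obtain T where T: "T \<in> (\<inter>) heart ` S" "\<And>T'. T' \<in> (\<inter>) heart ` S \<Longrightarrow> T \<subseteq> T' \<Longrightarrow> T = T'"
    using finite_has_maximal[OF finS] by metis
  obtain K where K: "K \<in> \<K>" "W \<subseteq> span (C K)" "heart \<inter> K \<subseteq> heart \<inter> M" "T = heart \<inter> K"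
    using T(1) by (auto simp: S_def)
  have "heart \<inter> K = heart \<inter> M"
  proof (rule ccontr)
    assume "heart \<inter> K \<noteq> heart \<inter> M"
    then have "heart \<inter> K \<subset> heart \<inter> M" using K(3) by blast
    then obtain L where L: "L \<in> \<K>" "W \<subseteq> span (C L)" "heart \<inter> K \<subset> heart \<inter> L" "heart \<inter> L \<subseteq> heart \<inter> M"
      using spanning_above[OF fl fin K(1,2) M] by blast
    then have "heart \<inter> L \<in> (\<inter>) heart ` S" by (auto simp: S_def)
    then show False using T(2) L(3) K(4) by blast
  qed
  then show ?thesis using eq_of_torsion[OF K(1) M] K(2) by blast
qed

theorem finite_cones_imp:
  assumes fl: finite_length and fin: "finite (C ` \<K>)"
  shows "finite \<K>" and "K \<in> \<K> \<Longrightarrow> length_category (full_subcat D K)"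
proof -
  have "{K \<in> \<K>. W \<subseteq> span (C K)} = \<K>" using finite_cones_spanning[OF fl fin] by blast
  then show "finite \<K>" using finite_spanning[OF fl fin] by simp
  assume K: "K \<in> \<K>"
  obtain U' V' where t: "tilted_heart D U V U' V'" "K = U' \<inter> V'" using tilted[OF K] .
  show "length_category (full_subcat D K)"
    using tilted_heart.spanning_length[OF t(1) fl] finite_cones_spanning[OF fl fin K] t(2) by blast
qed

text \<open>A torsion class with infinitely many torsion classes above it lies properly below another one, since
  each class above contains one of the finitely many \<open>s\<close> with \<open>s[1]\<close> simple in the tilted heart.\<close>

lemma infinite_above_step:
  assumes fl: finite_length and len: "\<And>K. K \<in> \<K> \<Longrightarrow> length_category (full_subcat D K)"
    and T: "torsion_class A T" "infinite {L. torsion_class A L \<and> T \<subseteq> L}"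
  obtains T' where "torsion_class A T'" "infinite {L. torsion_class A L \<and> T' \<subseteq> L}" "T \<subset> T'"
proof -
  obtain K where K: "K \<in> \<K>" "heart \<inter> K = T" using torsion_intermediate[OF T(1)] .
  obtain U' V' where tK: "tilted_heart D U V U' V'" and KK: "K = U' \<inter> V'" using tilted[OF K(1)] .
  interpret K: tilted_heart D U V U' V' by (rule tK)
  have TT: "K.tors = T" using K KK by blast
  have flK: K.B.finite_length using K.B.length_category_finite_length len[OF K(1)] KK by blast
  obtain \<Sigma> where \<Sigma>: "finite \<Sigma>" "\<Sigma> \<subseteq> {s. K.B.simple s}" "\<And>s. K.B.simple s \<Longrightarrow> \<exists>\<sigma> \<in> \<Sigma>. isomorphic D s \<sigma>"
    using K.finite_simples[OF flK] by blast
  define Ab where "Ab \<sigma> = {L. torsion_class A L \<and> T \<subseteq> L \<and> (\<exists>s \<in> K.tfree \<inter> L. isomorphic D (Sh D s) \<sigma>)}" for \<sigma>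
  have "{L. torsion_class A L \<and> T \<subseteq> L} \<subseteq> insert T (\<Union>\<sigma> \<in> \<Sigma>. Ab \<sigma>)"
  proof
    fix L assume L: "L \<in> {L. torsion_class A L \<and> T \<subseteq> L}"
    show "L \<in> insert T (\<Union>\<sigma> \<in> \<Sigma>. Ab \<sigma>)"
    proof (cases "L = T")
      case False
      then have "K.tors \<subset> L" using L TT by blast
      then obtain s where s: "s \<in> K.tfree" "s \<in> L" "K.B.simple (Sh D s)" using K.simple_tfree_above[OF flK] L by blast
      then obtain \<sigma> where "\<sigma> \<in> \<Sigma>" "isomorphic D (Sh D s) \<sigma>" using \<Sigma>(3) by blast
      then show ?thesis using s L unfolding Ab_def by blast
    qed simp
  qed
  then have "infinite (\<Union>\<sigma> \<in> \<Sigma>. Ab \<sigma>)" using T(2) by (metis finite_insert finite_subset)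
  then obtain \<sigma> where \<sigma>: "\<sigma> \<in> \<Sigma>" "infinite (Ab \<sigma>)" using \<Sigma>(1) by blast
  then obtain L0 where L0: "L0 \<in> Ab \<sigma>" by fastforce
  \<comment> \<open>The objects \<open>s\<close> whose shift is isomorphic to \<sigma> are
    isomorphic to each other, so all members of \<open>Ab \<sigma>\<close> contain the same ones and
    the intersection is strictly larger than \<open>T\<close>.\<close>
  define T' where "T' = \<Inter> (Ab \<sigma>)"
  have tL: "torsion_class A L" if "L \<in> Ab \<sigma>" for L using that by (simp add: Ab_def)
  have "torsion_class A T'"
  proof (rule torsion_classI[OF fl])
    show "T' \<subseteq> heart" using torsion_sub[OF tL[OF L0]] L0 by (auto simp: T'_def)
    show "z \<in> T'" if "zero_object D z" for z using torsion_zero[OF tL that] by (simp add: T'_def)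
    show "q \<in> T'" if "dtri D a t q" "t \<in> T'" "a \<in> heart" "q \<in> heart" for a t q
      unfolding T'_def
    proof
      fix L assume "L \<in> Ab \<sigma>"
      then show "q \<in> L" using torsion_quotient[OF tL that(1) _ that(3,4)] that(2) by (simp add: T'_def)
    qed
    show "b \<in> T'" if "dtri D a b c" "a \<in> T'" "c \<in> T'" for a b c
      unfolding T'_def
    proof
      fix L assume "L \<in> Ab \<sigma>"
      then show "b \<in> L" using torsion_ext[OF tL that(1)] that(2,3) by (simp add: T'_def)
    qed
  qed
  moreover have "Ab \<sigma> \<subseteq> {L. torsion_class A L \<and> T' \<subseteq> L}" by (auto simp: T'_def Ab_def)
  then have "infinite {L. torsion_class A L \<and> T' \<subseteq> L}" using \<sigma>(2) finite_subset by blast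
  moreover have "T \<subset> T'"
  proof (rule psubsetI)
    show "T \<subseteq> T'" by (auto simp: T'_def Ab_def)
    obtain s where s: "s \<in> K.tfree" "s \<in> L0" "isomorphic D (Sh D s) \<sigma>" using L0 by (auto simp: Ab_def)
    have sh: "s \<in> heart" "s \<in> Ob D" using s(1) K.tfree heart_Ob by blast+
    have nz: "\<not> zero_object D s"
    proof
      assume "zero_object D s"
      then have "zero_object D (Sh D s)" using zero_Sh_iff sh(2) by blast
      then have "zero_object D \<sigma>" by (rule zero_object_iso[OF _ s(3)])
      then show False using K.B.simple_nonzero \<sigma>(1) \<Sigma>(2) by blast
    qed
    have "s \<in> L" if L: "L \<in> Ab \<sigma>" for L
    proof -
      obtain s' where s': "s' \<in> K.tfree" "s' \<in> L" "isomorphic D (Sh D s') \<sigma>" using L by (auto simp: Ab_def)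
      have so': "s' \<in> Ob D" using s'(1) K.tfree heart_Ob by blast
      have "isomorphic D (Sh D s') (Sh D s)" by (rule isomorphic_trans[OF s'(3) isomorphic_sym[OF s(3)]])
      then have "isomorphic D s' s" by (rule isomorphic_Sh_cancel[OF _ so' sh(2)])
      then show ?thesis by (rule torsion_iso_closed[OF tL[OF L] s'(2)])
    qed
    then have "s \<in> T'" by (simp add: T'_def)
    moreover have "s \<notin> T" using torsion_perp_zero[of K.tors s] s(1) nz TT by blast
    ultimately show "T \<noteq> T'" by blast
  qed
  ultimately show ?thesis by (rule that)
qed

text \<open>The outer terms of an extension lie in a common member of the chain; the other closure
  properties concern one member at a time.\<close>

lemma chain_union_torsion:
  fixes T :: "nat \<Rightarrow> 'a set"
  assumes fl: finite_length and T: "\<And>n. torsion_class A (T n)" "incseq T" shows "torsion_class A (\<Union>n. T n)"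
proof (rule torsion_classI[OF fl])
  show "(\<Union>n. T n) \<subseteq> heart" using torsion_sub[OF T(1)] by blast
  show "z \<in> (\<Union>n. T n)" if "zero_object D z" for z using torsion_zero[OF T(1) that] by blast
  show "q \<in> (\<Union>n. T n)" if "dtri D a t q" "t \<in> (\<Union>n. T n)" "a \<in> heart" "q \<in> heart" for a t q
    using torsion_quotient[OF T(1) that(1) _ that(3,4)] that(2) by blast
  show "b \<in> (\<Union>n. T n)" if abc: "dtri D a b c" "a \<in> (\<Union>n. T n)" "c \<in> (\<Union>n. T n)" for a b c
  proof -
    obtain n m where "a \<in> T n" "c \<in> T m" using abc by blast
    then have "a \<in> T (max n m)" "c \<in> T (max n m)"
      using incseqD[OF T(2), of n "max n m"] incseqD[OF T(2), of m "max n m"] by auto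
    then show ?thesis using torsion_ext[OF T(1) abc(1)] by blast
  qed
qed

text \<open>Otherwise there is a strictly increasing chain of torsion classes. For each of its members there is a
  simple object of the heart tilted at the union that belongs to the union but is torsion-free for that member;
  some simple object serves infinitely many members.\<close>

theorem length_imp_finite:
  assumes fl: finite_length and len: "\<And>K. K \<in> \<K> \<Longrightarrow> length_category (full_subcat D K)"
  shows "finite \<K>"
proof (rule ccontr)
  assume inf: "infinite \<K>"
  define P where "P T \<longleftrightarrow> torsion_class A T \<and> infinite {L. torsion_class A L \<and> T \<subseteq> L}" for T
  have "infinite {L. torsion_class A L}" using inf bij_betw_finite[OF tilting_bij] by blast
  moreover have "{L. torsion_class A L} \<subseteq> {L. torsion_class A L \<and> {z. zero_object D z} \<subseteq> L}"
    using torsion_zero by blast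
  ultimately have start: "P {z. zero_object D z}"
    unfolding P_def using trivial_torsion_class[OF fl] finite_subset by blast
  have step: "\<exists>T'. P T' \<and> T \<subset> T'" if PT: "P T" for T
  proof -
    have t: "torsion_class A T" "infinite {L. torsion_class A L \<and> T \<subseteq> L}" using PT by (simp_all add: P_def)
    obtain T' where "torsion_class A T'" "infinite {L. torsion_class A L \<and> T' \<subseteq> L}" "T \<subset> T'"
      using infinite_above_step[OF fl len t] .
    then show ?thesis by (intro exI[of _ T']) (simp add: P_def)
  qed
  have "\<exists>T. \<forall>n :: nat. P (T n) \<and> T n \<subset> T (Suc n)"
    by (rule dependent_nat_choice[of "\<lambda>_. P" "\<lambda>_ T T'. T \<subset> T'"]) (use start in blast, rule step)
  then obtain T where "\<forall>n :: nat. P (T n) \<and> T n \<subset> T (Suc n)" by (rule exE)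
  then have T: "\<And>n. P (T n)" "\<And>n :: nat. T n \<subset> T (Suc n)" by simp_all
  have tT: "torsion_class A (T n)" for n using T(1) by (simp add: P_def)
  have inc: "incseq T" using T(2) by (intro incseq_SucI) blast
  define T\<omega> where "T\<omega> = (\<Union>n. T n)"
  have t\<omega>: "torsion_class A T\<omega>" unfolding T\<omega>_def by (rule chain_union_torsion[OF fl tT inc])
  obtain K where K: "K \<in> \<K>" "heart \<inter> K = T\<omega>" using torsion_intermediate[OF t\<omega>] .
  obtain U' V' where tK: "tilted_heart D U V U' V'" and KK: "K = U' \<inter> V'" using tilted[OF K(1)] .
  interpret K: tilted_heart D U V U' V' by (rule tK)
  have flK: K.B.finite_length using K.B.length_category_finite_length len[OF K(1)] KK by blast
  obtain \<Sigma> where \<Sigma>: "finite \<Sigma>" "\<Sigma> \<subseteq> {s. K.B.simple s}" "\<And>s. K.B.simple s \<Longrightarrow> \<exists>\<sigma> \<in> \<Sigma>. isomorphic D s \<sigma>"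
    using K.finite_simples[OF flK] by blast
  have ex: "\<exists>\<sigma> \<in> \<Sigma>. \<sigma> \<in> T\<omega> \<and> \<sigma> \<in> perp A (T n)" for n
  proof -
    obtain t where t: "t \<in> T (Suc n)" "t \<notin> T n" using T(2) by blast
    have t': "t \<in> T\<omega>" "t \<in> heart" using t(1) torsion_sub[OF tT] by (auto simp: T\<omega>_def)
    obtain a f where af: "a \<in> T n" "f \<in> perp A (T n)" "dtri D a t f" "a \<in> heart" "f \<in> heart"
      using torsion_decomp[OF tT t'(2)] .
    have fT: "f \<in> T\<omega>" by (rule torsion_quotient[OF t\<omega> af(3) t'(1) af(4,5)])
    have nz: "\<not> zero_object D f" using dtri_zero_third[OF af(3)] torsion_iso_closed[OF tT af(1)] t(2) by blast
    have fK: "f \<in> K.B.heart" using fT K KK by blast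
    obtain s c where s: "dtri D s f c" "K.B.simple s" "c \<in> K.B.heart" using K.B.simple_subobject[OF flK fK nz] .
    have sk: "s \<in> K.B.heart" by (rule K.B.simple_heart[OF s(2)])
    \<comment> \<open>A simple object of K isomorphic to some \<open>g[1]\<close> has no non-zero
      arrow to \<open>f\<close> in H, whereas \<open>s\<close> is a subobject of \<open>f\<close> in
      K.\<close>
    have "s \<in> T\<omega>"
      using s(2)
    proof (cases rule: K.simple_cases)
      case (1 g)
      have "g \<in> heart" using 1(1) K.tfree by blast
      then have "hom0 D s f" using hom0_iso_left[OF K.hom0_Sh_heart[OF _ af(5)] isomorphic_sym[OF 1(2)]] by blast
      then have "hom0 D s s" by (rule K.B.hom0_kernel[OF s(1) _ sk s(3)])
      then show ?thesis using K.B.simple_nonzero[OF s(2)] zero_object_iff by blast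
    next
      case 2
      then show ?thesis using K KK by blast
    qed
    moreover have "s \<in> perp A (T n)"
      unfolding perp_heart[OF torsion_sub[OF tT]]
    proof (intro CollectI conjI ballI)
      show "s \<in> heart" using calculation torsion_sub[OF t\<omega>] by blast
      fix x assume x: "x \<in> T n"
      have "x \<in> K.B.heart" using x K KK by (auto simp: T\<omega>_def)
      then show "hom0 D x s" using K.B.hom0_kernel[OF s(1) perpD(2)[OF af(2) torsion_sub[OF tT] x]] s(3) by blast
    qed
    moreover obtain \<sigma> where \<sigma>: "\<sigma> \<in> \<Sigma>" "isomorphic D s \<sigma>" using \<Sigma>(3)[OF s(2)] by blast
    moreover have "\<sigma> \<in> T\<omega>" by (rule torsion_iso_closed[OF t\<omega> calculation(1) \<sigma>(2)])
    moreover have "\<sigma> \<in> perp A (T n)"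
      using \<open>s \<in> perp A (T n)\<close> hom0_iso_right[OF _ \<sigma>(2)] heart_iso[OF _ \<sigma>(2)]
      unfolding perp_heart[OF torsion_sub[OF tT]] by blast
    ultimately show ?thesis by blast
  qed
  then obtain \<sigma> where \<sigma>: "\<And>n. \<sigma> n \<in> \<Sigma>" "\<And>n. \<sigma> n \<in> T\<omega>" "\<And>n. \<sigma> n \<in> perp A (T n)" by metis
  have "finite (range \<sigma>)" using \<Sigma>(1) \<sigma>(1) by (metis finite_subset image_subsetI)
  then obtain n0 where n0: "infinite {n. \<sigma> n = \<sigma> n0}" using pigeonhole_infinite[of UNIV \<sigma>] by auto
  \<comment> \<open>The repeated simple object belongs to all late members of the chain, yet it is
    torsion-free for arbitrarily late ones.\<close>
  obtain m where m: "\<sigma> n0 \<in> T m" using \<sigma>(2) by (auto simp: T\<omega>_def)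
  obtain n where n: "m < n" "\<sigma> n = \<sigma> n0" using n0 unfolding infinite_nat_iff_unbounded by blast
  have "\<sigma> n \<in> T n" using incseqD[OF inc, of m n] m n by auto
  then have "zero_object D (\<sigma> n)" by (rule torsion_perp_zero[OF torsion_sub[OF tT] _ \<sigma>(3)])
  then show False using K.B.simple_nonzero \<Sigma>(2) \<sigma>(1) by blast
qed

text \<open>A finite fan has finitely many cones C(K), each being a face of itself. For the
  converse, finitely many length hearts contribute finitely many faces each.\<close>

theorem finiteness:
  assumes len: "length_category A"
  shows "finite (heart_fan D heart) \<longleftrightarrow> (\<forall>K \<in> \<K>. length_category (full_subcat D K))"
    and "(\<forall>K \<in> \<K>. length_category (full_subcat D K)) \<longleftrightarrow> finite \<K>"
proof -
  have fl: finite_length by (rule length_category_finite_length[OF len])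
  have 1: "\<forall>K \<in> \<K>. length_category (full_subcat D K)" if "finite (C ` \<K>)"
    using finite_cones_imp(2)[OF fl that] by blast
  have 2: "finite \<K>" if "\<forall>K \<in> \<K>. length_category (full_subcat D K)"
    using length_imp_finite[OF fl] that by blast
  have "finite (C ` \<K>)" if "finite (heart_fan D heart)"
    by (rule finite_subset[OF _ that]) (use face_self C_convex_cone(1) in \<open>auto simp: heart_fan_def\<close>)
  moreover have "finite (heart_fan D heart)" if len: "\<forall>K \<in> \<K>. length_category (full_subcat D K)"
    unfolding heart_fan_def
  proof (rule finite_UN_I[OF 2[OF len]])
    fix K assume K: "K \<in> \<K>"
    obtain U' V' where t: "tilted_heart D U V U' V'" "K = U' \<inter> V'" using tilted[OF K] .
    interpret K: tilted_heart D U V U' V' by (rule t(1))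
    show "finite (faces (C K))"
      using K.finite_faces K.B.length_category_finite_length len K t(2) by blast
  qed
  ultimately show "finite (heart_fan D heart) \<longleftrightarrow> (\<forall>K \<in> \<K>. length_category (full_subcat D K))" using 1 by blast
  show "(\<forall>K \<in> \<K>. length_category (full_subcat D K)) \<longleftrightarrow> finite \<K>" using 1 2 by blast
qed

end

theorem theorem1:
  fixes D :: "('o, 'm) triangulated_data" and H :: "'o set"
  assumes "triangulated_category D"
    and "bounded_heart D H"
    and "free_of_finite_rank (K0 (full_subcat D H))"
  shows
    "(heart_cone D H H =
        {v \<in> heart_dual D H. \<forall>h \<in> H. 0 \<le> v (K0_class (full_subcat D H) h)} \<and>
      convex_cone (heart_cone D H H) \<and>
      closedin (top_of_set (heart_dual D H)) (heart_cone D H H) \<and>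
      strictly_convex (heart_cone D H H))
   \<and> fan_in (heart_dual D H) (heart_fan D H)
   \<and> (\<forall>(D' :: ('p, 'n) triangulated_data) H' Fo Fm.
        triangulated_category D' \<and> bounded_heart D' H' \<and>
        is_equivalence (full_subcat D H) (full_subcat D' H') Fo Fm \<longrightarrow>
        (\<lambda>\<tau>. dual_pullback (K0 (full_subcat D H)) (K0_map (full_subcat D' H') Fo) ` \<tau>)
          ` heart_fan D' H' = heart_fan D H)
   \<and> (length_category (full_subcat D H) \<longrightarrow>
        complete_fan_in (heart_dual D H) (heart_fan D H) \<and>
        (finite (heart_fan D H) \<longleftrightarrow>
           (\<forall>K \<in> intermediate_hearts D H. length_category (full_subcat D K))) \<and>
        ((\<forall>K \<in> intermediate_hearts D H. length_category (full_subcat D K)) \<longleftrightarrow>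
           finite (intermediate_hearts D H)))"
proof -
  interpret triangulated_category D by (rule assms(1))
  obtain U V where B: "bounded_t_structure D U V" and H: "H = U \<inter> V" using assms(2) by (auto simp: bounded_heart_def)
  interpret free_heart D U V by unfold_locales (use B assms(3) H in auto)
  have "(\<lambda>\<tau>. dual_pullback (K0 A) (K0_map (full_subcat D' H') Fo) ` \<tau>) ` heart_fan D' H' = heart_fan D heart"
    if D': "triangulated_category D'" "bounded_heart D' H'" "is_equivalence A (full_subcat D' H') Fo Fm"
    for D' :: "('p, 'n) triangulated_data" and H' Fo Fm
  proof -
    interpret D': triangulated_category D' by (rule D'(1))
    obtain U' V' where B': "bounded_t_structure D' U' V'" and H': "H' = U' \<inter> V'"
      using D'(2) by (auto simp: bounded_heart_def)
    interpret D': bounded_t D' U' V' by unfold_locales (rule B')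
    interpret B: additive_category A by (rule heart_additive)
    interpret B': additive_category "full_subcat D' (U' \<inter> V')" by (rule D'.heart_additive)
    interpret heart_equivalence D U V D' U' V' Fo Fm
      by unfold_locales (use D'(3) H' in simp)
    show ?thesis unfolding H' by (rule heart_fan_equivalence)
  qed
  then show ?thesis
    unfolding H using heart_cone_self heart_fan_is_fan heart_fan_complete length_category_finite_length finiteness by blast
qed

end
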